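(* Let $p$ be a prime and let $G$ be a finitely generated pro-$p$-group. Write $$\log P_{\mathrm{gr}(\mathbb{F}_p[[G]])}(t)=\sum_{n\ge 1} b_n t^n\in\mathbb{Q}[[t]],$$ and for $n\ge 1$ define $$w_n(G)=\frac1n\sum_{m\mid n}\mu(n/m)\,m\,b_m ,$$ where $\mu$ is the Möbius function. Let $n=p^k m$ with $k\ge 0$, $m\geq 1$ and $(m,p)=1$. Then $$c_n(G)=w_m(G)+w_{pm}(G)+\cdots+w_{p^k m}(G).$$
   Context: Finitely generated means topologically finitely generated. For a profinite group $G$ and a prime $p$, the Zassenhaus ($p$-)filtration $(G_{(n)})_{n\ge1}$ is defined inductively by $G_{(1)}=G$ and, for $n\ge2$, $G_{(n)}=G_{(\lceil n/p\rceil)}^p\prod_{i+j=n}[G_{(i)},G_{(j)}]$ (with $i,j\ge1$), where for closed subgroups $H,K$, $[H,K]$ is the smallest closed subgroup containing all commutators $[x,y]=x^{-1}y^{-1}xy$ with $x\in H,y\in K$, and $H^p$ is the smallest closed subgroup containing all $x^p$, $x\in H$. Put $c_n(G)=\dim_{\mathbb{F}_p}(G_{(n)}/G_{(n+1)})$, which is finite for $G$ a finitely generated pro-$p$-group. $\mathbb{F}_p[[G]]=\varprojlim_N\mathbb{F}_p[G/N]$ ($N$ over open normal subgroups) is the completed group algebra, $I(G)$ is its augmentation ideal (kernel of $\mathbb{F}_p[[G]]\to\mathbb{F}_p$, $g\mapsto1$), $I^n(G)$ is the $n$-th power of $I(G)$ (with $I^0(G)=\mathbb{F}_p[[G]]$),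 $\mathrm{gr}(\mathbb{F}_p[[G]])=\bigoplus_{n\ge0}I^n(G)/I^{n+1}(G)$, and its Hilbert–Poincaré series is $P_{\mathrm{gr}(\mathbb{F}_p[[G]])}(t)=\sum_{n\ge0}\dim_{\mathbb{F}_p}(I^n(G)/I^{n+1}(G))\,t^n$, which has finite coefficients and constant term $1$. *)

theory Defs
  imports
    "HOL-Analysis.T1_Spaces"
    "HOL-Analysis.Product_Topology"
    "HOL-Algebra.Ideal_Product"
    "HOL-Algebra.Generated_Groups"
    "HOL-Number_Theory.Residues"
    "HOL-Computational_Algebra.Formal_Power_Series"
    "HOL-Computational_Algebra.Squarefree"
    "Jordan_Normal_Form.Missing_VectorSpace"
begin

section \<open>Pro-p groups\<close>

locale topological_group = group G for G (structure) +
  fixes T :: "'a topology"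
  assumes topspace_eq: "topspace T = carrier G"
    and continuous_mult: "continuous_map (prod_topology T T) T (\<lambda>(x, y). x \<otimes> y)"
    and continuous_inv: "continuous_map T T (\<lambda>x. inv x)"

text \<open>The definitions of profinite and pro-p groups are those of Dixon, du Sautoy, Mann and
  Segal, Analytic Pro-p Groups.\<close>

locale profinite_group = topological_group +
  assumes compact: "compact_space T"
    and Hausdorff: "Hausdorff_space T"
    and open_subgroup_base: "\<And>U. openin T U \<Longrightarrow> \<one> \<in> U \<Longrightarrow> \<exists>H. subgroup H G \<and> openin T H \<and> H \<subseteq> U"

definition open_normal_subgroups :: "('a, 'b) monoid_scheme \<Rightarrow> 'a topology \<Rightarrow> 'a set set" where
  "open_normal_subgroups G T = {N. N \<lhd> G \<and> openin T N}"

locale pro_p_group = profinite_group +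
  fixes p :: nat
  assumes prime_p: "prime p"
    and p_power_index: "\<And>N. N \<in> open_normal_subgroups G T \<Longrightarrow> \<exists>k. order (G Mod N) = p ^ k"

definition topologically_finitely_generated ::
    "('a, 'b) monoid_scheme \<Rightarrow> 'a topology \<Rightarrow> bool" where
  "topologically_finitely_generated G T \<longleftrightarrow>
     (\<exists>S. finite S \<and> S \<subseteq> carrier G \<and> T closure_of (generate G S) = carrier G)"


section \<open>The Zassenhaus filtration\<close>

definition closed_subgroup_generated ::
    "('a, 'b) monoid_scheme \<Rightarrow> 'a topology \<Rightarrow> 'a set \<Rightarrow> 'a set" where
  "closed_subgroup_generated G T S = \<Inter>{H. subgroup H G \<and> closedin T H \<and> S \<subseteq> H}"

definition closed_commutator ::
    "('a, 'b) monoid_scheme \<Rightarrow> 'a topology \<Rightarrow> 'a set \<Rightarrow> 'a set \<Rightarrow> 'a set" where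
  "closed_commutator G T H K = closed_subgroup_generated G T
     {inv\<^bsub>G\<^esub> x \<otimes>\<^bsub>G\<^esub> inv\<^bsub>G\<^esub> y \<otimes>\<^bsub>G\<^esub> x \<otimes>\<^bsub>G\<^esub> y | x y. x \<in> H \<and> y \<in> K}"

definition closed_power ::
    "('a, 'b) monoid_scheme \<Rightarrow> 'a topology \<Rightarrow> nat \<Rightarrow> 'a set \<Rightarrow> 'a set" where
  "closed_power G T p H = closed_subgroup_generated G T {x [^]\<^bsub>G\<^esub> p | x. x \<in> H}"

text \<open>The product over \<open>i + j = n\<close> is the product of subsets of \<open>G\<close>, in increasing order of
  \<open>i\<close>; the factors are normal subgroups, so the order is irrelevant. The terms of index \<open>0\<close>, and
  those for \<open>p \<le> 1\<close>, are dummies: the latter case is split off only because the recursion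
  would not terminate for \<open>p = 1\<close>.\<close>

function zassenhaus ::
    "('a, 'b) monoid_scheme \<Rightarrow> 'a topology \<Rightarrow> nat \<Rightarrow> nat \<Rightarrow> 'a set" where
  "zassenhaus G T p n =
     (if n \<le> 1 \<or> p \<le> 1 then carrier G
      else closed_power G T p (zassenhaus G T p (nat \<lceil>real n / real p\<rceil>)) <#>\<^bsub>G\<^esub>
           foldr (set_mult G)
             (map (\<lambda>i. closed_commutator G T (zassenhaus G T p i) (zassenhaus G T p (n - i)))
               [1..<n])
             {\<one>\<^bsub>G\<^esub>})"
  by pat_completeness auto
termination
proof (relation "measure (\<lambda>(G, T, p, n). n)", goal_cases)
  case (2 G T p n)
  then have n: "2 \<le> real n" and p: "2 \<le> real p" by auto
  have "real n / real p \<le> real n / 2" by (rule divide_left_mono) (use n p in auto)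
  also have "\<dots> \<le> of_int (int n - 1)" using n by simp
  finally have "\<lceil>real n / real p\<rceil> \<le> int n - 1" by (rule ceiling_le)
  then show ?case using n by auto
qed auto

declare zassenhaus.simps [simp del]

text \<open>The \<open>\<bbbF>\<^sub>p\<close>-vector space underlying an abelian group \<open>A\<close> of exponent \<open>p\<close>, written
  multiplicatively: the residue \<open>a\<close> acts as \<open>x \<mapsto> x\<^sup>a\<close>. (The fields
  \<^term>\<open>monoid.mult\<close> and \<^term>\<open>one\<close> of the record of a module play no role, here and below.)\<close>

definition elementary_abelian_space :: "('a, 'b) monoid_scheme \<Rightarrow> (int, 'a) module" where
  "elementary_abelian_space A =
     \<lparr>carrier = carrier A, monoid.mult = undefined, one = undefined,
      zero = \<one>\<^bsub>A\<^esub>, add = (\<otimes>\<^bsub>A\<^esub>), smult = (\<lambda>a x. x [^]\<^bsub>A\<^esub> a)\<rparr>"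

definition zassenhaus_dim :: "('a, 'b) monoid_scheme \<Rightarrow> 'a topology \<Rightarrow> nat \<Rightarrow> nat \<Rightarrow> nat" where
  "zassenhaus_dim G T p n =
     vectorspace.dim (residue_ring (int p))
       (elementary_abelian_space
         (G\<lparr>carrier := zassenhaus G T p n\<rparr> Mod zassenhaus G T p (Suc n)))"


section \<open>The completed group algebra\<close>

text \<open>The group algebra \<open>K[Q]\<close> of a finite group \<open>Q\<close>; an element is the function giving its
  coefficients.\<close>

definition group_algebra ::
    "('k, 'c) ring_scheme \<Rightarrow> ('q, 'd) monoid_scheme \<Rightarrow> ('k, 'q \<Rightarrow> 'k) module" where
  "group_algebra K Q =
     \<lparr>carrier = carrier Q \<rightarrow>\<^sub>E carrier K,
      monoid.mult = (\<lambda>f g. \<lambda>x\<in>carrier Q.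
        (\<Oplus>\<^bsub>K\<^esub>y\<in>carrier Q. f y \<otimes>\<^bsub>K\<^esub> g (inv\<^bsub>Q\<^esub> y \<otimes>\<^bsub>Q\<^esub> x))),
      one = (\<lambda>x\<in>carrier Q. if x = \<one>\<^bsub>Q\<^esub> then \<one>\<^bsub>K\<^esub> else \<zero>\<^bsub>K\<^esub>),
      zero = (\<lambda>x\<in>carrier Q. \<zero>\<^bsub>K\<^esub>),
      add = (\<lambda>f g. \<lambda>x\<in>carrier Q. f x \<oplus>\<^bsub>K\<^esub> g x),
      smult = (\<lambda>a f. \<lambda>x\<in>carrier Q. a \<otimes>\<^bsub>K\<^esub> f x)\<rparr>"

definition group_algebra_map ::
    "('k, 'c) ring_scheme \<Rightarrow> ('q, 'd) monoid_scheme \<Rightarrow> ('r, 'e) monoid_scheme \<Rightarrow>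
     ('q \<Rightarrow> 'r) \<Rightarrow> ('q \<Rightarrow> 'k) \<Rightarrow> 'r \<Rightarrow> 'k" where
  "group_algebra_map K Q R h f =
     (\<lambda>y\<in>carrier R. \<Oplus>\<^bsub>K\<^esub>x\<in>{x \<in> carrier Q. h x = y}. f x)"

definition group_algebra_augmentation ::
    "('k, 'c) ring_scheme \<Rightarrow> ('q, 'd) monoid_scheme \<Rightarrow> ('q \<Rightarrow> 'k) \<Rightarrow> 'k" where
  "group_algebra_augmentation K Q f = (\<Oplus>\<^bsub>K\<^esub>x\<in>carrier Q. f x)"

text \<open>The inverse limit of the algebras \<open>K[G/N]\<close>: compatible families indexed by the open normal
  subgroups \<open>N\<close>. For \<open>N \<subseteq> M\<close> the projection \<open>G/N \<rightarrow> G/M\<close> maps a coset \<open>X\<close> of \<open>N\<close> to \<open>M X\<close>.\<close>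

definition completed_group_algebra ::
    "('k, 'c) ring_scheme \<Rightarrow> ('a, 'b) monoid_scheme \<Rightarrow> 'a topology \<Rightarrow>
     ('k, 'a set \<Rightarrow> 'a set \<Rightarrow> 'k) module" where
  "completed_group_algebra K G T =
     \<lparr>carrier = {\<phi> \<in> (\<Pi>\<^sub>E N\<in>open_normal_subgroups G T. carrier (group_algebra K (G Mod N))).
        \<forall>N\<in>open_normal_subgroups G T. \<forall>M\<in>open_normal_subgroups G T. N \<subseteq> M \<longrightarrow>
          group_algebra_map K (G Mod N) (G Mod M) (\<lambda>X. M <#>\<^bsub>G\<^esub> X) (\<phi> N) = \<phi> M},
      monoid.mult = (\<lambda>\<phi> \<psi>. \<lambda>N\<in>open_normal_subgroups G T.
        \<phi> N \<otimes>\<^bsub>group_algebra K (G Mod N)\<^esub> \<psi> N),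
      one = (\<lambda>N\<in>open_normal_subgroups G T. \<one>\<^bsub>group_algebra K (G Mod N)\<^esub>),
      zero = (\<lambda>N\<in>open_normal_subgroups G T. \<zero>\<^bsub>group_algebra K (G Mod N)\<^esub>),
      add = (\<lambda>\<phi> \<psi>. \<lambda>N\<in>open_normal_subgroups G T.
        \<phi> N \<oplus>\<^bsub>group_algebra K (G Mod N)\<^esub> \<psi> N),
      smult = (\<lambda>a \<phi>. \<lambda>N\<in>open_normal_subgroups G T.
        a \<odot>\<^bsub>group_algebra K (G Mod N)\<^esub> \<phi> N)\<rparr>"

text \<open>By compatibility, the augmentation may be computed at any level \<open>K[G/N]\<close>; we take
  \<open>N = G\<close>.\<close>

definition augmentation ::
    "('k, 'c) ring_scheme \<Rightarrow> ('a, 'b) monoid_scheme \<Rightarrow> ('a set \<Rightarrow> 'a set \<Rightarrow> 'k) \<Rightarrow> 'k" where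
  "augmentation K G \<phi> = group_algebra_augmentation K (G Mod carrier G) (\<phi> (carrier G))"

definition augmentation_ideal ::
    "('k, 'c) ring_scheme \<Rightarrow> ('a, 'b) monoid_scheme \<Rightarrow> 'a topology \<Rightarrow>
     ('a set \<Rightarrow> 'a set \<Rightarrow> 'k) set" where
  "augmentation_ideal K G T = a_kernel (completed_group_algebra K G T) K (augmentation K G)"

text \<open>Powers in the monoid of ideals, where \<open>I\<^sup>0\<close> is the whole ring.\<close>

definition augmentation_ideal_power ::
    "('k, 'c) ring_scheme \<Rightarrow> ('a, 'b) monoid_scheme \<Rightarrow> 'a topology \<Rightarrow> nat \<Rightarrow>
     ('a set \<Rightarrow> 'a set \<Rightarrow> 'k) set" where
  "augmentation_ideal_power K G T n =
     augmentation_ideal K G T [^]\<^bsub>ideals_set (completed_group_algebra K G T)\<^esub> n"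

text \<open>The quotient space \<open>U / W\<close> for subspaces \<open>W \<subseteq> U\<close> of \<open>M\<close>.\<close>

definition subquotient_space ::
    "('k, 'v, 'c) module_scheme \<Rightarrow> 'v set \<Rightarrow> 'v set \<Rightarrow> ('k, 'v set) module" where
  "subquotient_space M U W =
     \<lparr>carrier = a_rcosets\<^bsub>M\<lparr>carrier := U\<rparr>\<^esub> W, monoid.mult = undefined, one = undefined,
      zero = W, add = set_add M, smult = (\<lambda>a X. \<Union>x\<in>X. W +>\<^bsub>M\<^esub> (a \<odot>\<^bsub>M\<^esub> x))\<rparr>"

definition gr_component ::
    "('k, 'c) ring_scheme \<Rightarrow> ('a, 'b) monoid_scheme \<Rightarrow> 'a topology \<Rightarrow> nat \<Rightarrow>
     ('k, ('a set \<Rightarrow> 'a set \<Rightarrow> 'k) set) module" where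
  "gr_component K G T n =
     subquotient_space (completed_group_algebra K G T)
       (augmentation_ideal_power K G T n) (augmentation_ideal_power K G T (Suc n))"

definition gr_hilbert_series :: "('a, 'b) monoid_scheme \<Rightarrow> 'a topology \<Rightarrow> nat \<Rightarrow> rat fps" where
  "gr_hilbert_series G T p =
     Abs_fps (\<lambda>n. of_nat (vectorspace.dim (residue_ring (int p))
       (gr_component (residue_ring (int p)) G T n)))"


section \<open>The numbers \<open>w\<^sub>n\<close>\<close>

text \<open>The logarithm of a power series with constant term \<open>1\<close>; here \<^term>\<open>fps_ln 1\<close> is the
  series of \<open>log (1 + X)\<close>.\<close>

definition fps_log :: "rat fps \<Rightarrow> rat fps" where
  "fps_log P = fps_compose (fps_ln 1) (P - 1)"

definition moebius :: "nat \<Rightarrow> int" where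
  "moebius n = (if squarefree n then (- 1) ^ card (prime_factors n) else 0)"

definition gr_w :: "('a, 'b) monoid_scheme \<Rightarrow> 'a topology \<Rightarrow> nat \<Rightarrow> nat \<Rightarrow> rat" where
  "gr_w G T p n = 1 / of_nat n *
     (\<Sum>m | m dvd n. of_int (moebius (n div m)) * of_nat m *
        fps_nth (fps_log (gr_hilbert_series G T p)) m)"

end

theory Submission
  imports Defs "HOL-Algebra.Group_Action" "HOL-Algebra.Zassenhaus"
begin

text \<open>
  The heart of the matter is Jennings' theorem: with \<open>c\<^sub>n = c\<^sub>n(G)\<close>, the Hilbert series of
  \<open>gr \<bbbF>\<^sub>p[[G]]\<close> is \<open>\<Prod>w. (1 + t\<^sup>w + \<dots> + t\<^bsup>(p-1)w\<^esup>)\<^bsup>c\<^sub>w\<^esup>\<close>. Taking logarithmic derivatives and inverting by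
  Moebius, \<open>w\<^sub>n = c\<^sub>n - c\<^bsub>n/p\<^esub>\<close>, where \<open>c\<^bsub>n/p\<^esub> = 0\<close> if \<open>p\<close> does not divide \<open>n\<close>, and the sum telescopes.

  For a finite quotient \<open>Q\<close> of \<open>G\<close>, Jennings' theorem needs no Lie algebra, only counting. Choose elements
  whose classes form bases of the successive quotients of the filtration; the ordered monomials in
  the elements \<open>g - 1\<close> with exponents below \<open>p\<close> span each \<open>I\<^sup>n\<close> modulo \<open>I\<^bsup>n+1\<^esup>\<close>, because
  \<open>[H\<^sub>i, H\<^sub>j] \<subseteq> H\<^bsub>i+j\<^esub>\<close>, \<open>H\<^sub>i\<^sup>p \<subseteq> H\<^bsub>pi\<^esub>\<close> and \<open>H\<^sub>i - 1 \<subseteq> I\<^sup>i\<close>. There are at most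
  \<open>|Q|\<close> of them while \<open>I\<close> is nilpotent and \<open>|\<bbbF>\<^sub>p[Q]| = p\<^bsup>|Q|\<^esup>\<close>, so all these bounds are equalities.

  Finite generation bounds the indices of \<open>I\<^bsup>n+1\<^esup>\<close> in \<open>I\<^sup>n\<close>, and hence those of the filtration
  subgroups, uniformly over the finite quotients. By compactness these indices are then attained at a
  single sufficiently fine quotient, where Jennings' theorem applies.
\<close>

section \<open>Moebius inversion and logarithms of products\<close>

text \<open>Three points shape the argument. The powers I^n in the limit are algebraic and not
  closed by definition. Closedness comes from the finitely many left generators s - 1 of I, with s
  topologically generating G: the coefficients of an element over them can be chosen compatibly at
  all finite levels. Secondly, the finite quotient Q = G/N is filtered by the images of the
  subgroups of G, so that the indices counted in Q are the ones to be compared with those in G; the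
  images inherit the three inclusions from G. Finally, the index bound for the filtration subgroups
  follows from that for the ideals: a generator of weight n is itself an ordered monomial of weight
  n, so its logarithmic index c_n in Q is at most the dimension of I^n / I^(n+1). Once the indices
  are bounded, a largest set of pairwise inequivalent elements, taken over all levels, exists at
  some level, and no finer level can separate more; such a level sees the true quotient. Only
  coefficients up to degree n enter the formula for c_n, so N may depend on n.\<close>

lemma moebius_sum:
  assumes "n > 0"
  shows "(\<Sum>d | d dvd n. moebius d) = (if n = 1 then 1 else 0)"
proof -
  let ?P = "prime_factors n"
  \<comment> \<open>Square-free divisors of n correspond to sets of primes dividing n;
    \<open>sqf\<close> and \<open>rad\<close> are the two directions of this bijection.\<close>
  have sqf: "squarefree (\<Prod>A) \<and> \<Prod>A dvd n \<and> prime_factors (\<Prod>A) = A" if "A \<subseteq> ?P" for A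
  proof -
    have fin: "finite A" and pr: "\<And>q. q \<in> A \<Longrightarrow> prime q" "\<And>q. q \<in> A \<Longrightarrow> q dvd n"
      using that finite_subset by auto
    have cop: "coprime q q'" if "q \<in> A" "q' \<in> A" "q \<noteq> q'" for q q'
      using that pr primes_coprime by blast
    have "squarefree (\<Prod>A)"
      by (rule squarefree_prod_coprime) (use cop pr in \<open>auto intro: squarefree_prime\<close>)
    moreover have "\<Prod>A dvd n"
      using fin cop pr
    proof (induction rule: finite_induct)
      case (insert q A)
      have "coprime q (\<Prod>A)"
        by (intro prod_coprime_right insert.prems(1)) (use insert.hyps in auto)
      moreover have "\<Prod>A dvd n" by (rule insert.IH) (use insert.prems in auto)
      ultimately show ?case using insert by (simp add: divides_mult)
    qed simp
    moreover have "prime_factors (\<Prod>A) = A"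
    proof -
      have "0 \<notin> A" using pr(1) not_prime_0 by metis
      then have "prime_factors (\<Prod>A) = (\<Union>q\<in>A. prime_factors q)"
        using prime_factors_prod[OF fin, of "\<lambda>q. q"] by auto
      also have "\<dots> = (\<Union>q\<in>A. {q})" using pr by (intro SUP_cong) (auto simp: prime_prime_factors)
      finally show ?thesis by simp
    qed
    ultimately show ?thesis by blast
  qed
  have rad: "\<Prod>(prime_factors d) = d" if "squarefree d" for d :: nat
  proof -
    have "d \<noteq> 0" using that by (cases d) auto
    have "d = (\<Prod>q\<in>prime_factors d. q ^ multiplicity q d)"
      using \<open>d \<noteq> 0\<close> by (simp add: prime_factorization_nat)
    also have "\<dots> = \<Prod>(prime_factors d)"
      using that \<open>d \<noteq> 0\<close> by (intro prod.cong refl) (simp add: squarefree_factorial_semiring')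
    finally show ?thesis ..
  qed
  have "(\<Sum>d | d dvd n. moebius d) = (\<Sum>d | d dvd n \<and> squarefree d. moebius d)"
    by (rule sum.mono_neutral_right) (use assms in \<open>auto simp: moebius_def\<close>)
  also have "\<dots> = (\<Sum>A\<in>Pow ?P. (- 1) ^ card A)"
    by (rule sum.reindex_bij_witness[of _ "\<lambda>A. \<Prod>A" prime_factors])
      (use assms sqf rad in \<open>auto simp: moebius_def dvd_prime_factors intro: dvd_prime_factors[THEN subsetD]\<close>)
  \<comment> \<open>Expanding the product over subsets of \<open>?P\<close> gives the alternating
    sum; one prime factor is enough to make it vanish.\<close>
  also have "\<dots> = (\<Prod>q\<in>?P. (-1::int) + 1)"
    by (subst prod_add) (simp_all add: prod_constant)
  also have "\<dots> = (if n = 1 then 1 else 0)"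
  proof (cases "n = 1")
    case False
    then obtain q where "prime q" "q dvd n" using prime_factor_nat by blast
    then have "q \<in> ?P" using assms by (simp add: in_prime_factors_iff)
    then have "card ?P > 0" using card_gt_0_iff by blast
    then show ?thesis using False \<open>q \<in> ?P\<close> by (auto simp: power_0_left)
  qed simp
  finally show ?thesis .
qed

text \<open>The hypothesis on \<open>f\<close> is restricted to divisors of n because the
  logarithmic formula to be inverted is only known up to a fixed degree.\<close>

lemma moebius_inversion:
  fixes f g :: "nat \<Rightarrow> rat"
  assumes "n > 0" and f: "\<And>m. m dvd n \<Longrightarrow> f m = (\<Sum>d | d dvd m. g d)"
  shows "(\<Sum>m | m dvd n. of_int (moebius (n div m)) * f m) = g n"
proof -
  have fin: "finite {d. d dvd m}" if "m dvd n" for m using that assms(1) by (auto intro: dvd_pos_nat)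
  have "(\<Sum>m | m dvd n. of_int (moebius (n div m)) * f m)
     = (\<Sum>m | m dvd n. \<Sum>d | d dvd m. of_int (moebius (n div m)) * g d)"
    by (intro sum.cong refl) (simp add: f sum_distrib_left)
  also have "\<dots> = (\<Sum>d | d dvd n. \<Sum>m | d dvd m \<and> m dvd n. of_int (moebius (n div m)) * g d)"
    by (subst sum.Sigma, use fin in simp, use fin in simp,
        subst sum.Sigma, use fin in simp, use fin in \<open>simp add: finite_subset[OF _ fin[of n]]\<close>,
        rule sum.reindex_bij_witness[of _ "\<lambda>(a,b). (b,a)" "\<lambda>(a,b). (b,a)"])
      (auto intro: dvd_trans)
  \<comment> \<open>With n = d k, the substitution e = n div m turns the inner sum into the sum of
    the Moebius function over the divisors of k, which is 0 unless k = 1.\<close>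
  also have "\<dots> = (\<Sum>d | d dvd n. if d = n then g d else 0)"
  proof (intro sum.cong refl)
    fix d assume "d \<in> {d. d dvd n}"
    then obtain k where k: "n = d * k" by auto
    with assms(1) have dk: "d > 0" "k > 0" by auto
    have "(\<Sum>m | d dvd m \<and> m dvd n. of_int (moebius (n div m)) * g d)
        = (\<Sum>e | e dvd k. of_int (moebius e) * g d)"
      by (rule sum.reindex_bij_witness[of _ "\<lambda>e. n div e" "\<lambda>m. n div m"])
        (use k dk in \<open>auto simp: dvd_div_eq_mult elim!: dvdE\<close>)
    also have "\<dots> = of_int (\<Sum>e | e dvd k. moebius e) * g d"
      by (simp add: sum_distrib_right)
    also have "\<dots> = (if d = n then g d else 0)"
      using moebius_sum[OF dk(2)] k dk by auto
    finally show "(\<Sum>m | d dvd m \<and> m dvd n. of_int (moebius (n div m)) * g d) = \<dots>" .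
  qed
  also have "\<dots> = g n" using fin[of n] by simp
  finally show ?thesis .
qed

section \<open>Logarithmic derivatives of power series\<close>

text \<open>This is t d/dt log P = t P'/P. It sends products to sums, and its coefficient at m is m
  b_m, which is exactly what enters the definition of w_n.\<close>

definition euler_deriv :: "rat fps \<Rightarrow> rat fps" where
  "euler_deriv P = fps_X * fps_deriv P * inverse P"

lemma fps_log_nth:
  assumes "fps_nth P 0 = 1"
  shows "of_nat m * fps_nth (fps_log P) m = fps_nth (euler_deriv P) m"
proof -
  have "fps_deriv (fps_log P) = fps_compose (inverse (1 + fps_X)) (P - 1) * fps_deriv P"
    using assms unfolding fps_log_def by (subst fps_compose_deriv) (simp_all add: fps_ln_deriv)
  also have "fps_compose (inverse (1 + fps_X)) (P - 1) = inverse P"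
    using assms by (subst fps_inverse_compose) (simp_all add: fps_compose_add_distrib)
  finally have *: "fps_deriv (fps_log P) = inverse P * fps_deriv P" .
  show ?thesis
  proof (cases m)
    case (Suc k)
    have "of_nat (Suc k) * fps_nth (fps_log P) (Suc k) = fps_nth (fps_deriv (fps_log P)) k" by simp
    also have "\<dots> = fps_nth (inverse P * fps_deriv P) k" by (simp only: *)
    also have "\<dots> = fps_nth (euler_deriv P) (Suc k)"
      unfolding euler_deriv_def by (simp only: mult.assoc fps_X_mult_nth mult.commute[of "inverse P"]) simp
    finally show ?thesis using Suc by simp
  qed (simp add: euler_deriv_def mult.assoc)
qed

lemma euler_deriv_mult_aux:
  fixes x :: "'a :: comm_ring_1"
  assumes "P * P' = 1" "Q * Q' = 1"
  shows "x * (P * Qd + Pd * Q) * (P' * Q') = x * Pd * P' + x * Qd * Q'"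
proof -
  have "x * (P * Qd + Pd * Q) * (P' * Q') = x * Pd * P' * (Q * Q') + x * Qd * Q' * (P * P')"
    by (simp add: algebra_simps)
  then show ?thesis by (simp add: assms)
qed

lemma euler_deriv_mult:
  assumes "fps_nth P 0 = 1" "fps_nth Q 0 = 1"
  shows "euler_deriv (P * Q) = euler_deriv P + euler_deriv Q"
proof -
  have "P * inverse P = 1" "Q * inverse Q = 1"
    using assms by (simp_all add: inverse_mult_eq_1')
  then show ?thesis
    unfolding euler_deriv_def fps_inverse_mult fps_deriv_mult
    by (rule euler_deriv_mult_aux)
qed

lemma euler_deriv_power:
  assumes "fps_nth P 0 = 1"
  shows "euler_deriv (P ^ n) = of_nat n * euler_deriv P"
proof (induction n)
  case (Suc n)
  have "fps_nth (P ^ n) 0 = 1" using assms by (simp add: fps_nth_power_0)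
  with Suc show ?case using assms by (simp add: euler_deriv_mult distrib_right)
qed (simp add: euler_deriv_def)

lemma fps_nth_0_prod:
  assumes "finite A" "\<And>a. a \<in> A \<Longrightarrow> fps_nth (P a) 0 = (1::rat)"
  shows "fps_nth (prod P A) 0 = 1"
  using assms by (induction rule: finite_induct) auto

lemma euler_deriv_prod:
  assumes "finite A" "\<And>a. a \<in> A \<Longrightarrow> fps_nth (P a) 0 = 1"
  shows "euler_deriv (\<Prod>a\<in>A. P a) = (\<Sum>a\<in>A. euler_deriv (P a))"
  using assms by (induction rule: finite_induct)
    (auto simp: euler_deriv_mult fps_nth_0_prod, simp add: euler_deriv_def)

lemma euler_deriv_eqI:
  assumes "fps_nth P 0 = 1" "P * Y = fps_X * fps_deriv P"
  shows "euler_deriv P = Y"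
proof -
  have "P * inverse P = 1" using assms by (simp add: inverse_mult_eq_1')
  moreover have "P * Y * inverse P = (P * inverse P) * Y" by (simp only: mult_ac)
  ultimately have "P * Y * inverse P = Y" by simp
  then show ?thesis unfolding euler_deriv_def assms(2)[symmetric] .
qed

text \<open>Comparing coefficients in \<open>R * euler_deriv R = X R'\<close> gives a recursion in
  which degree i involves only coefficients of R up to i. This matters because the Hilbert series of
  the limit is compared with a finite product only up to a given degree.\<close>

lemma euler_deriv_cong:
  assumes "fps_nth P 0 = 1" "\<And>i. i \<le> n \<Longrightarrow> fps_nth P i = fps_nth Q i" "i \<le> n"
  shows "fps_nth (euler_deriv P) i = fps_nth (euler_deriv Q) i"
  using assms(3)
proof (induction i rule: less_induct)
  case (less i)
  have rec: "fps_nth (euler_deriv R) i = of_nat i * fps_nth R i -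
     (\<Sum>k=1..i. fps_nth R k * fps_nth (euler_deriv R) (i - k))" if "fps_nth R 0 = 1" for R
  proof -
    have "R * inverse R = 1" using that by (simp add: inverse_mult_eq_1')
    moreover have "R * euler_deriv R = (R * inverse R) * (fps_X * fps_deriv R)"
      unfolding euler_deriv_def by (simp only: mult_ac)
    ultimately have "R * euler_deriv R = fps_X * fps_deriv R" by simp
    then have "fps_nth (R * euler_deriv R) i = of_nat i * fps_nth R i" by (cases i) auto
    then show ?thesis using that by (simp add: fps_mult_nth sum.atLeast_Suc_atMost[of 0])
  qed
  have "fps_nth Q 0 = 1" using assms by force
  show ?case unfolding rec[OF assms(1)] rec[OF \<open>fps_nth Q 0 = 1\<close>]
    using less assms(2) by (intro arg_cong2[where f = "(-)"] sum.cong) auto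
qed

text \<open>The Hilbert series of F_p[x]/(x^p) with x in degree w: a letter of weight w occurs in an
  ordered monomial with an exponent below p.\<close>

definition truncated_geometric :: "nat \<Rightarrow> nat \<Rightarrow> rat fps" where
  "truncated_geometric p w = (\<Sum>e<p. fps_X ^ (e * w))"

lemma truncated_geometric_nth_0: "p > 0 \<Longrightarrow> w > 0 \<Longrightarrow> fps_nth (truncated_geometric p w) 0 = 1"
  unfolding truncated_geometric_def fps_sum_nth by (simp add: fps_X_power_nth sum.delta)

lemma euler_deriv_one_minus_power:
  assumes "w > 0"
  shows "euler_deriv (1 - fps_X ^ w) = Abs_fps (\<lambda>m. if m > 0 \<and> w dvd m then - of_nat w else 0)"
    (is "_ = ?Y")
proof (rule euler_deriv_eqI)
  show "fps_nth (1 - fps_X ^ w :: rat fps) 0 = 1" using assms by simp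
  have Y: "fps_nth ?Y m = fps_nth (fps_X * fps_deriv (1 - fps_X ^ w)) m + fps_nth (fps_X ^ w * ?Y) m" for m
  proof (cases "m = 0")
    case False
    then obtain k where k: "m = Suc k" by (cases m) auto
    have 1: "fps_nth (fps_X * fps_deriv (1 - fps_X ^ w :: rat fps)) m = (if m = w then - of_nat w else 0)"
      using assms by (auto simp: k fps_X_power_nth)
    show ?thesis unfolding 1 using assms False
      by (auto simp: fps_X_power_mult_nth dvd_minus_self)
  qed (use assms in \<open>simp add: fps_X_power_mult_nth\<close>)
  show "(1 - fps_X ^ w) * ?Y = fps_X * fps_deriv (1 - fps_X ^ w)"
    by (rule fps_ext) (use Y in \<open>simp add: algebra_simps\<close>)
qed

text \<open>From (1 - X^w) * \<open>truncated_geometric p w\<close> = 1 - X^(p w) and additivity.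
  The negative contribution at multiples of p w is the origin of the term c_(n/p).\<close>

lemma euler_deriv_truncated_geometric:
  assumes "p > 0" "w > 0" "m > 0"
  shows "fps_nth (euler_deriv (truncated_geometric p w)) m =
    (if w dvd m then of_nat w else 0) - (if p * w dvd m then of_nat (p * w) else 0)"
proof -
  have "(1 - fps_X ^ w) * truncated_geometric p w = 1 - fps_X ^ (p * w)"
    using one_diff_power_eq[of "fps_X ^ w :: rat fps" p]
    by (simp add: truncated_geometric_def power_mult[symmetric] mult.commute)
  then have "euler_deriv (1 - fps_X ^ w) + euler_deriv (truncated_geometric p w)
     = euler_deriv (1 - fps_X ^ (p * w))"
    using assms by (subst euler_deriv_mult[symmetric]) (auto simp: truncated_geometric_nth_0)
  then have "fps_nth (euler_deriv (truncated_geometric p w)) m =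
     fps_nth (euler_deriv (1 - fps_X ^ (p * w))) m - fps_nth (euler_deriv (1 - fps_X ^ w)) m"
    by (metis add_diff_cancel_left' fps_sub_nth)
  then show ?thesis using assms by (simp add: euler_deriv_one_minus_power del: mult_eq_0_iff of_nat_mult)
qed

text \<open>The product may stop at any W beyond n: every divisor of a number in 1..n, and every w
  with p w dividing such a number, is then in the range of the index.\<close>

lemma log_product_formula:
  fixes c :: "nat \<Rightarrow> nat"
  assumes p: "prime p" and n: "n = p ^ k * m" "m \<ge> 1" "coprime m p"
    and W: "n < W"
    and P: "\<And>i. i \<le> n \<Longrightarrow> fps_nth P i = fps_nth (\<Prod>w\<in>{1..<W}. truncated_geometric p w ^ c w) i"
  shows "(\<Sum>j\<le>k. 1 / of_nat (p ^ j * m) * (\<Sum>d | d dvd p ^ j * m.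
      of_int (moebius ((p ^ j * m) div d)) * of_nat d * fps_nth (fps_log P) d)) = of_nat (c n)"
proof -
  note [simp] = truncated_geometric_nth_0
  \<comment> \<open>Moebius inversion will give w_d = g d / d, that is c_d - c_(d/p), where c at a
    non-integral index counts as 0.\<close>
  define g :: "nat \<Rightarrow> rat" where
    "g d = of_nat d * (of_nat (c d) - (if p dvd d then of_nat (c (d div p)) else 0))" for d
  have p0: "p > 0" using p by (simp add: prime_gt_0_nat)
  let ?R = "\<Prod>w\<in>{1..<W}. truncated_geometric p w ^ c w"
  have R0: "fps_nth ?R 0 = 1" using p0 by (intro fps_nth_0_prod) (auto simp: fps_nth_power_0)
  then have P0: "fps_nth P 0 = 1" using P[of 0] by simp
  have log: "of_nat d * fps_nth (fps_log P) d = (\<Sum>e | e dvd d. g e)" if d: "0 < d" "d \<le> n" for d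
  proof -
    have fin: "finite {e. e dvd d}" using d by simp
    have "of_nat d * fps_nth (fps_log P) d = fps_nth (euler_deriv ?R) d"
      using P P0 d by (simp add: fps_log_nth[OF P0] euler_deriv_cong[of P n])
    also have "euler_deriv ?R = (\<Sum>w\<in>{1..<W}. of_nat (c w) * euler_deriv (truncated_geometric p w))"
      using p0 by (subst euler_deriv_prod) (auto simp: euler_deriv_power fps_nth_power_0 intro!: sum.cong)
    also have "fps_nth \<dots> d = (\<Sum>w\<in>{1..<W}. of_nat (c w) * ((if w dvd d then of_nat w else 0)
        - (if p * w dvd d then of_nat (p * w) else 0)))"
      unfolding fps_sum_nth using p0 d
      by (intro sum.cong refl) (simp add: fps_of_nat[symmetric] euler_deriv_truncated_geometric del: of_nat_mult)
    also have "\<dots> = (\<Sum>w\<in>{1..<W}. if w dvd d then of_nat w * of_nat (c w) else 0)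
       - (\<Sum>w\<in>{1..<W}. if p * w dvd d then of_nat (p * w) * of_nat (c w) else 0)"
      unfolding sum_subtractf[symmetric] by (intro sum.cong refl) (auto simp: algebra_simps)
    also have "(\<Sum>w\<in>{1..<W}. if w dvd d then of_nat w * of_nat (c w) else 0)
       = (\<Sum>e | e dvd d. of_nat e * of_nat (c e) :: rat)"
    proof (rule sum.mono_neutral_cong_right)
      have "e \<in> {1..<W}" if "e dvd d" for e
        using dvd_imp_le[OF that d(1)] dvd_pos_nat[OF d(1) that] d W by simp
      then show "{e. e dvd d} \<subseteq> {1..<W}" by auto
    qed auto
    also have "(\<Sum>w\<in>{1..<W}. if p * w dvd d then of_nat (p * w) * of_nat (c w) else 0)
       = (\<Sum>w | p * w dvd d. of_nat (p * w) * of_nat (c w) :: rat)"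
    proof (rule sum.mono_neutral_cong_right)
      have "w \<in> {1..<W}" if "p * w dvd d" for w
      proof -
        have "w > 0" using that d by (cases w) auto
        moreover have "w \<le> p * w" using p0 by simp
        moreover have "p * w \<le> d" using dvd_imp_le[OF that d(1)] .
        ultimately have "1 \<le> w" "w < W" using d W by linarith+
        then show ?thesis by simp
      qed
      then show "{w. p * w dvd d} \<subseteq> {1..<W}" by auto
    qed auto
    also have "\<dots> = (\<Sum>e | e dvd d \<and> p dvd e. of_nat e * of_nat (c (e div p)))"
      by (rule sum.reindex_bij_witness[of _ "\<lambda>e. e div p" "\<lambda>w. p * w"]) (use p0 in auto)
    also have "\<dots> = (\<Sum>e | e dvd d. if p dvd e then of_nat e * of_nat (c (e div p)) else 0)"
      by (rule sum.mono_neutral_cong_left) (use fin in auto)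
    finally show ?thesis unfolding g_def sum_subtractf[symmetric]
      by (simp add: algebra_simps if_distrib cong: if_cong)
  qed
  have w: "1 / of_nat j * (\<Sum>d | d dvd j. of_int (moebius (j div d)) * of_nat d * fps_nth (fps_log P) d)
     = of_nat (c j) - (if p dvd j then of_nat (c (j div p)) else 0)" if "j > 0" "j dvd n" for j
  proof -
    have "(\<Sum>d | d dvd j. of_int (moebius (j div d)) * (of_nat d * fps_nth (fps_log P) d)) = g j"
    proof (rule moebius_inversion[OF that(1)])
      fix d assume "d dvd j"
      with that have "d dvd n" "d > 0" by (auto intro: dvd_trans dvd_pos_nat)
      moreover have "n > 0" using n p0 by simp
      ultimately show "of_nat d * fps_nth (fps_log P) d = (\<Sum>e | e dvd d. g e)"
        using log dvd_imp_le by blast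
    qed
    then show ?thesis using that by (simp add: g_def mult.assoc)
  qed
  \<comment> \<open>At l = 0 there is nothing to subtract, since m is prime to p; afterwards each
    subtracted term cancels the previous partial sum.\<close>
  have tel: "(\<Sum>j\<le>l. of_nat (c (p ^ j * m)) - (if p dvd p ^ j * m then of_nat (c (p ^ j * m div p)) else 0))
     = (of_nat (c (p ^ l * m)) :: rat)" for l
  proof (induction l)
    case 0
    have "\<not> p dvd m" using n p coprime_absorb_right[of p m] by (metis coprime_commute not_prime_unit)
    then show ?case by simp
  next
    case (Suc l)
    then show ?case using p0 by (simp add: mult.assoc)
  qed
  have "(\<Sum>j\<le>k. 1 / of_nat (p ^ j * m) * (\<Sum>d | d dvd p ^ j * m.
      of_int (moebius ((p ^ j * m) div d)) * of_nat d * fps_nth (fps_log P) d))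
    = (\<Sum>j\<le>k. of_nat (c (p ^ j * m)) - (if p dvd p ^ j * m then of_nat (c (p ^ j * m div p)) else 0))"
    by (intro sum.cong refl w) (use n p0 in \<open>auto simp: le_imp_power_dvd\<close>)
  then show ?thesis using tel[of k] n by simp
qed

section \<open>Generators of elementary abelian sections\<close>

text \<open>Each b has at most p powers, and in a commutative group the product of the subgroup of b
  with the one generated so far is again a subgroup. It is applied additively, with I^(n+1) as S and
  the ordered monomials of weight n as B, to bound the order of I^n.\<close>

lemma (in comm_group) card_generate_Un_le:
  assumes "finite B" "B \<subseteq> carrier G" "subgroup S G" "finite S" "(p::nat) > 0"
    and "\<And>b. b \<in> B \<Longrightarrow> b [^] p = \<one>"
  shows "finite (generate G (B \<union> S)) \<and> card (generate G (B \<union> S)) \<le> p ^ card B * card S"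
  using assms(1,2,6)
proof (induction B rule: finite_induct)
  case empty
  have "generate G S = S"
    by (rule generateI[symmetric]) (use assms in auto)
  with assms show ?case by simp
next
  case (insert b B)
  let ?S = "generate G (B \<union> S)" and ?C = "generate G {b}"
  have b: "b \<in> carrier G" "b [^] p = \<one>" using insert by auto
  have BS: "B \<union> S \<subseteq> carrier G" using insert assms(3) subgroup.subset by blast
  have "?C \<subseteq> (\<lambda>k. b [^] k) ` {..<p}"
  proof
    fix x assume "x \<in> ?C"
    then obtain k :: int where k: "x = b [^] k" using generate_pow[OF b(1)] by auto
    have bi: "b [^] (int p) = \<one>" using b int_pow_int by metis
    have "x = b [^] (int p * (k div int p) + k mod int p)" using k by simp
    also have "\<dots> = (b [^] int p) [^] (k div int p) \<otimes> b [^] (k mod int p)"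
      using b by (simp only: int_pow_mult int_pow_pow)
    also have "\<dots> = b [^] (k mod int p)"
      unfolding bi using b by simp
    also have "\<dots> = b [^] nat (k mod int p)"
      using assms(5) by (metis int_pow_int nat_0_le of_nat_0_less_iff pos_mod_sign)
    finally show "x \<in> (\<lambda>k. b [^] k) ` {..<p}"
      using assms(5) by (auto intro!: image_eqI[of _ _ "nat (k mod int p)"] simp: nat_less_iff)
  qed
  then have C: "finite ?C" "card ?C \<le> p"
    by (auto dest: finite_subset) (use card_mono[of "(\<lambda>k. b [^] k) ` {..<p}" ?C]
      card_image_le[of "{..<p}" "\<lambda>k. b [^] k"] in simp)
  have S: "finite ?S" "card ?S \<le> p ^ card B * card S" using insert by auto
  have "subgroup (?C <#> ?S) G"
    using b BS by (intro mult_subgroups generate_is_subgroup) auto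
  moreover have "insert b B \<union> S \<subseteq> ?C <#> ?S"
  proof
    fix x assume "x \<in> insert b B \<union> S"
    then consider "x = b" | "x \<in> B \<union> S" by auto
    then show "x \<in> ?C <#> ?S"
    proof cases
      case 1
      have "b \<otimes> \<one> \<in> ?C <#> ?S" unfolding set_mult_def by (blast intro: generate.intros)
      then show ?thesis using 1 b by simp
    next
      case 2
      have "\<one> \<otimes> x \<in> ?C <#> ?S" unfolding set_mult_def using 2 by (blast intro: generate.intros)
      then show ?thesis using 2 BS by (metis l_one subsetD)
    qed
  qed
  ultimately have *: "generate G (insert b B \<union> S) \<subseteq> ?C <#> ?S"
    by (rule generate_subgroup_incl[rotated])
  have CS: "?C <#> ?S = (\<lambda>(x, y). x \<otimes> y) ` (?C \<times> ?S)" unfolding set_mult_def by auto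
  have "card (?C <#> ?S) \<le> card ?C * card ?S"
    unfolding CS using C S by (metis card_cartesian_product card_image_le finite_cartesian_product)
  also have "\<dots> \<le> p * (p ^ card B * card S)" using C S by (intro mult_le_mono)
  finally have "card (?C <#> ?S) \<le> p ^ card (insert b B) * card S" using insert by simp
  moreover have "finite (?C <#> ?S)" unfolding CS using C S by simp
  ultimately show ?case using * by (auto dest: finite_subset intro: order_trans[OF card_mono])
qed

text \<open>h l h^(-1) is the commutator of h^(-1) and l^(-1), followed by l.\<close>

lemma (in group) normal_in_of_commutators:
  assumes "subgroup H G" "subgroup L G" "L \<subseteq> H"
    and comm: "\<And>x y. x \<in> H \<Longrightarrow> y \<in> H \<Longrightarrow> inv x \<otimes> inv y \<otimes> x \<otimes> y \<in> L"
    and "h \<in> H" "l \<in> L"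
  shows "h \<otimes> l \<otimes> inv h \<in> L"
proof -
  have c: "h \<in> carrier G" "l \<in> carrier G" using assms subgroup.mem_carrier by fastforce+
  have "inv (inv h) \<otimes> inv (inv l) \<otimes> inv h \<otimes> inv l \<in> L"
    using assms by (intro comm) (auto intro: subgroup.m_inv_closed)
  then have "(inv (inv h) \<otimes> inv (inv l) \<otimes> inv h \<otimes> inv l) \<otimes> l \<in> L"
    using assms by (blast intro: subgroup.m_closed)
  then show ?thesis using c by (simp add: m_assoc)
qed

text \<open>The hypotheses make H/L elementary abelian, and B lifts a basis of it. The construction
  stays inside H: an element x outside L is adjoined, the subgroup L' = L<x> has order p |L|, still
  contains the commutators and p-th powers, and the induction continues with L' in place of
  L.\<close>

lemma (in group) elementary_section_generators:
  assumes "subgroup H G" "finite H" "prime p"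
    and "subgroup L G" "L \<subseteq> H"
    and comm: "\<And>x y. x \<in> H \<Longrightarrow> y \<in> H \<Longrightarrow> inv x \<otimes> inv y \<otimes> x \<otimes> y \<in> L"
    and pow: "\<And>x. x \<in> H \<Longrightarrow> x [^] p \<in> L"
  shows "\<exists>B\<subseteq>H. B \<inter> L = {} \<and> generate G (L \<union> B) = H \<and> card H = p ^ card B * card L"
  using assms(4-)
proof (induction "card H - card L" arbitrary: L rule: less_induct)
  case less
  have Hc: "H \<subseteq> carrier G" using assms(1) subgroup.subset by blast
  have p0: "p > 0" using \<open>prime p\<close> by (simp add: prime_gt_0_nat)
  show ?case
  proof (cases "L = H")
    case True
    have "generate G L = L" by (rule generateI[symmetric]) (use less in auto)
    then show ?thesis using True by (intro exI[of _ "{}"]) auto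
  next
    case False
    with less obtain x where x: "x \<in> H" "x \<notin> L" by blast
    then have xc: "x \<in> carrier G" using Hc by auto
    have Lc: "L \<subseteq> carrier G" using less Hc by auto
    \<comment> \<open>With arbitrary integer exponents, closure of \<open>L'\<close> under products
      and inverses is immediate from normality. The restriction of the exponents to 0..<p, which is
      what counts \<open>L'\<close>, is made afterwards and uses that x^p lies in L.\<close>
    define f where "f = (\<lambda>(l, k::int). l \<otimes> x [^] k)"
    define L' where "L' = f ` (L \<times> UNIV)"
    have xk: "x [^] k \<in> H" for k :: int using x assms(1) by (simp add: subgroup_int_pow_closed)
    have conj: "h \<otimes> l \<otimes> inv h \<in> L" if "h \<in> H" "l \<in> L" for h l
      by (rule normal_in_of_commutators[OF assms(1) less(2,3,4) that])
    have L'H: "L' \<subseteq> H"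
      using xk less(3) assms(1) by (auto simp: L'_def f_def intro!: subgroup.m_closed)
    have LL': "L \<subseteq> L'"
    proof
      fix l assume "l \<in> L"
      then have "l = f (l, 0)" using Lc by (auto simp: f_def)
      then show "l \<in> L'" using \<open>l \<in> L\<close> unfolding L'_def by blast
    qed
    have xL': "x \<in> L'"
    proof -
      have "x = f (\<one>, 1)" using xc by (simp add: f_def)
      then show ?thesis using less(2) subgroup.one_closed unfolding L'_def by blast
    qed
    have sub: "subgroup L' G"
    proof (rule subgroupI)
      show "L' \<subseteq> carrier G" using L'H Hc by auto
      show "L' \<noteq> {}" using xL' by auto
    next
      fix a assume "a \<in> L'"
      then obtain l k where a: "a = l \<otimes> x [^] (k::int)" "l \<in> L" by (auto simp: L'_def f_def)
      have c: "l \<in> carrier G" using a Lc by auto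
      have "x [^] (-k) \<otimes> inv l \<otimes> inv (x [^] (-k)) \<in> L"
        using a less(2) by (intro conj xk) (auto intro: subgroup.m_inv_closed)
      moreover have "inv a = (x [^] (-k) \<otimes> inv l \<otimes> inv (x [^] (-k))) \<otimes> x [^] (-k)"
        using a c xc by (simp add: m_assoc inv_mult_group int_pow_neg)
      ultimately show "inv a \<in> L'" unfolding L'_def f_def by force
    next
      fix a b assume "a \<in> L'" "b \<in> L'"
      then obtain l k m j where a: "a = l \<otimes> x [^] (k::int)" "l \<in> L" and b: "b = m \<otimes> x [^] (j::int)" "m \<in> L"
        by (auto simp: L'_def f_def)
      have c: "l \<in> carrier G" "m \<in> carrier G" using a b Lc by auto
      have "l \<otimes> (x [^] k \<otimes> m \<otimes> inv (x [^] k)) \<in> L"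
        using a b less(2) by (intro subgroup.m_closed conj xk) auto
      moreover have "a \<otimes> b = (l \<otimes> (x [^] k \<otimes> m \<otimes> inv (x [^] k))) \<otimes> x [^] (k + j)"
        using a b c xc by (simp add: m_assoc int_pow_mult inv_solve_left)
      ultimately show "a \<otimes> b \<in> L'" unfolding L'_def f_def by force
    qed
    have img: "L' = f ` (L \<times> {0..<int p})"
    proof
      show "L' \<subseteq> f ` (L \<times> {0..<int p})"
      proof
        fix a assume "a \<in> L'"
        then obtain l k where a: "a = l \<otimes> x [^] (k::int)" "l \<in> L" by (auto simp: L'_def f_def)
        have c: "l \<in> carrier G" using a Lc by auto
        have "x [^] k = x [^] (int p * (k div int p) + k mod int p)" by simp
        also have "\<dots> = (x [^] p) [^] (k div int p) \<otimes> x [^] (k mod int p)"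
          using xc by (simp only: int_pow_mult int_pow_pow int_pow_int[symmetric])
        finally have "a = (l \<otimes> (x [^] p) [^] (k div int p)) \<otimes> x [^] (k mod int p)"
          using a c xc by (simp add: m_assoc)
        moreover have "l \<otimes> (x [^] p) [^] (k div int p) \<in> L"
          using a less(2) less(5)[OF x(1)] by (auto intro!: subgroup.m_closed subgroup_int_pow_closed)
        ultimately show "a \<in> f ` (L \<times> {0..<int p})"
          using p0 by (intro image_eqI[of _ _ "(l \<otimes> (x [^] p) [^] (k div int p), k mod int p)"]) (auto simp: f_def)
      qed
    qed (auto simp: L'_def)
    have inj: "inj_on f (L \<times> {0..<int p})"
    proof -
      have key: "k = j" if "l \<in> L" "m \<in> L" "l \<otimes> x [^] k = m \<otimes> x [^] j" "k \<le> j" "0 \<le> k" "j < int p" for l m and k j :: int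
      proof (rule ccontr)
        assume "k \<noteq> j"
        have c: "l \<in> carrier G" "m \<in> carrier G" using that Lc by auto
        have "x [^] j = x [^] (j - k) \<otimes> x [^] k" using xc by (simp add: int_pow_mult[symmetric])
        then have "l \<otimes> x [^] k = (m \<otimes> x [^] (j - k)) \<otimes> x [^] k" using that(3) c xc by (simp add: m_assoc)
        then have "l = m \<otimes> x [^] (j - k)" using c xc by simp
        then have "x [^] (j - k) = inv m \<otimes> l" using c xc by (simp add: inv_solve_left)
        also have "\<dots> \<in> L" using that less(2) by (auto intro: subgroup.m_closed subgroup.m_inv_closed)
        finally have xjk: "x [^] (j - k) \<in> L" .
        \<comment> \<open>Two equal products with different exponents put x^(j-k) into L. Since x^p
          is in L too, Bezout's identity would put x itself into L.\<close>
        have "coprime (j - k) (int p)"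
        proof -
          have "\<not> int p dvd j - k" using that \<open>k \<noteq> j\<close> by (auto dest: zdvd_imp_le)
          then show ?thesis using \<open>prime p\<close> prime_imp_coprime[of "int p" "j - k"]
            by (simp add: coprime_commute)
        qed
        then obtain a b where ab: "a * (j - k) + b * int p = 1"
          using bezout_int[of "j - k" "int p"] by auto
        have "x = x [^] (a * (j - k) + b * int p)" using ab xc by simp
        also have "\<dots> = (x [^] (j - k)) [^] a \<otimes> (x [^] p) [^] b"
          using xc by (simp only: int_pow_mult int_pow_pow int_pow_int[symmetric] mult.commute)
        also have "\<dots> \<in> L" using less(2) less(5)[OF x(1)] xjk
          by (auto intro!: subgroup.m_closed subgroup_int_pow_closed)
        finally show False using x by simp
      qed
      have "l = m \<and> k = j" if "l \<in> L" "m \<in> L" "l \<otimes> x [^] k = m \<otimes> x [^] j"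
        "0 \<le> k" "k < int p" "0 \<le> j" "j < int p" for l m and k j :: int
      proof -
        have "k = j"
        proof (cases "k \<le> j")
          case True
          then show ?thesis using key[of l m k j] that by simp
        next
          case False
          then show ?thesis using key[of m l j k] that by simp
        qed
        moreover have "l \<in> carrier G" "m \<in> carrier G" using that Lc by auto
        ultimately show ?thesis using that xc by simp
      qed
      then show ?thesis by (fastforce simp: inj_on_def f_def)
    qed
    have finL: "finite L" using less(3) assms(2) finite_subset by blast
    have cardL': "card L' = p * card L"
      unfolding img card_image[OF inj] by (simp add: card_cartesian_product)
    have "finite L'" using L'H assms(2) finite_subset by blast
    then have "card L < card L'"
      using LL' xL' x by (intro psubset_card_mono) auto
    moreover have "card L' \<le> card H" using L'H assms(2) card_mono by blast
    ultimately have "card H - card L' < card H - card L" by linarith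
    moreover have "inv y \<otimes> inv z \<otimes> y \<otimes> z \<in> L'" if "y \<in> H" "z \<in> H" for y z
      using less(4)[OF that] LL' by blast
    moreover have "y [^] p \<in> L'" if "y \<in> H" for y using less(5)[OF that] LL' by blast
    ultimately have "\<exists>B\<subseteq>H. B \<inter> L' = {} \<and> generate G (L' \<union> B) = H \<and> card H = p ^ card B * card L'"
      by (intro less(1) sub L'H)
    then obtain B where B: "B \<subseteq> H" "B \<inter> L' = {}" "generate G (L' \<union> B) = H" "card H = p ^ card B * card L'"
      by blast
    have c: "L \<union> insert x B \<subseteq> carrier G" using Lc xc B(1) Hc by auto
    have genH: "generate G (L \<union> insert x B) = H"
    proof
      show "generate G (L \<union> insert x B) \<subseteq> H"
        by (rule generate_subgroup_incl[OF _ assms(1)]) (use less(3) x B(1) in auto)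
      have gs: "subgroup (generate G (L \<union> insert x B)) G" by (rule generate_is_subgroup[OF c])
      have "L' \<subseteq> generate G (L \<union> insert x B)"
      proof
        fix a assume "a \<in> L'"
        then obtain l k where a: "a = l \<otimes> x [^] (k::int)" "l \<in> L" by (auto simp: L'_def f_def)
        then have "l \<in> generate G (L \<union> insert x B)" "x \<in> generate G (L \<union> insert x B)"
          by (simp_all add: generate.incl)
        then show "a \<in> generate G (L \<union> insert x B)"
          unfolding a by (intro subgroup.m_closed[OF gs] subgroup_int_pow_closed[OF gs])
      qed
      moreover have "B \<subseteq> generate G (L \<union> insert x B)" by (auto intro: generate.incl)
      ultimately show "H \<subseteq> generate G (L \<union> insert x B)"
        using generate_subgroup_incl[OF _ gs, of "L' \<union> B"] B(3) by blast
    qed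
    have "finite B" using B(1) assms(2) finite_subset by blast
    moreover have "x \<notin> B" using B(2) xL' by auto
    ultimately have "card H = p ^ card (insert x B) * card L" using B(4) cardL' by simp
    moreover have "insert x B \<subseteq> H" "insert x B \<inter> L = {}" using B(1,2) LL' x by auto
    ultimately show ?thesis using genH by blast
  qed
qed

section \<open>Powers of an ideal\<close>

text \<open>For an arbitrary ring and ideal, so that the same facts serve the finite group algebras
  and their limit.\<close>

definition ideal_pow :: "('a, 'b) ring_scheme \<Rightarrow> 'a set \<Rightarrow> nat \<Rightarrow> 'a set" where
  "ideal_pow R I n = I [^]\<^bsub>ideals_set R\<^esub> n"

context ring
begin

lemma ideal_pow_0 [simp]: "ideal_pow R I 0 = carrier R"
  by (simp add: ideal_pow_def nat_pow_def ideals_set_def)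

lemma ideal_pow_Suc: "ideal_pow R I (Suc n) = ideal_pow R I n \<cdot> I"
  by (simp add: ideal_pow_def nat_pow_def ideals_set_def)

lemma ideal_pow_ideal: "ideal I R \<Longrightarrow> ideal (ideal_pow R I n) R"
  by (induction n) (simp_all add: ideal_pow_Suc oneideal ideal_prod_is_ideal)

lemma ideal_pow_subgroup: "ideal I R \<Longrightarrow> subgroup (ideal_pow R I n) (add_monoid R)"
  using ideal_pow_ideal additive_subgroup.a_subgroup ideal.axioms(1) by blast

lemma ideal_pow_subset: "ideal I R \<Longrightarrow> ideal_pow R I n \<subseteq> carrier R"
  using ideal_pow_subgroup subgroup.subset by fastforce

lemma ideal_pow_carrier: "ideal I R \<Longrightarrow> x \<in> ideal_pow R I n \<Longrightarrow> x \<in> carrier R"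
  using ideal_pow_subset by blast

lemma ideal_pow_1:
  assumes "ideal I R"
  shows "ideal_pow R I (Suc 0) = I"
proof
  show "ideal_pow R I (Suc 0) \<subseteq> I"
    using ideal_prod_inter[OF oneideal assms] by (simp add: ideal_pow_Suc)
  show "I \<subseteq> ideal_pow R I (Suc 0)"
  proof
    fix x assume "x \<in> I"
    then have "\<one> \<otimes> x \<in> carrier R \<cdot> I" by (intro ideal_prod.prod) auto
    then show "x \<in> ideal_pow R I (Suc 0)"
      using ideal.Icarr[OF assms \<open>x \<in> I\<close>] by (simp add: ideal_pow_Suc)
  qed
qed

lemma ideal_pow_add:
  assumes "ideal I R"
  shows "ideal_pow R I (m + n) = ideal_pow R I m \<cdot> ideal_pow R I n"
proof (induction n)
  case 0
  show ?case by (simp add: ideal_prod_one ideal_pow_ideal assms)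
next
  case (Suc n)
  then show ?case
    by (simp add: ideal_pow_Suc ideal_prod_assoc ideal_pow_ideal assms)
qed

lemma ideal_pow_mult:
  assumes "ideal I R" "x \<in> ideal_pow R I m" "y \<in> ideal_pow R I n"
  shows "x \<otimes> y \<in> ideal_pow R I (m + n)"
  using assms by (simp add: ideal_pow_add ideal_prod.prod)

lemma ideal_pow_antimono:
  assumes "ideal I R" "m \<le> n"
  shows "ideal_pow R I n \<subseteq> ideal_pow R I m"
proof -
  have "ideal_pow R I n = ideal_pow R I m \<cdot> ideal_pow R I (n - m)"
    using ideal_pow_add[OF assms(1), of m "n - m"] assms(2) by simp
  then show ?thesis using ideal_prod_inter[OF ideal_pow_ideal[OF assms(1)] ideal_pow_ideal[OF assms(1)]] by blast
qed

lemma ideal_pow_power: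
  assumes "ideal I R" "x \<in> ideal_pow R I m"
  shows "x [^] (k::nat) \<in> ideal_pow R I (k * m)"
proof (induction k)
  case (Suc k)
  then show ?case using ideal_pow_mult[OF assms(1) Suc assms(2)] by (simp add: add.commute)
qed simp

lemma subgroup_vimage_sandwich:
  assumes "subgroup S (add_monoid R)" "x \<in> carrier R" "z \<in> carrier R"
  shows "subgroup {y \<in> carrier R. x \<otimes> y \<otimes> z \<in> S} (add_monoid R)"
proof (rule add.subgroupI)
  show "{y \<in> carrier R. x \<otimes> y \<otimes> z \<in> S} \<noteq> {}"
    using assms subgroup.one_closed[OF assms(1)] by auto
next
  fix a assume "a \<in> {y \<in> carrier R. x \<otimes> y \<otimes> z \<in> S}"
  then show "\<ominus> a \<in> {y \<in> carrier R. x \<otimes> y \<otimes> z \<in> S}"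
    using assms subgroup.m_inv_closed[OF assms(1), of "x \<otimes> a \<otimes> z"]
    by (simp add: l_minus r_minus a_inv_def[symmetric])
next
  fix a b assume "a \<in> {y \<in> carrier R. x \<otimes> y \<otimes> z \<in> S}" "b \<in> {y \<in> carrier R. x \<otimes> y \<otimes> z \<in> S}"
  then show "a \<oplus> b \<in> {y \<in> carrier R. x \<otimes> y \<otimes> z \<in> S}"
    using assms subgroup.m_closed[OF assms(1), of "x \<otimes> a \<otimes> z" "x \<otimes> b \<otimes> z"]
    by (simp add: l_distr r_distr)
qed auto

text \<open>Multiplication from both sides is additive, so membership in an additive subgroup is
  decided on additive generators. The two outer factors are there for replacing a factor in the
  middle of a word.\<close>

lemma sandwich_generate:
  assumes "y \<in> generate (add_monoid R) B" "B \<subseteq> carrier R" "subgroup S (add_monoid R)"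
    and "x \<in> carrier R" "z \<in> carrier R" "\<And>b. b \<in> B \<Longrightarrow> x \<otimes> b \<otimes> z \<in> S"
  shows "x \<otimes> y \<otimes> z \<in> S"
proof -
  have "generate (add_monoid R) B \<subseteq> {y \<in> carrier R. x \<otimes> y \<otimes> z \<in> S}"
    by (rule add.generate_subgroup_incl) (use assms subgroup_vimage_sandwich in auto)
  then show ?thesis using assms(1) by blast
qed

lemma mult_generate:
  assumes "x \<in> generate (add_monoid R) B" "y \<in> generate (add_monoid R) C"
    and "B \<subseteq> carrier R" "C \<subseteq> carrier R" "subgroup S (add_monoid R)"
    and "\<And>b c. b \<in> B \<Longrightarrow> c \<in> C \<Longrightarrow> b \<otimes> c \<in> S"
  shows "x \<otimes> y \<in> S"
proof -
  have xc: "x \<in> carrier R" using add.generate_in_carrier assms by auto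
  have "x \<otimes> c \<in> S" if "c \<in> C" for c
    using sandwich_generate[OF assms(1,3,5), of \<one> c] that assms by (simp add: subset_iff xc)
  then show ?thesis
    using sandwich_generate[OF assms(2,4,5), of x \<one>] assms xc add.generate_in_carrier[of C y]
    by (simp add: subset_iff)
qed

lemma minus_in_subgroup_trans:
  assumes "subgroup S (add_monoid R)" "x \<in> carrier R" "y \<in> carrier R" "z \<in> carrier R"
    and "x \<ominus> y \<in> S" "y \<ominus> z \<in> S"
  shows "x \<ominus> z \<in> S"
proof -
  have "(x \<ominus> y) \<oplus> (y \<ominus> z) \<in> S" using subgroup.m_closed[OF assms(1,5,6)] by simp
  moreover have "(x \<ominus> y) \<oplus> (y \<ominus> z) = x \<ominus> z" using assms(2-4) by algebra
  ultimately show ?thesis by simp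
qed

lemma in_subgroup_of_minus:
  assumes "subgroup S (add_monoid R)" "x \<in> carrier R" "y \<in> carrier R" "x \<ominus> y \<in> S" "y \<in> S"
  shows "x \<in> S"
proof -
  have "(x \<ominus> y) \<oplus> y \<in> S" using subgroup.m_closed[OF assms(1,4,5)] by simp
  moreover have "(x \<ominus> y) \<oplus> y = x" using assms(2,3) by algebra
  ultimately show ?thesis by simp
qed

text \<open>The ring is not commutative, but the two summands are one and y, so Pascal's rule still
  works.\<close>

lemma one_plus_power:
  assumes y: "y \<in> carrier R"
  shows "(\<one> \<oplus> y) [^] (n::nat) = (\<Oplus>k\<in>{..n}. add_pow R (n choose k) (y [^] k))"
proof (induction n)
  case (Suc n)
  let ?f = "\<lambda>k. add_pow R (n choose k) (y [^] k)"
  let ?g = "\<lambda>k. add_pow R (Suc n choose k) (y [^] k)"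
  let ?h = "\<lambda>k. add_pow R (n choose Suc k) (y [^] Suc k)"
  have f: "?f \<in> A \<rightarrow> carrier R" for A using y by auto
  have h: "?h \<in> A \<rightarrow> carrier R" for A using y by auto
  have fy: "(\<lambda>k. ?f k \<otimes> y) \<in> A \<rightarrow> carrier R" for A using y by auto
  have gS: "?g (Suc k) = ?f k \<otimes> y \<oplus> ?h k" for k
    using y add_pow_ldistr[of "y [^] k" y "n choose k"] by (simp add: add.nat_pow_mult[symmetric])
  \<comment> \<open>The binomial coefficient at \<open>Suc n\<close> is 0, so the sum may be
    extended by that term and then re-indexed after splitting off k = 0.\<close>
  have S: "(\<Oplus>k\<in>{..n}. ?f k) = (\<Oplus>k\<in>{..n}. ?h k) \<oplus> ?f 0"
  proof -
    have "(\<Oplus>k\<in>{..Suc n}. ?f k) = ?f (Suc n) \<oplus> (\<Oplus>k\<in>{..n}. ?f k)" using f by (subst finsum_Suc) auto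
    moreover have "?f (Suc n) = \<zero>" by (simp add: binomial_eq_0 del: nat_pow_Suc)
    ultimately have "(\<Oplus>k\<in>{..n}. ?f k) = (\<Oplus>k\<in>{..Suc n}. ?f k)" using f by (simp add: finsum_closed del: nat_pow_Suc)
    then show ?thesis using f by (simp only: finsum_Suc2[OF f])
  qed
  have "(\<one> \<oplus> y) [^] Suc n = (\<Oplus>k\<in>{..n}. ?f k) \<oplus> (\<Oplus>k\<in>{..n}. ?f k \<otimes> y)"
    using y f by (simp add: Suc r_distr finsum_ldistr finsum_closed)
  also have "\<dots> = ((\<Oplus>k\<in>{..n}. ?f k \<otimes> y) \<oplus> (\<Oplus>k\<in>{..n}. ?h k)) \<oplus> ?f 0"
    unfolding S using y f h fy by (simp add: a_ac finsum_closed)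
  also have "(\<Oplus>k\<in>{..n}. ?f k \<otimes> y) \<oplus> (\<Oplus>k\<in>{..n}. ?h k) = (\<Oplus>k\<in>{..n}. ?g (Suc k))"
    unfolding gS by (rule finsum_addf[symmetric]) (use fy h in auto)
  also have "\<dots> \<oplus> ?f 0 = (\<Oplus>k\<in>{..Suc n}. ?g k)"
    using y by (subst finsum_Suc2) auto
  finally show ?case .
qed (use y in simp)

text \<open>The inner binomial coefficients are divisible by p. With y = g - 1 this reads g^p - 1 =
  (g - 1)^p, the reason why p equal letters collapse to a single one.\<close>

lemma frobenius_one_plus:
  assumes "prime (p::nat)" and char: "\<And>x. x \<in> carrier R \<Longrightarrow> add_pow R p x = \<zero>" and y: "y \<in> carrier R"
  shows "(\<one> \<oplus> y) [^] p = \<one> \<oplus> y [^] p"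
proof -
  obtain q where q: "p = Suc (Suc q)"
  proof
    show "p = Suc (Suc (p - 2))" using prime_ge_2_nat[OF assms(1)] by simp
  qed
  let ?f = "\<lambda>k. add_pow R (p choose k) (y [^] k)"
  have z: "?f (Suc k) = \<zero>" if "k \<le> q" for k
  proof -
    have "p dvd (p choose Suc k)" by (rule dvd_choose_prime) (use that q assms(1) in auto)
    then obtain c where c: "p choose Suc k = p * c" by auto
    have "?f (Suc k) = add_pow R c (add_pow R p (y [^] Suc k))"
      unfolding c by (rule add.nat_pow_pow[symmetric]) (use y in simp)
    then show ?thesis using y char by simp
  qed
  have "(\<one> \<oplus> y) [^] p = (\<Oplus>k\<in>{..Suc (Suc q)}. ?f k)" unfolding one_plus_power[OF y] using q by simp
  also have "\<dots> = ?f (Suc (Suc q)) \<oplus> ((\<Oplus>k\<in>{..q}. ?f (Suc k)) \<oplus> ?f 0)"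
  proof -
    have f: "?f \<in> A \<rightarrow> carrier R" for A using y by auto
    show ?thesis by (simp only: finsum_Suc[OF f, of "Suc q"] finsum_Suc2[OF f, of q])
  qed
  also have "(\<Oplus>k\<in>{..q}. ?f (Suc k)) = (\<Oplus>k\<in>{..q}. \<zero>)"
    by (rule finsum_cong') (use z in auto)
  also have "?f (Suc (Suc q)) \<oplus> ((\<Oplus>k\<in>{..q}. \<zero>) \<oplus> ?f 0) = \<one> \<oplus> y [^] p"
    using y q by (simp add: a_comm)
  finally show ?thesis .
qed

end

section \<open>Counting in a filtered finite group ring\<close>

context ring
begin

lemma add_minus_cancel:
  assumes "x \<in> carrier R" "y \<in> carrier R" "z \<in> carrier R"
  shows "(x \<oplus> z) \<ominus> (y \<oplus> z) = x \<ominus> y"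
proof -
  have "(x \<oplus> z) \<ominus> (y \<oplus> z) = x \<oplus> (z \<oplus> (\<ominus> z \<oplus> \<ominus> y))"
    using assms by (simp add: minus_eq minus_add a_assoc a_comm[of "\<ominus> y" "\<ominus> z"])
  then show ?thesis using assms by (simp add: r_neg2 minus_eq)
qed

lemma add_minus_cancel_one: "x \<in> carrier R \<Longrightarrow> (x \<oplus> \<one>) \<ominus> \<one> = x"
  by (simp add: minus_eq a_assoc r_neg)

lemma mult_minus_one:
  assumes "X \<in> carrier R" "Y \<in> carrier R"
  shows "X \<otimes> Y \<ominus> \<one> = (X \<ominus> \<one>) \<oplus> (Y \<ominus> \<one>) \<oplus> (X \<ominus> \<one>) \<otimes> (Y \<ominus> \<one>)"
proof -
  define a where "a = X \<ominus> \<one>"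
  define b where "b = Y \<ominus> \<one>"
  have X: "X = a \<oplus> \<one>" and Y: "Y = b \<oplus> \<one>" and c: "a \<in> carrier R" "b \<in> carrier R"
    using assms unfolding a_def b_def by (simp_all add: minus_eq a_assoc l_neg)
  have "X \<otimes> Y = (a \<oplus> b \<oplus> a \<otimes> b) \<oplus> \<one>"
    unfolding X Y using c by (simp add: l_distr r_distr a_ac)
  then have "X \<otimes> Y \<ominus> \<one> = a \<oplus> b \<oplus> a \<otimes> b" using c by (simp add: add_minus_cancel_one)
  then show ?thesis unfolding a_def b_def .
qed
text \<open>For group elements X, Y with commutator c the left side is X Y - Y X = Y X (c - 1). The
  right side splits this into its leading term c - 1 and a correction with one more factor from the
  augmentation ideal.\<close>

lemma commutator_minus_one:
  assumes "X \<in> carrier R" "Y \<in> carrier R" "c \<in> carrier R" "X \<otimes> Y = Y \<otimes> X \<otimes> c"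
  shows "(X \<ominus> \<one>) \<otimes> (Y \<ominus> \<one>) \<ominus> (Y \<ominus> \<one>) \<otimes> (X \<ominus> \<one>) = (c \<ominus> \<one>) \<oplus> (Y \<otimes> X \<ominus> \<one>) \<otimes> (c \<ominus> \<one>)"
proof -
  have comm: "(X \<ominus> \<one>) \<otimes> (Y \<ominus> \<one>) \<ominus> (Y \<ominus> \<one>) \<otimes> (X \<ominus> \<one>) = X \<otimes> Y \<ominus> Y \<otimes> X"
  proof -
    define a where "a = X \<ominus> \<one>"
    define b where "b = Y \<ominus> \<one>"
    have X: "X = a \<oplus> \<one>" and Y: "Y = b \<oplus> \<one>" and c: "a \<in> carrier R" "b \<in> carrier R"
      using assms(1,2) unfolding a_def b_def by (simp_all add: minus_eq a_assoc l_neg)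
    have "X \<otimes> Y = a \<otimes> b \<oplus> (a \<oplus> b \<oplus> \<one>)" "Y \<otimes> X = b \<otimes> a \<oplus> (a \<oplus> b \<oplus> \<one>)"
      unfolding X Y using c by (simp_all add: l_distr r_distr a_ac)
    then have "X \<otimes> Y \<ominus> Y \<otimes> X = a \<otimes> b \<ominus> b \<otimes> a" using c by (simp add: add_minus_cancel)
    then show ?thesis unfolding a_def b_def ..
  qed
  define d where "d = c \<ominus> \<one>"
  have d: "c = \<one> \<oplus> d" "d \<in> carrier R"
    using assms unfolding d_def by (simp_all add: minus_eq a_ac r_neg r_neg1 r_neg2)
  have "X \<otimes> Y \<ominus> Y \<otimes> X = Y \<otimes> X \<otimes> d"
    unfolding assms(4) unfolding d(1) using d(2) assms(1,2) by (simp add: r_distr minus_eq a_ac r_neg r_neg1 r_neg2)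
  also have "\<dots> = d \<oplus> (Y \<otimes> X \<ominus> \<one>) \<otimes> d"
    using d(2) assms(1,2) by (simp add: l_distr l_minus minus_eq a_ac r_neg r_neg1 r_neg2)
  finally show ?thesis unfolding comm d_def .
qed
end

text \<open>The properties of F_p[Q] that the count relies on: \<open>u\<close> is the inclusion of
  Q, \<open>I\<close> the augmentation ideal, and \<open>H\<close> any descending filtration
  satisfying the three inclusions. It is instantiated with the images in Q of the filtration of
  G.\<close>

locale filtered_group_ring = ring R + Q: group Q
  for R :: "('r, 'm) ring_scheme" (structure) and Q :: "('q, 'c) monoid_scheme" +
  fixes u :: "'q \<Rightarrow> 'r" and p :: nat and I :: "'r set" and H :: "nat \<Rightarrow> 'q set"
  assumes prime_p: "prime p"
    and char_p: "r \<in> carrier R \<Longrightarrow> add_pow R p r = \<zero>"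
    and u_closed [simp]: "x \<in> carrier Q \<Longrightarrow> u x \<in> carrier R"
    and u_mult: "x \<in> carrier Q \<Longrightarrow> y \<in> carrier Q \<Longrightarrow> u (x \<otimes>\<^bsub>Q\<^esub> y) = u x \<otimes> u y"
    and u_one [simp]: "u \<one>\<^bsub>Q\<^esub> = \<one>"
    and u_inj: "x \<in> carrier Q \<Longrightarrow> u x = \<one> \<Longrightarrow> x = \<one>\<^bsub>Q\<^esub>"
    and finite_Q: "finite (carrier Q)"
    and carrier_generate: "carrier R = generate (add_monoid R) (u ` carrier Q)"
    and card_R: "card (carrier R) = p ^ card (carrier Q)"
    and ideal_I: "ideal I R"
    and I_generate: "I = generate (add_monoid R) ((\<lambda>x. u x \<ominus> \<one>) ` carrier Q)"
    and nilpotent: "\<exists>N. ideal_pow R I N = {\<zero>}"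
    and H_1: "H (Suc 0) = carrier Q"
    and H_subgroup: "subgroup (H i) Q"
    and H_Suc: "H (Suc i) \<subseteq> H i"
    and H_comm: "x \<in> H i \<Longrightarrow> y \<in> H j \<Longrightarrow> i \<ge> 1 \<Longrightarrow> j \<ge> 1 \<Longrightarrow>
      inv\<^bsub>Q\<^esub> x \<otimes>\<^bsub>Q\<^esub> inv\<^bsub>Q\<^esub> y \<otimes>\<^bsub>Q\<^esub> x \<otimes>\<^bsub>Q\<^esub> y \<in> H (i + j)"
    and H_pow: "x \<in> H i \<Longrightarrow> i \<ge> 1 \<Longrightarrow> x [^]\<^bsub>Q\<^esub> p \<in> H (p * i)"
    and H_pow_I: "x \<in> H i \<Longrightarrow> u x \<ominus> \<one> \<in> ideal_pow R I i"
begin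

abbreviation A :: "nat \<Rightarrow> 'r set" where "A \<equiv> ideal_pow R I"

lemmas A_subgroup = ideal_pow_subgroup[OF ideal_I]
lemmas A_subset = ideal_pow_subset[OF ideal_I]
lemmas A_mult = ideal_pow_mult[OF ideal_I]
lemmas A_antimono = ideal_pow_antimono[OF ideal_I]

lemma p_gt_1: "p > 1" using prime_p by (rule prime_gt_1_nat)

lemma finite_R: "finite (carrier R)"
proof -
  have "card (carrier R) > 0" unfolding card_R using p_gt_1 by simp
  then show ?thesis by (rule card_ge_0_finite)
qed

lemma H_carrier: "x \<in> H i \<Longrightarrow> x \<in> carrier Q"
  by (rule subgroup.mem_carrier[OF H_subgroup])

lemma H_antimono: "i \<le> j \<Longrightarrow> H j \<subseteq> H i"
  by (induction j rule: dec_induct) (use H_Suc in auto)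

text \<open>The error is (u x - 1)(u y - 1), which lies in I^(2w) and hence in I^(w+1). So g
  \<mapsto> g - 1 is a homomorphism from \<open>H w\<close> to I^w / I^(w+1), and generators of
  \<open>H w\<close> modulo \<open>H (Suc w)\<close> suffice to span its image.\<close>

lemma u_mult_minus_one:
  assumes "x \<in> H w" "y \<in> H w" "w \<ge> 1"
  shows "\<exists>t\<in>A (Suc w). u (x \<otimes>\<^bsub>Q\<^esub> y) \<ominus> \<one> = (u x \<ominus> \<one>) \<oplus> (u y \<ominus> \<one>) \<oplus> t"
proof
  show "(u x \<ominus> \<one>) \<otimes> (u y \<ominus> \<one>) \<in> A (Suc w)"
    using A_mult[OF H_pow_I[OF assms(1)] H_pow_I[OF assms(2)]] A_antimono[of "Suc w" "w + w"] assms(3) by auto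
  have "u x \<in> carrier R" "u y \<in> carrier R" using assms H_carrier by auto
  then show "u (x \<otimes>\<^bsub>Q\<^esub> y) \<ominus> \<one> = (u x \<ominus> \<one>) \<oplus> (u y \<ominus> \<one>) \<oplus> (u x \<ominus> \<one>) \<otimes> (u y \<ominus> \<one>)"
    unfolding u_mult[OF H_carrier[OF assms(1)] H_carrier[OF assms(2)]] by (rule mult_minus_one)
qed

lemma u_minus_one_generate:
  assumes w: "w \<ge> 1" and gen: "H w = generate Q (H (Suc w) \<union> B)" and x: "x \<in> H w"
  shows "u x \<ominus> \<one> \<in> generate (add_monoid R) ((\<lambda>g. u g \<ominus> \<one>) ` B \<union> A (Suc w))"
proof -
  let ?S = "generate (add_monoid R) ((\<lambda>g. u g \<ominus> \<one>) ` B \<union> A (Suc w))"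
  have B: "B \<subseteq> H w" using gen by (auto intro: generate.incl)
  then have Bc: "(\<lambda>g. u g \<ominus> \<one>) ` B \<union> A (Suc w) \<subseteq> carrier R"
    using A_subset H_carrier by auto
  have S: "subgroup ?S (add_monoid R)" by (rule add.generate_is_subgroup) (use Bc in simp)
  have AS: "A (Suc w) \<subseteq> ?S" by (auto intro: generate.incl)
  have "H (Suc w) \<union> B \<subseteq> H w" using B H_Suc by auto
  have base: "u h \<ominus> \<one> \<in> ?S" if "h \<in> H (Suc w) \<union> B" for h
    using that H_pow_I AS by (auto intro!: generate.incl[of _ "(\<lambda>g. u g \<ominus> \<one>) ` B \<union> A (Suc w)"])
  have "x \<in> generate Q (H (Suc w) \<union> B)" using x gen by simp
  then show ?thesis
  proof (induction rule: generate.induct)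
    case one
    have "\<zero> \<in> ?S" using subgroup.one_closed[OF S] by simp
    then show ?case by (simp add: minus_eq r_neg)
  next
    case (incl h)
    then show ?case by (rule base)
  next
    case (inv h)
    then have h: "h \<in> H w" using \<open>H (Suc w) \<union> B \<subseteq> H w\<close> by auto
    have h': "inv\<^bsub>Q\<^esub> h \<in> H w" using h by (rule subgroup.m_inv_closed[OF H_subgroup])
    have c: "h \<in> carrier Q" "inv\<^bsub>Q\<^esub> h \<in> carrier Q" using h h' H_carrier by auto
    \<comment> \<open>Additivity modulo I^(w+1), applied to inv h times h, expresses u (inv h) - 1
      by u h - 1.\<close>
    obtain t where t: "t \<in> A (Suc w)"
      "u (inv\<^bsub>Q\<^esub> h \<otimes>\<^bsub>Q\<^esub> h) \<ominus> \<one> = (u (inv\<^bsub>Q\<^esub> h) \<ominus> \<one>) \<oplus> (u h \<ominus> \<one>) \<oplus> t"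
      using u_mult_minus_one[OF h' h w] by auto
    have tc: "t \<in> carrier R" using t A_subset by auto
    have "(u (inv\<^bsub>Q\<^esub> h) \<ominus> \<one>) \<oplus> (u h \<ominus> \<one>) \<oplus> t = \<zero>"
      using t(2) c by (simp add: minus_eq r_neg)
    then have "(u (inv\<^bsub>Q\<^esub> h) \<ominus> \<one>) \<oplus> ((u h \<ominus> \<one>) \<oplus> t) = \<zero>"
      using c tc by (simp add: a_assoc)
    then have "u (inv\<^bsub>Q\<^esub> h) \<ominus> \<one> = \<ominus> ((u h \<ominus> \<one>) \<oplus> t)"
      using c tc by (intro minus_equality[symmetric]) auto
    moreover have "(u h \<ominus> \<one>) \<oplus> t \<in> ?S"
      using subgroup.m_closed[OF S base[OF inv]] t(1) AS by auto
    ultimately show ?case using subgroup.m_inv_closed[OF S] by (simp add: a_inv_def)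
  next
    case (eng x y)
    have "x \<in> H w" "y \<in> H w" using eng gen by auto
    then obtain t where t: "t \<in> A (Suc w)"
      "u (x \<otimes>\<^bsub>Q\<^esub> y) \<ominus> \<one> = (u x \<ominus> \<one>) \<oplus> (u y \<ominus> \<one>) \<oplus> t"
      using u_mult_minus_one w by blast
    then show ?case using eng AS subgroup.m_closed[OF S] by auto
  qed
qed

end

section \<open>Words and ordered monomials in generators of the filtration\<close>

locale filtered_group_ring_generators = filtered_group_ring +
  fixes B :: "nat \<Rightarrow> 'c set" and W :: nat
  assumes B_subset: "B w \<subseteq> H w"
    and B_generate: "w \<ge> 1 \<Longrightarrow> H w = generate Q (H (Suc w) \<union> B w)"
    and B_empty: "w \<ge> W \<Longrightarrow> B w = {}"
begin

text \<open>A letter records its weight, because the same group element may be chosen as a generator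
  in the sets for several weights. The bound W makes the set of letters finite.\<close>

definition letters where "letters = (SIGMA w:{1..<W}. B w)"

definition word :: "(nat \<times> 'c) list \<Rightarrow> 'a" where
  "word xs = foldr (\<lambda>j r. (u (snd j) \<ominus> \<one>) \<otimes> r) xs \<one>"

definition weight :: "(nat \<times> 'c) list \<Rightarrow> nat" where
  "weight xs = sum_list (map fst xs)"

lemma letter_H: "j \<in> letters \<Longrightarrow> snd j \<in> H (fst j)" "j \<in> letters \<Longrightarrow> fst j \<ge> 1"
  unfolding letters_def by (auto intro: subsetD[OF B_subset])

lemma letter_closed [simp]: "j \<in> letters \<Longrightarrow> u (snd j) \<in> carrier R"
  by (rule u_closed[OF H_carrier[OF letter_H(1)]])

lemma word_Nil [simp]: "word [] = \<one>"
  and word_Cons [simp]: "word (j # xs) = (u (snd j) \<ominus> \<one>) \<otimes> word xs"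
  by (simp_all add: word_def)

lemma word_closed [simp]: "set xs \<subseteq> letters \<Longrightarrow> word xs \<in> carrier R"
  by (induction xs) auto

lemma word_append: "set xs \<subseteq> letters \<Longrightarrow> set ys \<subseteq> letters \<Longrightarrow> word (xs @ ys) = word xs \<otimes> word ys"
  by (induction xs) (auto simp: m_assoc)

lemma weight_simps [simp]: "weight [] = 0" "weight (j # xs) = fst j + weight xs"
  "weight (xs @ ys) = weight xs + weight ys"
  by (simp_all add: weight_def)

lemma word_in_A: "set xs \<subseteq> letters \<Longrightarrow> word xs \<in> A (weight xs)"
  by (induction xs) (auto intro!: A_mult H_pow_I letter_H)

lemma letters_generate:
  assumes "w \<ge> 1" "x \<in> H w"
  shows "u x \<ominus> \<one> \<in> generate (add_monoid R) (word ` {[j] | j. j \<in> letters \<and> fst j = w} \<union> A (Suc w))"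
proof -
  have "(\<lambda>g. u g \<ominus> \<one>) ` B w \<subseteq> word ` {[j] | j. j \<in> letters \<and> fst j = w}"
  proof
    fix y assume "y \<in> (\<lambda>g. u g \<ominus> \<one>) ` B w"
    then obtain g where g: "g \<in> B w" "y = u g \<ominus> \<one>" by auto
    then have "w < W" using B_empty[of w] by (cases "w < W") auto
    with g have "(w, g) \<in> letters" using assms(1) by (simp add: letters_def)
    moreover have "y = word [(w, g)]" using g letter_closed[OF calculation] by simp
    ultimately show "y \<in> word ` {[j] | j. j \<in> letters \<and> fst j = w}" by fastforce
  qed
  then show ?thesis
    by (intro subsetD[OF add.mono_generate u_minus_one_generate[OF assms(1) B_generate[OF assms(1)] assms(2)]]) blast
qed

lemma A_generate_words:
  "A n = generate (add_monoid R) (word ` {xs. set xs \<subseteq> letters \<and> weight xs = n} \<union> A (Suc n))"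
proof -
  let ?G = "\<lambda>n. word ` {xs. set xs \<subseteq> letters \<and> weight xs = n} \<union> A (Suc n)"
  have GA: "?G n \<subseteq> A n" for n using word_in_A A_antimono[of n "Suc n"] by auto
  then have Gc: "?G n \<subseteq> carrier R" for n using A_subset by blast
  have S: "subgroup (generate (add_monoid R) (?G n)) (add_monoid R)" for n
    by (rule add.generate_is_subgroup) (use Gc in simp)
  have "A n \<subseteq> generate (add_monoid R) (?G n)"
  proof (induction n)
    case 0
    have "u x \<in> generate (add_monoid R) (?G 0)" if "x \<in> carrier Q" for x
    proof -
      have "u x \<ominus> \<one> \<in> A (Suc 0)" using H_pow_I H_1 that by blast
      then have "u x \<ominus> \<one> \<in> generate (add_monoid R) (?G 0)" by (auto intro: generate.incl)
      moreover have "\<one> \<in> generate (add_monoid R) (?G 0)"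
        by (rule generate.incl) (force intro!: image_eqI[of _ _ "[]"])
      ultimately show ?thesis by (rule in_subgroup_of_minus[OF S u_closed[OF that] one_closed])
    qed
    then show ?case
      unfolding ideal_pow_0 by (subst carrier_generate, intro add.generate_subgroup_incl[OF _ S]) auto
  next
    case (Suc n)
    show ?case
    proof
      fix x assume "x \<in> A (Suc n)"
      then have "x \<in> A n \<cdot> I" by (simp add: ideal_pow_Suc)
      then show "x \<in> generate (add_monoid R) (?G (Suc n))"
      proof (induction rule: ideal_prod.induct)
        case (prod i j)
        let ?C = "word ` {[j] | j. j \<in> letters \<and> fst j = Suc 0} \<union> A (Suc (Suc 0))"
        have Cc: "?C \<subseteq> carrier R" using A_subset by (auto simp del: word_Cons)
        have SC: "subgroup (generate (add_monoid R) ?C) (add_monoid R)"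
          by (rule add.generate_is_subgroup) (use Cc in simp)
        have "I \<subseteq> generate (add_monoid R) ?C"
          by (subst I_generate, rule add.generate_subgroup_incl[OF _ SC]) (use letters_generate[of "Suc 0"] H_1 in auto)
        then have j: "j \<in> generate (add_monoid R) ?C" using prod by auto
        have i: "i \<in> generate (add_monoid R) (?G n)" using prod Suc by auto
        show ?case
        proof (rule mult_generate[OF i j Gc Cc S])
          fix b c assume b: "b \<in> ?G n" and c: "c \<in> ?C"
          have cA: "c \<in> A (Suc 0)"
          proof -
            consider "c \<in> A (Suc (Suc 0))" | j where "c = word [j]" "j \<in> letters" "fst j = Suc 0"
              using c by blast
            then show ?thesis
            proof cases
              case 1
              then show ?thesis using A_antimono[of "Suc 0" "Suc (Suc 0)"] by auto
            next
              case 2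
              then show ?thesis using word_in_A[of "[j]"] by simp
            qed
          qed
          have bA: "b \<in> A n" using b GA by blast
          consider "b \<in> A (Suc n)" | "c \<in> A (Suc (Suc 0))" |
            xs j where "b = word xs" "set xs \<subseteq> letters" "weight xs = n"
              "c = word [j]" "j \<in> letters" "fst j = Suc 0"
            using b c by blast
          then show "b \<otimes> c \<in> generate (add_monoid R) (?G (Suc n))"
          proof cases
            case 1
            then have "b \<otimes> c \<in> A (Suc (Suc n))" using A_mult[OF 1 cA] by simp
            then show ?thesis by (auto intro: generate.incl)
          next
            case 2
            then have "b \<otimes> c \<in> A (Suc (Suc n))" using A_mult[OF bA 2] by simp
            then show ?thesis by (auto intro: generate.incl)
          next
            case 3
            then have "b \<otimes> c = word (xs @ [j])" by (subst word_append) auto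
            moreover have "set (xs @ [j]) \<subseteq> letters" "weight (xs @ [j]) = Suc n" using 3 by auto
            ultimately show ?thesis by (blast intro: generate.incl)
          qed
        qed
      next
        case (sum s1 s2)
        then show ?case using subgroup.m_closed[OF S] by simp
      qed
    qed
  qed
  moreover have "generate (add_monoid R) (?G n) \<subseteq> A n"
    by (rule add.generate_subgroup_incl[OF GA A_subgroup])
  ultimately show ?thesis by blast
qed

lemma u_pow: "x \<in> carrier Q \<Longrightarrow> u (x [^]\<^bsub>Q\<^esub> (k::nat)) = u x [^] k"
  by (induction k) (simp_all add: u_mult)

lemma finite_letters: "finite letters"
proof -
  have "finite (B w)" for w
    by (rule finite_subset[OF _ finite_Q]) (use H_carrier B_subset in blast)
  then show ?thesis unfolding letters_def by (intro finite_SigmaI) auto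
qed

text \<open>An arbitrary but fixed order of the letters; it is the order in which monomials are
  written.\<close>

definition letter_list where "letter_list = (SOME js. set js = letters \<and> distinct js)"

lemma letter_list: "set letter_list = letters" "distinct letter_list"
  unfolding letter_list_def
  using someI_ex[OF finite_distinct_list[OF finite_letters]] by auto

definition monomial :: "(nat \<times> 'c \<Rightarrow> nat) \<Rightarrow> (nat \<times> 'c) list" where
  "monomial e = concat (map (\<lambda>j. replicate (e j) j) letter_list)"

definition exponents :: "nat \<Rightarrow> (nat \<times> 'c \<Rightarrow> nat) set" where
  "exponents n = {e \<in> letters \<rightarrow>\<^sub>E {..<p}. (\<Sum>j\<in>letters. e j * fst j) = n}"

lemma set_monomial: "set (monomial e) \<subseteq> letters"
proof
  fix x assume "x \<in> set (monomial e)"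
  then obtain j where "j \<in> set letter_list" "x \<in> set (replicate (e j) j)"
    unfolding monomial_def by auto
  then show "x \<in> letters" unfolding letter_list(1) using in_set_replicate[of x "e j" j] by simp
qed

lemma mset_monomial: "count (mset (monomial e)) x = (if x \<in> letters then e x else 0)"
proof -
  have "count (mset (concat (map (\<lambda>j. replicate (e j) j) js))) x = (if x \<in> set js then e x else 0)"
    if "distinct js" for js
    using that by (induction js) auto
  then show ?thesis unfolding monomial_def using letter_list by simp
qed

lemma weight_eq_sum:
  assumes "set xs \<subseteq> letters"
  shows "weight xs = (\<Sum>j\<in>letters. count (mset xs) j * fst j)"
  unfolding weight_def using sum_list_map_eq_sum_count2[OF assms finite_letters, of fst]
  by (simp add: count_mset)

lemma finite_exponents: "finite (exponents n)"
proof -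
  have "finite (letters \<rightarrow>\<^sub>E {..<p})" by (rule finite_PiE[OF finite_letters]) simp
  then show ?thesis unfolding exponents_def by simp
qed

text \<open>Having I^(n+1) among the generators turns congruences modulo I^(n+1) into plain
  membership.\<close>

definition monomials_span :: "nat \<Rightarrow> 'a set" where
  "monomials_span n = generate (add_monoid R) (word ` monomial ` exponents n \<union> A (Suc n))"

lemma monomials_span_subgroup: "subgroup (monomials_span n) (add_monoid R)"
  unfolding monomials_span_def
proof (rule add.generate_is_subgroup)
  have "word ` monomial ` exponents n \<subseteq> carrier R" by (auto intro!: word_closed set_monomial)
  then show "word ` monomial ` exponents n \<union> A (Suc n) \<subseteq> carrier R"
    using A_subset by simp
qed

lemma A_subset_monomials_span: "A (Suc n) \<subseteq> monomials_span n"
  unfolding monomials_span_def by (intro subsetI generate.incl UnI2)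

text \<open>The assumption \<open>shorter\<close> is the hypothesis of an induction on the length of words. Modulo
  \<open>A (Suc n)\<close>, transposing two letters changes a word by shorter words, as the commutator of the
  letters lies in a term of the filtration of at least the sum of their weights, and so does a
  \<open>p\<close>-th power of a letter.\<close>

context
  fixes n L :: nat
  assumes shorter: "\<And>ys. set ys \<subseteq> letters \<Longrightarrow> weight ys = n \<Longrightarrow> length ys < L \<Longrightarrow> word ys \<in> monomials_span n"
begin

text \<open>Here y is a commutator or a p-th power of letters, of weight k. Expanding it in letters
  of weight k gives words with one letter in place of at least two, so \<open>shorter\<close>
  applies, and the part of y in I^(k+1) raises the total weight to n + 1.\<close>

lemma replace_by_letter:
  assumes xs: "set xs \<subseteq> letters" and zs: "set zs \<subseteq> letters"
    and wt: "weight xs + k + weight zs = n" and len: "length xs + length zs + 1 < L"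
    and y: "y \<in> generate (add_monoid R) (word ` {[j] | j. j \<in> letters \<and> fst j = k} \<union> A (Suc k))"
  shows "word xs \<otimes> y \<otimes> word zs \<in> monomials_span n"
proof (rule sandwich_generate[OF y _ monomials_span_subgroup])
  show "word ` {[j] | j. j \<in> letters \<and> fst j = k} \<union> A (Suc k) \<subseteq> carrier R"
    using A_subset by (auto simp del: word_Cons)
  fix b assume "b \<in> word ` {[j] | j. j \<in> letters \<and> fst j = k} \<union> A (Suc k)"
  then consider "b \<in> A (Suc k)" | j where "b = word [j]" "j \<in> letters" "fst j = k" by blast
  then show "word xs \<otimes> b \<otimes> word zs \<in> monomials_span n"
  proof cases
    case 1
    have "word xs \<otimes> b \<otimes> word zs \<in> A (weight xs + Suc k + weight zs)"
      by (intro A_mult word_in_A xs zs 1)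
    then show ?thesis using A_subset_monomials_span[of n] wt by auto
  next
    case 2
    have "word xs \<otimes> b \<otimes> word zs = word (xs @ [j] @ zs)"
      using 2 xs zs by (simp add: word_append m_assoc del: append_Cons append_Nil)
    also have "\<dots> \<in> monomials_span n"
      by (rule shorter) (use 2 xs zs wt len in auto)
    finally show ?thesis .
  qed
qed (use xs zs in auto)

lemma swap_letters:
  assumes xs: "set xs \<subseteq> letters" and ij: "i \<in> letters" "j \<in> letters" and zs: "set zs \<subseteq> letters"
    and wt: "weight (xs @ i # j # zs) = n" and len: "length (xs @ i # j # zs) = L"
  shows "word (xs @ i # j # zs) \<ominus> word (xs @ j # i # zs) \<in> monomials_span n"
proof -
  obtain v g where i: "i = (v, g)" by (cases i)
  obtain w h where j: "j = (w, h)" by (cases j)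
  have g: "g \<in> H v" "v \<ge> 1" and h: "h \<in> H w" "w \<ge> 1" using letter_H[OF ij(1)] letter_H[OF ij(2)] i j by auto
  have c: "g \<in> carrier Q" "h \<in> carrier Q" using g h H_carrier by auto
  let ?k = "inv\<^bsub>Q\<^esub> g \<otimes>\<^bsub>Q\<^esub> inv\<^bsub>Q\<^esub> h \<otimes>\<^bsub>Q\<^esub> g \<otimes>\<^bsub>Q\<^esub> h"
  let ?y = "(u g \<ominus> \<one>) \<otimes> (u h \<ominus> \<one>) \<ominus> (u h \<ominus> \<one>) \<otimes> (u g \<ominus> \<one>)"
  let ?G = "generate (add_monoid R) (word ` {[j] | j. j \<in> letters \<and> fst j = v + w} \<union> A (Suc (v + w)))"
  have kH: "?k \<in> H (v + w)" using H_comm[OF g(1) h(1) g(2) h(2)] .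
  have kc: "?k \<in> carrier Q" using H_carrier[OF kH] .
  have cancel: "a \<otimes>\<^bsub>Q\<^esub> (inv\<^bsub>Q\<^esub> a \<otimes>\<^bsub>Q\<^esub> b) = b" if "a \<in> carrier Q" "b \<in> carrier Q" for a b
    using that Q.m_assoc[of a "inv\<^bsub>Q\<^esub> a" b] by simp
  have "h \<otimes>\<^bsub>Q\<^esub> g \<otimes>\<^bsub>Q\<^esub> ?k = g \<otimes>\<^bsub>Q\<^esub> h"
    using c by (simp add: Q.m_assoc cancel)
  then have "u (g \<otimes>\<^bsub>Q\<^esub> h) = u (h \<otimes>\<^bsub>Q\<^esub> g \<otimes>\<^bsub>Q\<^esub> ?k)" by simp
  then have uk: "u g \<otimes> u h = u h \<otimes> u g \<otimes> u ?k"
    unfolding u_mult[OF Q.m_closed[OF c(2,1)] kc] u_mult[OF c] u_mult[OF c(2,1)] .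
  have y: "?y = (u ?k \<ominus> \<one>) \<oplus> (u h \<otimes> u g \<ominus> \<one>) \<otimes> (u ?k \<ominus> \<one>)"
    by (rule commutator_minus_one[OF _ _ _ uk]) (use c kc in auto)
  have Gs: "subgroup ?G (add_monoid R)"
    by (rule add.generate_is_subgroup) (use A_subset in \<open>auto simp del: word_Cons\<close>)
  have "u ?k \<ominus> \<one> \<in> ?G" using letters_generate[OF _ kH] g by simp
  \<comment> \<open>The second summand of \<open>?y\<close> contains this additional factor from I;
    it therefore lies above weight v + w and is absorbed.\<close>
  moreover have "u h \<otimes> u g \<ominus> \<one> \<in> A (Suc 0)"
    using H_pow_I[of "h \<otimes>\<^bsub>Q\<^esub> g" "Suc 0"] c H_1 by (simp add: u_mult)
  then have "(u h \<otimes> u g \<ominus> \<one>) \<otimes> (u ?k \<ominus> \<one>) \<in> A (Suc (v + w))"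
    using A_mult[OF _ H_pow_I[OF kH], of _ "Suc 0"] by simp
  then have "(u h \<otimes> u g \<ominus> \<one>) \<otimes> (u ?k \<ominus> \<one>) \<in> ?G" by (auto intro: generate.incl)
  ultimately have yG: "?y \<in> ?G" unfolding y using subgroup.m_closed[OF Gs] by simp
  have "word (xs @ i # j # zs) \<ominus> word (xs @ j # i # zs) = word xs \<otimes> ?y \<otimes> word zs"
    using xs zs ij c by (simp add: word_append i j minus_eq l_distr r_distr l_minus r_minus m_assoc[symmetric])
  also have "\<dots> \<in> monomials_span n"
    by (rule replace_by_letter[OF xs zs _ _ yG]) (use wt len i j in auto)
  finally show ?thesis .
qed

lemma move_letter:
  assumes "set (xs @ i # us @ zs) \<subseteq> letters"
    and "weight (xs @ i # us @ zs) = n" and "length (xs @ i # us @ zs) = L"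
  shows "word (xs @ i # us @ zs) \<ominus> word (xs @ us @ i # zs) \<in> monomials_span n"
  using assms
proof (induction us arbitrary: xs)
  case Nil
  then show ?case using subgroup.one_closed[OF monomials_span_subgroup] by (simp add: minus_eq r_neg)
next
  case (Cons j us)
  have "word (xs @ i # j # us @ zs) \<ominus> word (xs @ j # i # us @ zs) \<in> monomials_span n"
    by (rule swap_letters) (use Cons.prems in auto)
  moreover have "word ((xs @ [j]) @ i # us @ zs) \<ominus> word ((xs @ [j]) @ us @ i # zs) \<in> monomials_span n"
    by (rule Cons.IH) (use Cons.prems in auto)
  ultimately show ?case
    using minus_in_subgroup_trans[OF monomials_span_subgroup, of "word (xs @ i # j # us @ zs)"
        "word (xs @ j # i # us @ zs)" "word (xs @ j # us @ i # zs)"] Cons.prems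
    by simp
qed

text \<open>The first letter of the target word is never searched for; instead the head x is moved
  to its position in the other word, and the tails, as equal multisets, are treated by induction
  behind the enlarged prefix \<open>zs\<close>.\<close>

lemma permute_letters:
  assumes "mset xs = mset ys" "set (zs @ xs) \<subseteq> letters" "weight (zs @ xs) = n" "length (zs @ xs) = L"
  shows "word (zs @ xs) \<ominus> word (zs @ ys) \<in> monomials_span n"
  using assms
proof (induction xs arbitrary: zs ys)
  case Nil
  then show ?case using subgroup.one_closed[OF monomials_span_subgroup] by (simp add: minus_eq r_neg)
next
  case (Cons x xs)
  have "x \<in> set ys" using Cons.prems(1) by (metis list.set_intros(1) set_mset_mset)
  then obtain us vs where ys: "ys = us @ x # vs" by (meson split_list)
  have ms: "mset xs = mset (us @ vs)" using Cons.prems(1) ys by simp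
  have len: "length xs = length (us @ vs)" using ms by (metis size_mset)
  have st: "set xs = set (us @ vs)" using ms by (metis set_mset_mset)
  have wt: "weight xs = weight (us @ vs)"
  proof -
    have "sum_mset (mset (map fst xs)) = sum_mset (mset (map fst (us @ vs)))"
      unfolding mset_map ms ..
    then show ?thesis unfolding weight_def sum_mset_sum_list .
  qed
  have "word ((zs @ [x]) @ xs) \<ominus> word ((zs @ [x]) @ us @ vs) \<in> monomials_span n"
    by (rule Cons.IH[OF ms]) (use Cons.prems in auto)
  moreover have "word (zs @ x # us @ vs) \<ominus> word (zs @ us @ x # vs) \<in> monomials_span n"
    by (rule move_letter) (use Cons.prems st wt len in auto)
  ultimately show ?case
    using minus_in_subgroup_trans[OF monomials_span_subgroup, of "word (zs @ x # xs)"
        "word (zs @ x # us @ vs)" "word (zs @ us @ x # vs)"] Cons.prems st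
    unfolding ys by simp
qed

text \<open>By Frobenius (g - 1)^p = g^p - 1, and g^p lies in the filtration term of index p w,
  which is the weight of the p letters. So they can be replaced by single letters of weight p
  w.\<close>

lemma power_of_letter:
  assumes i: "i \<in> letters" and zs: "set zs \<subseteq> letters"
    and wt: "weight (replicate p i @ zs) = n" and len: "length (replicate p i @ zs) = L"
  shows "word (replicate p i @ zs) \<in> monomials_span n"
proof -
  obtain w g where iw: "i = (w, g)" by (cases i)
  have g: "g \<in> H w" "w \<ge> 1" using letter_H[OF i] iw by auto
  have c: "g \<in> carrier Q" using g H_carrier by auto
  have "word (replicate k i) = (u g \<ominus> \<one>) [^] k" for k
  proof (induction k)
    case (Suc k)
    then show ?case using c nat_pow_Suc2[of "u g \<ominus> \<one>" k] iw by (simp del: nat_pow_Suc)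
  qed simp
  moreover have "u (g [^]\<^bsub>Q\<^esub> p) = \<one> \<oplus> (u g \<ominus> \<one>) [^] p"
  proof -
    have "u g = \<one> \<oplus> (u g \<ominus> \<one>)" using c by (simp add: minus_eq a_lcomm[of \<one>] r_neg)
    then have "u g [^] p = (\<one> \<oplus> (u g \<ominus> \<one>)) [^] p" by simp
    then show ?thesis using frobenius_one_plus[OF prime_p char_p, of "u g \<ominus> \<one>"] c by (simp add: u_pow)
  qed
  then have "u (g [^]\<^bsub>Q\<^esub> p) \<ominus> \<one> = (u g \<ominus> \<one>) [^] p"
    using c add_minus_cancel_one[of "(u g \<ominus> \<one>) [^] p"] by (simp add: a_comm)
  ultimately have *: "word (replicate p i) = u (g [^]\<^bsub>Q\<^esub> p) \<ominus> \<one>" by simp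
  have "u (g [^]\<^bsub>Q\<^esub> p) \<ominus> \<one> \<in>
      generate (add_monoid R) (word ` {[j] | j. j \<in> letters \<and> fst j = p * w} \<union> A (Suc (p * w)))"
    by (rule letters_generate[OF _ H_pow[OF g]]) (use g p_gt_1 in simp)
  moreover have "weight (replicate p i) = p * w" unfolding weight_def iw by (simp add: sum_list_replicate)
  ultimately have "word [] \<otimes> (u (g [^]\<^bsub>Q\<^esub> p) \<ominus> \<one>) \<otimes> word zs \<in> monomials_span n"
    using wt len p_gt_1 zs by (intro replace_by_letter) auto
  moreover have "word (replicate p i @ zs) = word [] \<otimes> (u (g [^]\<^bsub>Q\<^esub> p) \<ominus> \<one>) \<otimes> word zs"
    using zs i c by (subst word_append) (auto simp: * )
  ultimately show ?thesis by simp
qed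

text \<open>Reordering is free modulo shorter words. If some letter occurs at least p times, p
  copies are moved to the front and collapse; otherwise sorting yields an ordered monomial with all
  exponents below p.\<close>

lemma word_in_monomials_span_step:
  assumes "set xs \<subseteq> letters" "weight xs = n" "length xs = L"
  shows "word xs \<in> monomials_span n"
proof -
  have perm: "word xs \<in> monomials_span n" if "mset xs = mset ys" "word ys \<in> monomials_span n" for ys
  proof (rule in_subgroup_of_minus[OF monomials_span_subgroup])
    show "word xs \<ominus> word ys \<in> monomials_span n"
      using permute_letters[of xs ys "[]"] that assms by simp
    have "set xs = set ys" using that(1) by (metis set_mset_mset)
    then show "word ys \<in> carrier R" using assms by simp
  qed (use assms that in auto)
  show ?thesis
  proof (cases "\<exists>i. count (mset xs) i \<ge> p")
    case True
    then obtain i where i: "count (mset xs) i \<ge> p" by auto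
    obtain zs where "mset zs = mset xs - replicate_mset p i" using ex_mset by blast
    moreover have "replicate_mset p i \<subseteq># mset xs" using i by (simp add: count_le_replicate_mset_subset_eq)
    ultimately have ms: "mset xs = mset (replicate p i @ zs)" by simp
    have st: "set xs = set (replicate p i @ zs)" using ms by (metis set_mset_mset)
    have wt: "weight xs = weight (replicate p i @ zs)"
    proof -
      have "sum_mset (mset (map fst xs)) = sum_mset (mset (map fst (replicate p i @ zs)))"
        unfolding mset_map ms ..
      then show ?thesis unfolding weight_def sum_mset_sum_list .
    qed
    have len: "length xs = length (replicate p i @ zs)" using ms by (metis size_mset)
    have "word (replicate p i @ zs) \<in> monomials_span n"
      using assms st wt len p_gt_1 by (intro power_of_letter) auto
    then show ?thesis using perm ms by blast
  next
    case False
    define e where "e = restrict (count (mset xs)) letters"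
    have "mset xs = mset (monomial e)"
      using assms(1) by (intro multiset_eqI) (auto simp: mset_monomial e_def count_eq_zero_iff)
    moreover have "e \<in> exponents n"
      using False assms(2) weight_eq_sum[OF assms(1)] by (auto simp: exponents_def e_def not_le)
    then have "word (monomial e) \<in> monomials_span n"
      unfolding monomials_span_def by (intro generate.incl) blast
    ultimately show ?thesis using perm by blast
  qed
qed

end

lemma word_in_monomials_span:
  assumes "set xs \<subseteq> letters" "weight xs = n"
  shows "word xs \<in> monomials_span n"
  using assms
proof (induction "length xs" arbitrary: xs rule: less_induct)
  case less
  show ?case by (rule word_in_monomials_span_step[of n "length xs"]) (use less in auto)
qed

lemma A_subset_span: "A n \<subseteq> monomials_span n"
  by (subst A_generate_words, rule add.generate_subgroup_incl[OF _ monomials_span_subgroup])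
    (use word_in_monomials_span A_subset_monomials_span in auto)

lemma card_A_le: "card (A n) \<le> p ^ card (exponents n) * card (A (Suc n))"
proof -
  let ?B = "word ` monomial ` exponents n"
  have fin: "finite ?B" using finite_exponents by simp
  have Bc: "?B \<subseteq> carrier R" by (auto intro!: word_closed set_monomial)
  have "finite (monomials_span n) \<and> card (monomials_span n) \<le> p ^ card ?B * card (A (Suc n))"
    unfolding monomials_span_def
    by (rule add.card_generate_Un_le[OF fin Bc A_subgroup finite_subset[OF A_subset finite_R]])
      (use p_gt_1 Bc char_p in auto)
  moreover have "card ?B \<le> card (exponents n)"
    unfolding image_image by (rule card_image_le[OF finite_exponents])
  then have "p ^ card ?B * card (A (Suc n)) \<le> p ^ card (exponents n) * card (A (Suc n))"
    using p_gt_1 by (intro mult_le_mono1 power_increasing) auto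
  ultimately show ?thesis
    using card_mono[OF _ A_subset_span[of n]] by linarith
qed

lemma card_letters: "card letters = (\<Sum>w\<in>{1..<W}. card (B w))"
proof -
  have "finite (B w)" for w
    by (rule finite_subset[OF _ finite_Q]) (use H_carrier B_subset in blast)
  then show ?thesis unfolding letters_def by (intro card_SigmaI) auto
qed

text \<open>Expanding a product with one factor per letter: choosing the term X^(e j times the
  weight of j) in each factor is the same as choosing an exponent family e.\<close>

lemma card_exponents:
  "of_nat (card (exponents n)) = fps_nth (\<Prod>w\<in>{1..<W}. truncated_geometric p w ^ card (B w)) n"
proof -
  have fB: "finite (B w)" for w
    by (rule finite_subset[OF _ finite_Q]) (use H_carrier B_subset in blast)
  have fin: "finite (letters \<rightarrow>\<^sub>E {..<p})" by (rule finite_PiE[OF finite_letters]) simp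
  have "(\<Prod>w\<in>{1..<W}. truncated_geometric p w ^ card (B w))
      = (\<Prod>w\<in>{1..<W}. \<Prod>g\<in>B w. truncated_geometric p w)" by simp
  also have "\<dots> = (\<Prod>j\<in>letters. truncated_geometric p (fst j))"
    unfolding letters_def using fB by (subst prod.Sigma) (auto simp: case_prod_beta)
  also have "\<dots> = (\<Sum>e\<in>letters \<rightarrow>\<^sub>E {..<p}. \<Prod>j\<in>letters. fps_X ^ (e j * fst j))"
    unfolding truncated_geometric_def by (rule prod_sum_PiE) (use finite_letters in auto)
  also have "\<dots> = (\<Sum>e\<in>letters \<rightarrow>\<^sub>E {..<p}. fps_X ^ (\<Sum>j\<in>letters. e j * fst j))"
    by (simp add: power_sum)
  also have "fps_nth \<dots> n = (\<Sum>e\<in>letters \<rightarrow>\<^sub>E {..<p}. if (\<Sum>j\<in>letters. e j * fst j) = n then 1 else 0)"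
    unfolding fps_sum_nth by (intro sum.cong refl) (auto simp: fps_X_power_nth)
  also have "\<dots> = of_nat (card (exponents n))"
    unfolding exponents_def using fin by (simp add: sum.If_cases Int_def)
  finally show ?thesis by simp
qed

lemma sum_card_exponents_le: "(\<Sum>n<M. card (exponents n)) \<le> p ^ card letters"
proof -
  have "(\<Sum>n<M. card (exponents n)) = card (\<Union>n<M. exponents n)"
    by (rule card_UN_disjoint[symmetric]) (use finite_exponents in \<open>auto simp: exponents_def\<close>)
  also have "\<dots> \<le> card (letters \<rightarrow>\<^sub>E {..<p})"
    by (rule card_mono) (auto simp: exponents_def intro: finite_PiE finite_letters)
  also have "\<dots> = p ^ card letters" using finite_letters by (simp add: card_PiE)
  finally show ?thesis .
qed

text \<open>A single letter of weight n is an ordered monomial of weight n, as 1 is an admissible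
  exponent. This transfers bounds on the ideal indices to the subgroup indices.\<close>

lemma card_generators_le:
  assumes "1 \<le> n"
  shows "card (B n) \<le> card (exponents n)"
proof (cases "n < W")
  case True
  have "(\<lambda>g. \<lambda>j\<in>letters. if j = (n, g) then 1 else 0) ` B n \<subseteq> exponents n"
  proof
    fix e :: "nat \<times> 'c \<Rightarrow> nat" assume "e \<in> (\<lambda>g. \<lambda>j\<in>letters. if j = (n, g) then 1 else 0) ` B n"
    then obtain g where g: "g \<in> B n" "e = (\<lambda>j\<in>letters. if j = (n, g) then 1 else 0)" by auto
    have ng: "(n, g) \<in> letters" using g True assms by (simp add: letters_def)
    have "(\<Sum>j\<in>letters. e j * fst j) = (\<Sum>j\<in>letters. if j = (n, g) then n else 0)"
      by (rule sum.cong) (auto simp: g)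
    also have "\<dots> = n" using ng finite_letters by (simp add: sum.delta)
    finally show "e \<in> exponents n" using p_gt_1 by (auto simp: exponents_def g)
  qed
  moreover have "inj_on (\<lambda>g. \<lambda>j\<in>letters. if j = (n, g) then 1 else (0::nat)) (B n)"
  proof (rule inj_onI)
    fix g h assume gh: "g \<in> B n" "h \<in> B n"
      and eq: "(\<lambda>j\<in>letters. if j = (n, g) then 1 else (0::nat)) = (\<lambda>j\<in>letters. if j = (n, h) then 1 else 0)"
    have "(n, g) \<in> letters" using gh True assms by (simp add: letters_def)
    then show "g = h" using fun_cong[OF eq, of "(n, g)"] by (simp split: if_splits)
  qed
  ultimately show ?thesis using card_inj_on_le finite_exponents by blast
qed (use B_empty in simp)

end

section \<open>Jennings' theorem by counting\<close>

context filtered_group_ring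
begin

lemma card_A_prime_power: "\<exists>k. card (A n) = p ^ k"
proof -
  have "card (A n) dvd card (carrier R)"
    using add.lagrange[OF A_subgroup, of n] unfolding order_def by (metis dvd_triv_right partial_object.select_convs(1))
  then show ?thesis unfolding card_R using divides_primepow_nat[OF prime_p] by blast
qed

text \<open>The numbers c and h are logarithmic indices, independent of where the product is cut
  off. The cutoff W stays free above a bound, since the later comparison of coefficients needs it
  beyond a given degree as well.\<close>

theorem jennings:
  obtains c h W\<^sub>0 where
    "\<And>w. w \<ge> 1 \<Longrightarrow> card (H w) = p ^ c w * card (H (Suc w))"
    "\<And>n. card (A n) = p ^ h n * card (A (Suc n))"
    "\<And>n. n \<ge> 1 \<Longrightarrow> c n \<le> h n"
    "\<And>W n. W \<ge> W\<^sub>0 \<Longrightarrow> of_nat (h n) = fps_nth (\<Prod>w\<in>{1..<W}. truncated_geometric p w ^ c w) n"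
proof -
  obtain N where N: "A N = {\<zero>}" using nilpotent by blast
  \<comment> \<open>Elements of late filtration terms satisfy u x - 1 = 0 by nilpotency, and
    \<open>u\<close> separates the identity.\<close>
  have H_trivial: "H w = {\<one>\<^bsub>Q\<^esub>}" if "w \<ge> N" for w
  proof -
    have "x = \<one>\<^bsub>Q\<^esub>" if x: "x \<in> H w" for x
    proof -
      have "u x \<ominus> \<one> = \<zero>" using H_pow_I[OF x] A_antimono[OF \<open>w \<ge> N\<close>] N by auto
      then show ?thesis using u_inj H_carrier[OF x] r_right_minus_eq by auto
    qed
    then show ?thesis using subgroup.one_closed[OF H_subgroup[of w]] by blast
  qed
  have "\<exists>C\<subseteq>H w. generate Q (H (Suc w) \<union> C) = H w \<and> card (H w) = p ^ card C * card (H (Suc w))"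
    if w: "w \<ge> 1" for w
  proof -
    have le: "Suc w \<le> w + w" "Suc w \<le> p * w"
      using w p_gt_1 mult_le_mono1[of 2 p w] by linarith+
    have "finite (H w)" using finite_subset[OF _ finite_Q] H_carrier by blast
    then have "\<exists>C\<subseteq>H w. C \<inter> H (Suc w) = {} \<and> generate Q (H (Suc w) \<union> C) = H w \<and>
        card (H w) = p ^ card C * card (H (Suc w))"
      using H_antimono[OF le(1)] H_antimono[OF le(2)] H_comm[OF _ _ w w] H_pow[OF _ w]
      by (intro Q.elementary_section_generators[OF H_subgroup _ prime_p H_subgroup H_Suc]) auto
    then show ?thesis by blast
  qed
  then obtain C where C: "\<And>w. w \<ge> 1 \<Longrightarrow> C w \<subseteq> H w"
    "\<And>w. w \<ge> 1 \<Longrightarrow> generate Q (H (Suc w) \<union> C w) = H w"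
    "\<And>w. w \<ge> 1 \<Longrightarrow> card (H w) = p ^ card (C w) * card (H (Suc w))"
    by metis
  define B where "B w = (if w \<ge> 1 then C w else {})" for w
  have B_empty: "B w = {}" if "w \<ge> N" for w
  proof (cases "w \<ge> 1")
    case True
    have "p ^ card (C w) = 1" using C(3)[OF True] H_trivial[OF that] H_trivial[of "Suc w"] that by simp
    then have "card (C w) = 0" using p_gt_1 by simp
    moreover have "finite (C w)" using C(1)[OF True] H_trivial[OF that] finite_subset by auto
    ultimately show ?thesis using True by (simp add: B_def)
  qed (simp add: B_def)
  have gens: "filtered_group_ring_generators R Q u p I H B W" if "W \<ge> N" for W
  proof unfold_locales
    show "B w \<subseteq> H w" for w using C(1)[of w] by (simp add: B_def)
    show "H w = generate Q (H (Suc w) \<union> B w)" if "w \<ge> 1" for w using C(2)[OF that] that by (simp add: B_def)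
    show "B w = {}" if "w \<ge> W" for w using B_empty[of w] that \<open>W \<ge> N\<close> by simp
  qed
  define c where "c w = card (B w)" for w
  have cH: "card (H w) = p ^ c w * card (H (Suc w))" if "w \<ge> 1" for w
    using C(3)[OF that] that by (simp add: c_def B_def)
  have cQ: "card (carrier Q) = p ^ (\<Sum>w\<in>{1..<Suc W}. c w) * card (H (Suc W))" for W
  proof (induction W)
    case 0
    then show ?case using H_1 by simp
  next
    case (Suc W)
    then show ?case using cH[of "Suc W"] by (simp add: power_add mult.assoc)
  qed
  obtain e where e: "\<And>n. card (A n) = p ^ e n" using card_A_prime_power by metis
  have e0: "e 0 = card (carrier Q)" using e[of 0] card_R p_gt_1 by simp
  have eN: "e n = 0" if "n \<ge> N" for n
  proof -
    have "A n \<subseteq> {\<zero>}" using A_antimono[OF that] N by simp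
    then have "card (A n) \<le> card {\<zero>}" by (intro card_mono) auto
    then have "p ^ e n \<le> p ^ 0" using e by simp
    then show ?thesis using p_gt_1 power_le_imp_le_exp by blast
  qed
  \<comment> \<open>W at least \<open>Suc N\<close> guarantees that \<open>H W\<close> is trivial,
    so the orders p^(c w) for w < W multiply to |Q|; it also makes W - 1 a genuine
    predecessor.\<close>
  have main: "e n = card (filtered_group_ring_generators.exponents p B W n) + e (Suc n)" if W: "W \<ge> Suc N" for W n
  proof -
    interpret filtered_group_ring_generators R Q u p I H B W using gens W by simp
    have le: "e n \<le> card (exponents n) + e (Suc n)" for n
    proof -
      have "p ^ e n \<le> p ^ (card (exponents n) + e (Suc n))"
        using card_A_le[of n] unfolding e by (simp add: power_add)
      then show ?thesis using p_gt_1 power_le_imp_le_exp by blast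
    qed
    have tele: "e 0 \<le> (\<Sum>n<M. card (exponents n)) + e M" for M
      by (induction M) (use le in \<open>auto intro: order_trans\<close>)
    \<comment> \<open>One strict inequality anywhere makes the telescoped inequality strict.\<close>
    have tele': "e 0 < (\<Sum>n<M. card (exponents n)) + e M"
      if "n < M" "e n < card (exponents n) + e (Suc n)" for M
      using that
    proof (induction M)
      case (Suc M)
      then show ?case using tele[of M] le[of M] by (cases "n = M") auto
    qed simp
    have "card (carrier Q) = p ^ card letters"
      using cQ[of "W - 1"] W H_trivial[of W] unfolding card_letters c_def by simp
    then have "(\<Sum>n<Suc (max n N). card (exponents n)) \<le> e 0"
      using sum_card_exponents_le[of "Suc (max n N)"] e0 by simp
    moreover have "e (Suc (max n N)) = 0" by (rule eN) simp
    ultimately have "\<not> e n < card (exponents n) + e (Suc n)"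
      using tele'[of "Suc (max n N)"] by (auto simp: less_Suc_eq_le)
    then show ?thesis using le[of n] by simp
  qed
  define h where "h n = e n - e (Suc n)" for n
  have h: "h n = card (filtered_group_ring_generators.exponents p B W n)" if "W \<ge> Suc N" for W n
    using main[OF that, of n] by (simp add: h_def)
  show ?thesis
  proof (rule that[of c h "Suc N"])
    show "card (A n) = p ^ h n * card (A (Suc n))" for n
      using main[of "Suc N" n] h[of "Suc N" n] by (simp add: e power_add)
    show "c n \<le> h n" if "n \<ge> 1" for n
      using filtered_group_ring_generators.card_generators_le[OF gens[of "Suc N"] that] h[of "Suc N" n]
      by (simp add: c_def)
    show "of_nat (h n) = fps_nth (\<Prod>w\<in>{1..<W}. truncated_geometric p w ^ c w) n" if "W \<ge> Suc N" for W n
      using filtered_group_ring_generators.card_exponents[OF gens[of W]] h[OF that] that by (simp add: c_def)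
  qed (rule cH)
qed

end

section \<open>Group algebras of finite groups over the prime field\<close>

lemma carrier_residue_ring [simp]: "carrier (residue_ring (int p)) = {0..<int p}"
  by (auto simp: residue_ring_def)

text \<open>Sums in the residue ring become integer sums reduced once at the end, so that integer
  summation and congruences do the work.\<close>

lemma finsum_residue_ring:
  assumes "p > 1" "finite A" "f \<in> A \<rightarrow> {0..<int p}"
  shows "finsum (residue_ring (int p)) f A = (\<Sum>x\<in>A. f x) mod int p"
proof -
  interpret residues "int p" "residue_ring (int p)"
    by unfold_locales (use assms in auto)
  show ?thesis using assms(2,3)
  proof (induction A rule: finite_induct)
    case empty
    have "\<zero>\<^bsub>residue_ring (int p)\<^esub> = 0" by (simp add: residue_ring_def)
    then show ?case by simp
  next
    case (insert x A)
    then have "finsum (residue_ring (int p)) f (insert x A) = f x \<oplus>\<^bsub>residue_ring (int p)\<^esub> finsum (residue_ring (int p)) f A"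
      by (intro finsum_insert) auto
    also have "\<dots> = (f x + (\<Sum>x\<in>A. f x) mod int p) mod int p"
      using insert by (simp add: residue_ring_def)
    finally show ?case using insert by (simp add: mod_simps)
  qed
qed

locale finite_group_algebra = group Q for Q (structure) +
  fixes p :: nat
  assumes p_gt_1: "p > 1" and finite_carrier: "finite (carrier Q)"
begin

abbreviation GA :: "(int, 'a \<Rightarrow> int) module" where "GA \<equiv> group_algebra (residue_ring (int p)) Q"

lemma carrier_GA: "carrier GA = carrier Q \<rightarrow>\<^sub>E {0..<int p}"
  by (simp add: group_algebra_def)

lemma add_GA: "f \<oplus>\<^bsub>GA\<^esub> g = (\<lambda>x\<in>carrier Q. (f x + g x) mod int p)"
  by (simp add: group_algebra_def residue_ring_def)

lemma zero_GA: "\<zero>\<^bsub>GA\<^esub> = (\<lambda>x\<in>carrier Q. 0)"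
  by (simp add: group_algebra_def residue_ring_def)

definition delta :: "'a \<Rightarrow> 'a \<Rightarrow> int" where
  "delta x = (\<lambda>y\<in>carrier Q. if y = x then 1 else 0)"

lemma one_GA: "\<one>\<^bsub>GA\<^esub> = delta \<one>"
proof -
  have "\<zero>\<^bsub>residue_ring (int p)\<^esub> = 0" "\<one>\<^bsub>residue_ring (int p)\<^esub> = 1" by (simp_all add: residue_ring_def)
  then show ?thesis by (simp add: group_algebra_def delta_def cong: if_cong)
qed

lemma GA_range: "f \<in> carrier GA \<Longrightarrow> x \<in> carrier Q \<Longrightarrow> 0 \<le> f x \<and> f x < int p"
  by (auto simp: carrier_GA)

lemma mult_GA:
  assumes "f \<in> carrier GA" "g \<in> carrier GA"
  shows "f \<otimes>\<^bsub>GA\<^esub> g = (\<lambda>x\<in>carrier Q. (\<Sum>y\<in>carrier Q. f y * g (inv y \<otimes> x)) mod int p)"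
proof -
  have "finsum (residue_ring (int p)) (\<lambda>y. f y \<otimes>\<^bsub>residue_ring (int p)\<^esub> g (inv y \<otimes> x)) (carrier Q)
     = (\<Sum>y\<in>carrier Q. f y * g (inv y \<otimes> x)) mod int p" for x
    using p_gt_1 by (subst finsum_residue_ring) (auto simp: finite_carrier residue_ring_def mod_sum_eq)
  then show ?thesis by (simp add: group_algebra_def)
qed

text \<open>All identities below are checked by pairing with an arbitrary function \<open>F\<close> on the group, since
  \<open>f \<mapsto> \<Sum>x. f x * F x\<close> turns the convolution into a double sum without inverses.\<close>

definition pairing :: "('a \<Rightarrow> int) \<Rightarrow> ('a \<Rightarrow> int) \<Rightarrow> int" where
  "pairing f F = (\<Sum>x\<in>carrier Q. f x * F x)"

text \<open>Indicator functions recover the coefficients modulo p, and coefficients are stored as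
  least non-negative residues.\<close>

lemma GA_eqI:
  assumes "f \<in> carrier GA" "g \<in> carrier GA" "\<And>F. [pairing f F = pairing g F] (mod int p)"
  shows "f = g"
proof (rule PiE_ext[of f "carrier Q" "\<lambda>_. {0..<int p}" g])
  fix x assume x: "x \<in> carrier Q"
  have *: "pairing h (\<lambda>y. if y = x then 1 else 0) = h x" for h
    unfolding pairing_def using x finite_carrier by (simp add: sum.delta if_distrib cong: if_cong)
  have "[f x = g x] (mod int p)" using assms(3)[of "\<lambda>y. if y = x then 1 else 0"] unfolding * .
  then show "f x = g x"
    using GA_range[OF assms(1) x] GA_range[OF assms(2) x] by (simp add: cong_def)
qed (use assms carrier_GA in auto)

lemma pairing_restrict_mod: "[pairing (\<lambda>x\<in>carrier Q. h x mod int p) F = pairing h F] (mod int p)"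
  unfolding pairing_def by (rule cong_sum) (simp add: cong_def mod_mult_left_eq)

lemma pairing_add: "[pairing (f \<oplus>\<^bsub>GA\<^esub> g) F = pairing f F + pairing g F] (mod int p)"
  unfolding add_GA
  by (rule cong_trans[OF pairing_restrict_mod]) (simp add: pairing_def distrib_right sum.distrib)

lemma pairing_zero: "pairing \<zero>\<^bsub>GA\<^esub> F = 0"
  by (simp add: pairing_def zero_GA)

lemma pairing_delta: "x \<in> carrier Q \<Longrightarrow> pairing (delta x) F = F x"
  unfolding pairing_def delta_def using finite_carrier
  by (simp add: sum.delta if_distrib[of "\<lambda>a. a * _"] cong: if_cong)

lemma pairing_mult:
  assumes "f \<in> carrier GA" "g \<in> carrier GA"
  shows "[pairing (f \<otimes>\<^bsub>GA\<^esub> g) F = pairing f (\<lambda>y. pairing g (\<lambda>z. F (y \<otimes> z)))] (mod int p)"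
proof -
  have "pairing (\<lambda>x. \<Sum>y\<in>carrier Q. f y * g (inv y \<otimes> x)) F
      = (\<Sum>y\<in>carrier Q. \<Sum>x\<in>carrier Q. f y * g (inv y \<otimes> x) * F x)"
    unfolding pairing_def sum_distrib_right by (rule sum.swap)
  also have "\<dots> = (\<Sum>y\<in>carrier Q. \<Sum>z\<in>carrier Q. f y * g z * F (y \<otimes> z))"
  proof (rule sum.cong[OF refl])
    fix y assume y: "y \<in> carrier Q"
    show "(\<Sum>x\<in>carrier Q. f y * g (inv y \<otimes> x) * F x) = (\<Sum>z\<in>carrier Q. f y * g z * F (y \<otimes> z))"
      by (rule sum.reindex_bij_witness[of _ "\<lambda>z. y \<otimes> z" "\<lambda>x. inv y \<otimes> x"])
        (use y in \<open>auto simp: m_assoc[symmetric]\<close>)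
  qed
  also have "\<dots> = pairing f (\<lambda>y. pairing g (\<lambda>z. F (y \<otimes> z)))"
    unfolding pairing_def by (simp add: sum_distrib_left mult.assoc)
  finally have eq: "pairing (\<lambda>x. \<Sum>y\<in>carrier Q. f y * g (inv y \<otimes> x)) F
      = pairing f (\<lambda>y. pairing g (\<lambda>z. F (y \<otimes> z)))" .
  show ?thesis unfolding mult_GA[OF assms] by (rule cong_trans[OF pairing_restrict_mod]) (simp only: eq cong_refl)
qed

lemma delta_closed [simp]: "x \<in> carrier Q \<Longrightarrow> delta x \<in> carrier GA"
  using p_gt_1 by (auto simp: delta_def carrier_GA)

lemma restrict_mod_closed: "(\<lambda>x\<in>carrier Q. h x mod int p) \<in> carrier GA"
  using p_gt_1 by (auto simp: carrier_GA)

lemma mult_closed: "f \<in> carrier GA \<Longrightarrow> g \<in> carrier GA \<Longrightarrow> f \<otimes>\<^bsub>GA\<^esub> g \<in> carrier GA"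
  by (simp add: mult_GA restrict_mod_closed)

lemma add_closed: "f \<oplus>\<^bsub>GA\<^esub> g \<in> carrier GA"
  by (simp add: add_GA restrict_mod_closed)

lemma zero_closed: "\<zero>\<^bsub>GA\<^esub> \<in> carrier GA"
  using p_gt_1 by (auto simp: carrier_GA zero_GA)

lemma pairing_cong:
  assumes "\<And>x. x \<in> carrier Q \<Longrightarrow> [F x = F' x] (mod int p)"
  shows "[pairing f F = pairing f F'] (mod int p)"
  unfolding pairing_def by (rule cong_sum) (use assms in \<open>auto intro: cong_mult\<close>)

lemma pairing_add_right: "pairing f (\<lambda>x. F x + F' x) = pairing f F + pairing f F'"
  by (simp add: pairing_def distrib_left sum.distrib)

lemma ring_GA: "ring GA"
proof (rule ringI)
  show "abelian_group GA"
  proof (rule abelian_groupI)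
    fix f g h assume c: "f \<in> carrier GA" "g \<in> carrier GA" "h \<in> carrier GA"
    show "f \<oplus>\<^bsub>GA\<^esub> g \<oplus>\<^bsub>GA\<^esub> h = f \<oplus>\<^bsub>GA\<^esub> (g \<oplus>\<^bsub>GA\<^esub> h)"
      unfolding add_GA by (auto simp: fun_eq_iff mod_simps add.assoc)
    show "f \<oplus>\<^bsub>GA\<^esub> g = g \<oplus>\<^bsub>GA\<^esub> f" unfolding add_GA by (simp add: add.commute)
  next
    fix f assume f: "f \<in> carrier GA"
    show "\<zero>\<^bsub>GA\<^esub> \<oplus>\<^bsub>GA\<^esub> f = f"
      by (rule GA_eqI[OF add_closed f], rule cong_trans[OF pairing_add]) (simp add: pairing_zero)
    show "\<exists>g\<in>carrier GA. g \<oplus>\<^bsub>GA\<^esub> f = \<zero>\<^bsub>GA\<^esub>"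
    proof
      show "(\<lambda>x\<in>carrier Q. (- f x) mod int p) \<in> carrier GA" by (rule restrict_mod_closed)
      show "(\<lambda>x\<in>carrier Q. (- f x) mod int p) \<oplus>\<^bsub>GA\<^esub> f = \<zero>\<^bsub>GA\<^esub>"
        unfolding add_GA zero_GA by (auto simp: fun_eq_iff mod_simps)
    qed
  qed (simp_all only: add_closed zero_closed)
  show "Group.monoid GA"
  proof (rule monoidI)
    fix f g h assume c: "f \<in> carrier GA" "g \<in> carrier GA" "h \<in> carrier GA"
    show "f \<otimes>\<^bsub>GA\<^esub> g \<otimes>\<^bsub>GA\<^esub> h = f \<otimes>\<^bsub>GA\<^esub> (g \<otimes>\<^bsub>GA\<^esub> h)"
    proof (rule GA_eqI)
      fix F
      have "[pairing (f \<otimes>\<^bsub>GA\<^esub> g \<otimes>\<^bsub>GA\<^esub> h) F = pairing (f \<otimes>\<^bsub>GA\<^esub> g) (\<lambda>y. pairing h (\<lambda>z. F (y \<otimes> z)))] (mod int p)"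
        by (rule pairing_mult) (use c mult_closed in auto)
      also have "[pairing (f \<otimes>\<^bsub>GA\<^esub> g) (\<lambda>y. pairing h (\<lambda>z. F (y \<otimes> z)))
         = pairing f (\<lambda>x. pairing g (\<lambda>y. pairing h (\<lambda>z. F (x \<otimes> y \<otimes> z))))] (mod int p)"
        by (rule pairing_mult) (use c in auto)
      also have "pairing f (\<lambda>x. pairing g (\<lambda>y. pairing h (\<lambda>z. F (x \<otimes> y \<otimes> z))))
         = pairing f (\<lambda>x. pairing g (\<lambda>y. pairing h (\<lambda>z. F (x \<otimes> (y \<otimes> z)))))"
        unfolding pairing_def by (simp add: m_assoc)
      also have "[pairing f (\<lambda>x. pairing g (\<lambda>y. pairing h (\<lambda>z. F (x \<otimes> (y \<otimes> z)))))
          = pairing f (\<lambda>x. pairing (g \<otimes>\<^bsub>GA\<^esub> h) (\<lambda>y. F (x \<otimes> y)))] (mod int p)"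
        by (rule pairing_cong, rule cong_sym, rule pairing_mult) (use c in auto)
      also have "[pairing f (\<lambda>x. pairing (g \<otimes>\<^bsub>GA\<^esub> h) (\<lambda>y. F (x \<otimes> y)))
          = pairing (f \<otimes>\<^bsub>GA\<^esub> (g \<otimes>\<^bsub>GA\<^esub> h)) F] (mod int p)"
        by (rule cong_sym, rule pairing_mult) (use c mult_closed in auto)
      finally show "[pairing (f \<otimes>\<^bsub>GA\<^esub> g \<otimes>\<^bsub>GA\<^esub> h) F = pairing (f \<otimes>\<^bsub>GA\<^esub> (g \<otimes>\<^bsub>GA\<^esub> h)) F] (mod int p)" .
    qed (use c mult_closed in auto)
  next
    fix f assume f: "f \<in> carrier GA"
    show "\<one>\<^bsub>GA\<^esub> \<otimes>\<^bsub>GA\<^esub> f = f"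
      unfolding one_GA
    proof (rule GA_eqI)
      show "[pairing (delta \<one> \<otimes>\<^bsub>GA\<^esub> f) F = pairing f F] (mod int p)" for F
      proof -
        have "[pairing (delta \<one> \<otimes>\<^bsub>GA\<^esub> f) F = pairing f (\<lambda>z. F (\<one> \<otimes> z))] (mod int p)"
          using pairing_mult[OF delta_closed[OF one_closed] f, of F] by (simp add: pairing_delta)
        also have "[pairing f (\<lambda>z. F (\<one> \<otimes> z)) = pairing f F] (mod int p)"
          by (rule pairing_cong) simp
        finally show ?thesis .
      qed
    qed (use f mult_closed in auto)
    show "f \<otimes>\<^bsub>GA\<^esub> \<one>\<^bsub>GA\<^esub> = f"
      unfolding one_GA
    proof (rule GA_eqI)
      show "[pairing (f \<otimes>\<^bsub>GA\<^esub> delta \<one>) F = pairing f F] (mod int p)" for F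
        by (rule cong_trans[OF pairing_mult]) (use f in \<open>auto simp: pairing_delta, simp add: pairing_def cong: sum.cong\<close>)
    qed (use f mult_closed in auto)
  qed (use mult_closed one_GA in auto)
next
  fix f g h assume c: "f \<in> carrier GA" "g \<in> carrier GA" "h \<in> carrier GA"
  show "(f \<oplus>\<^bsub>GA\<^esub> g) \<otimes>\<^bsub>GA\<^esub> h = f \<otimes>\<^bsub>GA\<^esub> h \<oplus>\<^bsub>GA\<^esub> g \<otimes>\<^bsub>GA\<^esub> h"
  proof (rule GA_eqI)
    fix F
    have "[pairing ((f \<oplus>\<^bsub>GA\<^esub> g) \<otimes>\<^bsub>GA\<^esub> h) F = pairing (f \<oplus>\<^bsub>GA\<^esub> g) (\<lambda>y. pairing h (\<lambda>z. F (y \<otimes> z)))] (mod int p)"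
      by (rule pairing_mult) (use c add_closed in auto)
    also have "[pairing (f \<oplus>\<^bsub>GA\<^esub> g) (\<lambda>y. pairing h (\<lambda>z. F (y \<otimes> z))) =
        pairing f (\<lambda>y. pairing h (\<lambda>z. F (y \<otimes> z))) + pairing g (\<lambda>y. pairing h (\<lambda>z. F (y \<otimes> z)))] (mod int p)"
      by (rule pairing_add)
    also have "[pairing f (\<lambda>y. pairing h (\<lambda>z. F (y \<otimes> z))) + pairing g (\<lambda>y. pairing h (\<lambda>z. F (y \<otimes> z)))
        = pairing (f \<otimes>\<^bsub>GA\<^esub> h) F + pairing (g \<otimes>\<^bsub>GA\<^esub> h) F] (mod int p)"
      by (intro cong_add cong_sym[OF pairing_mult]) (use c in auto)
    also have "[pairing (f \<otimes>\<^bsub>GA\<^esub> h) F + pairing (g \<otimes>\<^bsub>GA\<^esub> h) F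
        = pairing (f \<otimes>\<^bsub>GA\<^esub> h \<oplus>\<^bsub>GA\<^esub> g \<otimes>\<^bsub>GA\<^esub> h) F] (mod int p)"
      by (rule cong_sym[OF pairing_add])
    finally show "[pairing ((f \<oplus>\<^bsub>GA\<^esub> g) \<otimes>\<^bsub>GA\<^esub> h) F = pairing (f \<otimes>\<^bsub>GA\<^esub> h \<oplus>\<^bsub>GA\<^esub> g \<otimes>\<^bsub>GA\<^esub> h) F] (mod int p)" .
  qed (use c mult_closed add_closed in auto)
  show "h \<otimes>\<^bsub>GA\<^esub> (f \<oplus>\<^bsub>GA\<^esub> g) = h \<otimes>\<^bsub>GA\<^esub> f \<oplus>\<^bsub>GA\<^esub> h \<otimes>\<^bsub>GA\<^esub> g"
  proof (rule GA_eqI)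
    fix F
    have "[pairing (h \<otimes>\<^bsub>GA\<^esub> (f \<oplus>\<^bsub>GA\<^esub> g)) F = pairing h (\<lambda>y. pairing (f \<oplus>\<^bsub>GA\<^esub> g) (\<lambda>z. F (y \<otimes> z)))] (mod int p)"
      by (rule pairing_mult) (use c add_closed in auto)
    also have "[pairing h (\<lambda>y. pairing (f \<oplus>\<^bsub>GA\<^esub> g) (\<lambda>z. F (y \<otimes> z))) =
        pairing h (\<lambda>y. pairing f (\<lambda>z. F (y \<otimes> z)) + pairing g (\<lambda>z. F (y \<otimes> z)))] (mod int p)"
      by (rule pairing_cong, rule pairing_add)
    also have "pairing h (\<lambda>y. pairing f (\<lambda>z. F (y \<otimes> z)) + pairing g (\<lambda>z. F (y \<otimes> z)))
      = pairing h (\<lambda>y. pairing f (\<lambda>z. F (y \<otimes> z))) + pairing h (\<lambda>y. pairing g (\<lambda>z. F (y \<otimes> z)))"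
      by (rule pairing_add_right)
    also have "[pairing h (\<lambda>y. pairing f (\<lambda>z. F (y \<otimes> z))) + pairing h (\<lambda>y. pairing g (\<lambda>z. F (y \<otimes> z)))
        = pairing (h \<otimes>\<^bsub>GA\<^esub> f) F + pairing (h \<otimes>\<^bsub>GA\<^esub> g) F] (mod int p)"
      by (intro cong_add cong_sym[OF pairing_mult]) (use c in auto)
    also have "[pairing (h \<otimes>\<^bsub>GA\<^esub> f) F + pairing (h \<otimes>\<^bsub>GA\<^esub> g) F
        = pairing (h \<otimes>\<^bsub>GA\<^esub> f \<oplus>\<^bsub>GA\<^esub> h \<otimes>\<^bsub>GA\<^esub> g) F] (mod int p)"
      by (rule cong_sym[OF pairing_add])
    finally show "[pairing (h \<otimes>\<^bsub>GA\<^esub> (f \<oplus>\<^bsub>GA\<^esub> g)) F = pairing (h \<otimes>\<^bsub>GA\<^esub> f \<oplus>\<^bsub>GA\<^esub> h \<otimes>\<^bsub>GA\<^esub> g) F] (mod int p)" .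
  qed (use c mult_closed add_closed in auto)
qed

lemma finite_GA: "finite (carrier GA)"
  unfolding carrier_GA using finite_carrier by (intro finite_PiE) auto

lemma card_GA: "card (carrier GA) = p ^ card (carrier Q)"
  unfolding carrier_GA using finite_carrier by (simp add: card_PiE)

lemma delta_mult: "x \<in> carrier Q \<Longrightarrow> y \<in> carrier Q \<Longrightarrow> delta x \<otimes>\<^bsub>GA\<^esub> delta y = delta (x \<otimes> y)"
proof (rule GA_eqI)
  fix F assume "x \<in> carrier Q" "y \<in> carrier Q"
  then show "[pairing (delta x \<otimes>\<^bsub>GA\<^esub> delta y) F = pairing (delta (x \<otimes> y)) F] (mod int p)"
    using pairing_mult[OF delta_closed delta_closed, of x y F] by (simp add: pairing_delta)
qed (simp_all add: mult_closed)

lemma delta_inj: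
  assumes "x \<in> carrier Q" "delta x = delta y"
  shows "x = y"
proof -
  have "delta y x = delta x x" using assms(2) by simp
  then show ?thesis using assms(1) by (simp add: delta_def split: if_splits)
qed

lemma add_pow_GA:
  assumes "f \<in> carrier GA"
  shows "add_pow GA (k::nat) f = (\<lambda>x\<in>carrier Q. (int k * f x) mod int p)"
proof -
  interpret ring GA by (rule ring_GA)
  show ?thesis
  proof (induction k)
    case 0
    then show ?case by (simp add: zero_GA)
  next
    case (Suc k)
    have "add_pow GA (Suc k) f = add_pow GA k f \<oplus>\<^bsub>GA\<^esub> f" using assms by simp
    then show ?case unfolding Suc by (simp add: add_GA restrict_def fun_eq_iff mod_simps algebra_simps)
  qed
qed

lemma char_GA: "f \<in> carrier GA \<Longrightarrow> add_pow GA p f = \<zero>\<^bsub>GA\<^esub>"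
  by (simp add: add_pow_GA zero_GA)

text \<open>Induction on the sum of the integer representatives. A non-zero f has some f x > 0;
  lowering it by one stays within 0..<p, and adding \<open>delta x\<close> back involves no
  wrap-around.\<close>

lemma GA_induct [consumes 1, case_names zero add]:
  assumes "f \<in> carrier GA" "P \<zero>\<^bsub>GA\<^esub>"
    and step: "\<And>f x. f \<in> carrier GA \<Longrightarrow> x \<in> carrier Q \<Longrightarrow> P f \<Longrightarrow> P (f \<oplus>\<^bsub>GA\<^esub> delta x)"
  shows "P f"
  using assms(1)
proof (induction "nat (\<Sum>x\<in>carrier Q. f x)" arbitrary: f rule: less_induct)
  case less
  show ?case
  proof (cases "\<forall>x\<in>carrier Q. f x = 0")
    case True
    then have "f = \<zero>\<^bsub>GA\<^esub>"
      using less.prems by (intro PiE_ext[of f "carrier Q" "\<lambda>_. {0..<int p}"]) (use zero_closed in \<open>auto simp: carrier_GA zero_GA\<close>)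
    then show ?thesis using assms(2) by simp
  next
    case False
    then obtain x where x: "x \<in> carrier Q" "f x \<noteq> 0" by auto
    have fx: "f x > 0" "f x < int p" using GA_range[OF less.prems x(1)] x(2) by auto
    define g where "g = f(x := f x - 1)"
    have g: "g \<in> carrier GA"
      using less.prems x(1) fx unfolding g_def carrier_GA by (auto simp: PiE_iff extensional_def)
    have "(\<Sum>y\<in>carrier Q. f y) = f x + (\<Sum>y\<in>carrier Q - {x}. f y)"
      using finite_carrier x(1) by (simp add: sum.remove)
    moreover have "(\<Sum>y\<in>carrier Q. g y) = g x + (\<Sum>y\<in>carrier Q - {x}. g y)"
      using finite_carrier x(1) by (simp add: sum.remove)
    moreover have "(\<Sum>y\<in>carrier Q - {x}. g y) = (\<Sum>y\<in>carrier Q - {x}. f y)"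
      by (rule sum.cong) (auto simp: g_def)
    moreover have "g x = f x - 1" by (simp add: g_def)
    moreover have "(\<Sum>y\<in>carrier Q - {x}. f y) \<ge> 0"
      by (rule sum_nonneg) (use GA_range[OF less.prems] in auto)
    ultimately have "P g" using g fx by (intro less.hyps) auto
    then have "P (g \<oplus>\<^bsub>GA\<^esub> delta x)" by (rule step[OF g x(1)])
    also have "g \<oplus>\<^bsub>GA\<^esub> delta x = f"
    proof (rule PiE_ext[of _ "carrier Q" "\<lambda>_. {0..<int p}"])
      fix y assume "y \<in> carrier Q"
      then show "(g \<oplus>\<^bsub>GA\<^esub> delta x) y = f y"
        using GA_range[OF less.prems \<open>y \<in> carrier Q\<close>] by (cases "y = x") (simp_all add: add_GA delta_def g_def)
    qed (use less.prems add_closed[of g "delta x"] in \<open>auto simp: carrier_GA\<close>)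
    finally show ?thesis .
  qed
qed

lemma GA_generate: "carrier GA = generate (add_monoid GA) (delta ` carrier Q)"
proof -
  interpret ring GA by (rule ring_GA)
  show ?thesis
  proof
    show "carrier GA \<subseteq> generate (add_monoid GA) (delta ` carrier Q)"
    proof
      fix f assume "f \<in> carrier GA"
      then show "f \<in> generate (add_monoid GA) (delta ` carrier Q)"
      proof (induction rule: GA_induct)
        case zero
        show ?case using generate.one[of "add_monoid GA"] by simp
      next
        case (add f x)
        then show ?case
          using generate.eng[of f "add_monoid GA" "delta ` carrier Q" "delta x"] by (simp add: generate.incl)
      qed
    qed
    show "generate (add_monoid GA) (delta ` carrier Q) \<subseteq> carrier GA"
    proof -
      have "delta ` carrier Q \<subseteq> carrier GA" by auto
      then show ?thesis using add.generate_incl[of "delta ` carrier Q"] by simp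
    qed
  qed
qed

definition aug :: "('a \<Rightarrow> int) set" where
  "aug = {f \<in> carrier GA. (\<Sum>x\<in>carrier Q. f x) mod int p = 0}"

lemma aug_iff: "f \<in> aug \<longleftrightarrow> f \<in> carrier GA \<and> [pairing f (\<lambda>_. 1) = 0] (mod int p)"
  by (simp add: aug_def pairing_def cong_def)

text \<open>Writing each group element x as (x - 1) + 1 gives f = g + k 1, with g in the span of the
  x - 1 and k congruent to the augmentation of f. For f in \<open>aug\<close> the number k is a
  multiple of p, so the second part vanishes.\<close>

lemma aug_generate: "aug = generate (add_monoid GA) ((\<lambda>x. delta x \<ominus>\<^bsub>GA\<^esub> \<one>\<^bsub>GA\<^esub>) ` carrier Q)" (is "_ = ?G")
proof -
  interpret ring GA by (rule ring_GA)
  have sub: "(\<lambda>x. delta x \<ominus>\<^bsub>GA\<^esub> \<one>\<^bsub>GA\<^esub>) ` carrier Q \<subseteq> carrier GA" by auto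
  have S: "subgroup ?G (add_monoid GA)" by (rule add.generate_is_subgroup) (use sub in simp)
  have Gc: "?G \<subseteq> carrier GA" using add.generate_incl[OF sub] by simp
  have *: "\<exists>g\<in>?G. \<exists>k::nat. f = g \<oplus>\<^bsub>GA\<^esub> add_pow GA k \<one>\<^bsub>GA\<^esub> \<and> [int k = pairing f (\<lambda>_. 1)] (mod int p)"
    if "f \<in> carrier GA" for f
    using that
  proof (induction rule: GA_induct)
    case zero
    have "\<zero>\<^bsub>GA\<^esub> \<in> ?G" using subgroup.one_closed[OF S] by simp
    then show ?case by (intro bexI[of _ "\<zero>\<^bsub>GA\<^esub>"] exI[of _ 0]) (auto simp: pairing_zero)
  next
    case (add f x)
    then obtain g k where g: "g \<in> ?G" "f = g \<oplus>\<^bsub>GA\<^esub> add_pow GA (k::nat) \<one>\<^bsub>GA\<^esub>" "[int k = pairing f (\<lambda>_. 1)] (mod int p)"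
      by auto
    have gc: "g \<in> carrier GA" using g(1) Gc by auto
    let ?d = "delta x \<ominus>\<^bsub>GA\<^esub> \<one>\<^bsub>GA\<^esub>"
    have dc: "?d \<in> carrier GA" "delta x = ?d \<oplus>\<^bsub>GA\<^esub> \<one>\<^bsub>GA\<^esub>"
      using add(2) by (simp_all add: minus_eq a_assoc l_neg)
    have "g \<oplus>\<^bsub>GA\<^esub> ?d \<in> ?G"
      using subgroup.m_closed[OF S g(1), of ?d] add(2) by (simp add: generate.incl)
    moreover have "f \<oplus>\<^bsub>GA\<^esub> delta x = (g \<oplus>\<^bsub>GA\<^esub> ?d) \<oplus>\<^bsub>GA\<^esub> add_pow GA (Suc k) \<one>\<^bsub>GA\<^esub>"
      by (subst dc(2), subst g(2)) (use gc dc(1) in \<open>simp add: a_ac\<close>)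
    moreover have "[int (Suc k) = pairing (f \<oplus>\<^bsub>GA\<^esub> delta x) (\<lambda>_. 1)] (mod int p)"
    proof (rule cong_sym, rule cong_trans[OF pairing_add])
      show "[pairing f (\<lambda>_. 1) + pairing (delta x) (\<lambda>_. 1) = int (Suc k)] (mod int p)"
        using cong_add[OF cong_refl[of 1] cong_sym[OF g(3)]] add(2) by (simp add: pairing_delta add.commute)
    qed
    ultimately show ?case by blast
  qed
  show ?thesis
  proof
    show "aug \<subseteq> ?G"
    proof
      fix f assume f: "f \<in> aug"
      then obtain g k where g: "g \<in> ?G" "f = g \<oplus>\<^bsub>GA\<^esub> add_pow GA (k::nat) \<one>\<^bsub>GA\<^esub>" "[int k = pairing f (\<lambda>_. 1)] (mod int p)"
        using * aug_iff by meson
      have "[int k = 0] (mod int p)" using g(3) f aug_iff cong_trans by blast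
      then have "p dvd k" by (simp add: cong_0_iff)
      then obtain l where l: "k = p * l" by auto
      have "add_pow GA k \<one>\<^bsub>GA\<^esub> = add_pow GA l (add_pow GA p \<one>\<^bsub>GA\<^esub>)"
        unfolding l by (rule add.nat_pow_pow[symmetric]) simp
      then have "add_pow GA k \<one>\<^bsub>GA\<^esub> = \<zero>\<^bsub>GA\<^esub>" using char_GA by simp
      then show "f \<in> ?G" using g Gc by auto
    qed
    have aug: "subgroup aug (add_monoid GA)"
    proof (rule add.subgroupI)
      have "\<zero>\<^bsub>GA\<^esub> \<in> aug" by (simp add: aug_iff pairing_zero)
      then show "aug \<noteq> {}" by auto
      show ab: "a \<oplus>\<^bsub>GA\<^esub> b \<in> aug" if "a \<in> aug" "b \<in> aug" for a b
        using that cong_trans[OF pairing_add[of a b "\<lambda>_. 1"], of 0]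
          cong_add[of "pairing a (\<lambda>_. 1)" 0 "int p" "pairing b (\<lambda>_. 1)" 0]
        by (simp add: aug_iff add_closed)
      show "\<ominus>\<^bsub>GA\<^esub> a \<in> aug" if a: "a \<in> aug" for a
      proof -
        have ac: "a \<in> carrier GA" using a aug_iff by auto
        have "[pairing (\<ominus>\<^bsub>GA\<^esub> a \<oplus>\<^bsub>GA\<^esub> a) (\<lambda>_. 1) = pairing (\<ominus>\<^bsub>GA\<^esub> a) (\<lambda>_. 1) + pairing a (\<lambda>_. 1)] (mod int p)"
          by (rule pairing_add)
        then have "[pairing (\<ominus>\<^bsub>GA\<^esub> a) (\<lambda>_. 1) + pairing a (\<lambda>_. 1) = 0] (mod int p)"
          using ac by (simp add: l_neg pairing_zero cong_sym)
        then show ?thesis using a ac by (auto simp: aug_iff cong_0_iff dvd_add_left_iff)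
      qed
    qed (auto simp: aug_def)
    show "?G \<subseteq> aug"
    proof (rule add.generate_subgroup_incl[OF _ aug])
      show "(\<lambda>x. delta x \<ominus>\<^bsub>GA\<^esub> \<one>\<^bsub>GA\<^esub>) ` carrier Q \<subseteq> aug"
      proof
        fix f assume "f \<in> (\<lambda>x. delta x \<ominus>\<^bsub>GA\<^esub> \<one>\<^bsub>GA\<^esub>) ` carrier Q"
        then obtain x where x: "x \<in> carrier Q" "f = delta x \<ominus>\<^bsub>GA\<^esub> \<one>\<^bsub>GA\<^esub>" by auto
        have fc: "f \<in> carrier GA" using x by auto
        have "f \<oplus>\<^bsub>GA\<^esub> delta \<one> = delta x" using x by (simp add: minus_eq a_assoc l_neg flip: one_GA)
        then have "[1 = pairing f (\<lambda>_. 1) + 1] (mod int p)"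
          using pairing_add[of f "delta \<one>" "\<lambda>_. 1"] x by (simp add: pairing_delta)
        then have "[0 = pairing f (\<lambda>_. 1)] (mod int p)" using cong_add_rcancel[of 0 1 "pairing f (\<lambda>_. 1)"] by simp
        then show "f \<in> aug" using fc by (simp add: aug_iff cong_sym)
      qed
    qed
  qed
qed

lemma aug_ideal: "ideal aug GA"
proof -
  interpret ring GA by (rule ring_GA)
  have sub: "(\<lambda>x. delta x \<ominus>\<^bsub>GA\<^esub> \<one>\<^bsub>GA\<^esub>) ` carrier Q \<subseteq> carrier GA" by auto
  show ?thesis
  proof (rule idealI[OF ring_GA])
    show "subgroup aug (add_monoid GA)"
      unfolding aug_generate by (rule add.generate_is_subgroup) (use sub in simp)
    fix a x assume a: "a \<in> aug" and x: "x \<in> carrier GA"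
    then have ac: "a \<in> carrier GA" and a0: "[pairing a (\<lambda>_. 1) = 0] (mod int p)" by (auto simp: aug_iff)
    have "[pairing x (\<lambda>y. pairing a (\<lambda>z. 1)) = pairing x (\<lambda>y. 0)] (mod int p)"
      by (rule pairing_cong) (rule a0)
    then show "x \<otimes>\<^bsub>GA\<^esub> a \<in> aug"
      using cong_trans[OF pairing_mult[OF x ac, of "\<lambda>_. 1"]] mult_closed[OF x ac] by (simp add: aug_iff pairing_def)
    have "pairing a (\<lambda>y. pairing x (\<lambda>z. 1)) = pairing a (\<lambda>_. 1) * pairing x (\<lambda>_. 1)"
      by (simp add: pairing_def sum_distrib_right)
    moreover have "[pairing a (\<lambda>_. 1) * pairing x (\<lambda>_. 1) = 0 * pairing x (\<lambda>_. 1)] (mod int p)"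
      by (rule cong_mult[OF a0 cong_refl])
    ultimately show "a \<otimes>\<^bsub>GA\<^esub> x \<in> aug"
      using cong_trans[OF pairing_mult[OF ac x, of "\<lambda>_. 1"]] mult_closed[OF ac x] by (simp add: aug_iff)
  qed
qed

end

section \<open>Nilpotency of the augmentation ideal of a p-group\<close>

text \<open>Orbit lengths divide p^k, so an orbit that is not a fixed point has length divisible by
  p.\<close>

lemma (in group_action) card_fixed_points:
  assumes "finite E" "finite (carrier G)" "prime p" "order G = p ^ k"
  shows "[card E = card {x \<in> E. \<forall>g\<in>carrier G. \<phi> g x = x}] (mod p)"
proof -
  let ?F = "{x \<in> E. \<forall>g\<in>carrier G. \<phi> g x = x}"
  let ?O = "orbits G E \<phi>"
  have part: "partition E ?O" by (rule orbit_partition)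
  have sub: "\<Union>?O \<subseteq> E" and cover: "E \<subseteq> \<Union>?O"
    using part unfolding partition_def by blast+
  have E: "E = \<Union>?O" using sub cover by blast
  have finO: "finite ?O" by (rule finite_subset[of _ "Pow E"]) (use sub assms(1) in auto)
  have fin: "finite C" if "C \<in> ?O" for C using that sub assms(1) by (meson Sup_upper finite_subset)
  have disj: "C \<inter> D = {}" if "C \<in> ?O" "D \<in> ?O" "C \<noteq> D" for C D
  proof (rule ccontr)
    assume "C \<inter> D \<noteq> {}"
    then obtain x where x: "x \<in> C" "x \<in> D" by blast
    then have "x \<in> E" using that sub by blast
    then show False using part that x unfolding partition_def by metis
  qed
  have "card E = (\<Sum>C\<in>?O. card C)"
    using card_Union_disjoint[of ?O] fin disj E by (metis disjnt_def pairwiseI)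
  also have "[(\<Sum>C\<in>?O. card C) = (\<Sum>C\<in>?O. card (C \<inter> ?F))] (mod p)"
  proof (rule cong_sum)
    fix C assume C: "C \<in> ?O"
    then obtain x where x: "x \<in> E" "C = orbit G \<phi> x" unfolding orbits_def by auto
    have Cim: "C = {\<phi> g x | g. g \<in> carrier G}" using x by (simp add: orbit_def)
    have xC: "x \<in> C" using orbit_refl[OF x(1)] x by simp
    have "card C * card (stabilizer G \<phi> x) = p ^ k"
      using orbit_stabilizer_theorem[OF x(1)] x assms(4) by simp
    then have "card C dvd p ^ k" by (metis dvd_triv_left)
    then obtain i where i: "card C = p ^ i" using divides_primepow_nat[OF assms(3)] by blast
    show "[card C = card (C \<inter> ?F)] (mod p)"
    proof (cases "x \<in> ?F")
      case True
      have "C \<subseteq> {x}" unfolding Cim using True by auto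
      then have "C = {x}" using xC by blast
      then show ?thesis using True by simp
    next
      case False
      have "C \<inter> ?F = {}"
      proof (rule ccontr)
        assume "C \<inter> ?F \<noteq> {}"
        then obtain y where y: "y \<in> C" "y \<in> ?F" by blast
        have "x \<in> orbit G \<phi> y" using orbit_sym[of x y] x y by simp
        then have "x = y" using y(2) unfolding orbit_def by auto
        then show False using False y by simp
      qed
      moreover have "i \<noteq> 0"
      proof
        assume "i = 0"
        then have "card C = 1" using i by simp
        then have "C = {x}" using xC by (metis card_1_singletonE singletonD)
        then have "x \<in> ?F" unfolding Cim using x(1) by blast
        then show False using False by simp
      qed
      ultimately show ?thesis using i by (simp add: cong_0_iff)
    qed
  qed
  also have "(\<Sum>C\<in>?O. card (C \<inter> ?F)) = card (\<Union>C\<in>?O. C \<inter> ?F)"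
    by (rule card_UN_disjoint[symmetric]) (use finO fin disj in blast)+
  also have "(\<Union>C\<in>?O. C \<inter> ?F) = ?F" using E by blast
  finally show ?thesis .
qed

context finite_group_algebra
begin

context
  fixes W k
  assumes prime: "prime p" and order: "card (carrier Q) = p ^ k"
    and W: "subgroup W (add_monoid GA)"
    and stable: "\<And>x w. x \<in> carrier Q \<Longrightarrow> w \<in> W \<Longrightarrow> delta x \<otimes>\<^bsub>GA\<^esub> w \<in> W"
begin

interpretation GA: ring GA by (rule ring_GA)

private lemma Wc: "W \<subseteq> carrier GA" using W subgroup.subset by fastforce

private abbreviation "X \<equiv> rcosets\<^bsub>add_monoid GA\<^esub> W"

text \<open>Left multiplication by Q on the cosets of W; it is restricted to them because
  permutations of a set are represented by extensional functions.\<close>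

private definition act :: "'a \<Rightarrow> ('a \<Rightarrow> int) set \<Rightarrow> ('a \<Rightarrow> int) set" where
  "act x = (\<lambda>C\<in>X. (\<lambda>v. delta x \<otimes>\<^bsub>GA\<^esub> v) ` C)"

private lemma delta_cancel:
  assumes "x \<in> carrier Q" "v \<in> carrier GA"
  shows "delta x \<otimes>\<^bsub>GA\<^esub> (delta (inv x) \<otimes>\<^bsub>GA\<^esub> v) = v" "delta (inv x) \<otimes>\<^bsub>GA\<^esub> (delta x \<otimes>\<^bsub>GA\<^esub> v) = v"
  using assms by (simp_all add: GA.m_assoc[symmetric] delta_mult flip: one_GA)

private lemma act_coset:
  assumes "x \<in> carrier Q" "v \<in> carrier GA"
  shows "act x (W #>\<^bsub>add_monoid GA\<^esub> v) = W #>\<^bsub>add_monoid GA\<^esub> (delta x \<otimes>\<^bsub>GA\<^esub> v)"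
proof -
  have "(\<lambda>v. delta x \<otimes>\<^bsub>GA\<^esub> v) ` (W #>\<^bsub>add_monoid GA\<^esub> v) = W #>\<^bsub>add_monoid GA\<^esub> (delta x \<otimes>\<^bsub>GA\<^esub> v)"
  proof
    show "(\<lambda>v. delta x \<otimes>\<^bsub>GA\<^esub> v) ` (W #>\<^bsub>add_monoid GA\<^esub> v) \<subseteq> W #>\<^bsub>add_monoid GA\<^esub> (delta x \<otimes>\<^bsub>GA\<^esub> v)"
    proof
      fix y assume "y \<in> (\<lambda>v. delta x \<otimes>\<^bsub>GA\<^esub> v) ` (W #>\<^bsub>add_monoid GA\<^esub> v)"
      then obtain w where w: "w \<in> W" "y = delta x \<otimes>\<^bsub>GA\<^esub> (w \<oplus>\<^bsub>GA\<^esub> v)" by (auto simp: r_coset_def)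
      then have "y = delta x \<otimes>\<^bsub>GA\<^esub> w \<oplus>\<^bsub>GA\<^esub> delta x \<otimes>\<^bsub>GA\<^esub> v"
        using assms Wc by (simp add: GA.r_distr subset_iff)
      then show "y \<in> W #>\<^bsub>add_monoid GA\<^esub> (delta x \<otimes>\<^bsub>GA\<^esub> v)"
        using stable[OF assms(1) w(1)] by (auto simp: r_coset_def)
    qed
    show "W #>\<^bsub>add_monoid GA\<^esub> (delta x \<otimes>\<^bsub>GA\<^esub> v) \<subseteq> (\<lambda>v. delta x \<otimes>\<^bsub>GA\<^esub> v) ` (W #>\<^bsub>add_monoid GA\<^esub> v)"
    proof
      fix y assume "y \<in> W #>\<^bsub>add_monoid GA\<^esub> (delta x \<otimes>\<^bsub>GA\<^esub> v)"
      then obtain w where w: "w \<in> W" "y = w \<oplus>\<^bsub>GA\<^esub> delta x \<otimes>\<^bsub>GA\<^esub> v" by (auto simp: r_coset_def)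
      have w': "delta (inv x) \<otimes>\<^bsub>GA\<^esub> w \<in> W" using stable[of "inv x"] assms w by simp
      have "y = delta x \<otimes>\<^bsub>GA\<^esub> (delta (inv x) \<otimes>\<^bsub>GA\<^esub> w \<oplus>\<^bsub>GA\<^esub> v)"
        using w assms Wc by (simp add: GA.r_distr subset_iff delta_cancel)
      moreover have "delta (inv x) \<otimes>\<^bsub>GA\<^esub> w \<oplus>\<^bsub>GA\<^esub> v \<in> W #>\<^bsub>add_monoid GA\<^esub> v"
        using w' by (auto simp: r_coset_def)
      ultimately show "y \<in> (\<lambda>v. delta x \<otimes>\<^bsub>GA\<^esub> v) ` (W #>\<^bsub>add_monoid GA\<^esub> v)" by blast
    qed
  qed
  moreover have "W #>\<^bsub>add_monoid GA\<^esub> v \<in> X" using assms by (auto simp: RCOSETS_def)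
  ultimately show ?thesis by (simp add: act_def)
qed

private lemma X_obtain: "C \<in> X \<Longrightarrow> \<exists>v\<in>carrier GA. C = W #>\<^bsub>add_monoid GA\<^esub> v"
  by (auto simp: RCOSETS_def)

private lemma X_intro: "v \<in> carrier GA \<Longrightarrow> W #>\<^bsub>add_monoid GA\<^esub> v \<in> X"
  by (auto simp: RCOSETS_def)

private lemma act_closed: "x \<in> carrier Q \<Longrightarrow> C \<in> X \<Longrightarrow> act x C \<in> X"
  using X_obtain[of C] act_coset X_intro mult_closed delta_closed by metis

private lemma act_mult: "x \<in> carrier Q \<Longrightarrow> y \<in> carrier Q \<Longrightarrow> C \<in> X \<Longrightarrow> act x (act y C) = act (x \<otimes> y) C"
  using X_obtain[of C] by (auto simp: act_coset delta_mult[symmetric] GA.m_assoc)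

private lemma act_one: "C \<in> X \<Longrightarrow> act \<one> C = C"
  using X_obtain[of C] by (auto simp: act_coset simp flip: one_GA)

private lemma action: "group_action Q X act"
proof -
  have bij: "act x \<in> Bij X" if x: "x \<in> carrier Q" for x
  proof -
    have "bij_betw (act x) X X"
      by (rule bij_betw_byWitness[of X "act (inv x)"])
        (use x act_mult[of "inv x" x] act_mult[of x "inv x"] act_one act_closed in auto)
    then show ?thesis by (simp add: Bij_def act_def)
  qed
  have "act \<in> hom Q (BijGroup X)"
  proof (rule homI)
    fix x y assume xy: "x \<in> carrier Q" "y \<in> carrier Q"
    have "act (x \<otimes> y) = compose X (act x) (act y)"
    proof
      fix C
      show "act (x \<otimes> y) C = compose X (act x) (act y) C"
      proof (cases "C \<in> X")
        case True
        then show ?thesis using act_mult[OF xy True] by (simp add: compose_def)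
      next
        case False
        then show ?thesis by (simp add: compose_def act_def)
      qed
    qed
    then show "act (x \<otimes> y) = act x \<otimes>\<^bsub>BijGroup X\<^esub> act y"
      using bij[OF xy(1)] bij[OF xy(2)] by (simp add: BijGroup_def)
  qed (simp add: BijGroup_def bij)
  then show ?thesis
    by (simp add: group_action_def group_hom_def group_hom_axioms_def group_BijGroup)
qed

text \<open>Q permutes the cosets of W. Their number is a power of p greater than 1, so the number
  of fixed cosets is divisible by p; W is one of them, hence there is another one, v + W.\<close>

lemma exists_invariant_mod:
  assumes "W \<noteq> carrier GA"
  shows "\<exists>v\<in>carrier GA - W. \<forall>x\<in>carrier Q. delta x \<otimes>\<^bsub>GA\<^esub> v \<ominus>\<^bsub>GA\<^esub> v \<in> W"
proof -
  interpret group_action Q X act by (rule action)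
  let ?F = "{C \<in> X. \<forall>x\<in>carrier Q. act x C = C}"
  have lag: "card X * card W = p ^ card (carrier Q)"
    using GA.add.lagrange[OF W] card_GA by (simp add: order_def)
  then have "card X dvd p ^ card (carrier Q)" by (metis dvd_triv_left)
  then obtain i where i: "card X = p ^ i" using divides_primepow_nat[OF prime] by blast
  have finX: "finite X" using i p_gt_1 by (intro card_ge_0_finite) simp
  have "i \<noteq> 0"
  proof
    assume "i = 0"
    then have "card W = card (carrier GA)" using lag i card_GA by simp
    then show False using assms card_subset_eq[OF finite_GA Wc] by simp
  qed
  then have "[card X = 0] (mod p)" using i by (simp add: cong_0_iff)
  moreover have "[card X = card ?F] (mod p)"
    by (rule card_fixed_points) (use finX finite_carrier prime order in \<open>auto simp: order_def\<close>)
  ultimately have "[card ?F = 0] (mod p)" by (rule cong_trans[OF cong_sym, rotated])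
  then have "p dvd card ?F" by (simp only: cong_0_iff)
  have W0: "W #>\<^bsub>add_monoid GA\<^esub> \<zero>\<^bsub>GA\<^esub> = W" using GA.add.coset_mult_one[OF Wc] by simp
  have "act x W = W" if "x \<in> carrier Q" for x
    using act_coset[OF that GA.zero_closed] that by (simp add: W0)
  moreover have "W \<in> X" using X_intro[OF GA.zero_closed] by (simp add: W0)
  ultimately have "W \<in> ?F" by blast
  have "?F \<noteq> {W}"
  proof
    assume "?F = {W}"
    then have "card ?F = 1" by simp
    then show False using \<open>p dvd card ?F\<close> p_gt_1 by simp
  qed
  then obtain C where C: "C \<in> ?F" "C \<noteq> W" using \<open>W \<in> ?F\<close> by blast
  then obtain v where v: "v \<in> carrier GA" "C = W #>\<^bsub>add_monoid GA\<^esub> v" using X_obtain by blast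
  have "v \<notin> W"
  proof
    assume "v \<in> W"
    then have "W #>\<^bsub>add_monoid GA\<^esub> v = W" using v by (intro GA.add.coset_join2[OF _ W]) auto
    then show False using C(2) v by simp
  qed
  moreover have "delta x \<otimes>\<^bsub>GA\<^esub> v \<ominus>\<^bsub>GA\<^esub> v \<in> W" if x: "x \<in> carrier Q" for x
  proof -
    have "W #>\<^bsub>add_monoid GA\<^esub> (delta x \<otimes>\<^bsub>GA\<^esub> v) = W #>\<^bsub>add_monoid GA\<^esub> v"
      using C(1) x v act_coset by auto
    moreover have "delta x \<otimes>\<^bsub>GA\<^esub> v \<in> W #>\<^bsub>add_monoid GA\<^esub> (delta x \<otimes>\<^bsub>GA\<^esub> v)"
      using GA.add.rcos_self[OF _ W] x v by simp
    ultimately obtain w where w: "w \<in> W" "delta x \<otimes>\<^bsub>GA\<^esub> v = w \<oplus>\<^bsub>GA\<^esub> v"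
      by (auto simp: r_coset_def)
    then have "delta x \<otimes>\<^bsub>GA\<^esub> v \<ominus>\<^bsub>GA\<^esub> v = w"
      using Wc v by (auto simp: GA.minus_eq GA.a_assoc GA.r_neg)
    then show ?thesis using w by simp
  qed
  ultimately show ?thesis using v by blast
qed

end

text \<open>The preimage of the Q-invariants of F_p[Q]/W. Iterated from 0 it gives the ascending
  series of successive invariants, the module analogue of the upper central series.\<close>

definition next_invariants :: "('a \<Rightarrow> int) set \<Rightarrow> ('a \<Rightarrow> int) set" where
  "next_invariants W = {v \<in> carrier GA. \<forall>x\<in>carrier Q. delta x \<otimes>\<^bsub>GA\<^esub> v \<ominus>\<^bsub>GA\<^esub> v \<in> W}"

lemma next_invariants_subgroup:
  assumes W: "subgroup W (add_monoid GA)"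
  shows "subgroup (next_invariants W) (add_monoid GA)"
proof -
  interpret GA: ring GA by (rule ring_GA)
  have eq: "next_invariants W = {v \<in> carrier GA. \<forall>x\<in>carrier Q. (delta x \<ominus>\<^bsub>GA\<^esub> \<one>\<^bsub>GA\<^esub>) \<otimes>\<^bsub>GA\<^esub> v \<otimes>\<^bsub>GA\<^esub> \<one>\<^bsub>GA\<^esub> \<in> W}"
    unfolding next_invariants_def by (auto simp: GA.minus_eq GA.l_distr GA.l_minus)
  have V: "subgroup {v \<in> carrier GA. (delta x \<ominus>\<^bsub>GA\<^esub> \<one>\<^bsub>GA\<^esub>) \<otimes>\<^bsub>GA\<^esub> v \<otimes>\<^bsub>GA\<^esub> \<one>\<^bsub>GA\<^esub> \<in> W} (add_monoid GA)"
    if "x \<in> carrier Q" for x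
    by (rule GA.subgroup_vimage_sandwich[OF W]) (use that in auto)
  have "next_invariants W = \<Inter>((\<lambda>x. {v \<in> carrier GA. (delta x \<ominus>\<^bsub>GA\<^esub> \<one>\<^bsub>GA\<^esub>) \<otimes>\<^bsub>GA\<^esub> v \<otimes>\<^bsub>GA\<^esub> \<one>\<^bsub>GA\<^esub> \<in> W}) ` carrier Q)"
    unfolding eq by auto
  then show ?thesis using GA.add.subgroups_Inter[of "(\<lambda>x. {v \<in> carrier GA. (delta x \<ominus>\<^bsub>GA\<^esub> \<one>\<^bsub>GA\<^esub>) \<otimes>\<^bsub>GA\<^esub> v \<otimes>\<^bsub>GA\<^esub> \<one>\<^bsub>GA\<^esub> \<in> W}) ` carrier Q"] V by auto
qed

text \<open>y x v - x v = x (z v - v) with z = x^(-1) y x, so invariance of v modulo W under all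
  group elements carries over to x v.\<close>

lemma next_invariants_stable:
  assumes "\<And>x w. x \<in> carrier Q \<Longrightarrow> w \<in> W \<Longrightarrow> delta x \<otimes>\<^bsub>GA\<^esub> w \<in> W"
    and x: "x \<in> carrier Q" and v: "v \<in> next_invariants W"
  shows "delta x \<otimes>\<^bsub>GA\<^esub> v \<in> next_invariants W"
proof -
  interpret GA: ring GA by (rule ring_GA)
  have vc: "v \<in> carrier GA" using v by (simp add: next_invariants_def)
  have "delta y \<otimes>\<^bsub>GA\<^esub> (delta x \<otimes>\<^bsub>GA\<^esub> v) \<ominus>\<^bsub>GA\<^esub> delta x \<otimes>\<^bsub>GA\<^esub> v \<in> W" if y: "y \<in> carrier Q" for y
  proof -
    let ?z = "inv x \<otimes> (y \<otimes> x)"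
    have "delta ?z \<otimes>\<^bsub>GA\<^esub> v \<ominus>\<^bsub>GA\<^esub> v \<in> W" using v x y by (simp add: next_invariants_def)
    then have "delta x \<otimes>\<^bsub>GA\<^esub> (delta ?z \<otimes>\<^bsub>GA\<^esub> v \<ominus>\<^bsub>GA\<^esub> v) \<in> W" by (rule assms(1)[OF x])
    moreover have "x \<otimes> ?z = y \<otimes> x" using x y by (simp add: m_assoc[symmetric])
    ultimately show ?thesis
      using x y vc by (simp add: GA.minus_eq GA.r_distr GA.r_minus GA.m_assoc[symmetric] delta_mult)
  qed
  then show ?thesis using vc x by (simp add: next_invariants_def mult_closed)
qed

lemma next_invariants_mono:
  assumes W: "subgroup W (add_monoid GA)" and "\<And>x w. x \<in> carrier Q \<Longrightarrow> w \<in> W \<Longrightarrow> delta x \<otimes>\<^bsub>GA\<^esub> w \<in> W"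
  shows "W \<subseteq> next_invariants W"
proof
  interpret GA: ring GA by (rule ring_GA)
  fix w assume w: "w \<in> W"
  have "\<ominus>\<^bsub>GA\<^esub> w \<in> W" using subgroup.m_inv_closed[OF W w] by (simp add: a_inv_def)
  then have "delta x \<otimes>\<^bsub>GA\<^esub> w \<ominus>\<^bsub>GA\<^esub> w \<in> W" if "x \<in> carrier Q" for x
    using subgroup.m_closed[OF W assms(2)[OF that w]] by (simp add: GA.minus_eq)
  then show "w \<in> next_invariants W" using subgroup.mem_carrier[OF W w] by (simp add: next_invariants_def)
qed

text \<open>The ascending series \<open>V\<close> grows strictly until it is the whole algebra. Each
  factor from I moves \<open>V (Suc n)\<close> into \<open>V n\<close>, so I^N annihilates
  \<open>V N\<close>, which contains one.\<close>

lemma aug_nilpotent: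
  assumes prime: "prime p" and order: "card (carrier Q) = p ^ k"
  shows "\<exists>N. ideal_pow GA aug N = {\<zero>\<^bsub>GA\<^esub>}"
proof -
  interpret GA: ring GA by (rule ring_GA)
  define V where "V n = (next_invariants ^^ n) {\<zero>\<^bsub>GA\<^esub>}" for n
  have V0: "V 0 = {\<zero>\<^bsub>GA\<^esub>}" and VS: "V (Suc n) = next_invariants (V n)" for n by (simp_all add: V_def)
  have V: "subgroup (V n) (add_monoid GA) \<and> (\<forall>x\<in>carrier Q. \<forall>w\<in>V n. delta x \<otimes>\<^bsub>GA\<^esub> w \<in> V n)" for n
  proof (induction n)
    case 0
    have "subgroup {\<zero>\<^bsub>GA\<^esub>} (add_monoid GA)" using GA.add.triv_subgroup by simp
    then show ?case by (simp add: V0)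
  next
    case (Suc n)
    then show ?case unfolding VS using next_invariants_subgroup next_invariants_stable[of "V n"] by blast
  qed
  have sub: "V n \<subseteq> V (Suc n)" for n unfolding VS
    by (rule next_invariants_mono) (use V[of n] in blast)+
  have psub: "V n \<subset> V (Suc n)" if "V n \<noteq> carrier GA" for n
  proof -
    have sV: "subgroup (V n) (add_monoid GA)" using V by (rule conjunct1)
    have "\<exists>v\<in>carrier GA - V n. \<forall>x\<in>carrier Q. delta x \<otimes>\<^bsub>GA\<^esub> v \<ominus>\<^bsub>GA\<^esub> v \<in> V n"
      by (rule exists_invariant_mod[OF prime order sV _ that]) (use V[of n] in blast)
    then obtain v where "v \<in> carrier GA - V n" "\<forall>x\<in>carrier Q. delta x \<otimes>\<^bsub>GA\<^esub> v \<ominus>\<^bsub>GA\<^esub> v \<in> V n"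
      by (elim bexE)
    then have "v \<in> V (Suc n) - V n" unfolding VS next_invariants_def by simp
    then show ?thesis using sub[of n] by blast
  qed
  have Vc: "V n \<subseteq> carrier GA" for n using V[of n] subgroup.subset by fastforce
  have "\<exists>n. V n = carrier GA"
  proof (rule ccontr)
    assume a: "\<nexists>n. V n = carrier GA"
    have low: "n \<le> card (V n)" for n
    proof (induction n)
      case (Suc n)
      have "card (V n) < card (V (Suc n))"
        by (rule psubset_card_mono[OF finite_subset[OF Vc finite_GA] psub]) (use a in auto)
      then show ?case using Suc by simp
    qed simp
    have "card (V n) \<le> card (carrier GA)" for n by (rule card_mono[OF finite_GA Vc])
    then have "card (V (Suc (card (carrier GA)))) \<le> card (carrier GA)" .
    then show False using low[of "Suc (card (carrier GA))"] by linarith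
  qed
  then obtain N where N: "V N = carrier GA" by blast
  have step: "a \<otimes>\<^bsub>GA\<^esub> v \<in> V n" if a: "a \<in> aug" and v: "v \<in> V (Suc n)" for a v n
  proof -
    have vc: "v \<in> carrier GA" using v Vc by blast
    have "a \<in> generate (add_monoid GA) ((\<lambda>x. delta x \<ominus>\<^bsub>GA\<^esub> \<one>\<^bsub>GA\<^esub>) ` carrier Q)" using a aug_generate by simp
    then have "\<one>\<^bsub>GA\<^esub> \<otimes>\<^bsub>GA\<^esub> a \<otimes>\<^bsub>GA\<^esub> v \<in> V n"
    proof (rule GA.sandwich_generate)
      fix b assume "b \<in> (\<lambda>x. delta x \<ominus>\<^bsub>GA\<^esub> \<one>\<^bsub>GA\<^esub>) ` carrier Q"
      then obtain x where x: "x \<in> carrier Q" "b = delta x \<ominus>\<^bsub>GA\<^esub> \<one>\<^bsub>GA\<^esub>" by blast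
      have "\<one>\<^bsub>GA\<^esub> \<otimes>\<^bsub>GA\<^esub> b \<otimes>\<^bsub>GA\<^esub> v = delta x \<otimes>\<^bsub>GA\<^esub> v \<ominus>\<^bsub>GA\<^esub> v"
        using x vc by (simp add: GA.minus_eq GA.l_distr GA.l_minus)
      then show "\<one>\<^bsub>GA\<^esub> \<otimes>\<^bsub>GA\<^esub> b \<otimes>\<^bsub>GA\<^esub> v \<in> V n" using v x unfolding VS next_invariants_def by simp
    qed (use V vc in auto)
    then show ?thesis using a vc by (simp add: aug_def)
  qed
  have ann: "a \<otimes>\<^bsub>GA\<^esub> v = \<zero>\<^bsub>GA\<^esub>" if "a \<in> ideal_pow GA aug n" "v \<in> V n" for a v n
    using that
  proof (induction n arbitrary: a v)
    case 0
    then show ?case by (simp add: V0)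
  next
    case (Suc n)
    have vc: "v \<in> carrier GA" using Suc.prems Vc by blast
    have "a \<in> ideal_prod GA (ideal_pow GA aug n) aug" using Suc.prems by (simp add: GA.ideal_pow_Suc)
    then show ?case
    proof (induction rule: ideal_prod.induct)
      case (prod i j)
      have "i \<otimes>\<^bsub>GA\<^esub> j \<otimes>\<^bsub>GA\<^esub> v = i \<otimes>\<^bsub>GA\<^esub> (j \<otimes>\<^bsub>GA\<^esub> v)"
        using prod vc GA.ideal_pow_carrier[OF aug_ideal] by (intro GA.m_assoc) (auto simp: aug_def)
      then show ?case using Suc.IH[OF prod(1) step[OF prod(2) Suc.prems(2)]] by simp
    next
      case (sum s t)
      have "s \<in> carrier GA" "t \<in> carrier GA"
        using sum GA.ideal_prod_in_carrier[OF GA.ideal_pow_ideal[OF aug_ideal] aug_ideal] by auto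
      then show ?case using sum vc by (simp add: GA.l_distr)
    qed
  qed
  have "ideal_pow GA aug N \<subseteq> {\<zero>\<^bsub>GA\<^esub>}"
  proof
    fix a assume a: "a \<in> ideal_pow GA aug N"
    then have "a \<otimes>\<^bsub>GA\<^esub> \<one>\<^bsub>GA\<^esub> = \<zero>\<^bsub>GA\<^esub>" using ann N by simp
    then show "a \<in> {\<zero>\<^bsub>GA\<^esub>}" using GA.ideal_pow_carrier[OF aug_ideal a] by simp
  qed
  then show ?thesis
    using subgroup.one_closed[OF GA.ideal_pow_subgroup[OF aug_ideal, of N]] by (intro exI[of _ N]) auto
qed

end

section \<open>Functoriality and inverse limits\<close>

locale finite_group_algebra_hom = dom: finite_group_algebra Q p + cod: finite_group_algebra Q' p
  for Q (structure) and Q' and p + 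
  fixes h :: "'a \<Rightarrow> 'c"
  assumes h_hom: "h \<in> hom Q Q'"
begin

abbreviation push :: "('a \<Rightarrow> int) \<Rightarrow> 'c \<Rightarrow> int" where
  "push \<equiv> group_algebra_map (residue_ring (int p)) Q Q' h"

lemma h_closed: "x \<in> carrier Q \<Longrightarrow> h x \<in> carrier Q'"
  using h_hom by (rule hom_in_carrier)

lemma push_eq:
  assumes "f \<in> carrier dom.GA"
  shows "push f = (\<lambda>y\<in>carrier Q'. (\<Sum>x\<in>{x \<in> carrier Q. h x = y}. f x) mod int p)"
proof -
  have "finsum (residue_ring (int p)) f {x \<in> carrier Q. h x = y} = (\<Sum>x\<in>{x \<in> carrier Q. h x = y}. f x) mod int p" for y
    by (rule finsum_residue_ring[OF dom.p_gt_1]) (use dom.GA_range[OF assms] dom.finite_carrier in auto)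
  then show ?thesis unfolding group_algebra_map_def by simp
qed

lemma push_closed: "f \<in> carrier dom.GA \<Longrightarrow> push f \<in> carrier cod.GA"
  by (simp add: push_eq cod.restrict_mod_closed)

lemma pairing_push:
  assumes "f \<in> carrier dom.GA"
  shows "[cod.pairing (push f) F = dom.pairing f (\<lambda>x. F (h x))] (mod int p)"
proof -
  have "cod.pairing (\<lambda>y. \<Sum>x\<in>{x \<in> carrier Q. h x = y}. f x) F
      = (\<Sum>y\<in>carrier Q'. \<Sum>x\<in>{x \<in> carrier Q. h x = y}. f x * F (h x))"
    unfolding cod.pairing_def sum_distrib_right by (rule sum.cong[OF refl], rule sum.cong[OF refl]) simp
  also have "\<dots> = dom.pairing f (\<lambda>x. F (h x))"
    unfolding dom.pairing_def
    by (rule sum.group[OF dom.finite_carrier cod.finite_carrier]) (use h_closed in blast)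
  finally have eq: "cod.pairing (\<lambda>y. \<Sum>x\<in>{x \<in> carrier Q. h x = y}. f x) F = dom.pairing f (\<lambda>x. F (h x))" .
  show ?thesis unfolding push_eq[OF assms]
    by (rule cong_trans[OF cod.pairing_restrict_mod]) (simp only: eq cong_refl)
qed

lemma push_eqI:
  assumes "f \<in> carrier dom.GA" "g \<in> carrier cod.GA"
    and "\<And>F. [dom.pairing f (\<lambda>x. F (h x)) = cod.pairing g F] (mod int p)"
  shows "push f = g"
  by (rule cod.GA_eqI[OF push_closed[OF assms(1)] assms(2)])
    (rule cong_trans[OF pairing_push[OF assms(1)] assms(3)])

lemma push_delta: "x \<in> carrier Q \<Longrightarrow> push (dom.delta x) = cod.delta (h x)"
  by (rule push_eqI) (simp_all add: h_closed dom.pairing_delta cod.pairing_delta)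

lemma push_one: "push \<one>\<^bsub>dom.GA\<^esub> = \<one>\<^bsub>cod.GA\<^esub>"
  unfolding dom.one_GA cod.one_GA using push_delta[OF dom.one_closed] hom_one[OF h_hom] dom.is_group cod.is_group
  by simp

lemma push_zero: "push \<zero>\<^bsub>dom.GA\<^esub> = \<zero>\<^bsub>cod.GA\<^esub>"
  by (rule push_eqI) (simp_all add: dom.zero_closed cod.zero_closed dom.pairing_zero cod.pairing_zero)

lemma push_add:
  assumes "f \<in> carrier dom.GA" "g \<in> carrier dom.GA"
  shows "push (f \<oplus>\<^bsub>dom.GA\<^esub> g) = push f \<oplus>\<^bsub>cod.GA\<^esub> push g"
proof (rule push_eqI[OF dom.add_closed cod.add_closed])
  fix F
  have "[dom.pairing (f \<oplus>\<^bsub>dom.GA\<^esub> g) (\<lambda>x. F (h x)) = dom.pairing f (\<lambda>x. F (h x)) + dom.pairing g (\<lambda>x. F (h x))] (mod int p)"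
    by (rule dom.pairing_add)
  also have "[dom.pairing f (\<lambda>x. F (h x)) + dom.pairing g (\<lambda>x. F (h x)) = cod.pairing (push f) F + cod.pairing (push g) F] (mod int p)"
    by (intro cong_add cong_sym[OF pairing_push] assms)
  also have "[cod.pairing (push f) F + cod.pairing (push g) F = cod.pairing (push f \<oplus>\<^bsub>cod.GA\<^esub> push g) F] (mod int p)"
    by (rule cong_sym[OF cod.pairing_add])
  finally show "[dom.pairing (f \<oplus>\<^bsub>dom.GA\<^esub> g) (\<lambda>x. F (h x)) = cod.pairing (push f \<oplus>\<^bsub>cod.GA\<^esub> push g) F] (mod int p)" .
qed

lemma push_mult:
  assumes "f \<in> carrier dom.GA" "g \<in> carrier dom.GA"
  shows "push (f \<otimes>\<^bsub>dom.GA\<^esub> g) = push f \<otimes>\<^bsub>cod.GA\<^esub> push g"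
proof (rule push_eqI[OF dom.mult_closed[OF assms] cod.mult_closed[OF push_closed push_closed, OF assms]])
  fix F
  have "[dom.pairing (f \<otimes>\<^bsub>dom.GA\<^esub> g) (\<lambda>x. F (h x))
      = dom.pairing f (\<lambda>x. dom.pairing g (\<lambda>y. F (h (x \<otimes> y))))] (mod int p)"
    by (rule dom.pairing_mult[OF assms])
  also have "dom.pairing f (\<lambda>x. dom.pairing g (\<lambda>y. F (h (x \<otimes> y))))
      = dom.pairing f (\<lambda>x. dom.pairing g (\<lambda>y. F (h x \<otimes>\<^bsub>Q'\<^esub> h y)))"
    unfolding dom.pairing_def using hom_mult[OF h_hom] by (intro sum.cong refl arg_cong2[where f = "(*)"]) simp
  also have "[dom.pairing f (\<lambda>x. dom.pairing g (\<lambda>y. F (h x \<otimes>\<^bsub>Q'\<^esub> h y)))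
      = dom.pairing f (\<lambda>x. cod.pairing (push g) (\<lambda>y. F (h x \<otimes>\<^bsub>Q'\<^esub> y)))] (mod int p)"
    by (rule dom.pairing_cong) (rule cong_sym[OF pairing_push[OF assms(2)]])
  also have "[dom.pairing f (\<lambda>x. cod.pairing (push g) (\<lambda>y. F (h x \<otimes>\<^bsub>Q'\<^esub> y)))
      = cod.pairing (push f) (\<lambda>x. cod.pairing (push g) (\<lambda>y. F (x \<otimes>\<^bsub>Q'\<^esub> y)))] (mod int p)"
    by (rule cong_sym[OF pairing_push[OF assms(1)]])
  also have "[cod.pairing (push f) (\<lambda>x. cod.pairing (push g) (\<lambda>y. F (x \<otimes>\<^bsub>Q'\<^esub> y)))
      = cod.pairing (push f \<otimes>\<^bsub>cod.GA\<^esub> push g) F] (mod int p)"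
    by (rule cong_sym[OF cod.pairing_mult[OF push_closed push_closed, OF assms]])
  finally show "[dom.pairing (f \<otimes>\<^bsub>dom.GA\<^esub> g) (\<lambda>x. F (h x)) = cod.pairing (push f \<otimes>\<^bsub>cod.GA\<^esub> push g) F] (mod int p)" .
qed

lemma push_aug_iff:
  assumes "f \<in> carrier dom.GA"
  shows "push f \<in> cod.aug \<longleftrightarrow> f \<in> dom.aug"
proof -
  have *: "[cod.pairing (push f) (\<lambda>_. 1) = dom.pairing f (\<lambda>_. 1)] (mod int p)" by (rule pairing_push[OF assms])
  show ?thesis
    using push_closed[OF assms] assms cong_trans[OF *] cong_trans[OF cong_sym[OF *]]
    by (auto simp: cod.aug_iff dom.aug_iff)
qed

end

text \<open>Tychonoff: \<open>Z i\<close>, the set of families that are compatible along all maps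
  out of i, is closed in a compact product of finite discrete spaces, and directedness gives the
  finite intersection property. Here \<open>r i j\<close> means that there is a map from level i to
  level j.\<close>

lemma inverse_limit_nonempty:
  fixes S :: "'i \<Rightarrow> 's set" and f :: "'i \<Rightarrow> 'i \<Rightarrow> 's \<Rightarrow> 's"
  assumes fin: "\<And>i. i \<in> D \<Longrightarrow> finite (S i)" and ne: "\<And>i. i \<in> D \<Longrightarrow> S i \<noteq> {}"
    and map: "\<And>i j s. i \<in> D \<Longrightarrow> j \<in> D \<Longrightarrow> r i j \<Longrightarrow> s \<in> S i \<Longrightarrow> f i j s \<in> S j"
    and trans: "\<And>i j k. i \<in> D \<Longrightarrow> j \<in> D \<Longrightarrow> k \<in> D \<Longrightarrow> r i j \<Longrightarrow> r j k \<Longrightarrow> r i k"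
    and funct: "\<And>i j k s. i \<in> D \<Longrightarrow> j \<in> D \<Longrightarrow> k \<in> D \<Longrightarrow> r i j \<Longrightarrow> r j k \<Longrightarrow> s \<in> S i \<Longrightarrow> f j k (f i j s) = f i k s"
    and dir: "\<And>F. finite F \<Longrightarrow> F \<subseteq> D \<Longrightarrow> \<exists>k\<in>D. \<forall>i\<in>F. r k i"
  shows "\<exists>s\<in>Pi\<^sub>E D S. \<forall>i\<in>D. \<forall>j\<in>D. r i j \<longrightarrow> f i j (s i) = s j"
proof -
  let ?X = "product_topology (\<lambda>i. discrete_topology (S i)) D"
  have top: "topspace ?X = Pi\<^sub>E D S" by simp
  have comp: "compact_space ?X"
    unfolding compact_space_product_topology using fin by (auto simp: compact_space_discrete_topology)
  define Z where "Z i = {s \<in> Pi\<^sub>E D S. \<forall>j\<in>D. r i j \<longrightarrow> f i j (s i) = s j}" for i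
  have clo: "closedin ?X (Z i)" if i: "i \<in> D" for i
  proof -
    have one: "closedin ?X {s \<in> topspace ?X. f i j (s i) = s j}" if j: "j \<in> D" "r i j" for j
    proof -
      have pre: "closedin ?X {s \<in> topspace ?X. s k \<in> {a}}" if "k \<in> D" "a \<in> S k" for k a
        by (rule closedin_continuous_map_preimage[OF continuous_map_product_projection[OF that(1)]])
          (use that(2) in simp)
      \<comment> \<open>Split by the finitely many values a at the index i: each piece fixes two
        coordinates, and a finite union of closed sets is closed.\<close>
      have "closedin ?X (\<Union>a\<in>S i. {s \<in> topspace ?X. s i \<in> {a}} \<inter> {s \<in> topspace ?X. s j \<in> {f i j a}})"
      proof (rule closedin_Union)
        show "finite ((\<lambda>a. {s \<in> topspace ?X. s i \<in> {a}} \<inter> {s \<in> topspace ?X. s j \<in> {f i j a}}) ` S i)"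
          using fin[OF i] by simp
        fix C assume "C \<in> (\<lambda>a. {s \<in> topspace ?X. s i \<in> {a}} \<inter> {s \<in> topspace ?X. s j \<in> {f i j a}}) ` S i"
        then obtain a where a: "a \<in> S i"
          "C = {s \<in> topspace ?X. s i \<in> {a}} \<inter> {s \<in> topspace ?X. s j \<in> {f i j a}}" by blast
        show "closedin ?X C" unfolding a(2)
          by (intro closedin_Int pre i j(1) a(1) map[OF i j(1) j(2) a(1)])
      qed
      moreover have "{s \<in> topspace ?X. f i j (s i) = s j}
          = (\<Union>a\<in>S i. {s \<in> topspace ?X. s i \<in> {a}} \<inter> {s \<in> topspace ?X. s j \<in> {f i j a}})"
        unfolding top using i by (auto simp: PiE_mem)
      ultimately show ?thesis by simp
    qed
    show ?thesis
    proof (cases "{j \<in> D. r i j} = {}")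
      case True
      then have *: "Z i = topspace ?X" unfolding Z_def top by blast
      show ?thesis unfolding * by (rule closedin_topspace)
    next
      case False
      have "closedin ?X (\<Inter>((\<lambda>j. {s \<in> topspace ?X. f i j (s i) = s j}) ` {j \<in> D. r i j}))"
        by (rule closedin_Inter) (use False one in auto)
      moreover have "Z i = \<Inter>((\<lambda>j. {s \<in> topspace ?X. f i j (s i) = s j}) ` {j \<in> D. r i j})"
        unfolding Z_def top using False by auto
      ultimately show ?thesis by simp
    qed
  qed
  have fip: "\<Inter>(Z ` F) \<noteq> {}" if F: "finite F" "F \<subseteq> D" "F \<noteq> {}" for F
  proof -
    obtain k where k: "k \<in> D" "\<And>i. i \<in> F \<Longrightarrow> r k i" using dir[OF F(1,2)] by blast
    obtain s0 where s0: "s0 \<in> S k" using ne[OF k(1)] by blast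
    \<comment> \<open>Transport one element from a level k above all of F. Indices that k does not
      reach get an arbitrary value, as no condition in \<open>Z i\<close> with i in F involves
      them.\<close>
    define s where "s = (\<lambda>j\<in>D. if r k j then f k j s0 else (SOME a. a \<in> S j))"
    have sS: "s \<in> Pi\<^sub>E D S"
      unfolding s_def using map[OF k(1) _ _ s0] ne by (auto simp: some_in_eq)
    have "s \<in> Z i" if i: "i \<in> F" for i
    proof -
      have iD: "i \<in> D" using i F by auto
      have "f i j (s i) = s j" if j: "j \<in> D" "r i j" for j
      proof -
        have kj: "r k j" by (rule trans[OF k(1) iD j(1) k(2)[OF i] j(2)])
        show ?thesis unfolding s_def using iD j(1) k(2)[OF i] kj funct[OF k(1) iD j(1) k(2)[OF i] j(2) s0] by simp
      qed
      then show ?thesis unfolding Z_def using sS by blast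
    qed
    then show ?thesis by blast
  qed
  have "\<Inter>(Z ` D) \<noteq> {}"
  proof (cases "D = {}")
    case False
    show ?thesis
    proof (rule compact_space_fip[THEN iffD1, rule_format, OF comp])
      show "(\<forall>C\<in>Z ` D. closedin ?X C) \<and> (\<forall>\<F>. finite \<F> \<and> \<F> \<subseteq> Z ` D \<longrightarrow> \<Inter>\<F> \<noteq> {})"
      proof (intro conjI ballI allI impI)
        fix C assume "C \<in> Z ` D"
        then show "closedin ?X C" using clo by blast
      next
        fix \<F> assume a: "finite \<F> \<and> \<F> \<subseteq> Z ` D"
        then obtain F where F: "F \<subseteq> D" "finite F" "\<F> = Z ` F" by (meson finite_subset_image)
        show "\<Inter>\<F> \<noteq> {}" using fip[OF F(2,1)] F(3) by (cases "F = {}") auto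
      qed
    qed
  qed simp
  then obtain s where s: "s \<in> \<Inter>(Z ` D)" by blast
  show ?thesis
  proof (cases "D = {}")
    case False
    then obtain i where "i \<in> D" by blast
    then have "s \<in> Pi\<^sub>E D S" using s unfolding Z_def by blast
    moreover have "f i j (s i) = s j" if "i \<in> D" "j \<in> D" "r i j" for i j
      using s that unfolding Z_def by blast
    ultimately show ?thesis by blast
  qed simp
qed

section \<open>Detection of a subgroup at a single finite level\<close>

context group
begin

context
  fixes A B :: "'a set" and D :: "'i set" and P :: "'i \<Rightarrow> ('q, 'm) monoid_scheme" and \<pi> :: "'i \<Rightarrow> 'a \<Rightarrow> 'q" and C :: nat
  assumes A: "subgroup A G" and B: "subgroup B G" and BA: "B \<subseteq> A"
    and hom: "\<And>i. i \<in> D \<Longrightarrow> group_hom G (P i) (\<pi> i)"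
    and dir: "\<And>i j. i \<in> D \<Longrightarrow> j \<in> D \<Longrightarrow> \<exists>k\<in>D. \<forall>x\<in>A. \<pi> k x \<in> \<pi> k ` B \<longrightarrow> \<pi> i x \<in> \<pi> i ` B \<and> \<pi> j x \<in> \<pi> j ` B"
    and closed: "\<And>x. x \<in> A \<Longrightarrow> (\<And>i. i \<in> D \<Longrightarrow> \<pi> i x \<in> \<pi> i ` B) \<Longrightarrow> x \<in> B"
    and fin: "\<And>i. i \<in> D \<Longrightarrow> finite (\<pi> i ` A)"
    and bound: "\<And>i. i \<in> D \<Longrightarrow> card (\<pi> i ` A) \<le> C * card (\<pi> i ` B)"
    and D: "D \<noteq> {}"
begin

text \<open>The approximation to B seen at level i: the preimage in A of the image of B.\<close>

private definition E where "E i = {x \<in> A. \<pi> i x \<in> \<pi> i ` B}"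

private lemma image_subgroup: "i \<in> D \<Longrightarrow> subgroup (\<pi> i ` B) (P i)"
  by (rule group_hom.subgroup_img_is_subgroup[OF hom B])

private lemma E_subgroup:
  assumes i: "i \<in> D"
  shows "subgroup (E i) G"
proof -
  interpret h: group_hom G "P i" "\<pi> i" by (rule hom[OF i])
  note S = image_subgroup[OF i]
  show ?thesis
  proof (rule subgroupI)
    show "E i \<subseteq> carrier G" unfolding E_def using subgroup.subset[OF A] by blast
    show "E i \<noteq> {}" unfolding E_def using subgroup.one_closed[OF A] subgroup.one_closed[OF B] by blast
    show "inv a \<in> E i" if "a \<in> E i" for a
    proof -
      have a: "a \<in> A" "\<pi> i a \<in> \<pi> i ` B" using that by (auto simp: E_def)
      show ?thesis unfolding E_def
        using subgroup.m_inv_closed[OF A a(1)] subgroup.m_inv_closed[OF S a(2)] subgroup.mem_carrier[OF A a(1)] by simp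
    qed
    show "a \<otimes> b \<in> E i" if "a \<in> E i" "b \<in> E i" for a b
    proof -
      have a: "a \<in> A" "\<pi> i a \<in> \<pi> i ` B" and b: "b \<in> A" "\<pi> i b \<in> \<pi> i ` B" using that by (auto simp: E_def)
      show ?thesis unfolding E_def
        using subgroup.m_closed[OF A a(1) b(1)] subgroup.m_closed[OF S a(2) b(2)]
          subgroup.mem_carrier[OF A a(1)] subgroup.mem_carrier[OF A b(1)] by simp
    qed
  qed
qed

text \<open>X meets each right coset of \<open>E i\<close> at most once; its size bounds the index
  of \<open>E i\<close> in A from below.\<close>

private definition separated :: "'i \<Rightarrow> 'a set \<Rightarrow> bool" where
  "separated i X \<longleftrightarrow> finite X \<and> X \<subseteq> A \<and> (\<forall>x\<in>X. \<forall>y\<in>X. x \<noteq> y \<longrightarrow> x \<otimes> inv y \<notin> E i)"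

private lemma separated_card_le:
  assumes i: "i \<in> D" and X: "separated i X"
  shows "card X \<le> C"
proof -
  interpret h: group_hom G "P i" "\<pi> i" by (rule hom[OF i])
  note S = image_subgroup[OF i]
  have finB: "finite (\<pi> i ` B)" using fin[OF i] BA by (meson finite_subset image_mono)
  have inj: "inj_on (\<lambda>(b, x). b \<otimes>\<^bsub>P i\<^esub> \<pi> i x) (\<pi> i ` B \<times> X)"
  proof (rule inj_onI, clarify)
    fix b x c y assume b: "b \<in> B" and c: "c \<in> B" and x: "x \<in> X" and y: "y \<in> X"
      and eq: "\<pi> i b \<otimes>\<^bsub>P i\<^esub> \<pi> i x = \<pi> i c \<otimes>\<^bsub>P i\<^esub> \<pi> i y"
    have car: "b \<in> carrier G" "c \<in> carrier G" "x \<in> carrier G" "y \<in> carrier G"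
      using b c x y X subgroup.mem_carrier[OF A] subgroup.mem_carrier[OF B] unfolding separated_def by blast+
    have "\<pi> i (x \<otimes> inv y) = \<pi> i (inv b \<otimes> c)"
    proof -
      have "\<pi> i (b \<otimes> x) = \<pi> i (c \<otimes> y)" using eq car by simp
      then have "\<pi> i (inv b \<otimes> (b \<otimes> x) \<otimes> inv y) = \<pi> i (inv b \<otimes> (c \<otimes> y) \<otimes> inv y)"
        using car by simp
      moreover have "inv b \<otimes> (b \<otimes> x) \<otimes> inv y = x \<otimes> inv y" "inv b \<otimes> (c \<otimes> y) \<otimes> inv y = inv b \<otimes> c"
        using car by (simp_all add: m_assoc[symmetric]) (simp add: m_assoc)
      ultimately show ?thesis by simp
    qed
    moreover have "inv b \<otimes> c \<in> B" using b c subgroup.m_closed[OF B] subgroup.m_inv_closed[OF B] by blast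
    moreover have "x \<otimes> inv y \<in> A"
      using x y X subgroup.m_closed[OF A] subgroup.m_inv_closed[OF A] unfolding separated_def by blast
    ultimately have "x \<otimes> inv y \<in> E i" unfolding E_def by blast
    then have "x = y" using X x y unfolding separated_def by blast
    then show "\<pi> i b = \<pi> i c \<and> x = y" using eq car by simp
  qed
  have "(\<lambda>(b, x). b \<otimes>\<^bsub>P i\<^esub> \<pi> i x) ` (\<pi> i ` B \<times> X) \<subseteq> \<pi> i ` A"
  proof clarify
    fix b x assume b: "b \<in> B" and x: "x \<in> X"
    then have bx: "b \<in> A" "x \<in> A" using BA X unfolding separated_def by blast+
    then have "\<pi> i b \<otimes>\<^bsub>P i\<^esub> \<pi> i x = \<pi> i (b \<otimes> x)" using subgroup.mem_carrier[OF A] by simp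
    then show "\<pi> i b \<otimes>\<^bsub>P i\<^esub> \<pi> i x \<in> \<pi> i ` A" using subgroup.m_closed[OF A bx] by simp
  qed
  then have "card (\<pi> i ` B \<times> X) \<le> card (\<pi> i ` A)"
    using card_inj_on_le[OF inj] fin[OF i] by blast
  then have "card (\<pi> i ` B) * card X \<le> card (\<pi> i ` A)" by (simp only: card_cartesian_product)
  from le_trans[OF this bound[OF i]] have "card (\<pi> i ` B) * card X \<le> card (\<pi> i ` B) * C"
    by (simp only: mult.commute[of C])
  moreover have "card (\<pi> i ` B) > 0" using finB subgroup.one_closed[OF B] by (auto simp: card_gt_0_iff)
  ultimately show ?thesis using nat_mult_le_cancel1 by blast
qed

text \<open>Take a separated set X of largest size over all levels, at level i. If some e in
  \<open>E i\<close> were not in B, then some level k finer than i would have e outside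
  \<open>E k\<close>; X would remain separated there, and e x0 could be added to it, against
  maximality.\<close>

lemma exists_level_detecting_subgroup: "\<exists>i\<in>D. \<forall>x\<in>A. \<pi> i x \<in> \<pi> i ` B \<longrightarrow> x \<in> B"
proof -
  let ?S = "{n. \<exists>i\<in>D. \<exists>X. separated i X \<and> card X = n}"
  obtain i0 where i0: "i0 \<in> D" using D by blast
  \<comment> \<open>A singleton is always separated, so a largest set is non-empty and contains an
    element \<open>x0\<close> to be translated by e.\<close>
  have "separated i0 {\<one>}" unfolding separated_def using subgroup.one_closed[OF A] by simp
  then have ne: "1 \<in> ?S" using i0 by force
  have le: "n \<le> C" if "n \<in> ?S" for n using that separated_card_le by blast
  have finS: "finite ?S" by (rule finite_subset[of _ "{..C}"]) (use le in blast, simp)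
  define m where "m = Max ?S"
  have "m \<in> ?S" unfolding m_def by (rule Max_in[OF finS]) (use ne in blast)
  then obtain i X where iX: "i \<in> D" "separated i X" "card X = m" by blast
  have max: "n \<le> m" if "n \<in> ?S" for n unfolding m_def by (rule Max_ge[OF finS that])
  have "card X \<ge> 1" using max[OF ne] iX by simp
  then obtain x0 where x0: "x0 \<in> X" by (metis card.empty equals0I not_one_le_zero)
  have X: "finite X" "X \<subseteq> A" "\<And>x y. x \<in> X \<Longrightarrow> y \<in> X \<Longrightarrow> x \<noteq> y \<Longrightarrow> x \<otimes> inv y \<notin> E i"
    using iX(2) unfolding separated_def by blast+
  have Xc: "x \<in> carrier G" if "x \<in> X" for x using X(2) that subgroup.mem_carrier[OF A] by blast
  have "e \<in> B" if e: "e \<in> A" "\<pi> i e \<in> \<pi> i ` B" for e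
  proof (rule ccontr)
    assume "e \<notin> B"
    then obtain j where j: "j \<in> D" "\<pi> j e \<notin> \<pi> j ` B" using closed[OF e(1)] by blast
    obtain k where k: "k \<in> D" and kE: "\<And>x. x \<in> A \<Longrightarrow> \<pi> k x \<in> \<pi> k ` B \<Longrightarrow> \<pi> i x \<in> \<pi> i ` B \<and> \<pi> j x \<in> \<pi> j ` B"
      using dir[OF iX(1) j(1)] by blast
    have Eki: "E k \<subseteq> E i" unfolding E_def using kE by blast
    have ek: "e \<notin> E k" unfolding E_def using kE[OF e(1)] j(2) by blast
    have ei: "e \<in> E i" unfolding E_def using e by blast
    have ec: "e \<in> carrier G" using e subgroup.mem_carrier[OF A] by blast
    note Ek = E_subgroup[OF k] and Ei = E_subgroup[OF iX(1)]
    \<comment> \<open>For x = x0 the element is e itself. Otherwise, since e lies in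
      \<open>E i\<close> and \<open>E k\<close> is smaller, membership would put x0 inv x into
      \<open>E i\<close>.\<close>
    have far: "e \<otimes> x0 \<otimes> inv x \<notin> E k" if x: "x \<in> X" for x
    proof
      assume a: "e \<otimes> x0 \<otimes> inv x \<in> E k"
      show False
      proof (cases "x = x0")
        case True
        then have "e \<otimes> x0 \<otimes> inv x = e" using ec Xc[OF x0] by (simp add: m_assoc)
        then show False using a ek by simp
      next
        case False
        have "inv e \<otimes> (e \<otimes> x0 \<otimes> inv x) \<in> E i"
          using subgroup.m_closed[OF Ei subgroup.m_inv_closed[OF Ei ei]] a Eki by blast
        moreover have "inv e \<otimes> (e \<otimes> x0 \<otimes> inv x) = x0 \<otimes> inv x"
          using ec Xc[OF x0] Xc[OF x] by (simp add: m_assoc[symmetric])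
        ultimately show False using X(3)[OF x0 x] False by simp
      qed
    qed
    have new: "e \<otimes> x0 \<notin> X"
    proof
      assume "e \<otimes> x0 \<in> X"
      then have "e \<otimes> x0 \<otimes> inv (e \<otimes> x0) \<notin> E k" by (rule far)
      then show False using ec Xc[OF x0] subgroup.one_closed[OF Ek] by simp
    qed
    have "separated k (insert (e \<otimes> x0) X)"
    proof -
      have far': "x \<otimes> inv (e \<otimes> x0) \<notin> E k" if x: "x \<in> X" for x
      proof
        assume "x \<otimes> inv (e \<otimes> x0) \<in> E k"
        then have "inv (x \<otimes> inv (e \<otimes> x0)) \<in> E k" by (rule subgroup.m_inv_closed[OF Ek])
        then show False using far[OF x] ec Xc[OF x0] Xc[OF x] by (simp add: inv_mult_group m_assoc)
      qed
      have "e \<otimes> x0 \<in> A" using subgroup.m_closed[OF A e(1)] x0 X(2) by blast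
      then show ?thesis unfolding separated_def using X far far' Eki by blast
    qed
    then have "card (insert (e \<otimes> x0) X) \<in> ?S" using k by blast
    then show False using max X(1) new iX(3) by fastforce
  qed
  then show ?thesis using iX(1) by blast
qed

end

text \<open>Detection makes the map from cosets of B to cosets of its image injective. Lagrange's
  theorem is applied in the finite image only, as A and B are infinite in general.\<close>

lemma card_rcosets_image:
  assumes A: "subgroup A G" and B: "subgroup B G" and BA: "B \<subseteq> A"
    and hom: "group_hom G P \<pi>" and fin: "finite (\<pi> ` A)"
    and detect: "\<And>x. x \<in> A \<Longrightarrow> \<pi> x \<in> \<pi> ` B \<Longrightarrow> x \<in> B"
  shows "finite (rcosets\<^bsub>G\<lparr>carrier := A\<rparr>\<^esub> B) \<and> card (rcosets\<^bsub>G\<lparr>carrier := A\<rparr>\<^esub> B) * card (\<pi> ` B) = card (\<pi> ` A)"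
proof -
  interpret h: group_hom G P \<pi> by (rule hom)
  let ?GA = "G\<lparr>carrier := A\<rparr>" and ?PA = "P\<lparr>carrier := \<pi> ` A\<rparr>"
  have Ac: "x \<in> carrier G" if "x \<in> A" for x using subgroup.mem_carrier[OF A that] .
  have gPA: "group ?PA" by (rule h.H.subgroup_imp_group[OF h.subgroup_img_is_subgroup[OF A]])
  have sB: "subgroup (\<pi> ` B) ?PA"
    by (rule h.H.subgroup_incl[OF h.subgroup_img_is_subgroup[OF B] h.subgroup_img_is_subgroup[OF A] image_mono[OF BA]])
  have img: "\<pi> ` (B #>\<^bsub>?GA\<^esub> a) = \<pi> ` B #>\<^bsub>?PA\<^esub> \<pi> a" if "a \<in> A" for a
  proof -
    have "\<pi> (b \<otimes> a) = \<pi> b \<otimes>\<^bsub>P\<^esub> \<pi> a" if "b \<in> B" for b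
      by (rule h.hom_mult[OF Ac[OF subsetD[OF BA that]] Ac[OF \<open>a \<in> A\<close>]])
    then show ?thesis unfolding r_coset_def by (simp add: image_UN)
  qed
  have "bij_betw (\<lambda>X. \<pi> ` X) (rcosets\<^bsub>?GA\<^esub> B) (rcosets\<^bsub>?PA\<^esub> (\<pi> ` B))"
  proof (rule bij_betwI')
    fix X Y assume "X \<in> rcosets\<^bsub>?GA\<^esub> B" "Y \<in> rcosets\<^bsub>?GA\<^esub> B"
    then obtain a b where ab: "a \<in> A" "b \<in> A" "X = B #>\<^bsub>?GA\<^esub> a" "Y = B #>\<^bsub>?GA\<^esub> b" by (auto simp: RCOSETS_def)
    have sub: "B #>\<^bsub>?GA\<^esub> a \<subseteq> B #>\<^bsub>?GA\<^esub> b" if ab: "a \<in> A" "b \<in> A" and eq: "\<pi> ` (B #>\<^bsub>?GA\<^esub> a) = \<pi> ` (B #>\<^bsub>?GA\<^esub> b)" for a b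
    proof
      fix x assume "x \<in> B #>\<^bsub>?GA\<^esub> a"
      then obtain c where c: "c \<in> B" "x = c \<otimes> a" by (auto simp: r_coset_def)
      have "\<pi> x \<in> \<pi> ` (B #>\<^bsub>?GA\<^esub> b)" using eq c by (auto simp: r_coset_def)
      then obtain d where d: "d \<in> B" "\<pi> x = \<pi> (d \<otimes> b)" by (auto simp: r_coset_def)
      have xA: "x \<in> A" using c ab BA subgroup.m_closed[OF A] by blast
      have car: "x \<in> carrier G" "b \<in> carrier G" "d \<in> carrier G" using xA ab d BA Ac by blast+
      have "\<pi> (x \<otimes> inv b) = \<pi> d" using d car by (simp add: h.H.m_assoc)
      then have "\<pi> (x \<otimes> inv b) \<in> \<pi> ` B" using d by blast
      then have "x \<otimes> inv b \<in> B"
        using detect subgroup.m_closed[OF A xA subgroup.m_inv_closed[OF A ab(2)]] by blast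
      moreover have "x = (x \<otimes> inv b) \<otimes> b" using car by (simp add: m_assoc)
      ultimately show "x \<in> B #>\<^bsub>?GA\<^esub> b" unfolding r_coset_def by (simp, blast)
    qed
    show "(\<pi> ` X = \<pi> ` Y) = (X = Y)"
      using sub[OF ab(1,2)] sub[OF ab(2,1)] unfolding ab(3,4) by blast
  next
    fix X assume "X \<in> rcosets\<^bsub>?GA\<^esub> B"
    then obtain a where "a \<in> A" "X = B #>\<^bsub>?GA\<^esub> a" by (auto simp: RCOSETS_def)
    then show "\<pi> ` X \<in> rcosets\<^bsub>?PA\<^esub> (\<pi> ` B)" using img by (auto simp: RCOSETS_def)
  next
    fix Y assume "Y \<in> rcosets\<^bsub>?PA\<^esub> (\<pi> ` B)"
    then obtain a where a: "a \<in> A" "Y = \<pi> ` B #>\<^bsub>?PA\<^esub> \<pi> a" by (auto simp: RCOSETS_def)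
    then have "Y = \<pi> ` (B #>\<^bsub>?GA\<^esub> a)" using img by simp
    moreover have "B #>\<^bsub>?GA\<^esub> a \<in> rcosets\<^bsub>?GA\<^esub> B" using a by (auto simp: RCOSETS_def)
    ultimately show "\<exists>X\<in>rcosets\<^bsub>?GA\<^esub> B. Y = \<pi> ` X" by blast
  qed
  note bij = this
  have lag: "card (rcosets\<^bsub>?PA\<^esub> (\<pi> ` B)) * card (\<pi> ` B) = card (\<pi> ` A)"
    using group.lagrange[OF gPA sB] by (simp add: order_def)
  have "rcosets\<^bsub>?PA\<^esub> (\<pi> ` B) \<subseteq> Pow (\<pi> ` A)"
    using group.rcosets_subset_PowG[OF gPA sB] by simp
  then have "finite (rcosets\<^bsub>?PA\<^esub> (\<pi> ` B))" using fin by (meson finite_Pow_iff finite_subset)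
  then have "finite (rcosets\<^bsub>?GA\<^esub> B)" using bij_betw_finite[OF bij] by simp
  then show ?thesis using lag bij_betw_same_card[OF bij] by simp
qed

end

section \<open>Uniform index bounds for powers of the augmentation ideal\<close>

lemma ring_hom_minus:
  assumes "ring R" "ring S" "h \<in> ring_hom R S" "x \<in> carrier R" "y \<in> carrier R"
  shows "h (x \<ominus>\<^bsub>R\<^esub> y) = h x \<ominus>\<^bsub>S\<^esub> h y"
proof -
  interpret ring_hom_ring R S h by (rule ring_hom_ringI2[OF assms(1-3)])
  show ?thesis using assms(4,5) by (simp add: R.minus_eq S.minus_eq)
qed

lemma ring_hom_finsum:
  assumes "ring R" "ring S" "h \<in> ring_hom R S" "finite A" "f \<in> A \<rightarrow> carrier R"
  shows "h (finsum R f A) = finsum S (\<lambda>a. h (f a)) A"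
proof -
  interpret ring_hom_ring R S h by (rule ring_hom_ringI2[OF assms(1-3)])
  show ?thesis using assms(4,5)
  proof (induction A rule: finite_induct)
    case (insert a A)
    then have c: "f a \<in> carrier R" "f \<in> A \<rightarrow> carrier R" by auto
    then have "(\<lambda>a. h (f a)) \<in> A \<rightarrow> carrier S" by (auto simp: Pi_def)
    then have "finsum S (\<lambda>a. h (f a)) (insert a A) = h (f a) \<oplus>\<^bsub>S\<^esub> finsum S (\<lambda>a. h (f a)) A"
      using insert.hyps c by (intro S.finsum_insert) auto
    moreover have "h (finsum R f (insert a A)) = h (f a) \<oplus>\<^bsub>S\<^esub> h (finsum R f A)"
      using insert.hyps c by (simp add: R.finsum_closed)
    ultimately show ?case using insert.IH[OF c(2)] by simp
  qed simp
qed

lemma ring_hom_ideal_pow: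
  assumes "ring R" "ring S" "h \<in> ring_hom R S" "ideal I R" "ideal J S" "h ` I \<subseteq> J"
    and "x \<in> ideal_pow R I n"
  shows "h x \<in> ideal_pow S J n"
proof -
  interpret ring_hom_ring R S h by (rule ring_hom_ringI2[OF assms(1-3)])
  show ?thesis using assms(7)
  proof (induction n arbitrary: x)
    case (Suc n)
    have "x \<in> ideal_prod R (ideal_pow R I n) I" using Suc.prems by (simp add: R.ideal_pow_Suc)
    then have "h x \<in> ideal_prod S (ideal_pow S J n) J \<and> x \<in> carrier R"
    proof (induction rule: ideal_prod.induct)
      case (prod i j)
      have "i \<in> carrier R" "j \<in> carrier R"
        using R.ideal_pow_carrier[OF assms(4) prod(1)] ideal.Icarr[OF assms(4) prod(2)] by auto
      moreover have "h i \<in> ideal_pow S J n" "h j \<in> J" using Suc.IH[OF prod(1)] prod(2) assms(6) by auto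
      ultimately show ?case by (simp add: ideal_prod.prod)
    next
      case (sum s t)
      then show ?case by (simp add: ideal_prod.sum)
    qed
    then show ?case by (simp add: S.ideal_pow_Suc)
  qed simp
qed

section \<open>Ideals with finitely many left generators\<close>

context ring
begin

text \<open>The left ideal generated by the family \<open>b\<close>, when J is finite.\<close>

definition left_combinations :: "('i \<Rightarrow> 'a) \<Rightarrow> 'i set \<Rightarrow> 'a set" where
  "left_combinations b J = (\<lambda>c. \<Oplus>s\<in>J. c s \<otimes> b s) ` (J \<rightarrow> carrier R)"

context
  fixes b :: "'i \<Rightarrow> 'a" and J :: "'i set"
  assumes J: "finite J" and b: "\<And>s. s \<in> J \<Longrightarrow> b s \<in> carrier R"
begin

lemma left_combinations_closed:
  assumes "x \<in> left_combinations b J"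
  shows "x \<in> carrier R"
proof -
  obtain c where c: "x = (\<Oplus>s\<in>J. c s \<otimes> b s)" "c \<in> J \<rightarrow> carrier R"
    using assms unfolding left_combinations_def by (rule imageE)
  have "(\<lambda>s. c s \<otimes> b s) \<in> J \<rightarrow> carrier R" using c(2) b by auto
  then show ?thesis unfolding c(1) by (rule finsum_closed)
qed

lemma left_combinations_mult:
  assumes r: "r \<in> carrier R" and x: "x \<in> left_combinations b J"
  shows "r \<otimes> x \<in> left_combinations b J"
proof -
  obtain c where c: "x = (\<Oplus>s\<in>J. c s \<otimes> b s)" "c \<in> J \<rightarrow> carrier R"
    using x unfolding left_combinations_def by (rule imageE)
  have "r \<otimes> x = (\<Oplus>s\<in>J. r \<otimes> (c s \<otimes> b s))"
    unfolding c(1) by (rule finsum_rdistr[OF J r]) (use c(2) b in auto)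
  also have "\<dots> = (\<Oplus>s\<in>J. (r \<otimes> c s) \<otimes> b s)"
    by (rule finsum_cong') (use r c(2) b in \<open>auto simp: m_assoc Pi_def\<close>)
  finally show ?thesis unfolding left_combinations_def
    by (rule image_eqI[of _ _ "\<lambda>s. r \<otimes> c s"]) (use c(2) r in auto)
qed

lemma left_combinations_add:
  assumes x: "x \<in> left_combinations b J" and y: "y \<in> left_combinations b J"
  shows "x \<oplus> y \<in> left_combinations b J"
proof -
  obtain c where c: "x = (\<Oplus>s\<in>J. c s \<otimes> b s)" "c \<in> J \<rightarrow> carrier R"
    using x unfolding left_combinations_def by (rule imageE)
  obtain d where d: "y = (\<Oplus>s\<in>J. d s \<otimes> b s)" "d \<in> J \<rightarrow> carrier R"
    using y unfolding left_combinations_def by (rule imageE)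
  have "x \<oplus> y = (\<Oplus>s\<in>J. c s \<otimes> b s \<oplus> d s \<otimes> b s)"
    unfolding c(1) d(1) by (rule finsum_addf[symmetric]) (use c(2) d(2) b in auto)
  also have "\<dots> = (\<Oplus>s\<in>J. (c s \<oplus> d s) \<otimes> b s)"
    by (rule finsum_cong') (use c(2) d(2) b in \<open>auto simp: l_distr Pi_def\<close>)
  finally show ?thesis unfolding left_combinations_def
    by (rule image_eqI[of _ _ "\<lambda>s. c s \<oplus> d s"]) (use c(2) d(2) in auto)
qed

lemma left_combinations_generator:
  assumes s: "s \<in> J"
  shows "b s \<in> left_combinations b J"
proof -
  have "(\<Oplus>t\<in>J. (if t = s then \<one> else \<zero>) \<otimes> b t) = (\<Oplus>t\<in>J. if s = t then b t else \<zero>)"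
    by (rule finsum_cong') (use b in auto)
  also have "\<dots> = b s" using add.finprod_singleton[OF s J, of b] b by auto
  finally show ?thesis unfolding left_combinations_def
    by (intro image_eqI[of _ _ "\<lambda>t. if t = s then \<one> else \<zero>"]) auto
qed

lemma left_combinations_subgroup: "subgroup (left_combinations b J) (add_monoid R)"
proof (rule add.subgroupI)
  have "(\<lambda>_. \<zero>) \<in> J \<rightarrow> carrier R" by simp
  then show "left_combinations b J \<noteq> {}" unfolding left_combinations_def by blast
  show "\<ominus> x \<in> left_combinations b J" if "x \<in> left_combinations b J" for x
    using left_combinations_mult[of "\<ominus> \<one>" x] that left_combinations_closed[OF that] by (simp add: l_minus)
qed (use left_combinations_closed left_combinations_add in auto)

end

text \<open>In a product i j with i in I^n, expand j over the generators; the new coefficients i c_s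
  stay in I^n because I^n is also a right ideal.\<close>

lemma ideal_pow_Suc_generators:
  assumes I: "ideal I R" and J: "finite J" and b: "b \<in> J \<rightarrow> I"
    and gen: "\<And>a. a \<in> I \<Longrightarrow> \<exists>c\<in>J \<rightarrow> carrier R. a = (\<Oplus>s\<in>J. c s \<otimes> b s)"
    and x: "x \<in> ideal_pow R I (Suc n)"
  shows "\<exists>c\<in>J \<rightarrow> ideal_pow R I n. x = (\<Oplus>s\<in>J. c s \<otimes> b s)"
proof -
  have bc: "b s \<in> carrier R" if "s \<in> J" for s
    by (rule ideal.Icarr[OF I]) (use b that in auto)
  have "x \<in> ideal_prod R (ideal_pow R I n) I" using x by (simp add: ideal_pow_Suc)
  then show ?thesis
  proof (induction rule: ideal_prod.induct)
    case (prod i j)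
    obtain c where c: "c \<in> J \<rightarrow> carrier R" "j = (\<Oplus>s\<in>J. c s \<otimes> b s)" using gen[OF prod(2)] by blast
    have ic: "i \<in> carrier R" by (rule ideal_pow_carrier[OF I prod(1)])
    have "i \<otimes> j = (\<Oplus>s\<in>J. i \<otimes> (c s \<otimes> b s))"
      unfolding c(2) by (rule finsum_rdistr[OF J ic]) (use c(1) bc in auto)
    also have "\<dots> = (\<Oplus>s\<in>J. (i \<otimes> c s) \<otimes> b s)"
      by (rule finsum_cong') (use ic c(1) bc in \<open>auto simp: m_assoc Pi_def\<close>)
    finally have "i \<otimes> j = (\<Oplus>s\<in>J. (i \<otimes> c s) \<otimes> b s)" .
    moreover have "(\<lambda>s. i \<otimes> c s) \<in> J \<rightarrow> ideal_pow R I n"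
      using ideal.I_r_closed[OF ideal_pow_ideal[OF I] prod(1)] c(1) by auto
    ultimately show ?case by (rule bexI[of _ "\<lambda>s. i \<otimes> c s"])
  next
    case (sum s t)
    then obtain c d where c: "c \<in> J \<rightarrow> ideal_pow R I n" "s = (\<Oplus>s\<in>J. c s \<otimes> b s)"
      and d: "d \<in> J \<rightarrow> ideal_pow R I n" "t = (\<Oplus>s\<in>J. d s \<otimes> b s)" by blast
    have cc: "c \<in> J \<rightarrow> carrier R" "d \<in> J \<rightarrow> carrier R" using c(1) d(1) ideal_pow_subset[OF I] by blast+
    have "(\<Oplus>s\<in>J. (c s \<oplus> d s) \<otimes> b s) = (\<Oplus>s\<in>J. c s \<otimes> b s \<oplus> d s \<otimes> b s)"
      by (rule finsum_cong') (use cc bc in \<open>auto simp: l_distr Pi_def\<close>)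
    also have "\<dots> = s \<oplus> t"
      unfolding c(2) d(2) by (rule finsum_addf) (use cc bc in auto)
    finally have "s \<oplus> t = (\<Oplus>s\<in>J. (c s \<oplus> d s) \<otimes> b s)" by simp
    moreover have "(\<lambda>s. c s \<oplus> d s) \<in> J \<rightarrow> ideal_pow R I n"
      using subgroup.m_closed[OF ideal_pow_subgroup[OF I]] c(1) d(1) by (auto simp: Pi_def)
    ultimately show ?case by (rule bexI[of _ "\<lambda>s. c s \<oplus> d s"])
  qed
qed

lemma finsum_ideal_pow:
  assumes I: "ideal I R" and J: "finite J" and "c \<in> J \<rightarrow> ideal_pow R I n"
  shows "finsum R c J \<in> ideal_pow R I n"
  using J assms(3)
proof (induction J rule: finite_induct)
  case empty
  then show ?case using subgroup.one_closed[OF ideal_pow_subgroup[OF I]] by simp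
next
  case (insert s J)
  have c: "c s \<in> ideal_pow R I n" "c \<in> J \<rightarrow> ideal_pow R I n" using insert.prems by auto
  then have "c s \<in> carrier R" "c \<in> J \<rightarrow> carrier R" using ideal_pow_subset[OF I] by blast+
  with insert c show ?case using subgroup.m_closed[OF ideal_pow_subgroup[OF I] c(1)] by simp
qed

lemma ideal_pow_Suc_combination:
  assumes I: "ideal I R" and J: "finite J" and b: "b \<in> J \<rightarrow> I" and c: "c \<in> J \<rightarrow> ideal_pow R I n"
  shows "(\<Oplus>s\<in>J. c s \<otimes> b s) \<in> ideal_pow R I (Suc n)"
  by (rule finsum_ideal_pow[OF I J])
    (use b c in \<open>auto simp: ideal_pow_Suc Pi_def intro!: ideal_prod.prod\<close>)

text \<open>The bound on the index depends only on the number of generators of the ideal.\<close>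

lemma card_ideal_pow_le:
  assumes I: "ideal I R" and J: "finite J" and b: "b \<in> J \<rightarrow> I"
    and gen: "\<And>a. a \<in> I \<Longrightarrow> \<exists>c\<in>J \<rightarrow> carrier R. a = (\<Oplus>s\<in>J. c s \<otimes> b s)"
    and fin: "finite (carrier R)"
    and F0: "finite F\<^sub>0" "F\<^sub>0 \<subseteq> carrier R" "card F\<^sub>0 \<le> m" "\<And>a. a \<in> carrier R \<Longrightarrow> \<exists>f\<in>F\<^sub>0. a \<ominus> f \<in> I"
  shows "card (ideal_pow R I n) \<le> ((\<lambda>c. c ^ card J) ^^ n) m * card (ideal_pow R I (Suc n))"
proof -
  have bc: "b s \<in> carrier R" if "s \<in> J" for s
    by (rule ideal.Icarr[OF I]) (use b that in auto)
  have "\<exists>F\<subseteq>ideal_pow R I n. finite F \<and> card F \<le> ((\<lambda>c. c ^ card J) ^^ n) m \<and>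
      (\<forall>a\<in>ideal_pow R I n. \<exists>f\<in>F. a \<ominus> f \<in> ideal_pow R I (Suc n))"
  proof (induction n)
    case 0
    show ?case using F0 by (intro exI[of _ "F\<^sub>0"]) (simp add: ideal_pow_1[OF I])
  next
    case (Suc n)
    then obtain F where F: "F \<subseteq> ideal_pow R I n" "finite F" "card F \<le> ((\<lambda>c. c ^ card J) ^^ n) m"
      "\<And>a. a \<in> ideal_pow R I n \<Longrightarrow> \<exists>f\<in>F. a \<ominus> f \<in> ideal_pow R I (Suc n)" by blast
    \<comment> \<open>Representatives for I^(n+1) modulo I^(n+2) are the combinations with
      coefficients taken from representatives for I^n modulo I^(n+1). This is the origin of the
      iterated map c \<mapsto> c^|J|, started at the index bound m of I itself.\<close>
    let ?F = "(\<lambda>c. \<Oplus>s\<in>J. c s \<otimes> b s) ` (J \<rightarrow>\<^sub>E F)"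
    have fP: "finite (J \<rightarrow>\<^sub>E F)" by (rule finite_PiE[OF J]) (rule F(2))
    have sub: "?F \<subseteq> ideal_pow R I (Suc n)"
    proof clarify
      fix c assume "c \<in> J \<rightarrow>\<^sub>E F"
      then have "c \<in> J \<rightarrow> ideal_pow R I n" using F(1) by blast
      then show "(\<Oplus>s\<in>J. c s \<otimes> b s) \<in> ideal_pow R I (Suc n)" by (rule ideal_pow_Suc_combination[OF I J b])
    qed
    have "card ?F \<le> card (J \<rightarrow>\<^sub>E F)" by (rule card_image_le[OF fP])
    also have "\<dots> = card F ^ card J" using J by (simp add: card_PiE)
    also have "\<dots> \<le> ((\<lambda>c. c ^ card J) ^^ n) m ^ card J" by (rule power_mono[OF F(3)]) simp
    finally have card: "card ?F \<le> ((\<lambda>c. c ^ card J) ^^ Suc n) m" by simp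
    have "\<exists>f\<in>?F. a \<ominus> f \<in> ideal_pow R I (Suc (Suc n))" if a: "a \<in> ideal_pow R I (Suc n)" for a
    proof -
      obtain c where c: "c \<in> J \<rightarrow> ideal_pow R I n" "a = (\<Oplus>s\<in>J. c s \<otimes> b s)"
        using ideal_pow_Suc_generators[OF I J b gen a] by blast
      have "\<forall>s\<in>J. \<exists>f\<in>F. c s \<ominus> f \<in> ideal_pow R I (Suc n)" using F(4) c(1) by blast
      then obtain d where d: "\<And>s. s \<in> J \<Longrightarrow> d s \<in> F" "\<And>s. s \<in> J \<Longrightarrow> c s \<ominus> d s \<in> ideal_pow R I (Suc n)"
        by metis
      have cc: "c s \<in> carrier R" "d s \<in> carrier R" if "s \<in> J" for s
        using that c(1) d(1) F(1) ideal_pow_subset[OF I] by blast+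
      have "(\<Oplus>s\<in>J. (c s \<ominus> d s) \<otimes> b s) \<oplus> (\<Oplus>s\<in>J. d s \<otimes> b s) = (\<Oplus>s\<in>J. (c s \<ominus> d s) \<otimes> b s \<oplus> d s \<otimes> b s)"
        by (rule finsum_addf[symmetric]) (use cc bc in auto)
      also have "\<dots> = a" unfolding c(2)
        by (rule finsum_cong') (use cc bc in \<open>auto simp: l_distr[symmetric] minus_eq a_assoc l_neg\<close>)
      finally have "(\<Oplus>s\<in>J. (c s \<ominus> d s) \<otimes> b s) \<oplus> (\<Oplus>s\<in>J. d s \<otimes> b s) = a" .
      moreover have "(\<Oplus>s\<in>J. (c s \<ominus> d s) \<otimes> b s) \<in> carrier R" "(\<Oplus>s\<in>J. d s \<otimes> b s) \<in> carrier R"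
        using cc bc by (auto intro!: finsum_closed)
      ultimately have "a \<ominus> (\<Oplus>s\<in>J. d s \<otimes> b s) = (\<Oplus>s\<in>J. (c s \<ominus> d s) \<otimes> b s)"
        by (auto simp: minus_eq a_assoc r_neg)
      also have "\<dots> \<in> ideal_pow R I (Suc (Suc n))"
        by (rule ideal_pow_Suc_combination[OF I J b]) (use d(2) in auto)
      finally have *: "a \<ominus> (\<Oplus>s\<in>J. d s \<otimes> b s) \<in> ideal_pow R I (Suc (Suc n))" .
      have "(\<Oplus>s\<in>J. d s \<otimes> b s) = (\<Oplus>s\<in>J. restrict d J s \<otimes> b s)"
        by (rule finsum_cong') (use cc bc in auto)
      moreover have "restrict d J \<in> J \<rightarrow>\<^sub>E F" using d(1) by auto
      ultimately show ?thesis using * by blast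
    qed
    then show ?case using sub card fP by (intro exI[of _ ?F]) simp
  qed
  then obtain F where F: "F \<subseteq> ideal_pow R I n" "finite F" "card F \<le> ((\<lambda>c. c ^ card J) ^^ n) m"
    "\<And>a. a \<in> ideal_pow R I n \<Longrightarrow> \<exists>f\<in>F. a \<ominus> f \<in> ideal_pow R I (Suc n)" by blast
  have fS: "finite (ideal_pow R I (Suc n))" by (rule finite_subset[OF ideal_pow_subset[OF I] fin])
  have "ideal_pow R I n \<subseteq> (\<lambda>(f, x). x \<oplus> f) ` (F \<times> ideal_pow R I (Suc n))"
  proof
    fix a assume a: "a \<in> ideal_pow R I n"
    then obtain f where f: "f \<in> F" "a \<ominus> f \<in> ideal_pow R I (Suc n)" using F(4) by blast
    have "a \<in> carrier R" "f \<in> carrier R" using a f(1) F(1) ideal_pow_subset[OF I] by blast+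
    then have "a = (a \<ominus> f) \<oplus> f" by (simp add: minus_eq a_assoc l_neg)
    then show "a \<in> (\<lambda>(f, x). x \<oplus> f) ` (F \<times> ideal_pow R I (Suc n))"
      using f by (intro image_eqI[of _ _ "(f, a \<ominus> f)"]) auto
  qed
  then have "card (ideal_pow R I n) \<le> card ((\<lambda>(f, x). x \<oplus> f) ` (F \<times> ideal_pow R I (Suc n)))"
    by (rule card_mono[rotated]) (use F(2) fS in simp)
  also have "\<dots> \<le> card (F \<times> ideal_pow R I (Suc n))" by (rule card_image_le) (use F(2) fS in simp)
  also have "\<dots> = card F * card (ideal_pow R I (Suc n))" by (rule card_cartesian_product)
  also have "\<dots> \<le> ((\<lambda>c. c ^ card J) ^^ n) m * card (ideal_pow R I (Suc n))" by (rule mult_le_mono1[OF F(3)])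
  finally show ?thesis .
qed

end

context finite_group_algebra
begin

lemma delta_minus_one_aug: "x \<in> carrier Q \<Longrightarrow> delta x \<ominus>\<^bsub>GA\<^esub> \<one>\<^bsub>GA\<^esub> \<in> aug"
  unfolding aug_generate by (rule generate.incl) blast

text \<open>The identities x y - 1 = x (y - 1) + (x - 1) and x^(-1) - 1 = - x^(-1) (x - 1) show that
  the elements x with x - 1 in the left ideal of the generators include everything generated by
  them.\<close>

lemma aug_generators:
  assumes J: "finite J" and g: "g \<in> J \<rightarrow> carrier Q" and gen: "generate Q (g ` J) = carrier Q" and a: "a \<in> aug"
  shows "\<exists>c\<in>J \<rightarrow> carrier GA. a = (\<Oplus>\<^bsub>GA\<^esub>s\<in>J. c s \<otimes>\<^bsub>GA\<^esub> (delta (g s) \<ominus>\<^bsub>GA\<^esub> \<one>\<^bsub>GA\<^esub>))"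
proof -
  interpret GA: ring GA by (rule ring_GA)
  define b where "b s = delta (g s) \<ominus>\<^bsub>GA\<^esub> \<one>\<^bsub>GA\<^esub>" for s
  define L where "L = GA.left_combinations b J"
  have gc: "g s \<in> carrier Q" if "s \<in> J" for s using g that by auto
  have bc: "b s \<in> carrier GA" if "s \<in> J" for s using gc[OF that] by (simp add: b_def)
  have subL: "subgroup L (add_monoid GA)"
    unfolding L_def by (rule GA.left_combinations_subgroup[where b = b and J = J, OF J bc])
  have add: "x \<oplus>\<^bsub>GA\<^esub> y \<in> L" if "x \<in> L" "y \<in> L" for x y
    unfolding L_def by (rule GA.left_combinations_add[where b = b and J = J, OF J bc])
      (use that in \<open>simp_all only: L_def\<close>)
  have mult: "r \<otimes>\<^bsub>GA\<^esub> x \<in> L" if "r \<in> carrier GA" "x \<in> L" for r x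
    unfolding L_def by (rule GA.left_combinations_mult[where b = b and J = J, OF J bc])
      (use that in \<open>simp_all only: L_def\<close>)
  have base: "delta (g s) \<ominus>\<^bsub>GA\<^esub> \<one>\<^bsub>GA\<^esub> \<in> L" if "s \<in> J" for s
    unfolding L_def using GA.left_combinations_generator[where b = b and J = J and s = s, OF J bc that] by (simp add: b_def)
  have zero: "\<zero>\<^bsub>GA\<^esub> \<in> L" using subgroup.one_closed[OF subL] by simp
  have neg: "\<ominus>\<^bsub>GA\<^esub> x \<in> L" if "x \<in> L" for x
    using subgroup.m_inv_closed[OF subL that] by (simp add: a_inv_def)
  have invL: "delta (inv y) \<ominus>\<^bsub>GA\<^esub> \<one>\<^bsub>GA\<^esub> \<in> L" if y: "y \<in> carrier Q" "delta y \<ominus>\<^bsub>GA\<^esub> \<one>\<^bsub>GA\<^esub> \<in> L" for y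
  proof -
    have "\<ominus>\<^bsub>GA\<^esub> (delta (inv y) \<otimes>\<^bsub>GA\<^esub> (delta y \<ominus>\<^bsub>GA\<^esub> \<one>\<^bsub>GA\<^esub>)) \<in> L"
      using neg mult y by simp
    moreover have "delta (inv y) \<otimes>\<^bsub>GA\<^esub> (delta y \<ominus>\<^bsub>GA\<^esub> \<one>\<^bsub>GA\<^esub>) = \<one>\<^bsub>GA\<^esub> \<oplus>\<^bsub>GA\<^esub> (\<ominus>\<^bsub>GA\<^esub> delta (inv y))"
      using y(1) by (simp add: GA.minus_eq GA.r_distr GA.r_minus delta_mult one_GA[symmetric])
    ultimately show ?thesis using y(1) by (simp add: GA.minus_eq GA.minus_add GA.a_comm)
  qed
  have all: "delta x \<ominus>\<^bsub>GA\<^esub> \<one>\<^bsub>GA\<^esub> \<in> L" if "x \<in> generate Q (g ` J)" for x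
    using that
  proof (induction rule: generate.induct)
    case one
    then show ?case using zero by (simp add: GA.minus_eq GA.r_neg flip: one_GA)
  next
    case (incl y)
    then show ?case using base by blast
  next
    case (inv y)
    then show ?case using base gc by (intro invL) blast+
  next
    case (eng x y)
    have c: "x \<in> carrier Q" "y \<in> carrier Q" using eng gen by auto
    have "delta x \<otimes>\<^bsub>GA\<^esub> (delta y \<ominus>\<^bsub>GA\<^esub> \<one>\<^bsub>GA\<^esub>) \<oplus>\<^bsub>GA\<^esub> (delta x \<ominus>\<^bsub>GA\<^esub> \<one>\<^bsub>GA\<^esub>) \<in> L"
      using add mult eng c by simp
    moreover have "delta x \<otimes>\<^bsub>GA\<^esub> (delta y \<ominus>\<^bsub>GA\<^esub> \<one>\<^bsub>GA\<^esub>) \<oplus>\<^bsub>GA\<^esub> (delta x \<ominus>\<^bsub>GA\<^esub> \<one>\<^bsub>GA\<^esub>) = delta (x \<otimes> y) \<ominus>\<^bsub>GA\<^esub> \<one>\<^bsub>GA\<^esub>"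
      using c by (simp add: GA.minus_eq GA.r_distr GA.r_minus delta_mult GA.a_assoc GA.r_neg1)
    ultimately show ?case by simp
  qed
  have "aug \<subseteq> L"
    unfolding aug_generate by (rule GA.add.generate_subgroup_incl[OF _ subL]) (use all gen in blast)
  then have "a \<in> L" using a by (rule subsetD)
  then obtain c where "a = (\<Oplus>\<^bsub>GA\<^esub>s\<in>J. c s \<otimes>\<^bsub>GA\<^esub> b s)" "c \<in> J \<rightarrow> carrier GA"
    unfolding L_def GA.left_combinations_def by (rule imageE)
  then show ?thesis unfolding b_def by (rule bexI)
qed

text \<open>The quotient by the augmentation ideal is F_p, which provides the p representatives that
  start the index bound.\<close>

lemma multiples_of_one_mod_aug:
  assumes "f \<in> carrier GA"
  shows "\<exists>k<p. f \<ominus>\<^bsub>GA\<^esub> add_pow GA (k::nat) \<one>\<^bsub>GA\<^esub> \<in> aug"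
proof -
  interpret GA: ring GA by (rule ring_GA)
  define k where "k = nat (pairing f (\<lambda>_. 1) mod int p)"
  have k: "k < p" "int k = pairing f (\<lambda>_. 1) mod int p"
    using p_gt_1 by (auto simp: k_def nat_less_iff)
  let ?x = "f \<ominus>\<^bsub>GA\<^esub> add_pow GA k \<one>\<^bsub>GA\<^esub>"
  have "[pairing (add_pow GA k \<one>\<^bsub>GA\<^esub>) (\<lambda>_. 1) = pairing (\<lambda>x. int k * \<one>\<^bsub>GA\<^esub> x) (\<lambda>_. 1)] (mod int p)"
    unfolding add_pow_GA[OF GA.one_closed] by (rule pairing_restrict_mod)
  also have "pairing (\<lambda>x. int k * \<one>\<^bsub>GA\<^esub> x) (\<lambda>_. 1) = int k * pairing (delta \<one>) (\<lambda>_. 1)"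
    unfolding pairing_def one_GA by (simp add: sum_distrib_left mult.assoc)
  also have "\<dots> = int k" by (simp add: pairing_delta)
  finally have 1: "[pairing (add_pow GA k \<one>\<^bsub>GA\<^esub>) (\<lambda>_. 1) = int k] (mod int p)" .
  have "?x \<oplus>\<^bsub>GA\<^esub> add_pow GA k \<one>\<^bsub>GA\<^esub> = f" using assms by (simp add: GA.minus_eq GA.a_assoc GA.l_neg)
  then have "[pairing f (\<lambda>_. 1) = pairing ?x (\<lambda>_. 1) + pairing (add_pow GA k \<one>\<^bsub>GA\<^esub>) (\<lambda>_. 1)] (mod int p)"
    using pairing_add[of ?x "add_pow GA k \<one>\<^bsub>GA\<^esub>" "\<lambda>_. 1"] by simp
  also have "[pairing ?x (\<lambda>_. 1) + pairing (add_pow GA k \<one>\<^bsub>GA\<^esub>) (\<lambda>_. 1) = pairing ?x (\<lambda>_. 1) + int k] (mod int p)"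
    by (rule cong_add[OF cong_refl 1])
  finally have "[int k = pairing ?x (\<lambda>_. 1) + int k] (mod int p)"
    using k(2) by (simp add: cong_def)
  then have "[0 = pairing ?x (\<lambda>_. 1)] (mod int p)" using cong_add_rcancel[of 0 "int k" "pairing ?x (\<lambda>_. 1)"] by simp
  then have "?x \<in> aug" using assms by (simp add: aug_iff cong_sym)
  then show ?thesis using k(1) by blast
qed

lemma card_aug_pow_le:
  assumes J: "finite J" and g: "g \<in> J \<rightarrow> carrier Q" and gen: "generate Q (g ` J) = carrier Q"
  shows "card (ideal_pow GA aug n) \<le> ((\<lambda>c. c ^ card J) ^^ n) p * card (ideal_pow GA aug (Suc n))"
proof -
  interpret GA: ring GA by (rule ring_GA)
  let ?F = "(\<lambda>k::nat. add_pow GA k \<one>\<^bsub>GA\<^esub>) ` {..<p}"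
  show ?thesis
  proof (rule GA.card_ideal_pow_le[OF aug_ideal J _ aug_generators[OF J g gen] finite_GA])
    show "(\<lambda>s. delta (g s) \<ominus>\<^bsub>GA\<^esub> \<one>\<^bsub>GA\<^esub>) \<in> J \<rightarrow> aug" using g delta_minus_one_aug by blast
    show "card ?F \<le> p" using card_image_le[of "{..<p}" "\<lambda>k::nat. add_pow GA k \<one>\<^bsub>GA\<^esub>"] by simp
    show "\<exists>f\<in>?F. a \<ominus>\<^bsub>GA\<^esub> f \<in> aug" if "a \<in> carrier GA" for a
      using multiples_of_one_mod_aug[OF that] by blast
  qed auto
qed

end

context finite_group_algebra_hom
begin

lemma push_ring_hom: "push \<in> ring_hom dom.GA cod.GA"
  by (rule ring_hom_memI) (simp_all only: push_closed push_mult push_add push_one)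

lemma push_aug_pow:
  assumes "f \<in> ideal_pow dom.GA dom.aug n"
  shows "push f \<in> ideal_pow cod.GA cod.aug n"
proof (rule ring_hom_ideal_pow[OF dom.ring_GA cod.ring_GA push_ring_hom dom.aug_ideal cod.aug_ideal _ assms])
  show "push ` dom.aug \<subseteq> cod.aug"
  proof
    fix y assume "y \<in> push ` dom.aug"
    then obtain f where f: "y = push f" "f \<in> dom.aug" by (rule imageE)
    have "f \<in> carrier dom.GA" using f(2) by (simp add: dom.aug_def)
    then show "y \<in> cod.aug" unfolding f(1) using f(2) by (simp only: push_aug_iff)
  qed
qed

lemma push_delta_minus_one: "x \<in> carrier Q \<Longrightarrow>
    push (dom.delta x \<ominus>\<^bsub>dom.GA\<^esub> \<one>\<^bsub>dom.GA\<^esub>) = cod.delta (h x) \<ominus>\<^bsub>cod.GA\<^esub> \<one>\<^bsub>cod.GA\<^esub>"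
  using ring_hom_minus[OF dom.ring_GA cod.ring_GA push_ring_hom dom.delta_closed, of x "\<one>\<^bsub>dom.GA\<^esub>"]
    ring.ring_simprules(6)[OF dom.ring_GA]
  by (simp only: push_delta push_one)

end

lemma push_compose:
  assumes "finite_group_algebra_hom Q Q' p h" "finite_group_algebra_hom Q' Q'' p h'" "finite_group_algebra_hom Q Q'' p h''"
    and "\<And>x. x \<in> carrier Q \<Longrightarrow> h' (h x) = h'' x"
    and f: "f \<in> carrier (group_algebra (residue_ring (int p)) Q)"
  shows "group_algebra_map (residue_ring (int p)) Q' Q'' h' (group_algebra_map (residue_ring (int p)) Q Q' h f)
    = group_algebra_map (residue_ring (int p)) Q Q'' h'' f"
proof -
  interpret a: finite_group_algebra_hom Q Q' p h by (rule assms(1))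
  interpret b: finite_group_algebra_hom Q' Q'' p h' by (rule assms(2))
  interpret c: finite_group_algebra_hom Q Q'' p h'' by (rule assms(3))
  show ?thesis
  proof (rule b.push_eqI[OF a.push_closed[OF f] c.push_closed[OF f]])
    fix F
    have "[a.cod.pairing (a.push f) (\<lambda>x. F (h' x)) = a.dom.pairing f (\<lambda>x. F (h' (h x)))] (mod int p)"
      by (rule a.pairing_push[OF f])
    also have "a.dom.pairing f (\<lambda>x. F (h' (h x))) = a.dom.pairing f (\<lambda>x. F (h'' x))"
      unfolding a.dom.pairing_def using assms(4) by (intro sum.cong) auto
    also have "[a.dom.pairing f (\<lambda>x. F (h'' x)) = b.cod.pairing (c.push f) F] (mod int p)"
      by (rule cong_sym[OF c.pairing_push[OF f]])
    finally show "[a.cod.pairing (a.push f) (\<lambda>x. F (h' x)) = b.cod.pairing (c.push f) F] (mod int p)" .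
  qed
qed

section \<open>The completed group algebra\<close>

context pro_p_group
begin

abbreviation NN where "NN \<equiv> open_normal_subgroups G T"
abbreviation level where "level N \<equiv> group_algebra (residue_ring (int p)) (G Mod N)"
abbreviation level_aug where "level_aug N \<equiv> finite_group_algebra.aug (G Mod N) p"
abbreviation level_delta where "level_delta N \<equiv> finite_group_algebra.delta (G Mod N)"
abbreviation proj where "proj N M \<equiv> group_algebra_map (residue_ring (int p)) (G Mod N) (G Mod M) (\<lambda>X. M <#> X)"
abbreviation Lam where "Lam \<equiv> completed_group_algebra (residue_ring (int p)) G T"

lemma NN_normal: "N \<in> NN \<Longrightarrow> N \<lhd> G"
  and NN_open: "N \<in> NN \<Longrightarrow> openin T N"
  by (simp_all add: open_normal_subgroups_def)

lemma NN_subgroup: "N \<in> NN \<Longrightarrow> subgroup N G"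
  using NN_normal normal_imp_subgroup by blast

lemma carrier_NN: "carrier G \<in> NN"
proof -
  have "carrier G \<lhd> G" by (rule normal_invI[OF subgroup_self]) simp
  moreover have "openin T (carrier G)" using openin_topspace[of T] topspace_eq by simp
  ultimately show ?thesis by (simp add: open_normal_subgroups_def)
qed

lemma Int_NN: "N \<in> NN \<Longrightarrow> M \<in> NN \<Longrightarrow> N \<inter> M \<in> NN"
  by (simp add: open_normal_subgroups_def normal_subgroup_intersect openin_Int)

lemma finite_NN_lower:
  assumes "finite F" "F \<subseteq> NN"
  shows "\<exists>k\<in>NN. \<forall>i\<in>F. k \<subseteq> i"
  using assms
proof (induction F rule: finite_induct)
  case empty
  then show ?case using carrier_NN by blast
next
  case (insert N F)
  then obtain k where k: "k \<in> NN" "\<forall>i\<in>F. k \<subseteq> i" by auto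
  have "N \<inter> k \<in> NN" using insert.prems k(1) by (intro Int_NN) auto
  then show ?case using k(2) by (intro bexI[of _ "N \<inter> k"]) auto
qed

lemma card_quotient: "N \<in> NN \<Longrightarrow> \<exists>k. card (carrier (G Mod N)) = p ^ k"
  using p_power_index unfolding order_def .

lemma level_algebra:
  assumes N: "N \<in> NN"
  shows "finite_group_algebra (G Mod N) p"
proof -
  have p1: "p > 1" using prime_p by (rule prime_gt_1_nat)
  obtain k where "card (carrier (G Mod N)) = p ^ k" using card_quotient[OF N] by blast
  then have "finite (carrier (G Mod N))" using p1 by (intro card_ge_0_finite) simp
  then show ?thesis
    using normal.factorgroup_is_group[OF NN_normal[OF N]] p1
    by (intro finite_group_algebra.intro finite_group_algebra_axioms.intro)
qed

lemma coset_closed: "x \<in> carrier G \<Longrightarrow> N #> x \<in> carrier (G Mod N)"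
  unfolding FactGroup_def RCOSETS_def by auto

lemma coset_cases:
  assumes "X \<in> carrier (G Mod N)"
  obtains x where "x \<in> carrier G" "X = N #> x"
  using assms unfolding FactGroup_def RCOSETS_def by auto

lemma coset_mult: "N \<in> NN \<Longrightarrow> x \<in> carrier G \<Longrightarrow> y \<in> carrier G \<Longrightarrow>
    (N #> x) \<otimes>\<^bsub>G Mod N\<^esub> (N #> y) = N #> (x \<otimes> y)"
  using normal.rcos_sum[OF NN_normal] by (simp add: FactGroup_def)

lemma quotient_hom: "N \<in> NN \<Longrightarrow> group_hom G (G Mod N) (\<lambda>x. N #> x)"
  by (rule group_hom.intro[OF is_group normal.factorgroup_is_group[OF NN_normal]], assumption)
    (rule group_hom_axioms.intro, rule normal.r_coset_hom_Mod[OF NN_normal], assumption)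

lemma coset_coarsen:
  assumes N: "N \<in> NN" and M: "M \<in> NN" and NM: "N \<subseteq> M" and x: "x \<in> carrier G"
  shows "M <#> (N #> x) = M #> x"
proof -
  have Mc: "M \<subseteq> carrier G" and Nc: "N \<subseteq> carrier G"
    using subgroup.subset[OF NN_subgroup[OF M]] subgroup.subset[OF NN_subgroup[OF N]] .
  have "M <#> N = M"
  proof
    show "M <#> N \<subseteq> M"
      using subgroup.m_closed[OF NN_subgroup[OF M]] NM unfolding set_mult_def by auto
    show "M \<subseteq> M <#> N"
    proof
      fix m assume m: "m \<in> M"
      have "m = m \<otimes> \<one>" using m Mc by auto
      then show "m \<in> M <#> N"
        using m subgroup.one_closed[OF NN_subgroup[OF N]] unfolding set_mult_def by blast
    qed
  qed
  then show ?thesis using setmult_rcos_assoc[OF Mc Nc x] by simp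
qed

lemma level_hom:
  assumes N: "N \<in> NN" and M: "M \<in> NN" and NM: "N \<subseteq> M"
  shows "finite_group_algebra_hom (G Mod N) (G Mod M) p (\<lambda>X. M <#> X)"
proof -
  have "(\<lambda>X. M <#> X) \<in> hom (G Mod N) (G Mod M)"
  proof (rule homI)
    fix X assume "X \<in> carrier (G Mod N)"
    then obtain x where "x \<in> carrier G" "X = N #> x" by (rule coset_cases)
    then show "M <#> X \<in> carrier (G Mod M)" using coset_coarsen[OF assms] coset_closed by simp
  next
    fix X Y assume "X \<in> carrier (G Mod N)" "Y \<in> carrier (G Mod N)"
    then obtain x y where "x \<in> carrier G" "X = N #> x" "y \<in> carrier G" "Y = N #> y"
      by (metis coset_cases)
    then show "M <#> (X \<otimes>\<^bsub>G Mod N\<^esub> Y) = (M <#> X) \<otimes>\<^bsub>G Mod M\<^esub> (M <#> Y)"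
      using coset_coarsen[OF assms] coset_mult[OF N] coset_mult[OF M] by simp
  qed
  then show ?thesis
    using level_algebra[OF N] level_algebra[OF M]
    by (intro finite_group_algebra_hom.intro finite_group_algebra_hom_axioms.intro)
qed

lemma proj_compose:
  assumes "N \<in> NN" "M \<in> NN" "L \<in> NN" "N \<subseteq> M" "M \<subseteq> L" "f \<in> carrier (level N)"
  shows "proj M L (proj N M f) = proj N L f"
proof (rule push_compose[OF level_hom level_hom level_hom])
  fix X assume "X \<in> carrier (G Mod N)"
  then obtain x where x: "x \<in> carrier G" "X = N #> x" by (rule coset_cases)
  show "L <#> (M <#> X) = L <#> X"
    using assms x by (simp add: coset_coarsen)
qed (use assms in auto)

lemma Lam_carrier: "\<phi> \<in> carrier Lam \<longleftrightarrow>
    \<phi> \<in> (\<Pi>\<^sub>E N\<in>NN. carrier (level N)) \<and> (\<forall>N\<in>NN. \<forall>M\<in>NN. N \<subseteq> M \<longrightarrow> proj N M (\<phi> N) = \<phi> M)"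
  by (simp add: completed_group_algebra_def)

lemma Lam_level: "\<phi> \<in> carrier Lam \<Longrightarrow> N \<in> NN \<Longrightarrow> \<phi> N \<in> carrier (level N)"
  unfolding Lam_carrier by (elim conjE PiE_mem)

lemma Lam_proj: "\<phi> \<in> carrier Lam \<Longrightarrow> N \<in> NN \<Longrightarrow> M \<in> NN \<Longrightarrow> N \<subseteq> M \<Longrightarrow> proj N M (\<phi> N) = \<phi> M"
  unfolding Lam_carrier by blast

lemma Lam_intro:
  assumes "\<And>N. N \<in> NN \<Longrightarrow> f N \<in> carrier (level N)"
    and "\<And>N M. N \<in> NN \<Longrightarrow> M \<in> NN \<Longrightarrow> N \<subseteq> M \<Longrightarrow> proj N M (f N) = f M"
  shows "(\<lambda>N\<in>NN. f N) \<in> carrier Lam"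
  unfolding Lam_carrier
proof (intro conjI ballI impI)
  show "(\<lambda>N\<in>NN. f N) \<in> (\<Pi>\<^sub>E N\<in>NN. carrier (level N))" using assms(1) by (simp only: restrict_PiE_iff) blast
qed (use assms(2) in simp)

lemma Lam_eqI:
  assumes "\<phi> \<in> carrier Lam" "\<psi> \<in> carrier Lam" "\<And>N. N \<in> NN \<Longrightarrow> \<phi> N = \<psi> N"
  shows "\<phi> = \<psi>"
proof (rule PiE_ext)
  show "\<phi> \<in> (\<Pi>\<^sub>E N\<in>NN. carrier (level N))" "\<psi> \<in> (\<Pi>\<^sub>E N\<in>NN. carrier (level N))"
    using assms(1,2) unfolding Lam_carrier by blast+
qed (rule assms(3))

lemma Lam_mult: "\<phi> \<otimes>\<^bsub>Lam\<^esub> \<psi> = (\<lambda>N\<in>NN. \<phi> N \<otimes>\<^bsub>level N\<^esub> \<psi> N)"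
  and Lam_add: "\<phi> \<oplus>\<^bsub>Lam\<^esub> \<psi> = (\<lambda>N\<in>NN. \<phi> N \<oplus>\<^bsub>level N\<^esub> \<psi> N)"
  and Lam_one: "\<one>\<^bsub>Lam\<^esub> = (\<lambda>N\<in>NN. \<one>\<^bsub>level N\<^esub>)"
  and Lam_zero: "\<zero>\<^bsub>Lam\<^esub> = (\<lambda>N\<in>NN. \<zero>\<^bsub>level N\<^esub>)"
  by (simp_all add: completed_group_algebra_def)

lemma level_ring: "N \<in> NN \<Longrightarrow> ring (level N)"
  by (rule finite_group_algebra.ring_GA[OF level_algebra])

lemma Lam_mult_closed:
  assumes "\<phi> \<in> carrier Lam" "\<psi> \<in> carrier Lam"
  shows "\<phi> \<otimes>\<^bsub>Lam\<^esub> \<psi> \<in> carrier Lam"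
  unfolding Lam_mult
proof (rule Lam_intro)
  show "\<phi> N \<otimes>\<^bsub>level N\<^esub> \<psi> N \<in> carrier (level N)" if N: "N \<in> NN" for N
    by (rule finite_group_algebra.mult_closed[OF level_algebra[OF N] Lam_level[OF assms(1) N] Lam_level[OF assms(2) N]])
  show "proj N M (\<phi> N \<otimes>\<^bsub>level N\<^esub> \<psi> N) = \<phi> M \<otimes>\<^bsub>level M\<^esub> \<psi> M"
    if N: "N \<in> NN" and M: "M \<in> NN" and NM: "N \<subseteq> M" for N M
    using finite_group_algebra_hom.push_mult[OF level_hom[OF N M NM] Lam_level[OF assms(1) N] Lam_level[OF assms(2) N]]
    by (simp only: Lam_proj[OF assms(1) N M NM] Lam_proj[OF assms(2) N M NM])
qed

lemma Lam_add_closed: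
  assumes "\<phi> \<in> carrier Lam" "\<psi> \<in> carrier Lam"
  shows "\<phi> \<oplus>\<^bsub>Lam\<^esub> \<psi> \<in> carrier Lam"
  unfolding Lam_add
proof (rule Lam_intro)
  show "\<phi> N \<oplus>\<^bsub>level N\<^esub> \<psi> N \<in> carrier (level N)" if N: "N \<in> NN" for N
    by (rule finite_group_algebra.add_closed[OF level_algebra[OF N]])
  show "proj N M (\<phi> N \<oplus>\<^bsub>level N\<^esub> \<psi> N) = \<phi> M \<oplus>\<^bsub>level M\<^esub> \<psi> M"
    if N: "N \<in> NN" and M: "M \<in> NN" and NM: "N \<subseteq> M" for N M
    using finite_group_algebra_hom.push_add[OF level_hom[OF N M NM] Lam_level[OF assms(1) N] Lam_level[OF assms(2) N]]
    by (simp only: Lam_proj[OF assms(1) N M NM] Lam_proj[OF assms(2) N M NM])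
qed

lemma Lam_one_closed: "\<one>\<^bsub>Lam\<^esub> \<in> carrier Lam"
  unfolding Lam_one
  by (rule Lam_intro, rule ring.ring_simprules(6)[OF level_ring], assumption)
    (rule finite_group_algebra_hom.push_one[OF level_hom])

lemma Lam_zero_closed: "\<zero>\<^bsub>Lam\<^esub> \<in> carrier Lam"
  unfolding Lam_zero
  by (rule Lam_intro, rule ring.ring_simprules(2)[OF level_ring], assumption)
    (rule finite_group_algebra_hom.push_zero[OF level_hom])

lemma Lam_ring: "ring Lam"
proof (rule ringI)
  show "abelian_group Lam"
  proof (rule abelian_groupI)
    fix x y z assume c: "x \<in> carrier Lam" "y \<in> carrier Lam" "z \<in> carrier Lam"
    show "x \<oplus>\<^bsub>Lam\<^esub> y \<oplus>\<^bsub>Lam\<^esub> z = x \<oplus>\<^bsub>Lam\<^esub> (y \<oplus>\<^bsub>Lam\<^esub> z)"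
      unfolding Lam_add
      by (rule restrict_ext) (simp add: abelian_monoid.a_assoc[OF abelian_group.axioms(1)[OF ring.is_abelian_group[OF level_ring]]] Lam_level c)
  next
    fix x y assume c: "x \<in> carrier Lam" "y \<in> carrier Lam"
    show "x \<oplus>\<^bsub>Lam\<^esub> y = y \<oplus>\<^bsub>Lam\<^esub> x"
      unfolding Lam_add
      by (rule restrict_ext) (rule abelian_monoid.a_comm[OF abelian_group.axioms(1)[OF ring.is_abelian_group[OF level_ring]]], simp_all add: Lam_level c)
  next
    fix x assume c: "x \<in> carrier Lam"
    show "\<zero>\<^bsub>Lam\<^esub> \<oplus>\<^bsub>Lam\<^esub> x = x"
    proof (rule Lam_eqI[OF Lam_add_closed[OF Lam_zero_closed c] c])
      fix N assume N: "N \<in> NN"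
      show "(\<zero>\<^bsub>Lam\<^esub> \<oplus>\<^bsub>Lam\<^esub> x) N = x N"
        using N abelian_monoid.l_zero[OF abelian_group.axioms(1)[OF ring.is_abelian_group[OF level_ring[OF N]]] Lam_level[OF c N]]
        by (simp add: Lam_add Lam_zero)
    qed
    show "\<exists>y\<in>carrier Lam. y \<oplus>\<^bsub>Lam\<^esub> x = \<zero>\<^bsub>Lam\<^esub>"
    proof
      show "(\<lambda>N\<in>NN. \<ominus>\<^bsub>level N\<^esub> x N) \<in> carrier Lam"
      proof (rule Lam_intro)
        show "\<ominus>\<^bsub>level N\<^esub> x N \<in> carrier (level N)" if N: "N \<in> NN" for N
          by (rule ring.ring_simprules(3)[OF level_ring[OF N] Lam_level[OF c N]])
        show "proj N M (\<ominus>\<^bsub>level N\<^esub> x N) = \<ominus>\<^bsub>level M\<^esub> x M"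
          if N: "N \<in> NN" and M: "M \<in> NN" and NM: "N \<subseteq> M" for N M
        proof -
          interpret h: ring_hom_ring "level N" "level M" "proj N M"
            by (rule ring_hom_ringI2[OF level_ring[OF N] level_ring[OF M] finite_group_algebra_hom.push_ring_hom[OF level_hom[OF N M NM]]])
          show ?thesis using h.hom_a_inv[OF Lam_level[OF c N]] by (simp only: Lam_proj[OF c N M NM])
        qed
      qed
      show "(\<lambda>N\<in>NN. \<ominus>\<^bsub>level N\<^esub> x N) \<oplus>\<^bsub>Lam\<^esub> x = \<zero>\<^bsub>Lam\<^esub>"
        unfolding Lam_add Lam_zero
        by (rule restrict_ext) (simp add: abelian_group.l_neg[OF ring.is_abelian_group[OF level_ring]] Lam_level c)
    qed
  qed (simp_all only: Lam_add_closed Lam_zero_closed)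
  show "Group.monoid Lam"
  proof (rule monoidI)
    fix x y z assume c: "x \<in> carrier Lam" "y \<in> carrier Lam" "z \<in> carrier Lam"
    show "x \<otimes>\<^bsub>Lam\<^esub> y \<otimes>\<^bsub>Lam\<^esub> z = x \<otimes>\<^bsub>Lam\<^esub> (y \<otimes>\<^bsub>Lam\<^esub> z)"
      unfolding Lam_mult
      by (rule restrict_ext) (simp add: monoid.m_assoc[OF ring.is_monoid[OF level_ring]] Lam_level c)
  next
    fix x assume c: "x \<in> carrier Lam"
    show "\<one>\<^bsub>Lam\<^esub> \<otimes>\<^bsub>Lam\<^esub> x = x"
    proof (rule Lam_eqI[OF Lam_mult_closed[OF Lam_one_closed c] c])
      fix N assume N: "N \<in> NN"
      show "(\<one>\<^bsub>Lam\<^esub> \<otimes>\<^bsub>Lam\<^esub> x) N = x N"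
        using N monoid.l_one[OF ring.is_monoid[OF level_ring[OF N]] Lam_level[OF c N]]
        by (simp add: Lam_mult Lam_one)
    qed
    show "x \<otimes>\<^bsub>Lam\<^esub> \<one>\<^bsub>Lam\<^esub> = x"
    proof (rule Lam_eqI[OF Lam_mult_closed[OF c Lam_one_closed] c])
      fix N assume N: "N \<in> NN"
      show "(x \<otimes>\<^bsub>Lam\<^esub> \<one>\<^bsub>Lam\<^esub>) N = x N"
        using N monoid.r_one[OF ring.is_monoid[OF level_ring[OF N]] Lam_level[OF c N]]
        by (simp add: Lam_mult Lam_one)
    qed
  qed (simp_all only: Lam_mult_closed Lam_one_closed)
next
  fix x y z assume c: "x \<in> carrier Lam" "y \<in> carrier Lam" "z \<in> carrier Lam"
  show "(x \<oplus>\<^bsub>Lam\<^esub> y) \<otimes>\<^bsub>Lam\<^esub> z = x \<otimes>\<^bsub>Lam\<^esub> z \<oplus>\<^bsub>Lam\<^esub> y \<otimes>\<^bsub>Lam\<^esub> z"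
    unfolding Lam_add Lam_mult
  proof (rule restrict_ext)
    fix N assume N: "N \<in> NN"
    interpret R: ring "level N" by (rule level_ring[OF N])
    show "(\<lambda>N\<in>NN. x N \<oplus>\<^bsub>level N\<^esub> y N) N \<otimes>\<^bsub>level N\<^esub> z N = (\<lambda>N\<in>NN. x N \<otimes>\<^bsub>level N\<^esub> z N) N \<oplus>\<^bsub>level N\<^esub> (\<lambda>N\<in>NN. y N \<otimes>\<^bsub>level N\<^esub> z N) N"
      using N by (simp add: R.l_distr[OF Lam_level[OF c(1) N] Lam_level[OF c(2) N] Lam_level[OF c(3) N]])
  qed
  show "z \<otimes>\<^bsub>Lam\<^esub> (x \<oplus>\<^bsub>Lam\<^esub> y) = z \<otimes>\<^bsub>Lam\<^esub> x \<oplus>\<^bsub>Lam\<^esub> z \<otimes>\<^bsub>Lam\<^esub> y"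
    unfolding Lam_add Lam_mult
  proof (rule restrict_ext)
    fix N assume N: "N \<in> NN"
    interpret R: ring "level N" by (rule level_ring[OF N])
    show "z N \<otimes>\<^bsub>level N\<^esub> (\<lambda>N\<in>NN. x N \<oplus>\<^bsub>level N\<^esub> y N) N = (\<lambda>N\<in>NN. z N \<otimes>\<^bsub>level N\<^esub> x N) N \<oplus>\<^bsub>level N\<^esub> (\<lambda>N\<in>NN. z N \<otimes>\<^bsub>level N\<^esub> y N) N"
      using N by (simp add: R.r_distr[OF Lam_level[OF c(1) N] Lam_level[OF c(2) N] Lam_level[OF c(3) N]])
  qed
qed

lemma eval_ring_hom: "N \<in> NN \<Longrightarrow> (\<lambda>\<phi>. \<phi> N) \<in> ring_hom Lam (level N)"
  by (rule ring_hom_memI) (simp_all add: Lam_level Lam_mult Lam_add Lam_one)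

text \<open>The canonical image of a group element of G in the completed group algebra.\<close>

definition embed :: "'a \<Rightarrow> 'a set \<Rightarrow> 'a set \<Rightarrow> int" where
  "embed g = (\<lambda>N\<in>NN. level_delta N (N #> g))"

lemma embed_level: "N \<in> NN \<Longrightarrow> embed g N = level_delta N (N #> g)"
  by (simp add: embed_def)

lemma embed_closed:
  assumes g: "g \<in> carrier G"
  shows "embed g \<in> carrier Lam"
  unfolding embed_def
proof (rule Lam_intro)
  show "level_delta N (N #> g) \<in> carrier (level N)" if N: "N \<in> NN" for N
    by (rule finite_group_algebra.delta_closed[OF level_algebra[OF N] coset_closed[OF g]])
  show "proj N M (level_delta N (N #> g)) = level_delta M (M #> g)"
    if N: "N \<in> NN" and M: "M \<in> NN" and NM: "N \<subseteq> M" for N M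
    using finite_group_algebra_hom.push_delta[OF level_hom[OF N M NM] coset_closed[OF g]]
    by (simp only: coset_coarsen[OF N M NM g])
qed

text \<open>Each finite level is additively generated by its group elements, and these lift through
  \<open>embed\<close>.\<close>

lemma eval_surj:
  assumes N: "N \<in> NN" and f: "f \<in> carrier (level N)"
  shows "\<exists>\<phi>\<in>carrier Lam. \<phi> N = f"
  using f
proof (induction rule: finite_group_algebra.GA_induct[OF level_algebra[OF N], consumes 1, case_names zero add])
  case zero
  show ?case using N Lam_zero_closed by (intro bexI[of _ "\<zero>\<^bsub>Lam\<^esub>"]) (simp_all add: Lam_zero)
next
  case (add f X)
  then obtain \<phi> where \<phi>: "\<phi> \<in> carrier Lam" "\<phi> N = f" by blast
  obtain x where x: "x \<in> carrier G" "X = N #> x" using add(2) by (rule coset_cases)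
  have "(\<phi> \<oplus>\<^bsub>Lam\<^esub> embed x) N = f \<oplus>\<^bsub>level N\<^esub> level_delta N X"
    using N \<phi>(2) x(2) by (simp add: Lam_add embed_level)
  then show ?case using Lam_add_closed[OF \<phi>(1) embed_closed[OF x(1)]] by blast
qed

abbreviation augI where "augI \<equiv> augmentation_ideal (residue_ring (int p)) G T"

text \<open>The projections between levels preserve the augmentation, so the condition at the
  coarsest level N = G is equivalent to the condition at any other one.\<close>

lemma augI_iff: "\<phi> \<in> augI \<longleftrightarrow> \<phi> \<in> carrier Lam \<and> (\<forall>N\<in>NN. \<phi> N \<in> level_aug N)"
proof -
  interpret C: finite_group_algebra "G Mod carrier G" p by (rule level_algebra[OF carrier_NN])
  have z: "\<zero>\<^bsub>residue_ring (int p)\<^esub> = 0" by (simp add: residue_ring_def)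
  have top: "augmentation (residue_ring (int p)) G \<phi> = 0 \<longleftrightarrow> \<phi> (carrier G) \<in> level_aug (carrier G)"
    if \<phi>: "\<phi> \<in> carrier Lam" for \<phi>
  proof -
    have c: "\<phi> (carrier G) \<in> carrier (level (carrier G))" by (rule Lam_level[OF \<phi> carrier_NN])
    have "\<phi> (carrier G) \<in> carrier (G Mod carrier G) \<rightarrow> {0..<int p}"
      using C.GA_range[OF c] by auto
    then have "augmentation (residue_ring (int p)) G \<phi> = (\<Sum>x\<in>carrier (G Mod carrier G). \<phi> (carrier G) x) mod int p"
      unfolding augmentation_def group_algebra_augmentation_def
      by (rule finsum_residue_ring[OF C.p_gt_1 C.finite_carrier])
    then show ?thesis using c by (simp add: C.aug_def)
  qed
  have lev: "\<phi> N \<in> level_aug N \<longleftrightarrow> \<phi> (carrier G) \<in> level_aug (carrier G)"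
    if \<phi>: "\<phi> \<in> carrier Lam" and N: "N \<in> NN" for \<phi> N
  proof -
    have NG: "N \<subseteq> carrier G" by (rule subgroup.subset[OF NN_subgroup[OF N]])
    show ?thesis
      using finite_group_algebra_hom.push_aug_iff[OF level_hom[OF N carrier_NN NG] Lam_level[OF \<phi> N]]
      by (simp only: Lam_proj[OF \<phi> N carrier_NN NG])
  qed
  have "\<phi> \<in> augI \<longleftrightarrow> \<phi> \<in> carrier Lam \<and> augmentation (residue_ring (int p)) G \<phi> = 0"
    unfolding augmentation_ideal_def a_kernel_def' z by simp
  then show ?thesis using top[of \<phi>] lev[of \<phi>] carrier_NN by blast
qed

lemma augI_ideal: "ideal augI Lam"
proof -
  interpret L: ring Lam by (rule Lam_ring)
  have lev: "\<phi> N \<in> level_aug N" if "\<phi> \<in> augI" "N \<in> NN" for \<phi> N using that augI_iff by blast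
  have car: "\<phi> \<in> carrier Lam" if "\<phi> \<in> augI" for \<phi> using that augI_iff by blast
  have I: "ideal (level_aug N) (level N)" if "N \<in> NN" for N
    by (rule finite_group_algebra.aug_ideal[OF level_algebra[OF that]])
  have sg: "subgroup (level_aug N) (add_monoid (level N))" if "N \<in> NN" for N
    using I[OF that] ideal.axioms(1) additive_subgroup.a_subgroup by blast
  show ?thesis
  proof (rule idealI[OF Lam_ring])
    show "subgroup augI (add_monoid Lam)"
    proof (rule L.add.subgroupI)
      show "augI \<subseteq> carrier Lam" using car by blast
      have "\<zero>\<^bsub>Lam\<^esub> \<in> augI" unfolding augI_iff
      proof (intro conjI ballI)
        fix N assume N: "N \<in> NN"
        show "\<zero>\<^bsub>Lam\<^esub> N \<in> level_aug N" using subgroup.one_closed[OF sg[OF N]] N by (simp add: Lam_zero)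
      qed (rule Lam_zero_closed)
      then show "augI \<noteq> {}" by blast
    next
      fix a b assume ab: "a \<in> augI" "b \<in> augI"
      show "a \<oplus>\<^bsub>Lam\<^esub> b \<in> augI" unfolding augI_iff
      proof (intro conjI ballI)
        fix N assume N: "N \<in> NN"
        show "(a \<oplus>\<^bsub>Lam\<^esub> b) N \<in> level_aug N"
          using subgroup.m_closed[OF sg[OF N] lev[OF ab(1) N] lev[OF ab(2) N]] N by (simp add: Lam_add)
      qed (rule Lam_add_closed[OF car[OF ab(1)] car[OF ab(2)]])
    next
      fix a assume a: "a \<in> augI"
      show "\<ominus>\<^bsub>Lam\<^esub> a \<in> augI" unfolding augI_iff
      proof (intro conjI ballI)
        fix N assume N: "N \<in> NN"
        interpret h: ring_hom_ring Lam "level N" "\<lambda>\<phi>. \<phi> N"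
          by (rule ring_hom_ringI2[OF Lam_ring level_ring[OF N] eval_ring_hom[OF N]])
        show "(\<ominus>\<^bsub>Lam\<^esub> a) N \<in> level_aug N"
          using subgroup.m_inv_closed[OF sg[OF N] lev[OF a N]] h.hom_a_inv[OF car[OF a]] by (simp add: a_inv_def)
      qed (rule L.a_inv_closed[OF car[OF a]])
    qed
  next
    fix a x assume a: "a \<in> augI" and x: "x \<in> carrier Lam"
    show "x \<otimes>\<^bsub>Lam\<^esub> a \<in> augI" unfolding augI_iff
    proof (intro conjI ballI)
      fix N assume N: "N \<in> NN"
      show "(x \<otimes>\<^bsub>Lam\<^esub> a) N \<in> level_aug N"
        using ideal.I_l_closed[OF I[OF N] lev[OF a N] Lam_level[OF x N]] N by (simp add: Lam_mult)
    qed (rule Lam_mult_closed[OF x car[OF a]])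
    show "a \<otimes>\<^bsub>Lam\<^esub> x \<in> augI" unfolding augI_iff
    proof (intro conjI ballI)
      fix N assume N: "N \<in> NN"
      show "(a \<otimes>\<^bsub>Lam\<^esub> x) N \<in> level_aug N"
        using ideal.I_r_closed[OF I[OF N] lev[OF a N] Lam_level[OF x N]] N by (simp add: Lam_mult)
    qed (rule Lam_mult_closed[OF car[OF a] x])
  qed
qed

lemma augmentation_ideal_power_eq: "augmentation_ideal_power (residue_ring (int p)) G T n = ideal_pow Lam augI n"
  by (simp add: augmentation_ideal_power_def ideal_pow_def)

lemma eval_aug_pow:
  assumes N: "N \<in> NN" and \<phi>: "\<phi> \<in> ideal_pow Lam augI n"
  shows "\<phi> N \<in> ideal_pow (level N) (level_aug N) n"
  by (rule ring_hom_ideal_pow[OF Lam_ring level_ring[OF N] eval_ring_hom[OF N] augI_ideal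
      finite_group_algebra.aug_ideal[OF level_algebra[OF N]] _ \<phi>]) (use N augI_iff in blast)

lemma open_r_coset:
  assumes U: "openin T U" and g: "g \<in> carrier G"
  shows "openin T (U #> g)"
proof -
  have Uc: "x \<in> carrier G" if "x \<in> U" for x
    using openin_subset[OF U] that topspace_eq by auto
  have "continuous_map T T (\<lambda>x. x \<otimes> inv g)"
  proof -
    have "continuous_map T (prod_topology T T) (\<lambda>x. (x, inv g))"
      by (intro continuous_map_pairedI continuous_map_id[unfolded id_def]) (simp add: topspace_eq g)
    from continuous_map_compose[OF this continuous_mult] show ?thesis by (simp add: comp_def)
  qed
  then have "openin T {x \<in> topspace T. x \<otimes> inv g \<in> U}"
    by (rule openin_continuous_map_preimage) (rule U)
  moreover have "{x \<in> topspace T. x \<otimes> inv g \<in> U} = U #> g"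
  proof
    show "{x \<in> topspace T. x \<otimes> inv g \<in> U} \<subseteq> U #> g"
    proof clarify
      fix x assume x: "x \<in> topspace T" "x \<otimes> inv g \<in> U"
      then have "x = (x \<otimes> inv g) \<otimes> g" using g topspace_eq by (simp add: m_assoc)
      then show "x \<in> U #> g" using x(2) unfolding r_coset_def by blast
    qed
    show "U #> g \<subseteq> {x \<in> topspace T. x \<otimes> inv g \<in> U}"
    proof
      fix x assume "x \<in> U #> g"
      then obtain n where n: "n \<in> U" "x = n \<otimes> g" unfolding r_coset_def by blast
      have nc: "n \<in> carrier G" by (rule Uc[OF n(1)])
      have "x \<otimes> inv g = n" using n(2) nc g by (simp add: m_assoc)
      then show "x \<in> {x \<in> topspace T. x \<otimes> inv g \<in> U}" using n nc g topspace_eq by simp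
    qed
  qed
  ultimately show ?thesis by simp
qed

section \<open>Consequences of topological finite generation for the completed algebra\<close>

context
  fixes S
  assumes S: "finite S" "S \<subseteq> carrier G" "T closure_of (generate G S) = carrier G"
begin

text \<open>Every coset of N is open, so it meets the dense subgroup generated by S.\<close>

lemma quotient_generate:
  assumes N: "N \<in> NN"
  shows "generate (G Mod N) ((\<lambda>s. N #> s) ` S) = carrier (G Mod N)"
proof
  interpret h: group_hom G "G Mod N" "\<lambda>x. N #> x" by (rule quotient_hom[OF N])
  show "generate (G Mod N) ((\<lambda>s. N #> s) ` S) \<subseteq> carrier (G Mod N)"
    by (rule h.H.generate_incl) (use S(2) coset_closed in blast)
  show "carrier (G Mod N) \<subseteq> generate (G Mod N) ((\<lambda>s. N #> s) ` S)"
  proof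
    fix X assume "X \<in> carrier (G Mod N)"
    then obtain g where g: "g \<in> carrier G" "X = N #> g" by (rule coset_cases)
    have "g \<in> T closure_of (generate G S)" using g(1) S(3) by simp
    moreover have "g \<in> N #> g" by (rule rcos_self[OF g(1) NN_subgroup[OF N]])
    ultimately obtain y where y: "y \<in> generate G S" "y \<in> N #> g"
      using open_r_coset[OF NN_open[OF N] g(1)] unfolding in_closure_of by blast
    have "N #> g = N #> y" by (rule repr_independence[OF y(2) g(1) NN_subgroup[OF N]])
    moreover have "(\<lambda>x. N #> x) ` generate G S = generate (G Mod N) ((\<lambda>s. N #> s) ` S)"
      by (rule h.generate_img[OF S(2), symmetric])
    ultimately show "X \<in> generate (G Mod N) ((\<lambda>s. N #> s) ` S)" using y(1) g(2) by blast
  qed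
qed

lemma coset_Pi: "(\<lambda>s. N #> s) \<in> S \<rightarrow> carrier (G Mod N)"
  using S(2) coset_closed by blast

lemma embed_minus_one:
  assumes s: "s \<in> S"
  shows "embed s \<ominus>\<^bsub>Lam\<^esub> \<one>\<^bsub>Lam\<^esub> \<in> augI"
    and "N \<in> NN \<Longrightarrow> (embed s \<ominus>\<^bsub>Lam\<^esub> \<one>\<^bsub>Lam\<^esub>) N = level_delta N (N #> s) \<ominus>\<^bsub>level N\<^esub> \<one>\<^bsub>level N\<^esub>"
proof -
  interpret L: ring Lam by (rule Lam_ring)
  have sG: "s \<in> carrier G" using s S(2) by blast
  show eq: "(embed s \<ominus>\<^bsub>Lam\<^esub> \<one>\<^bsub>Lam\<^esub>) N = level_delta N (N #> s) \<ominus>\<^bsub>level N\<^esub> \<one>\<^bsub>level N\<^esub>" if N: "N \<in> NN" for N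
    using ring_hom_minus[OF Lam_ring level_ring[OF N] eval_ring_hom[OF N] embed_closed[OF sG] Lam_one_closed] N
    by (simp add: embed_level Lam_one)
  show "embed s \<ominus>\<^bsub>Lam\<^esub> \<one>\<^bsub>Lam\<^esub> \<in> augI"
    unfolding augI_iff
  proof (intro conjI ballI)
    show "embed s \<ominus>\<^bsub>Lam\<^esub> \<one>\<^bsub>Lam\<^esub> \<in> carrier Lam" by (rule L.minus_closed[OF embed_closed[OF sG] Lam_one_closed])
    show "(embed s \<ominus>\<^bsub>Lam\<^esub> \<one>\<^bsub>Lam\<^esub>) N \<in> level_aug N" if N: "N \<in> NN" for N
      unfolding eq[OF N] by (rule finite_group_algebra.delta_minus_one_aug[OF level_algebra[OF N] coset_closed[OF sG]])
  qed
qed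

lemma level_aug_pow_Suc:
  assumes N: "N \<in> NN" and x: "x \<in> ideal_pow (level N) (level_aug N) (Suc n)"
  shows "\<exists>c\<in>S \<rightarrow> ideal_pow (level N) (level_aug N) n.
    x = (\<Oplus>\<^bsub>level N\<^esub>s\<in>S. c s \<otimes>\<^bsub>level N\<^esub> (level_delta N (N #> s) \<ominus>\<^bsub>level N\<^esub> \<one>\<^bsub>level N\<^esub>))"
proof (rule ring.ideal_pow_Suc_generators[OF level_ring[OF N] finite_group_algebra.aug_ideal[OF level_algebra[OF N]] S(1) _ _ x])
  show "(\<lambda>s. level_delta N (N #> s) \<ominus>\<^bsub>level N\<^esub> \<one>\<^bsub>level N\<^esub>) \<in> S \<rightarrow> level_aug N"
    using finite_group_algebra.delta_minus_one_aug[OF level_algebra[OF N]] coset_closed S(2) by blast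
  show "\<exists>c\<in>S \<rightarrow> carrier (level N). a = (\<Oplus>\<^bsub>level N\<^esub>s\<in>S. c s \<otimes>\<^bsub>level N\<^esub> (level_delta N (N #> s) \<ominus>\<^bsub>level N\<^esub> \<one>\<^bsub>level N\<^esub>))"
    if "a \<in> level_aug N" for a
    by (rule finite_group_algebra.aug_generators[OF level_algebra[OF N] S(1) coset_Pi quotient_generate[OF N] that])
qed

lemma card_level_aug_pow_le:
  assumes N: "N \<in> NN"
  shows "card (ideal_pow (level N) (level_aug N) n)
    \<le> ((\<lambda>c. c ^ card S) ^^ n) p * card (ideal_pow (level N) (level_aug N) (Suc n))"
  by (rule finite_group_algebra.card_aug_pow_le[OF level_algebra[OF N] S(1) coset_Pi quotient_generate[OF N]])

lemma eval_combination:
  assumes N: "N \<in> NN" and c: "\<And>s. s \<in> S \<Longrightarrow> c s \<in> carrier Lam"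
  shows "(\<Oplus>\<^bsub>Lam\<^esub>s\<in>S. c s \<otimes>\<^bsub>Lam\<^esub> (embed s \<ominus>\<^bsub>Lam\<^esub> \<one>\<^bsub>Lam\<^esub>)) N
    = (\<Oplus>\<^bsub>level N\<^esub>s\<in>S. c s N \<otimes>\<^bsub>level N\<^esub> (level_delta N (N #> s) \<ominus>\<^bsub>level N\<^esub> \<one>\<^bsub>level N\<^esub>))"
proof -
  interpret R: ring "level N" by (rule level_ring[OF N])
  have b: "embed s \<ominus>\<^bsub>Lam\<^esub> \<one>\<^bsub>Lam\<^esub> \<in> carrier Lam" if "s \<in> S" for s
    using embed_minus_one(1)[OF that] augI_iff by blast
  have cl: "(\<lambda>s. c s \<otimes>\<^bsub>Lam\<^esub> (embed s \<ominus>\<^bsub>Lam\<^esub> \<one>\<^bsub>Lam\<^esub>)) \<in> S \<rightarrow> carrier Lam"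
    using Lam_mult_closed[OF c b] by blast
  have d: "level_delta N (N #> s) \<ominus>\<^bsub>level N\<^esub> \<one>\<^bsub>level N\<^esub> \<in> carrier (level N)" if "s \<in> S" for s
    using Lam_level[OF b[OF that] N] embed_minus_one(2)[OF that N] by simp
  have "(\<Oplus>\<^bsub>Lam\<^esub>s\<in>S. c s \<otimes>\<^bsub>Lam\<^esub> (embed s \<ominus>\<^bsub>Lam\<^esub> \<one>\<^bsub>Lam\<^esub>)) N
    = (\<Oplus>\<^bsub>level N\<^esub>s\<in>S. (c s \<otimes>\<^bsub>Lam\<^esub> (embed s \<ominus>\<^bsub>Lam\<^esub> \<one>\<^bsub>Lam\<^esub>)) N)"
    by (rule ring_hom_finsum[OF Lam_ring level_ring[OF N] eval_ring_hom[OF N] S(1) cl])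
  also have "\<dots> = (\<Oplus>\<^bsub>level N\<^esub>s\<in>S. c s N \<otimes>\<^bsub>level N\<^esub> (level_delta N (N #> s) \<ominus>\<^bsub>level N\<^esub> \<one>\<^bsub>level N\<^esub>))"
  proof (rule R.finsum_cong'[OF refl])
    show "(\<lambda>s. c s N \<otimes>\<^bsub>level N\<^esub> (level_delta N (N #> s) \<ominus>\<^bsub>level N\<^esub> \<one>\<^bsub>level N\<^esub>)) \<in> S \<rightarrow> carrier (level N)"
      using R.m_closed[OF Lam_level[OF c N] d] by blast
    show "(c s \<otimes>\<^bsub>Lam\<^esub> (embed s \<ominus>\<^bsub>Lam\<^esub> \<one>\<^bsub>Lam\<^esub>)) N
        = c s N \<otimes>\<^bsub>level N\<^esub> (level_delta N (N #> s) \<ominus>\<^bsub>level N\<^esub> \<one>\<^bsub>level N\<^esub>)" if "s \<in> S" for s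
      using N embed_minus_one(2)[OF that N] by (simp add: Lam_mult)
  qed
  finally show ?thesis .
qed

lemma combination_aug_pow:
  assumes "c \<in> S \<rightarrow> ideal_pow Lam augI n"
  shows "(\<Oplus>\<^bsub>Lam\<^esub>s\<in>S. c s \<otimes>\<^bsub>Lam\<^esub> (embed s \<ominus>\<^bsub>Lam\<^esub> \<one>\<^bsub>Lam\<^esub>)) \<in> ideal_pow Lam augI (Suc n)"
  by (rule ring.ideal_pow_Suc_combination[OF Lam_ring augI_ideal S(1) _ assms]) (use embed_minus_one(1) in blast)

text \<open>The generators of the augmentation ideal at level N lift to \<open>embed s\<close> - 1,
  so only the coefficients of a combination must be lifted, and these lie in the preceding
  power.\<close>

lemma eval_aug_pow_surj:
  assumes N: "N \<in> NN"
  shows "f \<in> ideal_pow (level N) (level_aug N) n \<Longrightarrow> \<exists>\<phi>\<in>ideal_pow Lam augI n. \<phi> N = f"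
proof (induction n arbitrary: f)
  case 0
  then show ?case using eval_surj[OF N] by (simp add: ring.ideal_pow_0[OF Lam_ring] ring.ideal_pow_0[OF level_ring[OF N]])
next
  case (Suc n)
  obtain c where c: "c \<in> S \<rightarrow> ideal_pow (level N) (level_aug N) n"
    "f = (\<Oplus>\<^bsub>level N\<^esub>s\<in>S. c s \<otimes>\<^bsub>level N\<^esub> (level_delta N (N #> s) \<ominus>\<^bsub>level N\<^esub> \<one>\<^bsub>level N\<^esub>))"
    using level_aug_pow_Suc[OF N Suc.prems] by (elim bexE)
  have "\<forall>s\<in>S. \<exists>\<phi>\<in>ideal_pow Lam augI n. \<phi> N = c s" using Suc.IH c(1) by blast
  then obtain d where d: "\<And>s. s \<in> S \<Longrightarrow> d s \<in> ideal_pow Lam augI n" "\<And>s. s \<in> S \<Longrightarrow> d s N = c s"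
    using bchoice[of S "\<lambda>s \<phi>. \<phi> \<in> ideal_pow Lam augI n \<and> \<phi> N = c s"] by blast
  interpret R: ring "level N" by (rule level_ring[OF N])
  have dc: "d s \<in> carrier Lam" if "s \<in> S" for s
    by (rule ring.ideal_pow_carrier[OF Lam_ring augI_ideal d(1)[OF that]])
  have "(\<Oplus>\<^bsub>Lam\<^esub>s\<in>S. d s \<otimes>\<^bsub>Lam\<^esub> (embed s \<ominus>\<^bsub>Lam\<^esub> \<one>\<^bsub>Lam\<^esub>)) N
    = (\<Oplus>\<^bsub>level N\<^esub>s\<in>S. d s N \<otimes>\<^bsub>level N\<^esub> (level_delta N (N #> s) \<ominus>\<^bsub>level N\<^esub> \<one>\<^bsub>level N\<^esub>))"
    by (rule eval_combination[OF N dc])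
  also have "\<dots> = f" unfolding c(2)
  proof (rule R.finsum_cong'[OF refl])
    show "(\<lambda>s. c s \<otimes>\<^bsub>level N\<^esub> (level_delta N (N #> s) \<ominus>\<^bsub>level N\<^esub> \<one>\<^bsub>level N\<^esub>)) \<in> S \<rightarrow> carrier (level N)"
    proof
      fix s assume s: "s \<in> S"
      have "c s \<in> carrier (level N)" using Lam_level[OF dc[OF s] N] d(2)[OF s] by simp
      moreover have "level_delta N (N #> s) \<in> carrier (level N)"
        by (rule finite_group_algebra.delta_closed[OF level_algebra[OF N]]) (use coset_closed s S(2) in blast)
      ultimately show "c s \<otimes>\<^bsub>level N\<^esub> (level_delta N (N #> s) \<ominus>\<^bsub>level N\<^esub> \<one>\<^bsub>level N\<^esub>) \<in> carrier (level N)" by simp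
    qed
  qed (simp add: d(2))
  finally show ?case using combination_aug_pow[of d n] d(1) by blast
qed

text \<open>By compactness, membership in a power of the augmentation ideal can be tested at all finite
  levels. This uses that the ideal has finitely many generators.\<close>

lemma aug_pow_closed:
  assumes "\<phi> \<in> carrier Lam" "\<And>N. N \<in> NN \<Longrightarrow> \<phi> N \<in> ideal_pow (level N) (level_aug N) n"
  shows "\<phi> \<in> ideal_pow Lam augI n"
  using assms
proof (induction n arbitrary: \<phi>)
  case 0
  then show ?case by (simp add: ring.ideal_pow_0[OF Lam_ring])
next
  case (Suc n)
  \<comment> \<open>\<open>C N\<close> is the finite non-empty set of coefficient families in I^n
    that express \<open>\<phi>\<close> at level N, and \<open>P\<close> projects such families. A
    compatible choice of them is a family of coefficients in the completed algebra, to which the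
    induction hypothesis applies.\<close>
  define C where "C N = {c \<in> S \<rightarrow>\<^sub>E ideal_pow (level N) (level_aug N) n.
    \<phi> N = (\<Oplus>\<^bsub>level N\<^esub>s\<in>S. c s \<otimes>\<^bsub>level N\<^esub> (level_delta N (N #> s) \<ominus>\<^bsub>level N\<^esub> \<one>\<^bsub>level N\<^esub>))}" for N
  define P where "P N M c = (\<lambda>s\<in>S. proj N M (c s))" for N M and c :: "'a \<Rightarrow> 'a set \<Rightarrow> int"
  have powc: "ideal_pow (level N) (level_aug N) k \<subseteq> carrier (level N)" if N: "N \<in> NN" for N k
    by (rule ring.ideal_pow_subset[OF level_ring[OF N] finite_group_algebra.aug_ideal[OF level_algebra[OF N]]])
  have dl: "level_delta N (N #> s) \<ominus>\<^bsub>level N\<^esub> \<one>\<^bsub>level N\<^esub> \<in> carrier (level N)" if N: "N \<in> NN" and s: "s \<in> S" for N s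
  proof -
    have "embed s \<ominus>\<^bsub>Lam\<^esub> \<one>\<^bsub>Lam\<^esub> \<in> carrier Lam" using embed_minus_one(1)[OF s] augI_iff by blast
    then show ?thesis using Lam_level[OF _ N] embed_minus_one(2)[OF s N] by fastforce
  qed
  have "\<exists>c\<in>Pi\<^sub>E NN C. \<forall>N\<in>NN. \<forall>M\<in>NN. N \<subseteq> M \<longrightarrow> P N M (c N) = c M"
  proof (rule inverse_limit_nonempty)
    fix N assume N: "N \<in> NN"
    have "finite (ideal_pow (level N) (level_aug N) n)"
      by (rule finite_subset[OF powc[OF N] finite_group_algebra.finite_GA[OF level_algebra[OF N]]])
    then have "finite (S \<rightarrow>\<^sub>E ideal_pow (level N) (level_aug N) n)" using S(1) by (intro finite_PiE)
    then show "finite (C N)" unfolding C_def by simp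
    obtain c where c: "c \<in> S \<rightarrow> ideal_pow (level N) (level_aug N) n"
      "\<phi> N = (\<Oplus>\<^bsub>level N\<^esub>s\<in>S. c s \<otimes>\<^bsub>level N\<^esub> (level_delta N (N #> s) \<ominus>\<^bsub>level N\<^esub> \<one>\<^bsub>level N\<^esub>))"
      using level_aug_pow_Suc[OF N Suc.prems(2)[OF N]] by (elim bexE)
    interpret R: ring "level N" by (rule level_ring[OF N])
    have "(\<Oplus>\<^bsub>level N\<^esub>s\<in>S. restrict c S s \<otimes>\<^bsub>level N\<^esub> (level_delta N (N #> s) \<ominus>\<^bsub>level N\<^esub> \<one>\<^bsub>level N\<^esub>))
      = (\<Oplus>\<^bsub>level N\<^esub>s\<in>S. c s \<otimes>\<^bsub>level N\<^esub> (level_delta N (N #> s) \<ominus>\<^bsub>level N\<^esub> \<one>\<^bsub>level N\<^esub>))"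
    proof (rule R.finsum_cong'[OF refl])
      show "(\<lambda>s. c s \<otimes>\<^bsub>level N\<^esub> (level_delta N (N #> s) \<ominus>\<^bsub>level N\<^esub> \<one>\<^bsub>level N\<^esub>)) \<in> S \<rightarrow> carrier (level N)"
      proof
        fix s assume s: "s \<in> S"
        have "c s \<in> carrier (level N)" using c(1) s powc[OF N] by blast
        then show "c s \<otimes>\<^bsub>level N\<^esub> (level_delta N (N #> s) \<ominus>\<^bsub>level N\<^esub> \<one>\<^bsub>level N\<^esub>) \<in> carrier (level N)"
          by (rule R.m_closed[OF _ dl[OF N s]])
      qed
    qed simp
    then have "restrict c S \<in> C N" unfolding C_def using c by (simp add: restrict_PiE_iff Pi_def)
    then show "C N \<noteq> {}" by blast
  next
    fix N M c assume N: "N \<in> NN" and M: "M \<in> NN" and NM: "N \<subseteq> M" and c: "c \<in> C N"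
    interpret h: finite_group_algebra_hom "G Mod N" "G Mod M" p "\<lambda>X. M <#> X" by (rule level_hom[OF N M NM])
    have c1: "c \<in> S \<rightarrow>\<^sub>E ideal_pow (level N) (level_aug N) n" and
      c2: "\<phi> N = (\<Oplus>\<^bsub>level N\<^esub>s\<in>S. c s \<otimes>\<^bsub>level N\<^esub> (level_delta N (N #> s) \<ominus>\<^bsub>level N\<^esub> \<one>\<^bsub>level N\<^esub>))"
      using c unfolding C_def by blast+
    have cc: "c s \<in> carrier (level N)" if "s \<in> S" for s using c1 that powc[OF N] by blast
    have dc: "proj N M (c s) \<in> carrier (level M)" if "s \<in> S" for s by (rule h.push_closed[OF cc[OF that]])
    interpret RN: ring "level N" by (rule level_ring[OF N])
    interpret RM: ring "level M" by (rule level_ring[OF M])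
    have "\<phi> M = proj N M (\<phi> N)" using Lam_proj[OF Suc.prems(1) N M NM] by simp
    also have "\<dots> = (\<Oplus>\<^bsub>level M\<^esub>s\<in>S. proj N M (c s \<otimes>\<^bsub>level N\<^esub> (level_delta N (N #> s) \<ominus>\<^bsub>level N\<^esub> \<one>\<^bsub>level N\<^esub>)))"
      unfolding c2 by (rule ring_hom_finsum[OF level_ring[OF N] level_ring[OF M] h.push_ring_hom S(1)])
        (use RN.m_closed[OF cc dl[OF N]] in blast)
    also have "\<dots> = (\<Oplus>\<^bsub>level M\<^esub>s\<in>S. P N M c s \<otimes>\<^bsub>level M\<^esub> (level_delta M (M #> s) \<ominus>\<^bsub>level M\<^esub> \<one>\<^bsub>level M\<^esub>))"
    proof (rule RM.finsum_cong'[OF refl])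
      show "(\<lambda>s. P N M c s \<otimes>\<^bsub>level M\<^esub> (level_delta M (M #> s) \<ominus>\<^bsub>level M\<^esub> \<one>\<^bsub>level M\<^esub>)) \<in> S \<rightarrow> carrier (level M)"
      proof
        fix s assume s: "s \<in> S"
        show "P N M c s \<otimes>\<^bsub>level M\<^esub> (level_delta M (M #> s) \<ominus>\<^bsub>level M\<^esub> \<one>\<^bsub>level M\<^esub>) \<in> carrier (level M)"
          using RM.m_closed[OF dc[OF s] dl[OF M s]] s by (simp add: P_def)
      qed
      fix s assume s: "s \<in> S"
      have sG: "s \<in> carrier G" using s S(2) by blast
      show "proj N M (c s \<otimes>\<^bsub>level N\<^esub> (level_delta N (N #> s) \<ominus>\<^bsub>level N\<^esub> \<one>\<^bsub>level N\<^esub>))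
        = P N M c s \<otimes>\<^bsub>level M\<^esub> (level_delta M (M #> s) \<ominus>\<^bsub>level M\<^esub> \<one>\<^bsub>level M\<^esub>)"
        unfolding h.push_mult[OF cc[OF s] dl[OF N s]] h.push_delta_minus_one[OF coset_closed[OF sG]]
          coset_coarsen[OF N M NM sG] using s by (simp add: P_def)
    qed
    finally have "\<phi> M = (\<Oplus>\<^bsub>level M\<^esub>s\<in>S. P N M c s \<otimes>\<^bsub>level M\<^esub> (level_delta M (M #> s) \<ominus>\<^bsub>level M\<^esub> \<one>\<^bsub>level M\<^esub>))" .
    moreover have "P N M c \<in> S \<rightarrow>\<^sub>E ideal_pow (level M) (level_aug M) n"
      unfolding P_def restrict_PiE_iff using h.push_aug_pow c1 by blast
    ultimately show "P N M c \<in> C M" unfolding C_def by blast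
  next
    fix N M L c assume N: "N \<in> NN" and M: "M \<in> NN" and L: "L \<in> NN" and NM: "N \<subseteq> M" and LM: "M \<subseteq> L" and c: "c \<in> C N"
    have c1: "c \<in> S \<rightarrow>\<^sub>E ideal_pow (level N) (level_aug N) n" using c unfolding C_def by blast
    have cc: "c s \<in> carrier (level N)" if "s \<in> S" for s using c1 that powc[OF N] by blast
    show "P M L (P N M c) = P N L c"
      unfolding P_def by (rule restrict_ext) (simp add: proj_compose[OF N M L NM LM cc])
  next
    fix F assume "finite F" "F \<subseteq> NN"
    then show "\<exists>k\<in>NN. \<forall>i\<in>F. k \<subseteq> i" by (rule finite_NN_lower)
  qed blast
  then obtain c where c: "c \<in> Pi\<^sub>E NN C" "\<And>N M. N \<in> NN \<Longrightarrow> M \<in> NN \<Longrightarrow> N \<subseteq> M \<Longrightarrow> P N M (c N) = c M" by blast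
  have cC: "c N \<in> C N" if "N \<in> NN" for N using c(1) that by (rule PiE_mem)
  have cpow: "c N s \<in> ideal_pow (level N) (level_aug N) n" if N: "N \<in> NN" and s: "s \<in> S" for N s
  proof -
    have "c N \<in> S \<rightarrow>\<^sub>E ideal_pow (level N) (level_aug N) n" using cC[OF N] unfolding C_def by blast
    then show ?thesis using s by (rule PiE_mem)
  qed
  define d where "d s = (\<lambda>N\<in>NN. c N s)" for s
  have dL: "d s \<in> carrier Lam" if s: "s \<in> S" for s
    unfolding d_def
  proof (rule Lam_intro)
    show "c N s \<in> carrier (level N)" if N: "N \<in> NN" for N using cpow[OF N s] powc[OF N] by blast
    show "proj N M (c N s) = c M s" if "N \<in> NN" "M \<in> NN" "N \<subseteq> M" for N M
      using fun_cong[OF c(2)[OF that], of s] s by (simp add: P_def)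
  qed
  have "d s \<in> ideal_pow Lam augI n" if s: "s \<in> S" for s
    by (rule Suc.IH[OF dL[OF s]]) (simp add: d_def cpow[OF _ s])
  then have "(\<Oplus>\<^bsub>Lam\<^esub>s\<in>S. d s \<otimes>\<^bsub>Lam\<^esub> (embed s \<ominus>\<^bsub>Lam\<^esub> \<one>\<^bsub>Lam\<^esub>)) \<in> ideal_pow Lam augI (Suc n)" (is "?D \<in> _")
    by (intro combination_aug_pow) blast
  moreover have "\<phi> = ?D"
  proof (rule Lam_eqI[OF Suc.prems(1)])
    show "?D \<in> carrier Lam" by (rule ring.ideal_pow_carrier[OF Lam_ring augI_ideal calculation])
    fix N assume N: "N \<in> NN"
    have "\<phi> N = (\<Oplus>\<^bsub>level N\<^esub>s\<in>S. c N s \<otimes>\<^bsub>level N\<^esub> (level_delta N (N #> s) \<ominus>\<^bsub>level N\<^esub> \<one>\<^bsub>level N\<^esub>))"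
      using cC[OF N] unfolding C_def by blast
    moreover have "d s N = c N s" for s using N by (simp add: d_def)
    ultimately have "\<phi> N = (\<Oplus>\<^bsub>level N\<^esub>s\<in>S. d s N \<otimes>\<^bsub>level N\<^esub> (level_delta N (N #> s) \<ominus>\<^bsub>level N\<^esub> \<one>\<^bsub>level N\<^esub>))"
      by (simp only:)
    also have "\<dots> = ?D N" by (rule eval_combination[OF N dL, symmetric])
    finally show "\<phi> N = ?D N" .
  qed
  ultimately show ?case by simp
qed

end

end

section \<open>Dimension subgroups and the Zassenhaus filtration\<close>

context finite_group_algebra
begin

definition dimension_subgroup :: "nat \<Rightarrow> 'a set" where
  "dimension_subgroup n = {x \<in> carrier Q. delta x \<ominus>\<^bsub>GA\<^esub> \<one>\<^bsub>GA\<^esub> \<in> ideal_pow GA aug n}"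

lemma dimension_subgroup_subgroup: "subgroup (dimension_subgroup n) Q"
proof -
  interpret GA: ring GA by (rule ring_GA)
  note I = GA.ideal_pow_ideal[OF aug_ideal, of n]
  have add: "x \<oplus>\<^bsub>GA\<^esub> y \<in> ideal_pow GA aug n" if "x \<in> ideal_pow GA aug n" "y \<in> ideal_pow GA aug n" for x y
    using subgroup.m_closed[OF GA.ideal_pow_subgroup[OF aug_ideal] that] by simp
  show ?thesis
  proof (rule subgroupI)
    have "delta \<one> \<ominus>\<^bsub>GA\<^esub> \<one>\<^bsub>GA\<^esub> = \<zero>\<^bsub>GA\<^esub>" unfolding one_GA[symmetric] by (simp add: GA.minus_eq GA.r_neg)
    moreover have "\<zero>\<^bsub>GA\<^esub> \<in> ideal_pow GA aug n"
      using subgroup.one_closed[OF GA.ideal_pow_subgroup[OF aug_ideal, of n]] by simp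
    ultimately have "\<one> \<in> dimension_subgroup n"
      unfolding dimension_subgroup_def by (intro CollectI conjI one_closed) (simp only:)
    then show "dimension_subgroup n \<noteq> {}" by blast
  next
    fix a b assume a: "a \<in> dimension_subgroup n" and b: "b \<in> dimension_subgroup n"
    have c: "a \<in> carrier Q" "b \<in> carrier Q" using a b by (auto simp: dimension_subgroup_def)
    have m: "delta a \<ominus>\<^bsub>GA\<^esub> \<one>\<^bsub>GA\<^esub> \<in> ideal_pow GA aug n" "delta b \<ominus>\<^bsub>GA\<^esub> \<one>\<^bsub>GA\<^esub> \<in> ideal_pow GA aug n"
      using a b by (auto simp: dimension_subgroup_def)
    have mc: "delta a \<ominus>\<^bsub>GA\<^esub> \<one>\<^bsub>GA\<^esub> \<in> carrier GA" using c by simp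
    have "delta (a \<otimes> b) \<ominus>\<^bsub>GA\<^esub> \<one>\<^bsub>GA\<^esub> = (delta a \<ominus>\<^bsub>GA\<^esub> \<one>\<^bsub>GA\<^esub>) \<oplus>\<^bsub>GA\<^esub> (delta b \<ominus>\<^bsub>GA\<^esub> \<one>\<^bsub>GA\<^esub>)
        \<oplus>\<^bsub>GA\<^esub> (delta a \<ominus>\<^bsub>GA\<^esub> \<one>\<^bsub>GA\<^esub>) \<otimes>\<^bsub>GA\<^esub> (delta b \<ominus>\<^bsub>GA\<^esub> \<one>\<^bsub>GA\<^esub>)"
      unfolding delta_mult[OF c, symmetric] by (rule GA.mult_minus_one) (use c in simp_all)
    also have "\<dots> \<in> ideal_pow GA aug n"
      by (intro add m ideal.I_l_closed[OF I m(2) mc])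
    finally show "a \<otimes> b \<in> dimension_subgroup n" using c by (simp add: dimension_subgroup_def)
  next
    fix a assume a: "a \<in> dimension_subgroup n"
    have c: "a \<in> carrier Q" "inv a \<in> carrier Q" using a by (auto simp: dimension_subgroup_def)
    have m: "delta a \<ominus>\<^bsub>GA\<^esub> \<one>\<^bsub>GA\<^esub> \<in> ideal_pow GA aug n" using a by (auto simp: dimension_subgroup_def)
    have "(\<ominus>\<^bsub>GA\<^esub> delta (inv a)) \<otimes>\<^bsub>GA\<^esub> (delta a \<ominus>\<^bsub>GA\<^esub> \<one>\<^bsub>GA\<^esub>) \<in> ideal_pow GA aug n"
      by (rule ideal.I_l_closed[OF I m]) (use c in simp)
    moreover have "(\<ominus>\<^bsub>GA\<^esub> delta (inv a)) \<otimes>\<^bsub>GA\<^esub> (delta a \<ominus>\<^bsub>GA\<^esub> \<one>\<^bsub>GA\<^esub>) = delta (inv a) \<ominus>\<^bsub>GA\<^esub> \<one>\<^bsub>GA\<^esub>"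
      using c by (simp add: GA.minus_eq GA.r_distr GA.r_minus GA.l_minus delta_mult one_GA[symmetric] GA.a_comm)
    ultimately show "inv a \<in> dimension_subgroup n" using c by (simp add: dimension_subgroup_def)
  qed (auto simp: dimension_subgroup_def)
qed

text \<open>(x - 1)(y - 1) - (y - 1)(x - 1) equals y x times the commutator minus one; the left side
  is in I^(i+j), and the unit y x can be cancelled.\<close>

lemma dimension_subgroup_comm:
  assumes x: "x \<in> dimension_subgroup i" and y: "y \<in> dimension_subgroup j"
  shows "inv x \<otimes> inv y \<otimes> x \<otimes> y \<in> dimension_subgroup (i + j)"
proof -
  interpret GA: ring GA by (rule ring_GA)
  have c: "x \<in> carrier Q" "y \<in> carrier Q" using x y by (auto simp: dimension_subgroup_def)
  have m: "delta x \<ominus>\<^bsub>GA\<^esub> \<one>\<^bsub>GA\<^esub> \<in> ideal_pow GA aug i" "delta y \<ominus>\<^bsub>GA\<^esub> \<one>\<^bsub>GA\<^esub> \<in> ideal_pow GA aug j"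
    using x y by (auto simp: dimension_subgroup_def)
  let ?k = "inv x \<otimes> inv y \<otimes> x \<otimes> y"
  have kc: "?k \<in> carrier Q" using c by simp
  define A where "A = (delta x \<ominus>\<^bsub>GA\<^esub> \<one>\<^bsub>GA\<^esub>) \<otimes>\<^bsub>GA\<^esub> (delta y \<ominus>\<^bsub>GA\<^esub> \<one>\<^bsub>GA\<^esub>)"
  define B where "B = (delta y \<ominus>\<^bsub>GA\<^esub> \<one>\<^bsub>GA\<^esub>) \<otimes>\<^bsub>GA\<^esub> (delta x \<ominus>\<^bsub>GA\<^esub> \<one>\<^bsub>GA\<^esub>)"
  have AB: "A \<in> ideal_pow GA aug (i + j)" "B \<in> ideal_pow GA aug (i + j)"
    unfolding A_def B_def using GA.ideal_pow_mult[OF aug_ideal m] GA.ideal_pow_mult[OF aug_ideal m(2,1)]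
    by (simp_all add: add.commute)
  have cancel: "a \<otimes> (inv a \<otimes> b) = b" if "a \<in> carrier Q" "b \<in> carrier Q" for a b
    using that m_assoc[of a "inv a" b] by simp
  have "y \<otimes> x \<otimes> ?k = x \<otimes> y" using c by (simp add: m_assoc cancel)
  then have k: "delta x \<otimes>\<^bsub>GA\<^esub> delta y = delta y \<otimes>\<^bsub>GA\<^esub> delta x \<otimes>\<^bsub>GA\<^esub> delta ?k"
    using c kc by (simp add: delta_mult)
  have eq: "A \<ominus>\<^bsub>GA\<^esub> B = (delta ?k \<ominus>\<^bsub>GA\<^esub> \<one>\<^bsub>GA\<^esub>) \<oplus>\<^bsub>GA\<^esub>
      (delta y \<otimes>\<^bsub>GA\<^esub> delta x \<ominus>\<^bsub>GA\<^esub> \<one>\<^bsub>GA\<^esub>) \<otimes>\<^bsub>GA\<^esub> (delta ?k \<ominus>\<^bsub>GA\<^esub> \<one>\<^bsub>GA\<^esub>)"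
    unfolding A_def B_def
    by (rule GA.commutator_minus_one[OF delta_closed[OF c(1)] delta_closed[OF c(2)] delta_closed[OF kc] k])
  define d where "d = delta ?k \<ominus>\<^bsub>GA\<^esub> \<one>\<^bsub>GA\<^esub>"
  have dc: "d \<in> carrier GA" using kc by (simp add: d_def)
  have "A \<ominus>\<^bsub>GA\<^esub> B = delta (y \<otimes> x) \<otimes>\<^bsub>GA\<^esub> d"
    unfolding eq d_def[symmetric] using c dc
    by (simp add: delta_mult GA.minus_eq GA.l_distr GA.l_minus GA.a_ac GA.r_neg GA.r_neg1 GA.r_neg2)
  moreover have "A \<ominus>\<^bsub>GA\<^esub> B \<in> ideal_pow GA aug (i + j)"
    using subgroup.m_closed[OF GA.ideal_pow_subgroup[OF aug_ideal] AB(1)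
        subgroup.m_inv_closed[OF GA.ideal_pow_subgroup[OF aug_ideal] AB(2)]]
    by (simp add: GA.minus_eq a_inv_def)
  ultimately have "delta (inv (y \<otimes> x)) \<otimes>\<^bsub>GA\<^esub> (delta (y \<otimes> x) \<otimes>\<^bsub>GA\<^esub> d) \<in> ideal_pow GA aug (i + j)"
    using ideal.I_l_closed[OF GA.ideal_pow_ideal[OF aug_ideal], of "delta (y \<otimes> x) \<otimes>\<^bsub>GA\<^esub> d" "i + j" "delta (inv (y \<otimes> x))"] c
    by simp
  moreover have "delta (inv (y \<otimes> x)) \<otimes>\<^bsub>GA\<^esub> (delta (y \<otimes> x) \<otimes>\<^bsub>GA\<^esub> d) = d"
  proof -
    have "delta (inv (y \<otimes> x)) \<otimes>\<^bsub>GA\<^esub> (delta (y \<otimes> x) \<otimes>\<^bsub>GA\<^esub> d) = (delta (inv (y \<otimes> x)) \<otimes>\<^bsub>GA\<^esub> delta (y \<otimes> x)) \<otimes>\<^bsub>GA\<^esub> d"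
      by (rule GA.m_assoc[symmetric]) (use c dc in simp_all)
    also have "delta (inv (y \<otimes> x)) \<otimes>\<^bsub>GA\<^esub> delta (y \<otimes> x) = \<one>\<^bsub>GA\<^esub>"
      using c by (simp add: delta_mult one_GA del: inv_mult_group)
    finally show ?thesis using dc by simp
  qed
  ultimately show ?thesis using kc by (simp add: dimension_subgroup_def d_def)
qed

lemma delta_pow: "x \<in> carrier Q \<Longrightarrow> delta (x [^] (k::nat)) = delta x [^]\<^bsub>GA\<^esub> k"
proof (induction k)
  case 0
  interpret GA: ring GA by (rule ring_GA)
  show ?case by (simp flip: one_GA)
next
  case (Suc k)
  interpret GA: ring GA by (rule ring_GA)
  show ?case using delta_mult[of "x [^] k" x] Suc by simp
qed

lemma dimension_subgroup_pow:
  assumes "prime p" and x: "x \<in> dimension_subgroup i"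
  shows "x [^] p \<in> dimension_subgroup (p * i)"
proof -
  interpret GA: ring GA by (rule ring_GA)
  have c: "x \<in> carrier Q" and m: "delta x \<ominus>\<^bsub>GA\<^esub> \<one>\<^bsub>GA\<^esub> \<in> ideal_pow GA aug i"
    using x by (auto simp: dimension_subgroup_def)
  define d where "d = delta x \<ominus>\<^bsub>GA\<^esub> \<one>\<^bsub>GA\<^esub>"
  have dc: "d \<in> carrier GA" using c by (simp add: d_def)
  have "delta x = \<one>\<^bsub>GA\<^esub> \<oplus>\<^bsub>GA\<^esub> d" using c by (simp add: d_def GA.minus_eq GA.a_lcomm[of "\<one>\<^bsub>GA\<^esub>"] GA.r_neg)
  then have "delta (x [^] p) = \<one>\<^bsub>GA\<^esub> \<oplus>\<^bsub>GA\<^esub> d [^]\<^bsub>GA\<^esub> p"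
    using GA.frobenius_one_plus[OF assms(1) char_GA dc] c by (simp add: delta_pow)
  then have "delta (x [^] p) \<ominus>\<^bsub>GA\<^esub> \<one>\<^bsub>GA\<^esub> = d [^]\<^bsub>GA\<^esub> p"
    using GA.add_minus_cancel_one[of "d [^]\<^bsub>GA\<^esub> p"] dc by (simp add: GA.a_comm)
  then show ?thesis using GA.ideal_pow_power[OF aug_ideal m, of p] c by (simp add: dimension_subgroup_def d_def)
qed

lemma dimension_subgroup_antimono: "i \<le> j \<Longrightarrow> dimension_subgroup j \<subseteq> dimension_subgroup i"
  using ring.ideal_pow_antimono[OF ring_GA aug_ideal] unfolding dimension_subgroup_def by blast

lemma dimension_subgroup_1: "dimension_subgroup (Suc 0) = carrier Q" "dimension_subgroup 0 = carrier Q"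
  using delta_minus_one_aug ring.ring_simprules(4)[OF ring_GA delta_closed ring.ring_simprules(6)[OF ring_GA]]
  by (auto simp: dimension_subgroup_def ring.ideal_pow_1[OF ring_GA aug_ideal] ring.ideal_pow_0[OF ring_GA])

end

section \<open>The Zassenhaus filtration as a descending chain of closed normal subgroups\<close>

context pro_p_group
begin

lemma p_gt_1: "p > 1" using prime_p by (rule prime_gt_1_nat)

lemma closed_subgroup_generated_subgroup:
  assumes "S \<subseteq> carrier G"
  shows "subgroup (closed_subgroup_generated G T S) G"
    and "closedin T (closed_subgroup_generated G T S)"
    and "S \<subseteq> closed_subgroup_generated G T S"
proof -
  have top: "carrier G \<in> {H. subgroup H G \<and> closedin T H \<and> S \<subseteq> H}"
    using assms subgroup_self closedin_topspace[of T] topspace_eq by simp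
  show "subgroup (closed_subgroup_generated G T S) G"
    unfolding closed_subgroup_generated_def by (rule subgroups_Inter) (use top in auto)
  show "closedin T (closed_subgroup_generated G T S)"
    unfolding closed_subgroup_generated_def by (rule closedin_Inter) (use top in auto)
  show "S \<subseteq> closed_subgroup_generated G T S"
    unfolding closed_subgroup_generated_def by blast
qed

lemma closed_subgroup_generated_least:
  "subgroup H G \<Longrightarrow> closedin T H \<Longrightarrow> S \<subseteq> H \<Longrightarrow> closed_subgroup_generated G T S \<subseteq> H"
  unfolding closed_subgroup_generated_def by blast

lemma continuous_conjugation:
  assumes g: "g \<in> carrier G"
  shows "continuous_map T T (\<lambda>x. g \<otimes> x \<otimes> inv g)"
proof -
  have mult: "continuous_map T T (\<lambda>x. f x \<otimes> h x)" if "continuous_map T T f" "continuous_map T T h" for f h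
    using continuous_map_compose[OF continuous_map_pairedI[OF that] continuous_mult] by (simp add: comp_def)
  show ?thesis
    by (intro mult continuous_map_id[unfolded id_def]) (simp_all add: topspace_eq g)
qed

text \<open>Conjugation by g is continuous, so its preimage of the generated closed subgroup is
  again a closed subgroup, and it contains S.\<close>

lemma closed_subgroup_generated_normal:
  assumes S: "S \<subseteq> carrier G" and conj: "\<And>g x. g \<in> carrier G \<Longrightarrow> x \<in> S \<Longrightarrow> g \<otimes> x \<otimes> inv g \<in> S"
  shows "closed_subgroup_generated G T S \<lhd> G"
proof (rule normal_invI)
  let ?H = "closed_subgroup_generated G T S"
  show H: "subgroup ?H G" by (rule closed_subgroup_generated_subgroup(1)[OF S])
  fix g x assume g: "g \<in> carrier G" and x: "x \<in> ?H"
  let ?K = "{x \<in> carrier G. g \<otimes> x \<otimes> inv g \<in> ?H}"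
  have "subgroup ?K G"
  proof (rule subgroupI)
    show "?K \<noteq> {}" using g subgroup.one_closed[OF H] by (auto intro!: exI[of _ \<one>])
  next
    fix a assume a: "a \<in> ?K"
    have "inv (g \<otimes> a \<otimes> inv g) \<in> ?H" using a subgroup.m_inv_closed[OF H] by blast
    then show "inv a \<in> ?K" using a g by (simp add: inv_mult_group m_assoc)
  next
    fix a b assume a: "a \<in> ?K" and b: "b \<in> ?K"
    have cancel: "inv g \<otimes> (g \<otimes> z) = z" if "z \<in> carrier G" for z
      using that g m_assoc[of "inv g" g z] by simp
    have "(g \<otimes> a \<otimes> inv g) \<otimes> (g \<otimes> b \<otimes> inv g) \<in> ?H" using a b subgroup.m_closed[OF H] by blast
    then show "a \<otimes> b \<in> ?K" using a b g by (simp add: m_assoc cancel)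
  qed auto
  moreover have "closedin T ?K"
    using closedin_continuous_map_preimage[OF continuous_conjugation[OF g] closed_subgroup_generated_subgroup(2)[OF S]]
    by (simp add: topspace_eq)
  moreover have "S \<subseteq> ?K"
    using S conj[OF g] closed_subgroup_generated_subgroup(3)[OF S] by blast
  ultimately have "?H \<subseteq> ?K" by (rule closed_subgroup_generated_least)
  then show "g \<otimes> x \<otimes> inv g \<in> ?H" using x by blast
qed

text \<open>The product is a continuous image of a compact set. Hence the products of closed
  subgroups in the recursive definition are closed as they stand.\<close>

lemma closed_set_mult:
  assumes H: "closedin T H" and K: "closedin T K"
  shows "closedin T (H <#> K)"
proof -
  have "compactin T H" "compactin T K" using H K closedin_compact_space[OF compact] by auto
  then have "compactin (prod_topology T T) (H \<times> K)" by (simp add: compactin_Times)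
  then have "compactin T ((\<lambda>(x, y). x \<otimes> y) ` (H \<times> K))" by (rule image_compactin[OF _ continuous_mult])
  moreover have "(\<lambda>(x, y). x \<otimes> y) ` (H \<times> K) = H <#> K" unfolding set_mult_def by auto
  ultimately show ?thesis using compactin_imp_closedin[OF Hausdorff] by simp
qed

lemma normal_set_mult:
  assumes H: "H \<lhd> G" and K: "K \<lhd> G"
  shows "H <#> K \<lhd> G"
proof (rule normal_invI)
  have Hs: "subgroup H G" and Ks: "subgroup K G" using H K normal_imp_subgroup by auto
  show "subgroup (H <#> K) G" by (rule mult_norm_subgroup[OF H Ks])
  fix g x assume g: "g \<in> carrier G" and "x \<in> H <#> K"
  then obtain h k where h: "h \<in> H" "k \<in> K" "x = h \<otimes> k" unfolding set_mult_def by auto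
  have c: "h \<in> carrier G" "k \<in> carrier G" using h subgroup.mem_carrier[OF Hs] subgroup.mem_carrier[OF Ks] by auto
  have cancel: "inv g \<otimes> (g \<otimes> z) = z" if "z \<in> carrier G" for z
    using that g m_assoc[of "inv g" g z] by simp
  have "g \<otimes> x \<otimes> inv g = (g \<otimes> h \<otimes> inv g) \<otimes> (g \<otimes> k \<otimes> inv g)"
    using g c h(3) by (simp add: m_assoc cancel)
  moreover have "g \<otimes> h \<otimes> inv g \<in> H" "g \<otimes> k \<otimes> inv g \<in> K"
    using normal.inv_op_closed2[OF H g h(1)] normal.inv_op_closed2[OF K g h(2)] by auto
  ultimately show "g \<otimes> x \<otimes> inv g \<in> H <#> K" unfolding set_mult_def by blast
qed

abbreviation Z where "Z \<equiv> zassenhaus G T p"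

definition closed_normal :: "'a set \<Rightarrow> bool" where
  "closed_normal H \<longleftrightarrow> H \<lhd> G \<and> closedin T H"

lemma closed_normal_set_mult: "closed_normal H \<Longrightarrow> closed_normal K \<Longrightarrow> closed_normal (H <#> K)"
  unfolding closed_normal_def by (simp add: normal_set_mult closed_set_mult)

lemma closed_normal_subgroup: "closed_normal H \<Longrightarrow> subgroup H G"
  unfolding closed_normal_def by (elim conjE normal_imp_subgroup)

lemma closed_normal_carrier: "closed_normal H \<Longrightarrow> x \<in> H \<Longrightarrow> x \<in> carrier G"
  by (rule subgroup.mem_carrier[OF closed_normal_subgroup])

lemma closed_normal_one: "closed_normal {\<one>}"
  unfolding closed_normal_def
proof
  show "{\<one>} \<lhd> G" by (rule normal_invI[OF triv_subgroup]) simp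
  show "closedin T {\<one>}" using closedin_Hausdorff_singleton[OF Hausdorff, of \<one>] topspace_eq by simp
qed

lemma subset_set_mult:
  assumes "subgroup H G" "subgroup K G"
  shows "H \<subseteq> H <#> K" "K \<subseteq> H <#> K"
proof
  fix x assume x: "x \<in> H"
  then have "x = x \<otimes> \<one>" using subgroup.mem_carrier[OF assms(1)] by simp
  then show "x \<in> H <#> K" using x subgroup.one_closed[OF assms(2)] unfolding set_mult_def by blast
next
  show "K \<subseteq> H <#> K"
  proof
    fix x assume x: "x \<in> K"
    then have "x = \<one> \<otimes> x" using subgroup.mem_carrier[OF assms(2)] by simp
    then show "x \<in> H <#> K" using x subgroup.one_closed[OF assms(1)] unfolding set_mult_def by blast
  qed
qed

lemma closed_normal_foldr:
  assumes "\<And>i. i \<in> set xs \<Longrightarrow> closed_normal (F i)"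
  shows "closed_normal (foldr (\<lambda>A B. A <#> B) (map F xs) {\<one>})"
    and "\<And>i. i \<in> set xs \<Longrightarrow> F i \<subseteq> foldr (\<lambda>A B. A <#> B) (map F xs) {\<one>}"
proof -
  have *: "closed_normal (foldr (\<lambda>A B. A <#> B) (map F xs) {\<one>}) \<and>
      (\<forall>i\<in>set xs. F i \<subseteq> foldr (\<lambda>A B. A <#> B) (map F xs) {\<one>})"
    using assms
  proof (induction xs)
    case Nil
    then show ?case using closed_normal_one by simp
  next
    case (Cons j xs)
    let ?R = "foldr (\<lambda>A B. A <#> B) (map F xs) {\<one>}"
    have IH: "closed_normal ?R" "\<forall>i\<in>set xs. F i \<subseteq> ?R" using Cons.IH Cons.prems by auto
    have Fj: "closed_normal (F j)" using Cons.prems by simp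
    note sub = subset_set_mult[OF closed_normal_subgroup[OF Fj] closed_normal_subgroup[OF IH(1)]]
    have "\<forall>i\<in>set (j # xs). F i \<subseteq> F j <#> ?R" using sub IH(2) by auto
    then show ?case using closed_normal_set_mult[OF Fj IH(1)] by simp
  qed
  show "closed_normal (foldr (\<lambda>A B. A <#> B) (map F xs) {\<one>})" using * by blast
  show "\<And>i. i \<in> set xs \<Longrightarrow> F i \<subseteq> foldr (\<lambda>A B. A <#> B) (map F xs) {\<one>}" using * by blast
qed

lemma foldr_set_mult_subset:
  assumes "subgroup D G" "\<And>i. i \<in> set xs \<Longrightarrow> F i \<subseteq> D"
  shows "foldr (\<lambda>A B. A <#> B) (map F xs) {\<one>} \<subseteq> D"
  using assms(2)
proof (induction xs)
  case Nil
  then show ?case using subgroup.one_closed[OF assms(1)] by simp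
next
  case (Cons j xs)
  have "F j \<subseteq> D" "foldr (\<lambda>A B. A <#> B) (map F xs) {\<one>} \<subseteq> D" using Cons by auto
  then show ?case using subgroup.m_closed[OF assms(1)] by (auto simp: set_mult_def)
qed

lemma closed_normal_commutator:
  assumes H: "closed_normal H" and K: "closed_normal K"
  shows "closed_normal (closed_commutator G T H K)"
proof -
  let ?S = "{inv x \<otimes> inv y \<otimes> x \<otimes> y | x y. x \<in> H \<and> y \<in> K}"
  have S: "?S \<subseteq> carrier G" using closed_normal_carrier[OF H] closed_normal_carrier[OF K] by auto
  have "g \<otimes> z \<otimes> inv g \<in> ?S" if g: "g \<in> carrier G" and zS: "z \<in> ?S" for g z
  proof -
    obtain x y where x: "x \<in> H" and y: "y \<in> K" and z: "z = inv x \<otimes> inv y \<otimes> x \<otimes> y" using zS by blast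
    have c: "x \<in> carrier G" "y \<in> carrier G" using closed_normal_carrier[OF H x] closed_normal_carrier[OF K y] by auto
    have cancel: "inv g \<otimes> (g \<otimes> z) = z" if "z \<in> carrier G" for z
      using that g m_assoc[of "inv g" g z] by simp
    let ?x = "g \<otimes> x \<otimes> inv g" and ?y = "g \<otimes> y \<otimes> inv g"
    have "?x \<in> H" "?y \<in> K"
      using normal.inv_op_closed2[OF _ g x] normal.inv_op_closed2[OF _ g y] H K unfolding closed_normal_def by auto
    moreover have "g \<otimes> z \<otimes> inv g = inv ?x \<otimes> inv ?y \<otimes> ?x \<otimes> ?y"
      using g c unfolding z by (simp add: inv_mult_group m_assoc cancel)
    ultimately show ?thesis by blast
  qed
  then show ?thesis unfolding closed_normal_def closed_commutator_def
    using closed_subgroup_generated_normal[OF S] closed_subgroup_generated_subgroup(2)[OF S] by blast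
qed

lemma closed_normal_power:
  assumes H: "closed_normal H"
  shows "closed_normal (closed_power G T p H)"
proof -
  let ?S = "{x [^] p | x. x \<in> H}"
  have S: "?S \<subseteq> carrier G" using closed_normal_carrier[OF H] by auto
  have "g \<otimes> z \<otimes> inv g \<in> ?S" if g: "g \<in> carrier G" and zS: "z \<in> ?S" for g z
  proof -
    obtain x where x: "x \<in> H" and z: "z = x [^] p" using zS by blast
    have c: "x \<in> carrier G" using closed_normal_carrier[OF H x] .
    have cancel: "inv g \<otimes> (g \<otimes> z) = z" if "z \<in> carrier G" for z
      using that g m_assoc[of "inv g" g z] by simp
    have pow: "(g \<otimes> x \<otimes> inv g) [^] k = g \<otimes> x [^] k \<otimes> inv g" for k :: nat
    proof (induction k)
      case (Suc k)
      then show ?case using g c by (simp add: m_assoc cancel)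
    qed (use g in simp)
    have "g \<otimes> x \<otimes> inv g \<in> H" using normal.inv_op_closed2[OF _ g x] H unfolding closed_normal_def by auto
    then show ?thesis unfolding z pow[of p, symmetric] by blast
  qed
  then show ?thesis unfolding closed_normal_def closed_power_def
    using closed_subgroup_generated_normal[OF S] closed_subgroup_generated_subgroup(2)[OF S] by blast
qed

lemma Z_le_1: "n \<le> 1 \<Longrightarrow> Z n = carrier G"
  by (subst zassenhaus.simps) simp

lemma Z_rec: "n \<ge> 2 \<Longrightarrow> Z n = closed_power G T p (Z (nat \<lceil>real n / real p\<rceil>)) <#>
    foldr (\<lambda>A B. A <#> B) (map (\<lambda>i. closed_commutator G T (Z i) (Z (n - i))) [1..<n]) {\<one>}"
  using p_gt_1 by (subst zassenhaus.simps) simp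

text \<open>The first bound lets inductions reach the index of the power term. The last one ensures
  that p-th powers of elements of weight \<lceil>n/p\<rceil> have weight at least n.\<close>

lemma ceiling_div_bounds:
  assumes "n \<ge> 2"
  shows "nat \<lceil>real n / real p\<rceil> < n" "1 \<le> nat \<lceil>real n / real p\<rceil>" "n \<le> p * nat \<lceil>real n / real p\<rceil>"
proof -
  have n: "2 \<le> real n" and p: "2 \<le> real p" using assms p_gt_1 by auto
  have "real n / real p \<le> real n / 2" by (rule divide_left_mono) (use n p in auto)
  also have "\<dots> \<le> of_int (int n - 1)" using n by simp
  finally have "\<lceil>real n / real p\<rceil> \<le> int n - 1" by (rule ceiling_le)
  then show "nat \<lceil>real n / real p\<rceil> < n" using n by auto
  have "0 < real n / real p" using n p by auto
  then show "1 \<le> nat \<lceil>real n / real p\<rceil>" by linarith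
  have "real n = real p * (real n / real p)" using p by simp
  also have "\<dots> \<le> real p * real (nat \<lceil>real n / real p\<rceil>)"
    by (rule mult_left_mono) (use p in \<open>auto intro: real_nat_ceiling_ge\<close>)
  finally show "n \<le> p * nat \<lceil>real n / real p\<rceil>" by (metis of_nat_le_iff of_nat_mult)
qed

lemma Z_closed_normal: "closed_normal (Z n)"
proof (induction n rule: less_induct)
  case (less n)
  show ?case
  proof (cases "n \<le> 1")
    case True
    have "carrier G \<lhd> G" using NN_normal[OF carrier_NN] .
    then show ?thesis using True closedin_topspace[of T] topspace_eq by (simp add: Z_le_1 closed_normal_def)
  next
    case False
    then have n: "n \<ge> 2" by simp
    show ?thesis unfolding Z_rec[OF n]
      by (intro closed_normal_set_mult closed_normal_power closed_normal_foldr(1) closed_normal_commutator less)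
        (use ceiling_div_bounds(1)[OF n] in auto)
  qed
qed

lemmas Z_subgroup = closed_normal_subgroup[OF Z_closed_normal]
lemmas Z_carrier = closed_normal_carrier[OF Z_closed_normal]

lemma Z_normal: "Z n \<lhd> G" and Z_closed: "closedin T (Z n)"
  using Z_closed_normal unfolding closed_normal_def by blast+

lemma Z_contains:
  assumes n: "n \<ge> 2"
  shows "closed_power G T p (Z (nat \<lceil>real n / real p\<rceil>)) \<subseteq> Z n"
    and "1 \<le> i \<Longrightarrow> i < n \<Longrightarrow> closed_commutator G T (Z i) (Z (n - i)) \<subseteq> Z n"
proof -
  let ?F = "\<lambda>i. closed_commutator G T (Z i) (Z (n - i))"
  let ?P = "closed_power G T p (Z (nat \<lceil>real n / real p\<rceil>))"
  let ?R = "foldr (\<lambda>A B. A <#> B) (map ?F [1..<n]) {\<one>}"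
  have F: "closed_normal (?F i)" for i by (intro closed_normal_commutator Z_closed_normal)
  have P: "closed_normal ?P" by (intro closed_normal_power Z_closed_normal)
  have R: "closed_normal ?R" by (rule closed_normal_foldr(1)[OF F])
  note sub = subset_set_mult[OF closed_normal_subgroup[OF P] closed_normal_subgroup[OF R]]
  show "?P \<subseteq> Z n" unfolding Z_rec[OF n] by (rule sub(1))
  show "?F i \<subseteq> Z n" if "1 \<le> i" "i < n"
  proof -
    have "?F i \<subseteq> ?R" by (rule closed_normal_foldr(2)[OF F]) (use that in simp)
    then show ?thesis unfolding Z_rec[OF n] using sub(2) by blast
  qed
qed

lemma Z_comm:
  assumes x: "x \<in> Z i" and y: "y \<in> Z j" and "i \<ge> 1" "j \<ge> 1"
  shows "inv x \<otimes> inv y \<otimes> x \<otimes> y \<in> Z (i + j)"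
proof -
  let ?S = "{inv x \<otimes> inv y \<otimes> x \<otimes> y | x y. x \<in> Z i \<and> y \<in> Z j}"
  have "?S \<subseteq> carrier G" using Z_carrier by auto
  then have "?S \<subseteq> closed_commutator G T (Z i) (Z j)"
    unfolding closed_commutator_def by (rule closed_subgroup_generated_subgroup(3))
  moreover have "closed_commutator G T (Z i) (Z (i + j - i)) \<subseteq> Z (i + j)"
    by (rule Z_contains(2)) (use assms in auto)
  ultimately show ?thesis using x y by auto
qed

lemma Z_pow_ceiling:
  assumes n: "n \<ge> 2" and x: "x \<in> Z (nat \<lceil>real n / real p\<rceil>)"
  shows "x [^] p \<in> Z n"
proof -
  have "{x [^] p | x. x \<in> Z (nat \<lceil>real n / real p\<rceil>)} \<subseteq> carrier G" using Z_carrier by auto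
  then have "{x [^] p | x. x \<in> Z (nat \<lceil>real n / real p\<rceil>)} \<subseteq> closed_power G T p (Z (nat \<lceil>real n / real p\<rceil>))"
    unfolding closed_power_def by (rule closed_subgroup_generated_subgroup(3))
  then show ?thesis using Z_contains(1)[OF n] x by blast
qed

lemma Z_pow:
  assumes "x \<in> Z i" "i \<ge> 1"
  shows "x [^] p \<in> Z (p * i)"
proof -
  have "real (p * i) / real p = real i" using p_gt_1 by simp
  then have "nat \<lceil>real (p * i) / real p\<rceil> = i" by simp
  moreover have "p * i \<ge> 2" using p_gt_1 assms(2) mult_le_mono[of 2 p 1 i] by simp
  ultimately show ?thesis using Z_pow_ceiling[of "p * i" x] assms(1) by simp
qed

text \<open>An induction principle for upper bounds: p-th powers and commutators generate, so only
  they are checked. Their entries are given as elements of \<open>Z\<close>, and membership in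
  smaller \<open>D m\<close> comes from the hypothesis, so that a proof can combine both kinds of
  information.\<close>

lemma Z_least:
  assumes sub: "\<And>n. subgroup (D n) G" and clo: "\<And>n. closedin T (D n)"
    and D1: "\<And>n. n \<le> 1 \<Longrightarrow> carrier G \<subseteq> D n"
    and comm: "\<And>n i x y. n \<ge> 2 \<Longrightarrow> 1 \<le> i \<Longrightarrow> i < n \<Longrightarrow> (\<And>m. m < n \<Longrightarrow> Z m \<subseteq> D m) \<Longrightarrow>
        x \<in> Z i \<Longrightarrow> y \<in> Z (n - i) \<Longrightarrow> inv x \<otimes> inv y \<otimes> x \<otimes> y \<in> D n"
    and pow: "\<And>n x. n \<ge> 2 \<Longrightarrow> (\<And>m. m < n \<Longrightarrow> Z m \<subseteq> D m) \<Longrightarrow> x \<in> Z (nat \<lceil>real n / real p\<rceil>) \<Longrightarrow> x [^] p \<in> D n"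
  shows "Z n \<subseteq> D n"
proof (induction n rule: less_induct)
  case (less n)
  show ?case
  proof (cases "n \<le> 1")
    case True
    then show ?thesis using D1 by (simp add: Z_le_1)
  next
    case False
    then have n: "n \<ge> 2" by simp
    have P: "closed_power G T p (Z (nat \<lceil>real n / real p\<rceil>)) \<subseteq> D n"
      unfolding closed_power_def
    proof (rule closed_subgroup_generated_least[OF sub clo], rule subsetI)
      fix z assume "z \<in> {x [^] p | x. x \<in> Z (nat \<lceil>real n / real p\<rceil>)}"
      then obtain x where "z = x [^] p" and x: "x \<in> Z (nat \<lceil>real n / real p\<rceil>)" by (elim CollectE exE conjE)
      then show "z \<in> D n" using pow[OF n less x] by simp
    qed
    have F: "closed_commutator G T (Z i) (Z (n - i)) \<subseteq> D n" if "i \<in> set [1..<n]" for i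
    proof -
      have i: "1 \<le> i" "i < n" using that by auto
      show ?thesis unfolding closed_commutator_def
      proof (rule closed_subgroup_generated_least[OF sub clo], rule subsetI)
        fix z assume "z \<in> {inv x \<otimes> inv y \<otimes> x \<otimes> y | x y. x \<in> Z i \<and> y \<in> Z (n - i)}"
        then obtain x y where "z = inv x \<otimes> inv y \<otimes> x \<otimes> y" and x: "x \<in> Z i" and y: "y \<in> Z (n - i)"
          by (elim CollectE exE conjE)
        then show "z \<in> D n" using comm[OF n i less x y] by simp
      qed
    qed
    have R: "foldr (\<lambda>A B. A <#> B) (map (\<lambda>i. closed_commutator G T (Z i) (Z (n - i))) [1..<n]) {\<one>} \<subseteq> D n"
      by (rule foldr_set_mult_subset[OF sub F])
    show ?thesis unfolding Z_rec[OF n]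
    proof
      fix z assume "z \<in> closed_power G T p (Z (nat \<lceil>real n / real p\<rceil>)) <#>
        foldr (\<lambda>A B. A <#> B) (map (\<lambda>i. closed_commutator G T (Z i) (Z (n - i))) [1..<n]) {\<one>}" (is "_ \<in> ?A <#> ?B")
      then obtain a b where "a \<in> ?A" "b \<in> ?B" "z = a \<otimes> b" unfolding set_mult_def by auto
      then show "z \<in> D n" using subgroup.m_closed[OF sub subsetD[OF P] subsetD[OF R]] by simp
    qed
  qed
qed

text \<open>\<open>Z_least\<close> is applied to the shifted filtration. Truncated subtraction makes
  the shifted terms 0 and 1 equal to G.\<close>

lemma Z_Suc: "Z (Suc n) \<subseteq> Z n"
proof -
  define D where "D n = Z (n - 1)" for n
  have "Z (Suc n) \<subseteq> D (Suc n)"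
  proof (rule Z_least)
    show "subgroup (D n) G" "closedin T (D n)" for n unfolding D_def by (rule Z_subgroup, rule Z_closed)
    show "carrier G \<subseteq> D n" if "n \<le> 1" for n using that by (simp add: D_def Z_le_1)
  next
    fix n i x y assume n: "n \<ge> 2" and i: "1 \<le> i" "i < n" and IH: "\<And>m. m < n \<Longrightarrow> Z m \<subseteq> D m"
      and x: "x \<in> Z i" and y: "y \<in> Z (n - i)"
    show "inv x \<otimes> inv y \<otimes> x \<otimes> y \<in> D n"
    \<comment> \<open>Lowering the first entry of a commutator by one index lowers the sum of the
      indices to n - 1. For i = 1 there is no lower positive index; then y is in
      \<open>Z (n - 1)\<close>, and normality suffices.\<close>
    proof (cases "i = 1")
      case True
      have c: "x \<in> carrier G" using Z_carrier[OF x] .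
      have yZ: "y \<in> Z (n - 1)" using y True by simp
      have "inv x \<otimes> inv y \<otimes> x \<in> Z (n - 1)"
        by (rule normal.inv_op_closed1[OF Z_normal c subgroup.m_inv_closed[OF Z_subgroup yZ]])
      then show ?thesis unfolding D_def using subgroup.m_closed[OF Z_subgroup _ yZ] by blast
    next
      case False
      have "x \<in> Z (i - 1)" using IH[OF i(2)] x by (auto simp: D_def)
      then have "inv x \<otimes> inv y \<otimes> x \<otimes> y \<in> Z (i - 1 + (n - i))"
        by (rule Z_comm[OF _ y]) (use False i in auto)
      moreover have "i - 1 + (n - i) = n - 1" using False i by simp
      ultimately show ?thesis by (simp add: D_def)
    qed
  next
    fix n x assume n: "n \<ge> 2" and IH: "\<And>m. m < n \<Longrightarrow> Z m \<subseteq> D m" and x: "x \<in> Z (nat \<lceil>real n / real p\<rceil>)"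
    show "x [^] p \<in> D n"
    proof (cases "n = 2")
      case True
      then show ?thesis using Z_carrier[OF x] by (simp add: D_def Z_le_1)
    next
      case False
      then have n1: "n - 1 \<ge> 2" using n by simp
      \<comment> \<open>The two ceilings differ by at most one. If they differ, the induction
        hypothesis at \<open>?a\<close> moves x into \<open>Z ?b\<close>.\<close>
      let ?a = "nat \<lceil>real n / real p\<rceil>" and ?b = "nat \<lceil>real (n - 1) / real p\<rceil>"
      have b: "n - 1 \<le> p * ?b" "1 \<le> ?b" using ceiling_div_bounds[OF n1] by auto
      have "real n / real p \<le> real (Suc ?b)"
      proof -
        have "n \<le> p * Suc ?b" using b p_gt_1 n by simp
        then have "real n \<le> real p * real (Suc ?b)" by (metis of_nat_le_iff of_nat_mult)
        then show ?thesis using p_gt_1 by (simp add: divide_le_eq mult.commute)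
      qed
      then have ab1: "?a \<le> Suc ?b" by linarith
      have "real (n - 1) / real p \<le> real n / real p" by (rule divide_right_mono) auto
      then have ab2: "?b \<le> ?a" by (intro nat_mono ceiling_mono)
      have "x \<in> Z ?b"
      proof (cases "?a = ?b")
        case True
        then show ?thesis using x by simp
      next
        case False
        have Suc_of_le: "a = Suc b" if "a \<le> Suc b" "b \<le> a" "a \<noteq> b" for a b :: nat
          using that by simp
        have a: "?a = Suc ?b" by (rule Suc_of_le[OF ab1 ab2 False])
        have "Z ?a \<subseteq> D ?a" by (rule IH[OF ceiling_div_bounds(1)[OF n]])
        then show ?thesis using x unfolding a D_def by auto
      qed
      then have "x [^] p \<in> Z (n - 1)" by (rule Z_pow_ceiling[OF n1])
      then show ?thesis by (simp add: D_def)
    qed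
  qed
  then show ?thesis by (simp add: D_def)
qed

text \<open>The easy inclusion between the two filtrations: pulled back to G, the dimension
  subgroups of G/N are closed subgroups that respect commutators and p-th powers.\<close>

lemma Z_subset_dimension_subgroup:
  assumes N: "N \<in> NN"
  shows "Z n \<subseteq> {g \<in> carrier G. N #> g \<in> finite_group_algebra.dimension_subgroup (G Mod N) p n}"
proof -
  interpret L: finite_group_algebra "G Mod N" p by (rule level_algebra[OF N])
  interpret h: group_hom G "G Mod N" "\<lambda>x. N #> x" by (rule quotient_hom[OF N])
  define D where "D n = {g \<in> carrier G. N #> g \<in> L.dimension_subgroup n}" for n
  note S = L.dimension_subgroup_subgroup
  have "Z n \<subseteq> D n"
  proof (rule Z_least)
    show "subgroup (D n) G" for n
    proof (rule subgroupI)
      show "D n \<noteq> {}" using subgroup.one_closed[OF S[of n]] h.hom_one by (auto simp: D_def intro!: exI[of _ \<one>])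
      show "inv a \<in> D n" if "a \<in> D n" for a
        using that subgroup.m_inv_closed[OF S[of n]] by (simp add: D_def)
      show "a \<otimes> b \<in> D n" if "a \<in> D n" "b \<in> D n" for a b
        using that subgroup.m_closed[OF S[of n]] by (simp add: D_def)
    qed (auto simp: D_def)
    show "closedin T (D n)" for n
    proof -
      \<comment> \<open>\<open>D n\<close> is a union of cosets of the open subgroup N, and so is
        its complement, which is therefore open.\<close>
      have "openin T (\<Union>((\<lambda>g. N #> g) ` (carrier G - D n)))"
        by (rule openin_Union) (use open_r_coset[OF NN_open[OF N]] in blast)
      moreover have "\<Union>((\<lambda>g. N #> g) ` (carrier G - D n)) = carrier G - D n"
      proof
        show "\<Union>((\<lambda>g. N #> g) ` (carrier G - D n)) \<subseteq> carrier G - D n"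
        proof clarify
          fix g x assume g: "g \<in> carrier G" "g \<notin> D n" and x: "x \<in> N #> g"
          have "N #> g = N #> x" by (rule repr_independence[OF x g(1) NN_subgroup[OF N]])
          moreover have "x \<in> carrier G"
            using r_coset_subset_G[OF subgroup.subset[OF NN_subgroup[OF N]] g(1)] x by blast
          ultimately show "x \<in> carrier G - D n" using g by (simp add: D_def)
        qed
        show "carrier G - D n \<subseteq> \<Union>((\<lambda>g. N #> g) ` (carrier G - D n))"
          using rcos_self[OF _ NN_subgroup[OF N]] by blast
      qed
      ultimately have "openin T (topspace T - D n)" by (simp add: topspace_eq)
      then show ?thesis unfolding closedin_def by (simp add: D_def topspace_eq)
    qed
    show "carrier G \<subseteq> D n" if "n \<le> 1" for n
    proof -
      have "L.dimension_subgroup n = carrier (G Mod N)"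
        using that L.dimension_subgroup_1 by (cases n) auto
      then show ?thesis using coset_closed by (auto simp: D_def)
    qed
  next
    fix n i x y assume n: "n \<ge> 2" and i: "1 \<le> i" "i < n" and IH: "\<And>m. m < n \<Longrightarrow> Z m \<subseteq> D m"
      and x: "x \<in> Z i" and y: "y \<in> Z (n - i)"
    have "x \<in> D i" using IH[OF i(2)] x by blast
    moreover have "y \<in> D (n - i)" using IH[of "n - i"] y i by auto
    ultimately have c: "x \<in> carrier G" "y \<in> carrier G"
      and d: "N #> x \<in> L.dimension_subgroup i" "N #> y \<in> L.dimension_subgroup (n - i)" by (simp_all add: D_def)
    show "inv x \<otimes> inv y \<otimes> x \<otimes> y \<in> D n"
      using L.dimension_subgroup_comm[OF d] c i by (simp add: D_def)
  next
    fix n x assume n: "n \<ge> 2" and IH: "\<And>m. m < n \<Longrightarrow> Z m \<subseteq> D m" and x: "x \<in> Z (nat \<lceil>real n / real p\<rceil>)"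
    have "x \<in> D (nat \<lceil>real n / real p\<rceil>)" using IH[OF ceiling_div_bounds(1)[OF n]] x by blast
    then have c: "x \<in> carrier G" and d: "N #> x \<in> L.dimension_subgroup (nat \<lceil>real n / real p\<rceil>)" by (simp_all add: D_def)
    have "N #> (x [^] p) = (N #> x) [^]\<^bsub>G Mod N\<^esub> p" using h.hom_nat_pow[OF c] by simp
    also have "\<dots> \<in> L.dimension_subgroup (p * nat \<lceil>real n / real p\<rceil>)"
      by (rule L.dimension_subgroup_pow[OF prime_p d])
    finally have "N #> (x [^] p) \<in> L.dimension_subgroup n"
      using L.dimension_subgroup_antimono[OF ceiling_div_bounds(3)[OF n]] by blast
    then show "x [^] p \<in> D n" using c by (simp add: D_def)
  qed
  then show ?thesis by (simp add: D_def)
qed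

end

section \<open>Vector spaces over the prime field\<close>

text \<open>On an abelian group of exponent \<open>p\<close> the only \<open>\<bbbF>\<^sub>p\<close>-structure is by integer multiples.\<close>

lemma vectorspace_of_exponent:
  fixes V :: "(int, 'v) module"
  assumes p: "prime p" and V: "abelian_group V"
    and smult: "\<And>a x. a \<in> {0..<int p} \<Longrightarrow> x \<in> carrier V \<Longrightarrow> a \<odot>\<^bsub>V\<^esub> x = add_pow V a x"
    and exponent: "\<And>x. x \<in> carrier V \<Longrightarrow> add_pow V p x = \<zero>\<^bsub>V\<^esub>"
  shows "vectorspace (residue_ring (int p)) V"
proof -
  interpret V: abelian_group V by (rule V)
  interpret K: residues_prime p "residue_ring (int p)" by unfold_locales (use p in auto)
  have ops: "a \<oplus>\<^bsub>residue_ring (int p)\<^esub> b = (a + b) mod int p" "a \<otimes>\<^bsub>residue_ring (int p)\<^esub> b = (a * b) mod int p"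
    "\<one>\<^bsub>residue_ring (int p)\<^esub> = 1" for a b by (simp_all add: residue_ring_def)
  have p0: "int p > 0" using p by (simp add: prime_gt_0_nat)
  have red: "add_pow V (a mod int p) x = add_pow V a x" if x: "x \<in> carrier V" for a x
  proof -
    have "add_pow V (int p) x = \<zero>\<^bsub>V\<^esub>" using exponent[OF x] by (simp add: add_pow_int_ge)
    then have "add_pow V (int p * (a div int p)) x = \<zero>\<^bsub>V\<^esub>"
      using V.add.int_pow_pow[OF x, of "a div int p" "int p"] V.add.int_pow_one by simp
    then have "add_pow V (int p * (a div int p) + a mod int p) x = add_pow V (a mod int p) x"
      using V.add.int_pow_mult[OF x, of "int p * (a div int p)" "a mod int p"] x by simp
    then show ?thesis by simp
  qed
  have mem: "a mod int p \<in> {0..<int p}" for a using p0 by simp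
  have "module (residue_ring (int p)) V"
  proof (rule moduleI)
    fix a x assume a: "a \<in> carrier (residue_ring (int p))" and x: "x \<in> carrier V"
    show "a \<odot>\<^bsub>V\<^esub> x \<in> carrier V" using a x by (simp add: smult)
  next
    fix a b x assume a: "a \<in> carrier (residue_ring (int p))" and b: "b \<in> carrier (residue_ring (int p))" and x: "x \<in> carrier V"
    show "(a \<oplus>\<^bsub>residue_ring (int p)\<^esub> b) \<odot>\<^bsub>V\<^esub> x = a \<odot>\<^bsub>V\<^esub> x \<oplus>\<^bsub>V\<^esub> b \<odot>\<^bsub>V\<^esub> x"
      using a b x V.add.int_pow_mult[OF x, of a b] mem[of "a + b"] by (simp add: ops smult red)
    show "(a \<otimes>\<^bsub>residue_ring (int p)\<^esub> b) \<odot>\<^bsub>V\<^esub> x = a \<odot>\<^bsub>V\<^esub> (b \<odot>\<^bsub>V\<^esub> x)"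
      using a b x V.add.int_pow_pow[OF x, of a b] mem[of "a * b"] by (simp add: ops smult red mult.commute)
  next
    fix a x y assume a: "a \<in> carrier (residue_ring (int p))" and x: "x \<in> carrier V" and y: "y \<in> carrier V"
    show "a \<odot>\<^bsub>V\<^esub> (x \<oplus>\<^bsub>V\<^esub> y) = a \<odot>\<^bsub>V\<^esub> x \<oplus>\<^bsub>V\<^esub> a \<odot>\<^bsub>V\<^esub> y"
      using a x y V.add.int_pow_distrib[OF x y, of a] by (simp add: smult)
  next
    fix x assume x: "x \<in> carrier V"
    have "(1::int) \<in> {0..<int p}" using p prime_gt_1_nat[of p] by simp
    then show "\<one>\<^bsub>residue_ring (int p)\<^esub> \<odot>\<^bsub>V\<^esub> x = x"
      using x V.add.int_pow_1[OF x] by (simp add: ops smult)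
  qed (use K.cring V in auto)
  then show ?thesis using K.is_field by (simp add: vectorspace_def)
qed

text \<open>All dimensions below are obtained from cardinalities through this formula, so no basis
  has to be transported between levels.\<close>

lemma card_vectorspace:
  assumes p: "prime p" and V: "vectorspace (residue_ring (int p)) V" and fin: "finite (carrier V)"
  shows "card (carrier V) = p ^ vectorspace.dim (residue_ring (int p)) V"
proof -
  interpret V: vectorspace "residue_ring (int p)" V by (rule V)
  have "carrier V \<subseteq> V.span (carrier V)" by (rule V.in_own_span) simp
  moreover have "V.span (carrier V) \<subseteq> carrier V" by (rule V.span_is_subset2) simp
  ultimately have "V.gen_set (carrier V)" by blast
  then have "V.fin_dim" unfolding V.fin_dim_def using fin by blast
  then obtain B where B: "finite B" "V.basis B" using V.finite_basis_exists by blast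
  have Bc: "B \<subseteq> carrier V" using B(2) unfolding V.basis_def by blast
  have ex1: "\<And>v. v \<in> carrier V \<Longrightarrow> \<exists>!a. a \<in> B \<rightarrow>\<^sub>E carrier (residue_ring (int p)) \<and> V.lincomb a B = v"
    using V.basis_criterion[OF B(1) Bc] B(2) by blast
  have "bij_betw (\<lambda>a. V.lincomb a B) (B \<rightarrow>\<^sub>E carrier (residue_ring (int p))) (carrier V)"
  proof (rule bij_betwI')
    fix a b assume a: "a \<in> B \<rightarrow>\<^sub>E carrier (residue_ring (int p))" and b: "b \<in> B \<rightarrow>\<^sub>E carrier (residue_ring (int p))"
    have "V.lincomb a B \<in> carrier V" by (rule V.lincomb_closed) (use Bc a in auto)
    then show "(V.lincomb a B = V.lincomb b B) = (a = b)" using ex1[of "V.lincomb a B"] a b by metis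
  next
    fix a assume a: "a \<in> B \<rightarrow>\<^sub>E carrier (residue_ring (int p))"
    show "V.lincomb a B \<in> carrier V" by (rule V.lincomb_closed) (use Bc a in auto)
  next
    fix v assume "v \<in> carrier V"
    then show "\<exists>a\<in>B \<rightarrow>\<^sub>E carrier (residue_ring (int p)). v = V.lincomb a B" using ex1[of v] by blast
  qed
  then have "card (carrier V) = card (B \<rightarrow>\<^sub>E carrier (residue_ring (int p)))" by (rule bij_betw_same_card[symmetric])
  also have "\<dots> = p ^ card B" using B(1) by (simp add: card_PiE)
  also have "card B = V.dim" using V.dim_basis[OF B] by simp
  finally show ?thesis .
qed

text \<open>Translates between a multiplicative group of exponent p and a module record with the
  same underlying set. It serves both the quotients of filtration subgroups and those of ideal
  powers.\<close>

lemma card_eq_power_dim: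
  fixes V :: "(int, 'v) module"
  assumes p: "prime p" and A: "comm_group A" and fin: "finite (carrier A)"
    and exponent: "\<And>x. x \<in> carrier A \<Longrightarrow> x [^]\<^bsub>A\<^esub> p = \<one>\<^bsub>A\<^esub>"
    and V: "carrier V = carrier A" "\<zero>\<^bsub>V\<^esub> = \<one>\<^bsub>A\<^esub>" "add V = monoid.mult A"
    and smult: "\<And>a x. a \<in> {0..<int p} \<Longrightarrow> x \<in> carrier A \<Longrightarrow> a \<odot>\<^bsub>V\<^esub> x = x [^]\<^bsub>A\<^esub> a"
  shows "card (carrier A) = p ^ vectorspace.dim (residue_ring (int p)) V"
proof -
  interpret A: comm_group A by (rule A)
  have npow: "add_pow V k x = x [^]\<^bsub>A\<^esub> k" for k :: nat and x
    by (simp add: add_pow_def nat_pow_def V)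
  have ainv: "\<ominus>\<^bsub>V\<^esub> x = inv\<^bsub>A\<^esub> x" for x
    by (simp add: a_inv_def m_inv_def V)
  have ipow: "add_pow V a x = x [^]\<^bsub>A\<^esub> a" for a :: int and x
  proof (cases "a \<ge> 0")
    case True
    then show ?thesis by (simp add: add_pow_int_ge npow int_pow_def nat_pow_def)
  next
    case False
    then show ?thesis by (simp add: add_pow_int_lt npow ainv int_pow_def nat_pow_def)
  qed
  have ab: "abelian_group V"
  proof (rule abelian_groupI)
    fix x assume "x \<in> carrier V"
    then show "\<exists>y\<in>carrier V. y \<oplus>\<^bsub>V\<^esub> x = \<zero>\<^bsub>V\<^esub>" unfolding V by (intro bexI[of _ "inv\<^bsub>A\<^esub> x"]) auto
  qed (auto simp: V A.m_ac)
  have vs: "vectorspace (residue_ring (int p)) V"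
    by (rule vectorspace_of_exponent[OF p ab]) (simp_all add: ipow npow V exponent smult)
  show ?thesis using card_vectorspace[OF p vs] fin by (simp add: V)
qed

lemma (in group) comm_group_Mod:
  assumes A: "subgroup A G" and B: "B \<lhd> G\<lparr>carrier := A\<rparr>"
    and comm: "\<And>x y. x \<in> A \<Longrightarrow> y \<in> A \<Longrightarrow> inv x \<otimes> inv y \<otimes> x \<otimes> y \<in> B"
  shows "comm_group (G\<lparr>carrier := A\<rparr> Mod B)"
proof (rule group.group_comm_groupI)
  let ?A = "G\<lparr>carrier := A\<rparr>"
  interpret N: normal B ?A by (rule B)
  show "group (?A Mod B)" by (rule N.factorgroup_is_group)
  fix X Y assume "X \<in> carrier (?A Mod B)" "Y \<in> carrier (?A Mod B)"
  then obtain x y where x: "x \<in> A" "X = B #>\<^bsub>?A\<^esub> x" and y: "y \<in> A" "Y = B #>\<^bsub>?A\<^esub> y"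
    by (auto simp: FactGroup_def RCOSETS_def)
  have c: "x \<in> carrier G" "y \<in> carrier G" using x y subgroup.mem_carrier[OF A] by auto
  have i: "inv x \<in> A" "inv y \<in> A" using subgroup.m_inv_closed[OF A] x y by auto
  have cancel: "inv z \<otimes> (z \<otimes> w) = w" if "z \<in> carrier G" "w \<in> carrier G" for z w
    using that m_assoc[of "inv z" z w] by simp
  have "inv (inv x) \<otimes> inv (inv y) \<otimes> inv x \<otimes> inv y \<in> B" by (rule comm[OF i])
  then have k: "x \<otimes> y \<otimes> inv x \<otimes> inv y \<in> B" using c by simp
  have "x \<otimes> y = (x \<otimes> y \<otimes> inv x \<otimes> inv y) \<otimes> (y \<otimes> x)" using c by (simp add: m_assoc cancel)
  then have "x \<otimes> y \<in> B #>\<^bsub>?A\<^esub> (y \<otimes> x)" using k by (auto simp: r_coset_def)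
  then have "B #>\<^bsub>?A\<^esub> (y \<otimes> x) = B #>\<^bsub>?A\<^esub> (x \<otimes> y)"
    by (rule N.repr_independence[OF _ _ N.subgroup_axioms]) (use subgroup.m_closed[OF A] x y in simp)
  then show "X \<otimes>\<^bsub>?A Mod B\<^esub> Y = Y \<otimes>\<^bsub>?A Mod B\<^esub> X"
    using N.rcos_sum x y by (simp add: FactGroup_def)
qed

lemma (in group) exponent_Mod:
  assumes A: "subgroup A G" and B: "B \<lhd> G\<lparr>carrier := A\<rparr>"
    and pow: "\<And>x. x \<in> A \<Longrightarrow> x [^] (k::nat) \<in> B" and X: "X \<in> carrier (G\<lparr>carrier := A\<rparr> Mod B)"
  shows "X [^]\<^bsub>G\<lparr>carrier := A\<rparr> Mod B\<^esub> k = \<one>\<^bsub>G\<lparr>carrier := A\<rparr> Mod B\<^esub>"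
proof -
  let ?A = "G\<lparr>carrier := A\<rparr>"
  interpret N: normal B ?A by (rule B)
  interpret h: group_hom ?A "?A Mod B" "\<lambda>x. B #>\<^bsub>?A\<^esub> x"
    by (rule group_hom.intro[OF N.is_group N.factorgroup_is_group group_hom_axioms.intro[OF N.r_coset_hom_Mod]])
  obtain x where x: "x \<in> A" "X = B #>\<^bsub>?A\<^esub> x" using X by (auto simp: FactGroup_def RCOSETS_def)
  have "X [^]\<^bsub>?A Mod B\<^esub> k = B #>\<^bsub>?A\<^esub> (x [^]\<^bsub>?A\<^esub> k)" using h.hom_nat_pow[of x k] x by simp
  also have "x [^]\<^bsub>?A\<^esub> k = x [^] k" by (rule nat_pow_consistent[symmetric])
  also have "B #>\<^bsub>?A\<^esub> (x [^] k) = B"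
    by (rule N.coset_join2) (use x pow[of x] subgroup.mem_carrier[OF N.subgroup_axioms] N.subgroup_axioms in auto)
  finally show ?thesis by (simp add: FactGroup_def)
qed

lemma card_subquotient_space:
  assumes p: "prime p" and M: "abelian_group M" and U: "subgroup U (add_monoid M)" and W: "subgroup W (add_monoid M)"
    and WU: "W \<subseteq> U"
    and smult: "\<And>a x. a \<in> {0..<int p} \<Longrightarrow> x \<in> carrier M \<Longrightarrow> a \<odot>\<^bsub>M\<^esub> x = add_pow M a x"
    and exponent: "\<And>x. x \<in> carrier M \<Longrightarrow> add_pow M p x = \<zero>\<^bsub>M\<^esub>"
    and fin: "finite (rcosets\<^bsub>add_monoid M\<lparr>carrier := U\<rparr>\<^esub> W)"
  shows "card (rcosets\<^bsub>add_monoid M\<lparr>carrier := U\<rparr>\<^esub> W)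
    = p ^ vectorspace.dim (residue_ring (int p)) (subquotient_space M U W)"
proof -
  interpret M: abelian_group M by (rule M)
  let ?X = "add_monoid M\<lparr>carrier := U\<rparr>" and ?V = "subquotient_space M U W"
  have Xg: "group ?X" by (rule M.add.subgroup_imp_group[OF U])
  interpret X: comm_group ?X
    by (rule group.group_comm_groupI[OF Xg]) (use subgroup.mem_carrier[OF U] in \<open>auto intro: M.a_comm\<close>)
  have WX: "subgroup W ?X" by (rule M.add.subgroup_incl[OF W U WU])
  interpret N: normal W ?X by (rule X.subgroup_imp_normal[OF WX])
  interpret F: comm_group "?X Mod W" by (rule X.abelian_FactGroup[OF WX])
  interpret h: group_hom ?X "?X Mod W" "\<lambda>x. W #>\<^bsub>?X\<^esub> x"
    by (rule group_hom.intro[OF Xg F.is_group group_hom_axioms.intro[OF N.r_coset_hom_Mod]])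
  have carF: "carrier (?X Mod W) = rcosets\<^bsub>?X\<^esub> W" by (simp add: FactGroup_def)
  have npow: "add_pow M (k::nat) x = x [^]\<^bsub>?X\<^esub> k" for k x by (simp add: add_pow_def nat_pow_def)
  have ipow: "add_pow M (a::int) x = x [^]\<^bsub>?X\<^esub> a" if "0 \<le> a" for a x
    using that by (simp add: add_pow_int_ge npow int_pow_def nat_pow_def)
  have "card (carrier (?X Mod W)) = p ^ vectorspace.dim (residue_ring (int p)) ?V"
  proof (rule card_eq_power_dim[OF p F.comm_group_axioms])
    show "finite (carrier (?X Mod W))" unfolding carF by (rule fin)
    show "carrier ?V = carrier (?X Mod W)"
      by (simp add: subquotient_space_def FactGroup_def A_RCOSETS_def RCOSETS_def r_coset_def)
    show "\<zero>\<^bsub>?V\<^esub> = \<one>\<^bsub>?X Mod W\<^esub>" by (simp add: subquotient_space_def FactGroup_def)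
    show "add ?V = monoid.mult (?X Mod W)"
      by (simp add: subquotient_space_def FactGroup_def set_add_def set_mult_def fun_eq_iff)
  next
    fix C assume "C \<in> carrier (?X Mod W)"
    then have "C \<in> rcosets\<^bsub>?X\<^esub> W" unfolding carF .
    then obtain x where x: "x \<in> U" "C = W #>\<^bsub>?X\<^esub> x" unfolding RCOSETS_def by auto
    have xc: "x \<in> carrier M" using subgroup.mem_carrier[OF U x(1)] by simp
    have "C [^]\<^bsub>?X Mod W\<^esub> p = W #>\<^bsub>?X\<^esub> (x [^]\<^bsub>?X\<^esub> p)" using h.hom_nat_pow[of x p] x by simp
    also have "x [^]\<^bsub>?X\<^esub> p = \<one>\<^bsub>?X\<^esub>" using exponent[OF xc] by (simp add: npow)
    also have "W #>\<^bsub>?X\<^esub> \<one>\<^bsub>?X\<^esub> = W" by (rule X.coset_mult_one[OF N.subset])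
    finally show "C [^]\<^bsub>?X Mod W\<^esub> p = \<one>\<^bsub>?X Mod W\<^esub>" by (simp add: FactGroup_def)
    fix a assume a: "a \<in> {0..<int p}"
    have ax: "y \<in> U \<Longrightarrow> a \<odot>\<^bsub>M\<^esub> y = y [^]\<^bsub>?X\<^esub> a" for y
      using smult[OF a] subgroup.mem_carrier[OF U] a ipow by simp
    have coset: "W +>\<^bsub>M\<^esub> y = W #>\<^bsub>?X\<^esub> y" for y by (simp add: a_r_coset_def r_coset_def)
    \<comment> \<open>The scalar multiple of a coset is defined as a union over its elements; every
      element contributes the same coset, so the union is a single one.\<close>
    have all: "W +>\<^bsub>M\<^esub> (a \<odot>\<^bsub>M\<^esub> y) = W #>\<^bsub>?X\<^esub> (x [^]\<^bsub>?X\<^esub> a)" if y: "y \<in> C" for y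
    proof -
      have yU: "y \<in> U" using y x N.subset X.r_coset_subset_G[of W x] by auto
      have eq: "W #>\<^bsub>?X\<^esub> y = W #>\<^bsub>?X\<^esub> x"
        using X.repr_independence[of y W x] y x WX by simp
      have "W #>\<^bsub>?X\<^esub> (y [^]\<^bsub>?X\<^esub> a) = (W #>\<^bsub>?X\<^esub> y) [^]\<^bsub>?X Mod W\<^esub> a" using h.hom_int_pow[of y a] yU by simp
      also have "\<dots> = W #>\<^bsub>?X\<^esub> (x [^]\<^bsub>?X\<^esub> a)" unfolding eq using h.hom_int_pow[of x a] x by simp
      finally show ?thesis unfolding coset ax[OF yU] .
    qed
    have "x \<in> C" using X.rcos_self[OF _ WX, of x] x by simp
    then have "(\<Union>y\<in>C. W +>\<^bsub>M\<^esub> (a \<odot>\<^bsub>M\<^esub> y)) = W #>\<^bsub>?X\<^esub> (x [^]\<^bsub>?X\<^esub> a)" using all by blast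
    also have "\<dots> = C [^]\<^bsub>?X Mod W\<^esub> a" using h.hom_int_pow[of x a] x by simp
    finally show "a \<odot>\<^bsub>?V\<^esub> C = C [^]\<^bsub>?X Mod W\<^esub> a" by (simp add: subquotient_space_def)
  qed
  then show ?thesis by (simp only: carF)
qed

section \<open>Passage to the limit\<close>

context pro_p_group
begin

text \<open>By compactness an open subgroup has only finitely many conjugates, so its core is open.\<close>

lemma open_normal_base:
  assumes "openin T U" "\<one> \<in> U"
  shows "\<exists>N\<in>NN. N \<subseteq> U"
proof -
  obtain H where H: "subgroup H G" "openin T H" "H \<subseteq> U"
    using open_subgroup_base[OF assms] by blast
  have "compactin T (carrier G)" using compact topspace_eq by (simp add: compact_space_def)
  moreover have "\<And>C. C \<in> (\<lambda>g. H #> g) ` carrier G \<Longrightarrow> openin T C"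
    using open_r_coset[OF H(2)] by blast
  moreover have "carrier G \<subseteq> \<Union>((\<lambda>g. H #> g) ` carrier G)"
    using rcos_self[OF _ H(1)] by blast
  ultimately obtain \<F> where \<F>: "finite \<F>" "\<F> \<subseteq> (\<lambda>g. H #> g) ` carrier G" "carrier G \<subseteq> \<Union>\<F>"
    by (rule compactinD[THEN exE]) blast+
  obtain F where F: "finite F" "F \<subseteq> carrier G" "\<F> = (\<lambda>g. H #> g) ` F"
    using finite_subset_image[OF \<F>(1,2)] by blast
  define N where "N = {x \<in> carrier G. \<forall>g\<in>carrier G. g \<otimes> x \<otimes> inv g \<in> H}"
  have N_carrier: "x \<in> carrier G" and N_conj: "g \<otimes> x \<otimes> inv g \<in> H"
    if "x \<in> N" "g \<in> carrier G" for x g using that by (simp_all add: N_def)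
  have NH: "N \<subseteq> H"
  proof
    fix x assume x: "x \<in> N"
    show "x \<in> H" using N_conj[OF x one_closed] N_carrier[OF x one_closed] by simp
  qed
  have sub: "subgroup N G"
  proof (rule subgroupI)
    show "N \<subseteq> carrier G" by (auto simp: N_def)
    have "\<one> \<in> N" using subgroup.one_closed[OF H(1)] by (simp add: N_def)
    then show "N \<noteq> {}" by blast
    fix a assume a: "a \<in> N"
    have ac: "a \<in> carrier G" by (rule N_carrier[OF a one_closed])
    have "g \<otimes> inv a \<otimes> inv g \<in> H" if g: "g \<in> carrier G" for g
      using subgroup.m_inv_closed[OF H(1) N_conj[OF a g]] ac g by (simp add: inv_mult_group m_assoc)
    then show "inv a \<in> N" using ac by (simp add: N_def)
    fix b assume b: "b \<in> N"
    have bc: "b \<in> carrier G" by (rule N_carrier[OF b one_closed])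
    have "g \<otimes> (a \<otimes> b) \<otimes> inv g \<in> H" if g: "g \<in> carrier G" for g
    proof -
      have cancel: "inv g \<otimes> (g \<otimes> y) = y" if "y \<in> carrier G" for y
        using g that m_assoc[of "inv g" g y] by simp
      have "g \<otimes> (a \<otimes> b) \<otimes> inv g = (g \<otimes> a \<otimes> inv g) \<otimes> (g \<otimes> b \<otimes> inv g)"
        using g ac bc by (simp add: m_assoc cancel)
      also have "\<dots> \<in> H" by (rule subgroup.m_closed[OF H(1) N_conj[OF a g] N_conj[OF b g]])
      finally show ?thesis .
    qed
    then show "a \<otimes> b \<in> N" using ac bc by (simp add: N_def)
  qed
  have "N \<lhd> G"
  proof (rule normal_invI[OF sub])
    fix h x assume x: "x \<in> carrier G" and h: "h \<in> N"
    have hc: "h \<in> carrier G" by (rule N_carrier[OF h x])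
    have "g \<otimes> (x \<otimes> h \<otimes> inv x) \<otimes> inv g \<in> H" if g: "g \<in> carrier G" for g
      using N_conj[OF h m_closed[OF g x]] hc x g by (simp add: inv_mult_group m_assoc)
    then show "x \<otimes> h \<otimes> inv x \<in> N" using x hc by (simp add: N_def)
  qed
  moreover have "openin T N"
  proof -
    \<comment> \<open>Conjugation by h in H preserves H, so for g = h f the condition on x depends
      only on the representative f, of which there are finitely many.\<close>
    have "N = (\<Inter>f\<in>F. {x \<in> topspace T. f \<otimes> x \<otimes> inv f \<in> H}) \<inter> topspace T"
    proof
      show "N \<subseteq> (\<Inter>f\<in>F. {x \<in> topspace T. f \<otimes> x \<otimes> inv f \<in> H}) \<inter> topspace T"
        using F(2) by (auto simp: N_def topspace_eq)
      show "(\<Inter>f\<in>F. {x \<in> topspace T. f \<otimes> x \<otimes> inv f \<in> H}) \<inter> topspace T \<subseteq> N"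
      proof
        fix x assume x: "x \<in> (\<Inter>f\<in>F. {x \<in> topspace T. f \<otimes> x \<otimes> inv f \<in> H}) \<inter> topspace T"
        then have xc: "x \<in> carrier G" by (simp add: topspace_eq)
        have "g \<otimes> x \<otimes> inv g \<in> H" if g: "g \<in> carrier G" for g
        proof -
          obtain f where f: "f \<in> F" "g \<in> H #> f" using g \<F>(3) unfolding F(3) by blast
          then obtain h where h: "h \<in> H" "g = h \<otimes> f" unfolding r_coset_def by blast
          have fc: "f \<in> carrier G" using F(2) f(1) by blast
          have hc: "h \<in> carrier G" by (rule subgroup.mem_carrier[OF H(1) h(1)])
          have fx: "f \<otimes> x \<otimes> inv f \<in> H" using x f(1) by blast
          have "g \<otimes> x \<otimes> inv g = h \<otimes> (f \<otimes> x \<otimes> inv f) \<otimes> inv h"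
            unfolding h(2) using fc hc xc by (simp add: inv_mult_group m_assoc)
          also have "\<dots> \<in> H"
            by (intro subgroup.m_closed[OF H(1)] subgroup.m_inv_closed[OF H(1)] h(1) fx)
          finally show ?thesis .
        qed
        then show "x \<in> N" using xc by (simp add: N_def)
      qed
    qed
    moreover have "openin T ((\<Inter>f\<in>F. {x \<in> topspace T. f \<otimes> x \<otimes> inv f \<in> H}) \<inter> topspace T)"
    proof (rule openin_INT[OF F(1)])
      fix f assume "f \<in> F"
      then have fc: "f \<in> carrier G" using F(2) by blast
      show "openin T {x \<in> topspace T. f \<otimes> x \<otimes> inv f \<in> H}"
        by (rule openin_continuous_map_preimage[OF continuous_conjugation[OF fc] H(2)])
    qed
    ultimately show ?thesis by simp
  qed
  ultimately have "N \<in> NN" by (simp add: open_normal_subgroups_def)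
  moreover have "N \<subseteq> U" using NH H(3) by (rule subset_trans)
  ultimately show ?thesis by blast
qed

text \<open>If x is not in B, translating the open complement of B by inv x gives a neighbourhood of
  one; an N inside it makes the coset of x disjoint from B.\<close>

lemma closed_of_levels:
  assumes B: "closedin T B" and x: "x \<in> carrier G"
    and levels: "\<And>N. N \<in> NN \<Longrightarrow> N #> x \<in> (\<lambda>x. N #> x) ` B"
  shows "x \<in> B"
proof (rule ccontr)
  assume nx: "x \<notin> B"
  have Bc: "y \<in> carrier G" if "y \<in> B" for y
    using closedin_subset[OF B] that topspace_eq by auto
  define U where "U = topspace T - B"
  have U: "openin T U" using B by (simp add: U_def closedin_def)
  have xU: "x \<in> U" using nx x by (simp add: U_def topspace_eq)
  have "openin T (U #> inv x)" by (rule open_r_coset[OF U]) (use x in simp)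
  moreover have "\<one> \<in> U #> inv x" unfolding r_coset_def using xU x by (auto intro!: bexI[of _ x])
  ultimately obtain N where N: "N \<in> NN" "N \<subseteq> U #> inv x" using open_normal_base by blast
  obtain b where b: "b \<in> B" "N #> x = N #> b" using levels[OF N(1)] by blast
  have "b \<in> N #> x" unfolding b(2) by (rule rcos_self[OF Bc[OF b(1)] NN_subgroup[OF N(1)]])
  then obtain n where n: "n \<in> N" "b = n \<otimes> x" unfolding r_coset_def by blast
  obtain v where v: "v \<in> U" "n = v \<otimes> inv x" using n(1) N(2) unfolding r_coset_def by blast
  have vc: "v \<in> carrier G" using v(1) by (simp add: U_def topspace_eq)
  have "b = v" using n(2) v(2) vc x by (simp add: m_assoc)
  then show False using v(1) b(1) by (simp add: U_def)
qed

lemma level_filtered_group_ring: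
  assumes N: "N \<in> NN"
  shows "filtered_group_ring (level N) (G Mod N) (level_delta N) p (level_aug N) (\<lambda>i. (\<lambda>x. N #> x) ` Z i)"
proof -
  interpret L: finite_group_algebra "G Mod N" p by (rule level_algebra[OF N])
  interpret h: group_hom G "G Mod N" "\<lambda>x. N #> x" by (rule quotient_hom[OF N])
  obtain k where k: "card (carrier (G Mod N)) = p ^ k" using card_quotient[OF N] by blast
  show ?thesis
  proof (intro filtered_group_ring.intro filtered_group_ring_axioms.intro)
    show "ring (level N)" by (rule L.ring_GA)
    show "group (G Mod N)" by (rule L.group_axioms)
    show "prime p" by (rule prime_p)
    show "\<And>r. r \<in> carrier (level N) \<Longrightarrow> add_pow (level N) p r = \<zero>\<^bsub>level N\<^esub>" by (rule L.char_GA)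
    show "\<And>x. x \<in> carrier (G Mod N) \<Longrightarrow> level_delta N x \<in> carrier (level N)" by (rule L.delta_closed)
    show "\<And>x y. x \<in> carrier (G Mod N) \<Longrightarrow> y \<in> carrier (G Mod N) \<Longrightarrow>
      level_delta N (x \<otimes>\<^bsub>G Mod N\<^esub> y) = level_delta N x \<otimes>\<^bsub>level N\<^esub> level_delta N y"
      by (rule L.delta_mult[symmetric])
    show "level_delta N \<one>\<^bsub>G Mod N\<^esub> = \<one>\<^bsub>level N\<^esub>" by (rule L.one_GA[symmetric])
    show "\<And>x. x \<in> carrier (G Mod N) \<Longrightarrow> level_delta N x = \<one>\<^bsub>level N\<^esub> \<Longrightarrow> x = \<one>\<^bsub>G Mod N\<^esub>"
      unfolding L.one_GA by (rule L.delta_inj)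
    show "finite (carrier (G Mod N))" by (rule L.finite_carrier)
    show "carrier (level N) = generate (add_monoid (level N)) (level_delta N ` carrier (G Mod N))" by (rule L.GA_generate)
    show "card (carrier (level N)) = p ^ card (carrier (G Mod N))" by (rule L.card_GA)
    show "ideal (level_aug N) (level N)" by (rule L.aug_ideal)
    show "level_aug N = generate (add_monoid (level N))
        ((\<lambda>x. level_delta N x \<ominus>\<^bsub>level N\<^esub> \<one>\<^bsub>level N\<^esub>) ` carrier (G Mod N))" by (rule L.aug_generate)
    show "\<exists>M. ideal_pow (level N) (level_aug N) M = {\<zero>\<^bsub>level N\<^esub>}" by (rule L.aug_nilpotent[OF prime_p k])
    have Z1: "Z (Suc 0) = carrier G" by (rule Z_le_1) simp
    show "(\<lambda>x. N #> x) ` Z (Suc 0) = carrier (G Mod N)"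
      unfolding Z1 by (auto simp: coset_closed elim: coset_cases)
    show "subgroup ((\<lambda>x. N #> x) ` Z i) (G Mod N)" for i by (rule h.subgroup_img_is_subgroup[OF Z_subgroup])
    show "(\<lambda>x. N #> x) ` Z (Suc i) \<subseteq> (\<lambda>x. N #> x) ` Z i" for i by (rule image_mono[OF Z_Suc])
  next
    fix X Y i j assume X: "X \<in> (\<lambda>x. N #> x) ` Z i" and Y: "Y \<in> (\<lambda>x. N #> x) ` Z j" and ij: "1 \<le> i" "1 \<le> j"
    obtain x where x: "x \<in> Z i" "X = N #> x" using X by blast
    obtain y where y: "y \<in> Z j" "Y = N #> y" using Y by blast
    have c: "x \<in> carrier G" "y \<in> carrier G" using Z_carrier x(1) y(1) by blast+
    have "inv\<^bsub>G Mod N\<^esub> X \<otimes>\<^bsub>G Mod N\<^esub> inv\<^bsub>G Mod N\<^esub> Y \<otimes>\<^bsub>G Mod N\<^esub> X \<otimes>\<^bsub>G Mod N\<^esub> Y = N #> (inv x \<otimes> inv y \<otimes> x \<otimes> y)"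
      using c by (simp add: x(2) y(2))
    also have "\<dots> \<in> (\<lambda>x. N #> x) ` Z (i + j)" by (rule imageI[OF Z_comm[OF x(1) y(1) ij]])
    finally show "inv\<^bsub>G Mod N\<^esub> X \<otimes>\<^bsub>G Mod N\<^esub> inv\<^bsub>G Mod N\<^esub> Y \<otimes>\<^bsub>G Mod N\<^esub> X \<otimes>\<^bsub>G Mod N\<^esub> Y
        \<in> (\<lambda>x. N #> x) ` Z (i + j)" .
  next
    fix X i assume X: "X \<in> (\<lambda>x. N #> x) ` Z i" and i: "1 \<le> i"
    obtain x where x: "x \<in> Z i" "X = N #> x" using X by blast
    have "X [^]\<^bsub>G Mod N\<^esub> p = N #> (x [^] p)" using h.hom_nat_pow[OF Z_carrier[OF x(1)]] x(2) by simp
    also have "\<dots> \<in> (\<lambda>x. N #> x) ` Z (p * i)" by (rule imageI[OF Z_pow[OF x(1) i]])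
    finally show "X [^]\<^bsub>G Mod N\<^esub> p \<in> (\<lambda>x. N #> x) ` Z (p * i)" .
  next
    fix X i assume X: "X \<in> (\<lambda>x. N #> x) ` Z i"
    obtain x where x: "x \<in> Z i" "X = N #> x" using X by blast
    show "level_delta N X \<ominus>\<^bsub>level N\<^esub> \<one>\<^bsub>level N\<^esub> \<in> ideal_pow (level N) (level_aug N) i"
      using subsetD[OF Z_subset_dimension_subgroup[OF N] x(1)] unfolding x(2) L.dimension_subgroup_def by simp
  qed
qed

lemma finite_level_aug_pow: "N \<in> NN \<Longrightarrow> finite (ideal_pow (level N) (level_aug N) n)"
  by (rule finite_subset[OF ring.ideal_pow_subset[OF level_ring finite_group_algebra.aug_ideal[OF level_algebra]]
        finite_group_algebra.finite_GA[OF level_algebra]])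

lemma card_level_aug_pow_pos: 
  assumes N: "N \<in> NN"
  shows "card (ideal_pow (level N) (level_aug N) n) > 0"
proof -
  have "\<one>\<^bsub>add_monoid (level N)\<^esub> \<in> ideal_pow (level N) (level_aug N) n"
    by (rule subgroup.one_closed[OF ring.ideal_pow_subgroup[OF level_ring[OF N] finite_group_algebra.aug_ideal[OF level_algebra[OF N]]]])
  then have "ideal_pow (level N) (level_aug N) n \<noteq> {}" by blast
  then show ?thesis using finite_level_aug_pow[OF N, of n] unfolding card_gt_0_iff by (rule conjI)
qed

lemma finite_level_Z: 
  assumes N: "N \<in> NN"
  shows "finite ((\<lambda>x. N #> x) ` Z n)"
proof (rule finite_subset)
  show "(\<lambda>x. N #> x) ` Z n \<subseteq> carrier (G Mod N)"
    by (rule image_subsetI) (rule coset_closed[OF Z_carrier])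
  show "finite (carrier (G Mod N))" by (rule finite_group_algebra.finite_carrier[OF level_algebra[OF N]])
qed

lemma eval_group_hom:
  assumes N: "N \<in> NN"
  shows "group_hom (add_monoid Lam) (add_monoid (level N)) (\<lambda>\<phi>. \<phi> N)"
proof (rule group_hom.intro)
  show "group (add_monoid Lam)" by (rule abelian_group.a_group[OF ring.is_abelian_group[OF Lam_ring]])
  show "group (add_monoid (level N))" by (rule abelian_group.a_group[OF ring.is_abelian_group[OF level_ring[OF N]]])
  show "group_hom_axioms (add_monoid Lam) (add_monoid (level N)) (\<lambda>\<phi>. \<phi> N)"
    by (rule group_hom_axioms.intro, rule homI) (simp_all add: Lam_level[OF _ N] Lam_add N)
qed

section \<open>Finite quotients that detect the filtrations of G and of its algebra\<close>

context
  fixes S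
  assumes S: "finite S" "S \<subseteq> carrier G" "T closure_of (generate G S) = carrier G"
begin

text \<open>The bound is the one for the ideal powers: c n \<le> h n by Jennings' theorem at level
  N, and h is controlled by the number of generators alone.\<close>

lemma card_level_Z_le:
  assumes N: "N \<in> NN" and n: "n \<ge> 1"
  shows "card ((\<lambda>x. N #> x) ` Z n) \<le> ((\<lambda>c. c ^ card S) ^^ n) p * card ((\<lambda>x. N #> x) ` Z (Suc n))"
proof -
  interpret F: filtered_group_ring "level N" "G Mod N" "level_delta N" p "level_aug N" "\<lambda>i. (\<lambda>x. N #> x) ` Z i"
    by (rule level_filtered_group_ring[OF N])
  obtain c h W\<^sub>0 where ch: "\<And>w. w \<ge> 1 \<Longrightarrow> card ((\<lambda>x. N #> x) ` Z w) = p ^ c w * card ((\<lambda>x. N #> x) ` Z (Suc w))"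
    "\<And>n. card (ideal_pow (level N) (level_aug N) n) = p ^ h n * card (ideal_pow (level N) (level_aug N) (Suc n))"
    "\<And>n. n \<ge> 1 \<Longrightarrow> c n \<le> h n"
    "\<And>W n. W \<ge> W\<^sub>0 \<Longrightarrow> of_nat (h n) = fps_nth (\<Prod>w\<in>{1..<W}. truncated_geometric p w ^ c w) n"
    by (rule F.jennings) (rule that, assumption+)
  have "p ^ h n \<le> ((\<lambda>c. c ^ card S) ^^ n) p"
    using card_level_aug_pow_le[OF S N, of n] ch(2)[of n] card_level_aug_pow_pos[OF N, of "Suc n"] by simp
  moreover have "p ^ c n \<le> p ^ h n" by (rule power_increasing) (use ch(3)[OF n] p_gt_1 in auto)
  ultimately have "p ^ c n \<le> ((\<lambda>c. c ^ card S) ^^ n) p" by simp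
  then show ?thesis unfolding ch(1)[OF n] by (rule mult_le_mono1)
qed

text \<open>A detecting M passes this property on to all smaller N, because cosets of N determine
  cosets of M. In this form one N can serve several indices at once.\<close>

lemma Z_detected:
  assumes n: "n \<ge> 1"
  shows "\<exists>M\<in>NN. \<forall>N\<in>NN. N \<subseteq> M \<longrightarrow> (\<forall>x\<in>Z n. N #> x \<in> (\<lambda>x. N #> x) ` Z (Suc n) \<longrightarrow> x \<in> Z (Suc n))"
proof -
  have coarsen: "M #> x \<in> (\<lambda>x. M #> x) ` Z (Suc n)"
    if N: "N \<in> NN" and M: "M \<in> NN" and NM: "N \<subseteq> M" and x: "x \<in> Z n" and img: "N #> x \<in> (\<lambda>x. N #> x) ` Z (Suc n)" for N M x
  proof -
    obtain z where z: "z \<in> Z (Suc n)" "N #> x = N #> z" using img by blast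
    have "M #> x = M #> z"
      using coset_coarsen[OF N M NM Z_carrier[OF x]] coset_coarsen[OF N M NM Z_carrier[OF z(1)]] z(2) by simp
    then show ?thesis using z(1) by blast
  qed
  have "\<exists>M\<in>NN. \<forall>x\<in>Z n. M #> x \<in> (\<lambda>x. M #> x) ` Z (Suc n) \<longrightarrow> x \<in> Z (Suc n)"
  proof (rule exists_level_detecting_subgroup[where P = "\<lambda>N. G Mod N"])
    show "subgroup (Z n) G" "subgroup (Z (Suc n)) G" by (rule Z_subgroup)+
    show "Z (Suc n) \<subseteq> Z n" by (rule Z_Suc)
    show "group_hom G (G Mod N) (\<lambda>x. N #> x)" if "N \<in> NN" for N by (rule quotient_hom[OF that])
    show "\<exists>k\<in>NN. \<forall>x\<in>Z n. k #> x \<in> (\<lambda>x. k #> x) ` Z (Suc n) \<longrightarrow>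
        N #> x \<in> (\<lambda>x. N #> x) ` Z (Suc n) \<and> M #> x \<in> (\<lambda>x. M #> x) ` Z (Suc n)"
      if "N \<in> NN" "M \<in> NN" for N M
      using coarsen[OF Int_NN[OF that] that(1) Int_lower1] coarsen[OF Int_NN[OF that] that(2) Int_lower2] Int_NN[OF that]
      by (intro bexI[of _ "N \<inter> M"]) simp_all
    show "x \<in> Z (Suc n)" if "x \<in> Z n" "\<And>N. N \<in> NN \<Longrightarrow> N #> x \<in> (\<lambda>x. N #> x) ` Z (Suc n)" for x
      by (rule closed_of_levels[OF Z_closed Z_carrier[OF that(1)] that(2)])
    show "finite ((\<lambda>x. N #> x) ` Z n)" if "N \<in> NN" for N by (rule finite_level_Z[OF that])
    show "card ((\<lambda>x. N #> x) ` Z n) \<le> ((\<lambda>c. c ^ card S) ^^ n) p * card ((\<lambda>x. N #> x) ` Z (Suc n))" if "N \<in> NN" for N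
      by (rule card_level_Z_le[OF that n])
    show "NN \<noteq> {}" using carrier_NN by blast
  qed
  then obtain M where M: "M \<in> NN" "\<And>x. x \<in> Z n \<Longrightarrow> M #> x \<in> (\<lambda>x. M #> x) ` Z (Suc n) \<Longrightarrow> x \<in> Z (Suc n)" by blast
  show ?thesis
    by (intro bexI[OF _ M(1)] ballI impI) (rule M(2), assumption, rule coarsen[OF _ M(1)])
qed

lemma eval_aug_pow_image:
  assumes N: "N \<in> NN"
  shows "(\<lambda>\<phi>. \<phi> N) ` ideal_pow Lam augI n = ideal_pow (level N) (level_aug N) n"
proof
  show "(\<lambda>\<phi>. \<phi> N) ` ideal_pow Lam augI n \<subseteq> ideal_pow (level N) (level_aug N) n"
    by (rule image_subsetI) (rule eval_aug_pow[OF N])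
  show "ideal_pow (level N) (level_aug N) n \<subseteq> (\<lambda>\<phi>. \<phi> N) ` ideal_pow Lam augI n"
  proof
    fix f assume "f \<in> ideal_pow (level N) (level_aug N) n"
    from eval_aug_pow_surj[OF S N this] obtain \<phi> where "\<phi> \<in> ideal_pow Lam augI n" "\<phi> N = f" ..
    then show "f \<in> (\<lambda>\<phi>. \<phi> N) ` ideal_pow Lam augI n" by (intro image_eqI[of _ _ \<phi>]) simp_all
  qed
qed

text \<open>The additive counterpart of \<open>Z_detected\<close>. The closedness required by the
  detection principle is the compactness statement \<open>aug_pow_closed\<close>.\<close>

lemma aug_pow_detected:
  "\<exists>M\<in>NN. \<forall>N\<in>NN. N \<subseteq> M \<longrightarrow> (\<forall>\<phi>\<in>ideal_pow Lam augI n.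
     \<phi> N \<in> (\<lambda>\<phi>. \<phi> N) ` ideal_pow Lam augI (Suc n) \<longrightarrow> \<phi> \<in> ideal_pow Lam augI (Suc n))"
proof -
  let ?A = "\<lambda>n. ideal_pow Lam augI n"
  have coarsen: "\<phi> M \<in> (\<lambda>\<phi>. \<phi> M) ` ?A (Suc n)"
    if N: "N \<in> NN" and M: "M \<in> NN" and NM: "N \<subseteq> M" and \<phi>: "\<phi> \<in> ?A n" and img: "\<phi> N \<in> (\<lambda>\<phi>. \<phi> N) ` ?A (Suc n)" for N M \<phi>
  proof -
    have \<phi>c: "\<phi> \<in> carrier Lam" by (rule subsetD[OF ring.ideal_pow_subset[OF Lam_ring augI_ideal] \<phi>])
    have "\<phi> N \<in> ideal_pow (level N) (level_aug N) (Suc n)" using img unfolding eval_aug_pow_image[OF N] .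
    then have "proj N M (\<phi> N) \<in> ideal_pow (level M) (level_aug M) (Suc n)"
      by (rule finite_group_algebra_hom.push_aug_pow[OF level_hom[OF N M NM]])
    then show ?thesis unfolding eval_aug_pow_image[OF M] Lam_proj[OF \<phi>c N M NM] .
  qed
  have grp: "group (add_monoid Lam)" by (rule abelian_group.a_group[OF ring.is_abelian_group[OF Lam_ring]])
  have "\<exists>M\<in>NN. \<forall>\<phi>\<in>?A n. \<phi> M \<in> (\<lambda>\<phi>. \<phi> M) ` ?A (Suc n) \<longrightarrow> \<phi> \<in> ?A (Suc n)"
  proof (rule group.exists_level_detecting_subgroup[OF grp, where P = "\<lambda>N. add_monoid (level N)"])
    show "subgroup (?A n) (add_monoid Lam)" "subgroup (?A (Suc n)) (add_monoid Lam)"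
      by (rule ring.ideal_pow_subgroup[OF Lam_ring augI_ideal])+
    show "?A (Suc n) \<subseteq> ?A n" by (rule ring.ideal_pow_antimono[OF Lam_ring augI_ideal]) simp
    show "group_hom (add_monoid Lam) (add_monoid (level N)) (\<lambda>\<phi>. \<phi> N)" if "N \<in> NN" for N by (rule eval_group_hom[OF that])
    show "\<exists>k\<in>NN. \<forall>\<phi>\<in>?A n. \<phi> k \<in> (\<lambda>\<phi>. \<phi> k) ` ?A (Suc n) \<longrightarrow>
        \<phi> N \<in> (\<lambda>\<phi>. \<phi> N) ` ?A (Suc n) \<and> \<phi> M \<in> (\<lambda>\<phi>. \<phi> M) ` ?A (Suc n)"
      if "N \<in> NN" "M \<in> NN" for N M
    proof (intro bexI[of _ "N \<inter> M"] ballI impI conjI)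
      show I: "N \<inter> M \<in> NN" by (rule Int_NN[OF that])
      fix \<phi> assume \<phi>: "\<phi> \<in> ?A n" "\<phi> (N \<inter> M) \<in> (\<lambda>\<phi>. \<phi> (N \<inter> M)) ` ?A (Suc n)"
      show "\<phi> N \<in> (\<lambda>\<phi>. \<phi> N) ` ?A (Suc n)" by (rule coarsen[OF I that(1) Int_lower1 \<phi>])
      show "\<phi> M \<in> (\<lambda>\<phi>. \<phi> M) ` ?A (Suc n)" by (rule coarsen[OF I that(2) Int_lower2 \<phi>])
    qed
    show "\<phi> \<in> ?A (Suc n)" if "\<phi> \<in> ?A n" "\<And>N. N \<in> NN \<Longrightarrow> \<phi> N \<in> (\<lambda>\<phi>. \<phi> N) ` ?A (Suc n)" for \<phi>
    proof (rule aug_pow_closed[OF S])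
      show "\<phi> \<in> carrier Lam" by (rule subsetD[OF ring.ideal_pow_subset[OF Lam_ring augI_ideal] that(1)])
      show "\<phi> N \<in> ideal_pow (level N) (level_aug N) (Suc n)" if N: "N \<in> NN" for N
        using \<open>\<And>N. N \<in> NN \<Longrightarrow> \<phi> N \<in> (\<lambda>\<phi>. \<phi> N) ` ?A (Suc n)\<close>[OF N] unfolding eval_aug_pow_image[OF N] .
    qed
    show "finite ((\<lambda>\<phi>. \<phi> N) ` ?A n)" if "N \<in> NN" for N
      unfolding eval_aug_pow_image[OF that] by (rule finite_level_aug_pow[OF that])
    show "card ((\<lambda>\<phi>. \<phi> N) ` ?A n) \<le> ((\<lambda>c. c ^ card S) ^^ n) p * card ((\<lambda>\<phi>. \<phi> N) ` ?A (Suc n))" if "N \<in> NN" for N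
      unfolding eval_aug_pow_image[OF that] by (rule card_level_aug_pow_le[OF S that])
    show "NN \<noteq> {}" using carrier_NN by blast
  qed
  then obtain M where M: "M \<in> NN" "\<forall>\<phi>\<in>?A n. \<phi> M \<in> (\<lambda>\<phi>. \<phi> M) ` ?A (Suc n) \<longrightarrow> \<phi> \<in> ?A (Suc n)" ..
  show ?thesis
  proof (intro bexI[OF _ M(1)] ballI impI)
    fix N \<phi> assume "N \<in> NN" "N \<subseteq> M" "\<phi> \<in> ?A n" "\<phi> N \<in> (\<lambda>\<phi>. \<phi> N) ` ?A (Suc n)"
    then have "\<phi> M \<in> (\<lambda>\<phi>. \<phi> M) ` ?A (Suc n)" by (intro coarsen[OF _ M(1), of N])
    then show "\<phi> \<in> ?A (Suc n)" by (rule M(2)[THEN bspec, THEN mp, OF \<open>\<phi> \<in> ?A n\<close>])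
  qed
qed

end

lemma Lam_nat_pow:
  assumes N: "N \<in> NN" and \<phi>: "\<phi> \<in> carrier Lam"
  shows "add_pow Lam (k::nat) \<phi> N = add_pow (level N) k (\<phi> N)"
proof -
  interpret E: group_hom "add_monoid Lam" "add_monoid (level N)" "\<lambda>\<phi>. \<phi> N" by (rule eval_group_hom[OF N])
  show ?thesis unfolding add_pow_def by (rule E.hom_nat_pow) (simp add: \<phi>)
qed

lemma Lam_nat_pow_closed:
  assumes \<phi>: "\<phi> \<in> carrier Lam"
  shows "add_pow Lam (k::nat) \<phi> \<in> carrier Lam"
proof -
  interpret L: ring Lam by (rule Lam_ring)
  show ?thesis by (rule L.add.nat_pow_closed[OF \<phi>])
qed

lemma Lam_exponent:
  assumes \<phi>: "\<phi> \<in> carrier Lam"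
  shows "add_pow Lam p \<phi> = \<zero>\<^bsub>Lam\<^esub>"
proof (rule Lam_eqI[OF Lam_nat_pow_closed[OF \<phi>] Lam_zero_closed])
  fix N assume N: "N \<in> NN"
  have "add_pow Lam p \<phi> N = add_pow (level N) p (\<phi> N)" by (rule Lam_nat_pow[OF N \<phi>])
  also have "\<dots> = \<zero>\<^bsub>level N\<^esub>" by (rule finite_group_algebra.char_GA[OF level_algebra[OF N] Lam_level[OF \<phi> N]])
  finally show "add_pow Lam p \<phi> N = \<zero>\<^bsub>Lam\<^esub> N" using N by (simp add: Lam_zero)
qed

lemma Lam_smult:
  assumes a: "a \<in> {0..<int p}" and \<phi>: "\<phi> \<in> carrier Lam"
  shows "a \<odot>\<^bsub>Lam\<^esub> \<phi> = add_pow Lam a \<phi>"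
proof -
  have a0: "0 \<le> a" using a by simp
  have pow: "add_pow Lam a \<phi> = add_pow Lam (nat a) \<phi>" by (rule add_pow_int_ge[OF a0])
  have "add_pow Lam (nat a) \<phi> \<in> extensional NN"
    using Lam_nat_pow_closed[OF \<phi>, of "nat a"] unfolding Lam_carrier PiE_def by (elim conjE IntE)
  then have "add_pow Lam (nat a) \<phi> = (\<lambda>N\<in>NN. add_pow Lam (nat a) \<phi> N)" by (rule extensional_restrict[symmetric])
  also have "\<dots> = (\<lambda>N\<in>NN. a \<odot>\<^bsub>level N\<^esub> \<phi> N)"
  proof (rule restrict_ext)
    fix N assume N: "N \<in> NN"
    have "add_pow Lam (nat a) \<phi> N = add_pow (level N) (nat a) (\<phi> N)" by (rule Lam_nat_pow[OF N \<phi>])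
    also have "\<dots> = (\<lambda>x\<in>carrier (G Mod N). (int (nat a) * \<phi> N x) mod int p)"
      by (rule finite_group_algebra.add_pow_GA[OF level_algebra[OF N] Lam_level[OF \<phi> N]])
    also have "\<dots> = a \<odot>\<^bsub>level N\<^esub> \<phi> N" using a0 by (simp add: group_algebra_def residue_ring_def)
    finally show "add_pow Lam (nat a) \<phi> N = a \<odot>\<^bsub>level N\<^esub> \<phi> N" .
  qed
  also have "\<dots> = a \<odot>\<^bsub>Lam\<^esub> \<phi>" by (simp add: completed_group_algebra_def)
  finally show ?thesis unfolding pow by (rule sym)
qed

lemma zassenhaus_dim_level:
  assumes N: "N \<in> NN" and n: "n \<ge> 1"
    and detect: "\<And>x. x \<in> Z n \<Longrightarrow> N #> x \<in> (\<lambda>x. N #> x) ` Z (Suc n) \<Longrightarrow> x \<in> Z (Suc n)"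
    and card: "card ((\<lambda>x. N #> x) ` Z n) = p ^ c * card ((\<lambda>x. N #> x) ` Z (Suc n))"
  shows "zassenhaus_dim G T p n = c"
proof -
  let ?A = "G\<lparr>carrier := Z n\<rparr>"
  have rc: "finite (rcosets\<^bsub>?A\<^esub> Z (Suc n)) \<and>
      card (rcosets\<^bsub>?A\<^esub> Z (Suc n)) * card ((\<lambda>x. N #> x) ` Z (Suc n)) = card ((\<lambda>x. N #> x) ` Z n)"
    by (rule card_rcosets_image[OF Z_subgroup Z_subgroup Z_Suc quotient_hom[OF N] finite_level_Z[OF N] detect])
  have "(\<lambda>x. N #> x) ` Z (Suc n) \<noteq> {}" using subgroup.one_closed[OF Z_subgroup[of "Suc n"]] by blast
  then have pos: "card ((\<lambda>x. N #> x) ` Z (Suc n)) > 0"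
    using finite_level_Z[OF N, of "Suc n"] unfolding card_gt_0_iff by (rule conjI)
  have normal: "Z (Suc n) \<lhd> ?A"
    by (rule normal_restrict_supergroup[OF Z_subgroup Z_normal Z_Suc])
  have carF: "carrier (?A Mod Z (Suc n)) = rcosets\<^bsub>?A\<^esub> Z (Suc n)" by (simp add: FactGroup_def)
  have Z_mono: "Z j \<subseteq> Z i" if "i \<le> j" for i j by (rule lift_Suc_antimono_le[of Z, OF Z_Suc that])
  \<comment> \<open>Because 2 n and p n are at least n + 1, commutators and p-th powers of elements
    of \<open>Z n\<close> fall into \<open>Z (Suc n)\<close>; hence the quotient is elementary
    abelian.\<close>
  have "Suc n \<le> n + n" "Suc n \<le> p * n" using n p_gt_1 mult_le_mono1[of 2 p n] by linarith+
  then have low: "Z (n + n) \<subseteq> Z (Suc n)" "Z (p * n) \<subseteq> Z (Suc n)" using Z_mono by blast+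
  have comm: "comm_group (?A Mod Z (Suc n))"
    by (rule comm_group_Mod[OF Z_subgroup normal]) (rule subsetD[OF low(1) Z_comm[OF _ _ n n]])
  have exponent: "X [^]\<^bsub>?A Mod Z (Suc n)\<^esub> p = \<one>\<^bsub>?A Mod Z (Suc n)\<^esub>" if "X \<in> carrier (?A Mod Z (Suc n))" for X
    by (rule exponent_Mod[OF Z_subgroup normal _ that]) (rule subsetD[OF low(2) Z_pow[OF _ n]])
  have "card (carrier (?A Mod Z (Suc n))) = p ^ zassenhaus_dim G T p n"
    unfolding zassenhaus_dim_def
    by (rule card_eq_power_dim[OF prime_p comm _ exponent]) (simp_all add: carF rc elementary_abelian_space_def)
  then have "p ^ zassenhaus_dim G T p n = p ^ c"
    using rc card pos unfolding carF by simp
  then show ?thesis using p_gt_1 by simp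
qed

lemma gr_component_dim_level:
  assumes N: "N \<in> NN"
    and img: "\<And>n. (\<lambda>\<phi>. \<phi> N) ` ideal_pow Lam augI n = ideal_pow (level N) (level_aug N) n"
    and detect: "\<And>\<phi>. \<phi> \<in> ideal_pow Lam augI n \<Longrightarrow> \<phi> N \<in> (\<lambda>\<phi>. \<phi> N) ` ideal_pow Lam augI (Suc n) \<Longrightarrow>
      \<phi> \<in> ideal_pow Lam augI (Suc n)"
    and card: "card (ideal_pow (level N) (level_aug N) n) = p ^ h * card (ideal_pow (level N) (level_aug N) (Suc n))"
  shows "vectorspace.dim (residue_ring (int p)) (gr_component (residue_ring (int p)) G T n) = h"
proof -
  interpret E: group_hom "add_monoid Lam" "add_monoid (level N)" "\<lambda>\<phi>. \<phi> N" by (rule eval_group_hom[OF N])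
  let ?A = "ideal_pow Lam augI" and ?X = "add_monoid Lam\<lparr>carrier := ideal_pow Lam augI n\<rparr>"
  note S = ring.ideal_pow_subgroup[OF Lam_ring augI_ideal]
  have mono: "?A (Suc n) \<subseteq> ?A n" by (rule ring.ideal_pow_antimono[OF Lam_ring augI_ideal]) simp
  have fin: "finite ((\<lambda>\<phi>. \<phi> N) ` ?A n)" unfolding img by (rule finite_level_aug_pow[OF N])
  have rc: "finite (rcosets\<^bsub>?X\<^esub> ?A (Suc n)) \<and>
      card (rcosets\<^bsub>?X\<^esub> ?A (Suc n)) * card ((\<lambda>\<phi>. \<phi> N) ` ?A (Suc n)) = card ((\<lambda>\<phi>. \<phi> N) ` ?A n)"
    by (rule E.G.card_rcosets_image[OF S S mono E.group_hom_axioms fin detect])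
  have "card (rcosets\<^bsub>?X\<^esub> ?A (Suc n))
      = p ^ vectorspace.dim (residue_ring (int p)) (subquotient_space Lam (?A n) (?A (Suc n)))"
    by (rule card_subquotient_space[OF prime_p ring.is_abelian_group[OF Lam_ring] S S mono Lam_smult Lam_exponent
          conjunct1[OF rc]])
  then have "p ^ vectorspace.dim (residue_ring (int p)) (subquotient_space Lam (?A n) (?A (Suc n))) = p ^ h"
    using conjunct2[OF rc] card_level_aug_pow_pos[OF N, of "Suc n"] unfolding img card by simp
  then show ?thesis using p_gt_1 unfolding gr_component_def augmentation_ideal_power_eq by simp
qed

theorem zassenhaus_dim_eq:
  assumes S: "finite S" "S \<subseteq> carrier G" "T closure_of (generate G S) = carrier G"
    and n: "n = p ^ k * m" "m \<ge> 1" "coprime m p"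
  shows "of_nat (zassenhaus_dim G T p n) = (\<Sum>j\<le>k. gr_w G T p (p ^ j * m))"
proof -
  let ?A = "ideal_pow Lam augI"
  have "\<forall>i. \<exists>M. M \<in> NN \<and> (\<forall>N\<in>NN. N \<subseteq> M \<longrightarrow> (\<forall>\<phi>\<in>?A i. \<phi> N \<in> (\<lambda>\<phi>. \<phi> N) ` ?A (Suc i) \<longrightarrow> \<phi> \<in> ?A (Suc i)))"
    using aug_pow_detected[OF S] unfolding Bex_def by (rule allI)
  then obtain K where K: "\<forall>i. K i \<in> NN \<and>
      (\<forall>N\<in>NN. N \<subseteq> K i \<longrightarrow> (\<forall>\<phi>\<in>?A i. \<phi> N \<in> (\<lambda>\<phi>. \<phi> N) ` ?A (Suc i) \<longrightarrow> \<phi> \<in> ?A (Suc i)))"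
    by (rule choice[THEN exE])
  \<comment> \<open>Index 0 imposes no condition here, since the filtration of G starts at 1,
    whereas the ideal powers above start at 0.\<close>
  have "\<exists>M. M \<in> NN \<and> (i \<ge> 1 \<longrightarrow>
      (\<forall>N\<in>NN. N \<subseteq> M \<longrightarrow> (\<forall>x\<in>Z i. N #> x \<in> (\<lambda>x. N #> x) ` Z (Suc i) \<longrightarrow> x \<in> Z (Suc i))))" for i
    using Z_detected[OF S, of i] carrier_NN unfolding Bex_def by (cases "i \<ge> 1") auto
  then have "\<forall>i. \<exists>M. M \<in> NN \<and> (i \<ge> 1 \<longrightarrow>
      (\<forall>N\<in>NN. N \<subseteq> M \<longrightarrow> (\<forall>x\<in>Z i. N #> x \<in> (\<lambda>x. N #> x) ` Z (Suc i) \<longrightarrow> x \<in> Z (Suc i))))" by (rule allI)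
  then obtain L where L: "\<forall>i. L i \<in> NN \<and> (i \<ge> 1 \<longrightarrow>
      (\<forall>N\<in>NN. N \<subseteq> L i \<longrightarrow> (\<forall>x\<in>Z i. N #> x \<in> (\<lambda>x. N #> x) ` Z (Suc i) \<longrightarrow> x \<in> Z (Suc i))))"
    by (rule choice[THEN exE])
  have sub: "K ` {..n} \<union> L ` {..n} \<subseteq> NN" using K L by auto
  have "finite (K ` {..n} \<union> L ` {..n})" by simp
  \<comment> \<open>A single N detects all ideal powers and filtration subgroups up to index n, so
    one instance of Jennings' theorem gives all the numbers that are needed.\<close>
  from finite_NN_lower[OF this sub] obtain N where N: "N \<in> NN" and below: "\<forall>M\<in>K ` {..n} \<union> L ` {..n}. N \<subseteq> M"
    ..
  have detect_aug: "\<phi> \<in> ?A (Suc i)" if "i \<le> n" "\<phi> \<in> ?A i" "\<phi> N \<in> (\<lambda>\<phi>. \<phi> N) ` ?A (Suc i)" for i \<phi>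
  proof -
    have "N \<subseteq> K i" using below that(1) by simp
    from K[THEN spec, THEN conjunct2, THEN bspec, OF N, THEN mp, OF this, THEN bspec, OF that(2), THEN mp, OF that(3)]
    show ?thesis .
  qed
  have detect_Z: "x \<in> Z (Suc i)" if "1 \<le> i" "i \<le> n" "x \<in> Z i" "N #> x \<in> (\<lambda>x. N #> x) ` Z (Suc i)" for i x
  proof -
    have "N \<subseteq> L i" using below that(2) by simp
    from L[THEN spec, THEN conjunct2, THEN mp, OF that(1), THEN bspec, OF N, THEN mp, OF this, THEN bspec, OF that(3),
        THEN mp, OF that(4)]
    show ?thesis .
  qed
  interpret F: filtered_group_ring "level N" "G Mod N" "level_delta N" p "level_aug N" "\<lambda>i. (\<lambda>x. N #> x) ` Z i"
    by (rule level_filtered_group_ring[OF N])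
  obtain c h W\<^sub>0 where ch: "\<And>w. w \<ge> 1 \<Longrightarrow> card ((\<lambda>x. N #> x) ` Z w) = p ^ c w * card ((\<lambda>x. N #> x) ` Z (Suc w))"
    "\<And>n. card (ideal_pow (level N) (level_aug N) n) = p ^ h n * card (ideal_pow (level N) (level_aug N) (Suc n))"
    "\<And>n. n \<ge> 1 \<Longrightarrow> c n \<le> h n"
    "\<And>W n. W \<ge> W\<^sub>0 \<Longrightarrow> of_nat (h n) = fps_nth (\<Prod>w\<in>{1..<W}. truncated_geometric p w ^ c w) n"
    by (rule F.jennings) (rule that, assumption+)
  \<comment> \<open>Beyond \<open>W\<^sub>0\<close> for Jennings' product formula and beyond n for
    the extraction of the coefficients.\<close>
  define W where "W = max W\<^sub>0 (Suc n)"
  have n1: "n \<ge> 1" using n p_gt_1 by simp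
  have dim: "zassenhaus_dim G T p n = c n"
    by (rule zassenhaus_dim_level[OF N n1 detect_Z[OF n1 order_refl] ch(1)[OF n1]])
  have "fps_nth (gr_hilbert_series G T p) i = fps_nth (\<Prod>w\<in>{1..<W}. truncated_geometric p w ^ c w) i" if i: "i \<le> n" for i
  proof -
    have "vectorspace.dim (residue_ring (int p)) (gr_component (residue_ring (int p)) G T i) = h i"
      by (rule gr_component_dim_level[OF N eval_aug_pow_image[OF S N] detect_aug[OF i] ch(2)])
    then have "fps_nth (gr_hilbert_series G T p) i = of_nat (h i)" by (simp add: gr_hilbert_series_def)
    also have "\<dots> = fps_nth (\<Prod>w\<in>{1..<W}. truncated_geometric p w ^ c w) i" by (rule ch(4)) (simp add: W_def)
    finally show ?thesis .
  qed
  moreover have "n < W" by (simp add: W_def)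
  ultimately have "(\<Sum>j\<le>k. gr_w G T p (p ^ j * m)) = of_nat (c n)"
    unfolding gr_w_def by (intro log_product_formula[OF prime_p n])
  then show ?thesis by (simp only: dim)
qed

end

theorem theorem2p9:
  fixes G :: "('a, 'b) monoid_scheme" and T :: "'a topology" and p n k m :: nat
  assumes "prime p"
    and "pro_p_group G T p"
    and "topologically_finitely_generated G T"
    and "n = p ^ k * m" and "m \<ge> 1" and "coprime m p"
  shows "of_nat (zassenhaus_dim G T p n) = (\<Sum>j\<le>k. gr_w G T p (p ^ j * m))"
proof -
  obtain S where "finite S" "S \<subseteq> carrier G" "T closure_of (generate G S) = carrier G"
    using assms(3) unfolding topologically_finitely_generated_def by blast
  then show ?thesis by (rule pro_p_group.zassenhaus_dim_eq[OF assms(2) _ _ _ assms(4-6)])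
qed

end
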